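(* Let $0<\epsilon<1/2$ and $0<\rho<1$ both be fixed. There exists a constant $c$ such that the following holds. Suppose that $D$ is a simply connected grid domain (with respect to $\mathbb{Z}^2$) containing $0$ with $\operatorname{inrad}(D)=R$, $0<R<\infty$, and let $V=D\cap\mathbb{Z}^2$. If $x,y\in V$ with $x\ne y$ and $|\psi_D(x)|\le\rho$, then $$\left|G_D(x,y)-\frac{2}{\pi}\,g_D(x,y)-k_{y-x}\right|\le c\,R^{-(1/2-\epsilon)},$$ where $k_z=k_0+\frac{2}{\pi}\log|z|-a(z)$, $a$ is the potential kernel of simple random walk on $\mathbb{Z}^2$, and $k_0=(2\varsigma+3\ln 2)/\pi$ with $\varsigma$ Euler's constant.
   Context: A domain $D\subset\mathbb{C}$ is a grid domain (with respect to $\mathbb{Z}^2$) if $\partial D$ consists of edges of the lattice $\mathbb{Z}^2$. $\operatorname{inrad}(D)=\sup\{r:\{|z|<r\}\subset D\}$. $\psi_D:D\to\mathbb{D}$ is the conformal map onto the unit disk with $\psi_D(0)=0$, $\psi_D'(0)>0$. $g_D(x,y)$ is the (continuous) Green's function of $D$: $g_D(x,\cdot)$ is harmonic on $D\setminus\{x\}$, tends to $0$ at $\partial D$, and $g_D(x,y)=-\log|x-y|+O(1)$ as $y\to x$; equivalently $g_D(x,y)=\mathbb{E}^x[\log|B_{T_D}-y|]-\log|x-y|$, with $B$ planar Brownian motion and $T_D$ its exit time from $D$; also $g_D(x,y)=g_{\mathbb{D}}(\psi_D(x),\psi_D(y))$ with $g_{\mathbb{D}}(z,w)=\log|\overline{w}z-1|-\log|w-z|$.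 $G_D(x,y)=\sum_{j=0}^\infty\mathbb{P}^x(S_j=y,\ \tau>j)$ is the Green's function of simple random walk $S$ on $\mathbb{Z}^2$ killed on exiting $V=D\cap\mathbb{Z}^2$, where $\tau=\min\{j\ge0:S_j\notin V\}$. The potential kernel is $a(x)=\sum_{j=0}^\infty[\mathbb{P}^0(S_j=0)-\mathbb{P}^x(S_j=0)]$. *)

theory Defs
  imports "HOL-Probability.Probability" "HOL-Complex_Analysis.Complex_Analysis"
    "HOL-Library.Landau_Symbols"
begin

section \<open>Grid domains\<close>

definition square_lattice :: "complex set" where
  "square_lattice = {z. Re z \<in> \<int> \<and> Im z \<in> \<int>}"

definition lattice_edges :: "complex set set" where
  "lattice_edges = {closed_segment z w | z w. z \<in> square_lattice \<and> w \<in> square_lattice \<and> dist z w = 1}"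

definition grid_domain :: "complex set \<Rightarrow> bool" where
  "grid_domain D \<longleftrightarrow> D \<noteq> {} \<and> open D \<and> connected D \<and> (\<exists>E \<subseteq> lattice_edges. frontier D = \<Union>E)"

definition inrad :: "complex set \<Rightarrow> ereal" where
  "inrad D = (SUP r \<in> {r. ball 0 r \<subseteq> D}. ereal r)"

section \<open>Riemann map\<close>

definition is_riemann_map :: "complex set \<Rightarrow> (complex \<Rightarrow> complex) \<Rightarrow> bool" where
  "is_riemann_map D f \<longleftrightarrow>
     f holomorphic_on D \<and> bij_betw f D (ball 0 1) \<and>
     f 0 = 0 \<and> deriv f 0 \<in> \<real> \<and> Re (deriv f 0) > 0"

text \<open>For a simply connected domain containing 0, other than the whole plane, such a map exists
  and its values on the domain are determined, so the choice only affects values outside.\<close>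

definition riemann_map :: "complex set \<Rightarrow> complex \<Rightarrow> complex" where
  "riemann_map D = (SOME f. is_riemann_map D f)"

section \<open>Continuous Green's function\<close>

text \<open>Here \<open>ux, uy, uxx, uxy, uyy\<close> are the first and second order partial derivatives;
  by Schwarz's theorem the mixed ones agree for a twice continuously differentiable function.\<close>

definition harmonic_on :: "(complex \<Rightarrow> real) \<Rightarrow> complex set \<Rightarrow> bool" where
  "harmonic_on u A \<longleftrightarrow> open A \<and>
     (\<exists>ux uy uxx uxy uyy.
        (\<forall>z\<in>A. (u has_derivative (\<lambda>h. ux z * Re h + uy z * Im h)) (at z) \<and>
               (ux has_derivative (\<lambda>h. uxx z * Re h + uxy z * Im h)) (at z) \<and>
               (uy has_derivative (\<lambda>h. uxy z * Re h + uyy z * Im h)) (at z) \<and>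
               uxx z + uyy z = 0) \<and>
        continuous_on A uxx \<and> continuous_on A uxy \<and> continuous_on A uyy)"

text \<open>The boundary of \<open>D\<close> is taken in the Riemann sphere: the limit at infinity is needed for
  uniqueness when \<open>D\<close> is unbounded, and is vacuous when \<open>D\<close> is bounded.\<close>

definition is_green :: "complex set \<Rightarrow> complex \<Rightarrow> (complex \<Rightarrow> real) \<Rightarrow> bool" where
  "is_green D x g \<longleftrightarrow>
     harmonic_on g (D - {x}) \<and>
     (\<forall>\<zeta> \<in> frontier D. (g \<longlongrightarrow> 0) (at \<zeta> within D)) \<and>
     (g \<longlongrightarrow> 0) (inf at_infinity (principal D)) \<and>
     (\<lambda>y. g y + ln (cmod (x - y))) \<in> O[at x](\<lambda>_. 1)"

text \<open>As above, the choice only affects values outside \<open>D - {x}\<close>.\<close>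

definition green :: "complex set \<Rightarrow> complex \<Rightarrow> complex \<Rightarrow> real" where
  "green D x = (SOME g. is_green D x g)"

section \<open>Simple random walk\<close>

text \<open>A sample point is the sequence of independent uniform steps.\<close>

definition srw_space :: "(nat \<Rightarrow> complex) measure" where
  "srw_space = PiM UNIV (\<lambda>_. measure_pmf (pmf_of_set {1, -1, \<i>, -\<i>}))"

definition srw :: "complex \<Rightarrow> (nat \<Rightarrow> complex) \<Rightarrow> nat \<Rightarrow> complex" where
  "srw x \<omega> j = x + (\<Sum>i<j. \<omega> i)"

definition exit_time :: "complex set \<Rightarrow> (nat \<Rightarrow> complex) \<Rightarrow> enat" where
  "exit_time V S = (INF j \<in> {j. S j \<notin> V}. enat j)"

definition rw_green :: "complex set \<Rightarrow> complex \<Rightarrow> complex \<Rightarrow> real" where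
  "rw_green D x y =
     (\<Sum>j. measure srw_space {\<omega> \<in> space srw_space.
        srw x \<omega> j = y \<and> enat j < exit_time (D \<inter> square_lattice) (srw x \<omega>)})"

text \<open>The series is in general only conditionally convergent.\<close>

definition potential_kernel :: "complex \<Rightarrow> real" where
  "potential_kernel x =
     (\<Sum>j. measure srw_space {\<omega> \<in> space srw_space. srw 0 \<omega> j = 0}
         - measure srw_space {\<omega> \<in> space srw_space. srw x \<omega> j = 0})"

definition k_zero :: real where
  "k_zero = (2 * euler_mascheroni + 3 * ln 2) / pi"

definition k_corr :: "complex \<Rightarrow> real" where
  "k_corr z = k_zero + 2 / pi * ln (cmod z) - potential_kernel z"

end

(*
  Let psi map D conformally onto the disk with psi(x) = 0, and put g = -ln |psi|,
  v = 1 - |psi|^2, d(w) = dist(w, complement of D) and r = d(x).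

  The function (2/pi) g - b(. - x), where b = a - (2/pi) ln - k_0 is the error in the asymptotics
  of the potential kernel, has the right discrete pole at x and vanishes on the boundary once b is
  cut off at distance of order r.  By Taylor expansion the discrete Laplacian of g
  away from x is O(v / d^4), since the harmonic function g is positive and comparable to v there;
  near the boundary it is O(v).  Koebe's theorem gives Beurling's bound v <= 16 (d / r)^(1/2), so for
  small alpha the total error of the parametrix is O(r^(-(1 - alpha)/2) v^alpha / d^2).

  This is dominated by a discrete supersolution: for d large, v^alpha is superharmonic for the lattice
  Laplacian with a gain of order alpha v^alpha / d^2, because |psi'| >= v / (8 d) by Koebe's 1/4-theorem
  and t -> t^alpha is concave; for d bounded, the walk exits D with a fixed probability
  within a fixed number of steps, and v^alpha times the expected (truncated) survival time gains
  a constant factor.  The maximum principle then bounds G_D - parametrix by C r^(-(1 - alpha)/2).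

  The potential kernel is computed exactly on the diagonal by Fourier series. Its asymptotics elsewhere
  follow from the maximum principle in the quarter plane |Im z| < Re z, with barrier Re z^(-3/2).
*)

theory Submission imports Defs "HOL-Real_Asymp.Real_Asymp"
begin

section \<open>The killed walk\<close>

text \<open>D has no boundary regularity, so estimates can be spent only in the conformally natural
  quantities v and d. With alpha = 0 the rate would be r^(-1/2), but a constant barrier gains
  nothing: the relative gain alpha / 1024 of the power is the reason for the epsilon in the
  exponent. Close to the boundary Taylor expansion says nothing about v^alpha, and only Harnack's
  ratio 54 between neighbouring values of v is left; the truncated survival time has to beat the
  factor 54^alpha, which fixes how small alpha must be. All bounds are first obtained in terms of r,
  the distance of the pole from the complement. The assumption |psi_D(x)| <= rho enters at the very
  end, through Beurling's bound for the map normalised at 0, which gives r >= b R with b = (1 -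
  rho^2)^2 / 256. A domain of finite inner radius may be unbounded, so the comparison arguments on D
  need decay at infinity; compactness of the level sets of |psi| supplies it.\<close>

definition nmean :: "(complex \<Rightarrow> real) \<Rightarrow> complex \<Rightarrow> real" where
  "nmean f w = (f (w + 1) + f (w - 1) + f (w + \<i>) + f (w - \<i>)) / 4"

abbreviation step_pmf :: "complex pmf" where
  "step_pmf \<equiv> pmf_of_set {1, -1, \<i>, -\<i>}"

text \<open>The event is survival up to and including time \<open>j\<close>, that is, an exit time
  larger than \<open>j\<close>. \<open>V = UNIV\<close> gives the free walk, so the same recursions
  serve the potential kernel.\<close>

definition killed_prob :: "complex set \<Rightarrow> nat \<Rightarrow> complex \<Rightarrow> complex \<Rightarrow> real" where
  "killed_prob V j x w =
     measure srw_space {\<omega> \<in> space srw_space. srw x \<omega> j = w \<and> (\<forall>i\<le>j. srw x \<omega> i \<in> V)}"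

interpretation steps: sequence_space "measure_pmf step_pmf"
  by unfold_locales

lemma srw_space_eq: "srw_space = steps.S"
  by (simp add: srw_space_def)

lemma prob_space_srw: "prob_space srw_space"
  unfolding srw_space_eq by (rule steps.P.prob_space_axioms)

lemma srw_measurable [measurable]: "(\<lambda>\<omega>. srw x \<omega> j) \<in> borel_measurable srw_space"
proof -
  have "(\<lambda>\<omega>. \<omega> i) \<in> borel_measurable srw_space" for i :: nat
  proof -
    have 1: "(\<lambda>\<omega>. \<omega> i) \<in> measurable srw_space (measure_pmf step_pmf)"
      unfolding srw_space_def by (rule measurable_component_singleton) simp
    have 2: "(\<lambda>z::complex. z) \<in> measurable (measure_pmf step_pmf) borel" by simp
    show ?thesis using measurable_comp[OF 1 2] by (simp add: comp_def)
  qed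
  then show ?thesis unfolding srw_def by measurable
qed

lemma killed_event_measurable:
  assumes [measurable]: "V \<in> sets borel"
  shows "{\<omega> \<in> space srw_space. srw x \<omega> j = w \<and> (\<forall>i\<le>j. srw x \<omega> i \<in> V)} \<in> sets srw_space"
  by measurable

lemma srw_case_nat: "srw x (case_nat s \<omega>) (Suc j) = srw (x + s) \<omega> j"
  by (simp add: srw_def sum.lessThan_Suc_shift algebra_simps del: sum.lessThan_Suc)

lemma killed_prob_0: "killed_prob V 0 x w = (if x = w \<and> x \<in> V then 1 else 0)"
proof -
  have "{\<omega> \<in> space srw_space. srw x \<omega> 0 = w \<and> (\<forall>i\<le>0. srw x \<omega> i \<in> V)}
      = (if x = w \<and> x \<in> V then space srw_space else {})"
    by (auto simp: srw_def)
  then show ?thesis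
    using prob_space.prob_space[OF prob_space_srw] unfolding killed_prob_def by auto
qed

lemma killed_prob_nonneg: "killed_prob V j x w \<ge> 0"
  by (simp add: killed_prob_def)

lemma killed_prob_le_1: "killed_prob V j x w \<le> 1"
  unfolding killed_prob_def by (rule prob_space.prob_le_1[OF prob_space_srw])

lemma killed_prob_outside: "w \<notin> V \<Longrightarrow> killed_prob V j x w = 0"
proof -
  assume "w \<notin> V"
  then have "{\<omega> \<in> space srw_space. srw x \<omega> j = w \<and> (\<forall>i\<le>j. srw x \<omega> i \<in> V)} = {}" by auto
  then show ?thesis unfolding killed_prob_def by (simp only: measure_empty)
qed

text \<open>Markov property at time 1: by \<open>PiM_iter\<close> the law of the steps is unchanged
  when an independent step is put in front, so Tonelli integrates over the first step.\<close>

lemma killed_prob_first_step: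
  assumes V: "V \<in> sets borel"
  shows "killed_prob V (Suc j) x w = (if x \<in> V then nmean (\<lambda>z. killed_prob V j z w) x else 0)"
proof -
  let ?A = "{\<omega> \<in> space srw_space. srw x \<omega> (Suc j) = w \<and> (\<forall>i\<le>Suc j. srw x \<omega> i \<in> V)}"
  let ?B = "\<lambda>s. {\<omega> \<in> space srw_space. srw (x+s) \<omega> j = w \<and> (\<forall>i\<le>j. srw (x+s) \<omega> i \<in> V)}"
  let ?M = "measure_pmf step_pmf"
  interpret P: prob_space srw_space by (rule prob_space_srw)
  have A: "?A \<in> sets srw_space" by (rule killed_event_measurable[OF V])
  have sp: "space srw_space = UNIV" by (simp add: srw_space_def space_PiM)
  have meas: "(\<lambda>(s, \<omega>). case_nat s \<omega>) \<in> measurable (?M \<Otimes>\<^sub>M srw_space) srw_space"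
    unfolding srw_space_eq by measurable
  have all: "(\<forall>i\<le>Suc j. srw x (case_nat s \<omega>) i \<in> V) \<longleftrightarrow> x \<in> V \<and> (\<forall>i\<le>j. srw (x+s) \<omega> i \<in> V)" for s \<omega>
  proof -
    have "(\<forall>i\<le>Suc j. P i) \<longleftrightarrow> P 0 \<and> (\<forall>i\<le>j. P (Suc i))" for P :: "nat \<Rightarrow> bool"
      by (metis Suc_le_mono le0 not0_implies_Suc)
    then show ?thesis by (simp only: srw_case_nat) (simp add: srw_def)
  qed
  have "emeasure srw_space ?A = emeasure (distr (?M \<Otimes>\<^sub>M srw_space) srw_space (\<lambda>(s, \<omega>). case_nat s \<omega>)) ?A"
    using steps.PiM_iter unfolding srw_space_eq by simp
  also have "\<dots> = emeasure (?M \<Otimes>\<^sub>M srw_space) ((\<lambda>(s, \<omega>). case_nat s \<omega>) -` ?A \<inter> space (?M \<Otimes>\<^sub>M srw_space))"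
    by (rule emeasure_distr[OF meas A])
  also have "\<dots> = (\<integral>\<^sup>+s. emeasure srw_space (Pair s -` ((\<lambda>(s, \<omega>). case_nat s \<omega>) -` ?A \<inter> space (?M \<Otimes>\<^sub>M srw_space))) \<partial>?M)"
    by (rule P.emeasure_pair_measure_alt) (rule measurable_sets[OF meas A])
  also have "\<dots> = (\<integral>\<^sup>+s. ennreal (if x \<in> V then killed_prob V j (x+s) w else 0) \<partial>?M)"
  proof (intro nn_integral_cong)
    fix s
    have "Pair s -` ((\<lambda>(s, \<omega>). case_nat s \<omega>) -` ?A \<inter> space (?M \<Otimes>\<^sub>M srw_space)) = (if x \<in> V then ?B s else {})"
      by (auto simp: sp space_pair_measure all srw_case_nat)
    then show "emeasure srw_space (Pair s -` ((\<lambda>(s, \<omega>). case_nat s \<omega>) -` ?A \<inter> space (?M \<Otimes>\<^sub>M srw_space)))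
       = ennreal (if x \<in> V then killed_prob V j (x+s) w else 0)"
      by (simp add: P.emeasure_eq_measure killed_prob_def)
  qed
  also have "\<dots> = ennreal (\<integral>s. (if x \<in> V then killed_prob V j (x+s) w else 0) \<partial>?M)"
    by (rule nn_integral_eq_integral)
       (auto simp: killed_prob_nonneg intro!: measure_pmf.integrable_const_bound[where B=1] killed_prob_le_1)
  also have "(\<integral>s. (if x \<in> V then killed_prob V j (x+s) w else 0) \<partial>?M)
      = (if x \<in> V then nmean (\<lambda>z. killed_prob V j z w) x else 0)"
  proof -
    have "1 \<noteq> (-1::complex)" "\<i> \<noteq> 1" "\<i> \<noteq> -1" "\<i> \<noteq> -\<i>" "-\<i> \<noteq> 1" "-\<i> \<noteq> -1"
      by (auto simp: complex_eq_iff)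
    then have "(\<Sum>s\<in>{1, -1, \<i>, -\<i>}. h s) = h 1 + h (-1) + h \<i> + h (-\<i>)" "card {1, -1, \<i>, -\<i>} = 4" for h :: "complex \<Rightarrow> real"
      by auto
    then show ?thesis by (subst integral_pmf_of_set) (auto simp: nmean_def)
  qed
  finally show ?thesis
    unfolding P.emeasure_eq_measure killed_prob_def[of V "Suc j" x w]
    by (subst (asm) ennreal_inj) (auto simp: nmean_def killed_prob_nonneg)
qed

lemma nmean_if: "nmean (\<lambda>z. if P then f z else 0) w = (if P then nmean f w else 0)"
  by (simp add: nmean_def)

lemma nmean_cmult: "nmean (\<lambda>z. c * f z) w = c * nmean f w"
  by (simp add: nmean_def algebra_simps)

lemma nmean_add: "nmean (\<lambda>z. f z + g z) w = nmean f w + nmean g w"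
  by (simp add: nmean_def algebra_simps add_divide_distrib)

lemma nmean_diff: "nmean (\<lambda>z. f z - g z) w = nmean f w - nmean g w"
  by (simp add: nmean_def algebra_simps add_divide_distrib diff_divide_distrib)

lemma nmean_const: "nmean (\<lambda>z. c) w = c"
  by (simp add: nmean_def)

lemma nmean_sum: "nmean (\<lambda>z. \<Sum>i\<in>I. f i z) w = (\<Sum>i\<in>I. nmean (f i) w)"
  unfolding nmean_def by (simp only: sum.distrib sum_divide_distrib[symmetric])

lemma nmean_mono:
  assumes "\<And>e. e \<in> {1, -1, \<i>, -\<i>} \<Longrightarrow> f (w + e) \<le> g (w + e)"
  shows "nmean f w \<le> nmean g w"
  using assms[of 1] assms[of "-1"] assms[of \<i>] assms[of "-\<i>"] unfolding nmean_def by simp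

lemma nmean_cong:
  assumes "\<And>e. e \<in> {1, -1, \<i>, -\<i>} \<Longrightarrow> f (w + e) = g (w + e)"
  shows "nmean f w = nmean g w"
  using assms[of 1] assms[of "-1"] assms[of \<i>] assms[of "-\<i>"] unfolding nmean_def by simp

lemma nmean_abs_le:
  assumes "\<And>e. e \<in> {1, -1, \<i>, -\<i>} \<Longrightarrow> \<bar>f (w + e)\<bar> \<le> B"
  shows "\<bar>nmean f w\<bar> \<le> B"
  using assms[of 1] assms[of "-1"] assms[of \<i>] assms[of "-\<i>"] unfolding nmean_def by auto

text \<open>The first-step equation moves the starting point, but the comparison principle works in
  the end point. The means in \<open>x\<close> and in \<open>w\<close> act on different variables
  and commute; the base case uses that \<open>e\<close> and \<open>-e\<close> are equally
  likely.\<close>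

lemma killed_prob_last_step:
  assumes V: "V \<in> sets borel"
  shows "killed_prob V (Suc j) x w = (if w \<in> V then nmean (killed_prob V j x) w else 0)"
proof (induction j arbitrary: x w)
  case 0
  have t: "(if x \<in> V then killed_prob V 0 (x + e) w else 0) = (if w \<in> V then killed_prob V 0 x (w - e) else 0)" for e
    by (auto simp: killed_prob_0)
  let ?f = "\<lambda>z. if x \<in> V then killed_prob V 0 z w else 0"
  let ?g = "\<lambda>z. if w \<in> V then killed_prob V 0 x z else 0"
  have t': "?f (x + 1) = ?g (w - 1)" "?f (x - 1) = ?g (w + 1)" "?f (x + \<i>) = ?g (w - \<i>)" "?f (x - \<i>) = ?g (w + \<i>)"
    using t[of 1] t[of "-1"] t[of \<i>] t[of "-\<i>"]
    by (simp_all only: diff_minus_eq_add add_uminus_conv_diff)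
  have "nmean ?f x = nmean ?g w"
    unfolding nmean_def t' by (simp only: add_ac)
  then show ?case
    unfolding killed_prob_first_step[OF V] nmean_if .
next
  case (Suc j)
  have "killed_prob V (Suc (Suc j)) x w = (if x \<in> V then nmean (\<lambda>z. killed_prob V (Suc j) z w) x else 0)"
    by (rule killed_prob_first_step[OF V])
  also have "\<dots> = (if w \<in> V then nmean (\<lambda>w'. if x \<in> V then nmean (\<lambda>z. killed_prob V j z w') x else 0) w else 0)"
    unfolding Suc by (simp add: nmean_def add_divide_distrib add_ac)
  also have "\<dots> = (if w \<in> V then nmean (killed_prob V (Suc j) x) w else 0)"
  proof -
    have "killed_prob V (Suc j) x = (\<lambda>w'. if x \<in> V then nmean (\<lambda>z. killed_prob V j z w') x else 0)"
      by (rule ext, rule killed_prob_first_step[OF V])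
    then show ?thesis by (simp only:)
  qed
  finally show ?case .
qed

lemma less_exit_time_iff: "enat j < exit_time V S \<longleftrightarrow> (\<forall>i\<le>j. S i \<in> V)"
proof -
  have "enat j < exit_time V S \<longleftrightarrow> (\<forall>i. S i \<notin> V \<longrightarrow> j < i)"
  proof
    assume *: "enat j < exit_time V S"
    { fix i assume "S i \<notin> V"
      then have "exit_time V S \<le> enat i" unfolding exit_time_def by (intro INF_lower) auto
      with * have "j < i" using enat_ord_simps(2) less_le_trans by blast }
    then show "\<forall>i. S i \<notin> V \<longrightarrow> j < i" by blast
  next
    assume *: "\<forall>i. S i \<notin> V \<longrightarrow> j < i"
    have "enat (Suc j) \<le> exit_time V S" unfolding exit_time_def using * by (intro INF_greatest) auto
    then show "enat j < exit_time V S" by (simp add: Suc_ile_eq)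
  qed
  then show ?thesis by (metis not_less)
qed

lemma countable_square_lattice: "countable square_lattice"
proof -
  have "square_lattice \<subseteq> (\<lambda>(m, n). Complex (of_int m) (of_int n)) ` (UNIV :: (int \<times> int) set)"
  proof
    fix z assume "z \<in> square_lattice"
    then obtain m n where "Re z = of_int m" "Im z = of_int n" by (auto simp: square_lattice_def elim!: Ints_cases)
    then have "z = (\<lambda>(m, n). Complex (of_int m) (of_int n)) (m, n)" by (simp add: complex_eq_iff)
    then show "z \<in> (\<lambda>(m, n). Complex (of_int m) (of_int n)) ` (UNIV :: (int \<times> int) set)" by blast
  qed
  then show ?thesis by (rule countable_subset) simp
qed

lemma borel_subset_lattice: "V \<subseteq> square_lattice \<Longrightarrow> V \<in> sets borel"
  by (rule sets.countable[OF _ countable_subset[OF _ countable_square_lattice]]) (rule borel_closed, simp)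

lemma rw_green_eq: "rw_green D x y = (\<Sum>j. killed_prob (D \<inter> square_lattice) j x y)"
  unfolding rw_green_def killed_prob_def less_exit_time_iff ..

lemma potential_kernel_eq:
  "potential_kernel x = (\<Sum>j. killed_prob UNIV j 0 0 - killed_prob UNIV j x 0)"
  unfolding potential_kernel_def killed_prob_def by (simp only: UNIV_I simp_thms)

section \<open>Area theorem and Koebe distortion\<close>

definition vec_complex :: "complex \<Rightarrow> real^2" where "vec_complex z = (\<chi> i. if i = 1 then Re z else Im z)"
definition complex_vec :: "real^2 \<Rightarrow> complex" where "complex_vec v = Complex (v $ 1) (v $ 2)"

lemma vec_complex_nth [simp]: "vec_complex z $ 1 = Re z" "vec_complex z $ 2 = Im z"
  by (simp_all add: vec_complex_def)

lemma complex_vec_inverse [simp]: "complex_vec (vec_complex z) = z" "vec_complex (complex_vec v) = v"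
  by (simp_all add: complex_vec_def vec_eq_iff forall_2)

lemma norm_vec_complex [simp]: "norm (vec_complex z) = norm z"
  by (simp add: norm_vec_def L2_set_def UNIV_2 cmod_def)

lemma complex_vec_sel [simp]: "Re (complex_vec v) = v $ 1" "Im (complex_vec v) = v $ 2"
  by (simp_all add: complex_vec_def)

lemma linear_complex_vec: "linear complex_vec"
  by (intro linearI) (simp_all add: complex_eq_iff)

lemma linear_vec_complex: "linear vec_complex"
  by (intro linearI) (simp_all add: vec_eq_iff forall_2)

lemma bounded_linear_complex_vec: "bounded_linear complex_vec"
  using linear_complex_vec by (rule linear_conv_bounded_linear[THEN iffD1])

lemma bounded_linear_vec_complex: "bounded_linear vec_complex"
  using linear_vec_complex by (rule linear_conv_bounded_linear[THEN iffD1])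

text \<open>Iterated integrals come from \<open>integral_prod_continuous\<close> on pairs, the
  change of variables from \<open>measure_differentiable_image_eq\<close> on \<open>real^2\<close>;
  the coordinate bijection maps boxes to boxes of equal content.\<close>

lemma has_integral_real2:
  fixes f :: "real \<times> real \<Rightarrow> real"
  assumes "(f has_integral I) (cbox (a, c) (b, d))"
  shows "((\<lambda>v::real^2. f (v $ 1, v $ 2)) has_integral I) (cbox (vector [a, c]) (vector [b, d]))"
proof -
  define g :: "real^2 \<Rightarrow> real \<times> real" where "g = (\<lambda>v. (v $ 1, v $ 2))"
  define h :: "real \<times> real \<Rightarrow> real^2" where "h = (\<lambda>p. vector [fst p, snd p])"
  have hg: "h (g x) = x" and gh: "g (h p) = p" for x p
    by (simp_all add: g_def h_def vec_eq_iff forall_2)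
  have gi: "g ` cbox u v = cbox (u $ 1, u $ 2) (v $ 1, v $ 2)" for u v
  proof -
    have "g ` cbox u v = h -` cbox u v" using hg gh by (auto simp: image_iff intro: gh[symmetric])
    also have "\<dots> = cbox (u $ 1, u $ 2) (v $ 1, v $ 2)"
      by (auto simp: h_def mem_box_cart forall_2 cbox_Pair_eq)
    finally show ?thesis .
  qed
  have hi: "h ` cbox u v = cbox (h u) (h v)" for u v
  proof -
    have "h ` cbox u v = g -` cbox u v" using hg gh by (auto simp: image_iff intro: hg[symmetric])
    also have "\<dots> = cbox (h u) (h v)"
      by (cases u; cases v) (auto simp: h_def g_def mem_box_cart forall_2 cbox_Pair_eq)
    finally show ?thesis .
  qed
  have "((\<lambda>x. f (g x)) has_integral (1 / 1) *\<^sub>R I) (h ` cbox (a, c) (b, d))"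
  proof (rule has_integral_twiddle[OF _ _ _ _ _ _ _ assms])
    show "continuous (at x) g" for x unfolding g_def by (intro continuous_intros)
    show "measure lborel (g ` cbox u v) = 1 * measure lborel (cbox u v)" for u v
    proof -
      have 1: "cbox u v = {} \<longleftrightarrow> v $ 1 < u $ 1 \<or> v $ 2 < u $ 2"
        using forall_2[of "\<lambda>i. \<not> v $ i < u $ i"] by (auto simp: interval_eq_empty_cart)
      show ?thesis
        unfolding gi content_Pair content_real_if content_cbox_if_cart 1 UNIV_2 by (simp add: not_less)
    qed
    show "\<exists>w z. g ` cbox u v = cbox w z" for u v using gi by blast
    show "\<exists>w z. h ` cbox u v = cbox w z" for u v using hi by blast
  qed (use hg gh in auto)
  then show ?thesis by (simp add: hi) (simp add: g_def h_def)
qed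

text \<open>The real-linear map w -> w - q cnj w has determinant 1 - |q|^2, and multiplication by p
  before it contributes |p|^2. For a suitable q this map makes an ellipse round.\<close>

lemma det_complex_real_linear:
  fixes p q :: complex
  defines "T \<equiv> (\<lambda>h::real^2. vec_complex (p * complex_vec h - q * cnj (p * complex_vec h)))"
  shows "det (matrix T) = (cmod p)\<^sup>2 * (1 - (cmod q)\<^sup>2)"
proof -
  have "det (matrix T) = Re (p - q * cnj p) * Im (p * \<i> - q * cnj (p * \<i>)) - Re (p * \<i> - q * cnj (p * \<i>)) * Im (p - q * cnj p)"
    unfolding det_2 matrix_def T_def by (simp add: axis_def complex_vec_def vec_complex_def Complex_eq algebra_simps)
  also have "\<dots> = (cmod p)\<^sup>2 * (1 - (cmod q)\<^sup>2)"
    unfolding cmod_power2 by (simp add: algebra_simps power2_eq_square)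
  finally show ?thesis .
qed

text \<open>\<open>G\<close> followed by w -> w - q cnj w stays injective, since A = q cnj A with
  |q| < 1 forces A = 0. The area of the image is therefore the integral of the Jacobian and at most
  that of the disk containing it. \<open>hh\<close> is a minorant of |G'|^2 whose integral can be
  computed.\<close>

lemma area_conformal_le:
  fixes G :: "complex \<Rightarrow> complex" and q :: complex and hh :: "complex \<Rightarrow> real"
  assumes holo: "G holomorphic_on U" "open U" "cbox (Complex a c) (Complex b d) \<subseteq> U"
    and inj: "inj_on G (box (Complex a c) (Complex b d))"
    and q: "cmod q < 1" and t: "t > 0"
    and bnd: "\<And>s. s \<in> box (Complex a c) (Complex b d) \<Longrightarrow> cmod (G s - q * cnj (G s)) \<le> t"
    and hc: "continuous_on (cbox (Complex a c) (Complex b d)) hh"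
    and hh: "\<And>s. s \<in> box (Complex a c) (Complex b d) \<Longrightarrow> hh s \<le> (cmod (deriv G s))\<^sup>2"
  shows "(1 - (cmod q)\<^sup>2) * integral {a..b} (\<lambda>x. integral {c..d} (\<lambda>y. hh (Complex x y))) \<le> pi * t\<^sup>2"
proof -
  define S where "S = box (vector [a, c] :: real^2) (vector [b, d])"
  define F where "F = (\<lambda>v. vec_complex (G (complex_vec v) - q * cnj (G (complex_vec v))))"
  have memS: "v \<in> S \<longleftrightarrow> complex_vec v \<in> box (Complex a c) (Complex b d)" for v
    by (auto simp: S_def mem_box_cart forall_2 in_box_complex_iff)
  have sub: "box (Complex a c) (Complex b d) \<subseteq> U"
    using holo(3) box_subset_cbox by blast
  have der: "(F has_derivative (\<lambda>h. vec_complex (deriv G (complex_vec v) * complex_vec h - q * cnj (deriv G (complex_vec v) * complex_vec h)))) (at v within S)"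
    if "v \<in> S" for v
  proof -
    have "complex_vec v \<in> U" using that memS sub by blast
    then have "(G has_field_derivative deriv G (complex_vec v)) (at (complex_vec v))"
      using holo holomorphic_derivI by blast
    then have 1: "(G has_derivative (*) (deriv G (complex_vec v))) (at (complex_vec v))"
      by (simp add: has_field_derivative_def)
    have 2: "(complex_vec has_derivative complex_vec) (at v within S)"
      by (rule bounded_linear_imp_has_derivative[OF bounded_linear_complex_vec])
    have 3: "((\<lambda>v. G (complex_vec v)) has_derivative (\<lambda>h. deriv G (complex_vec v) * complex_vec h)) (at v within S)"
      using has_derivative_compose[OF 2 1] by (simp add: o_def)
    have 4: "((\<lambda>v. G (complex_vec v) - q * cnj (G (complex_vec v))) has_derivative
        (\<lambda>h. deriv G (complex_vec v) * complex_vec h - q * cnj (deriv G (complex_vec v) * complex_vec h))) (at v within S)"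
      by (intro has_derivative_diff 3 has_derivative_mult_right has_derivative_cnj)
    show ?thesis unfolding F_def
      by (rule bounded_linear.has_derivative[OF bounded_linear_vec_complex 4])
  qed
  have injF: "inj_on F S"
  proof (rule inj_onI)
    fix v w assume vw: "v \<in> S" "w \<in> S" "F v = F w"
    define A where "A = G (complex_vec v) - G (complex_vec w)"
    have "G (complex_vec v) - q * cnj (G (complex_vec v)) = G (complex_vec w) - q * cnj (G (complex_vec w))"
      using vw(3) unfolding F_def by (metis complex_vec_inverse(1))
    then have "A = q * cnj A" by (simp add: A_def algebra_simps)
    then have "cmod A = cmod q * cmod A" by (metis complex_mod_cnj norm_mult)
    then have "A = 0" using q by auto
    then have "complex_vec v = complex_vec w"
      using inj vw(1,2) unfolding memS A_def inj_on_def by simp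
    then show "v = w" by (metis complex_vec_inverse(2))
  qed
  have Sm: "S \<in> sets lebesgue" by (simp add: S_def)
  define J where "J = (\<lambda>v. \<bar>det (matrix (\<lambda>h. vec_complex (deriv G (complex_vec v) * complex_vec h - q * cnj (deriv G (complex_vec v) * complex_vec h))))\<bar>)"
  have J: "J v = (cmod (deriv G (complex_vec v)))\<^sup>2 * (1 - (cmod q)\<^sup>2)" for v
  proof -
    have "(cmod q)\<^sup>2 \<le> 1" using q by (simp add: power_le_one)
    then show ?thesis unfolding J_def det_complex_real_linear by (simp add: abs_mult)
  qed
  have Fsub: "F ` S \<subseteq> cball 0 t" using bnd memS by (auto simp: F_def)
  have contcv: "continuous_on X complex_vec" for X
    using bounded_linear_complex_vec linear_continuous_on by blast
  have contJ: "continuous_on (closure S) J"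
  proof -
    have *: "complex_vec ` (cbox (vector [a, c]) (vector [b, d])) \<subseteq> U"
    proof
      fix z assume "z \<in> complex_vec ` (cbox (vector [a, c]) (vector [b, d]))"
      then have "z \<in> cbox (Complex a c) (Complex b d)"
        by (auto simp: mem_box_cart forall_2 in_cbox_complex_iff)
      with holo show "z \<in> U" by blast
    qed
    have "continuous_on (cbox (vector [a, c]) (vector [b, d])) (\<lambda>v. deriv G (complex_vec v))"
      using holomorphic_on_imp_continuous_on[OF holomorphic_deriv[OF holo(1,2)]] *
      by (intro continuous_on_compose2[OF _ contcv]) auto
    then have "continuous_on (cbox (vector [a, c]) (vector [b, d])) J"
      unfolding J by (intro continuous_intros)
    moreover have "closure S \<subseteq> cbox (vector [a, c]) (vector [b, d])"
      unfolding S_def by (intro closure_minimal box_subset_cbox closed_cbox)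
    ultimately show ?thesis by (rule continuous_on_subset)
  qed
  have Jint: "J integrable_on S"
  proof (cases "S = {}")
    case False
    then have "closure S = cbox (vector [a, c]) (vector [b, d])" unfolding S_def by (rule closure_box)
    with contJ have "J integrable_on cbox (vector [a, c]) (vector [b, d])" by (simp add: integrable_continuous)
    then show ?thesis unfolding S_def using integrable_on_open_interval by blast
  qed (simp add: integrable_on_empty)
  have mF: "F ` S \<in> lmeasurable"
    using measurable_differentiable_image_eq[OF Sm der injF] Jint unfolding J_def by blast
  have "integral S J = measure lebesgue (F ` S)"
    using measure_differentiable_image_eq[OF Sm der injF] Jint unfolding J_def by simp
  also have "\<dots> \<le> measure lebesgue (cball 0 t :: (real^2) set)"
    by (rule measure_mono_fmeasurable[OF Fsub]) (use mF in auto)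
  also have "\<dots> = pi * t\<^sup>2" using t by (simp add: content_cball unit_ball_vol_2)
  finally have up: "integral S J \<le> pi * t\<^sup>2" .
  define f where "f = (\<lambda>p::real\<times>real. hh (Complex (fst p) (snd p)))"
  have fc: "continuous_on (cbox (a, c) (b, d)) f"
    unfolding f_def
  proof (rule continuous_on_compose2[OF hc])
    show "continuous_on (cbox (a, c) (b, d)) (\<lambda>x. Complex (fst x) (snd x))"
      unfolding Complex_eq by (intro continuous_intros)
    show "(\<lambda>x. Complex (fst x) (snd x)) ` cbox (a, c) (b, d) \<subseteq> cbox (Complex a c) (Complex b d)"
      by (auto simp: in_cbox_complex_iff cbox_Pair_eq)
  qed
  have "integral (cbox (a, c) (b, d)) f = integral (cbox a b) (\<lambda>x. integral (cbox c d) (\<lambda>y. f (x, y)))"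
    by (rule integral_prod_continuous[OF fc])
  moreover have "(f has_integral integral (cbox (a, c) (b, d)) f) (cbox (a, c) (b, d))"
    using integrable_continuous[OF fc] by (simp add: integrable_integral)
  ultimately have "((\<lambda>v::real^2. f (v $ 1, v $ 2)) has_integral
      integral {a..b} (\<lambda>x. integral {c..d} (\<lambda>y. hh (Complex x y)))) (cbox (vector [a, c]) (vector [b, d]))"
    using has_integral_real2[of f] by (simp add: f_def cbox_interval)
  then have I: "((\<lambda>v::real^2. f (v $ 1, v $ 2)) has_integral
      integral {a..b} (\<lambda>x. integral {c..d} (\<lambda>y. hh (Complex x y)))) S"
    unfolding S_def by (simp only: has_integral_open_interval)
  have "(1 - (cmod q)\<^sup>2) * integral {a..b} (\<lambda>x. integral {c..d} (\<lambda>y. hh (Complex x y))) \<le> integral S J"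
  proof (rule has_integral_le[OF has_integral_mult_right[OF I]])
    show "(J has_integral integral S J) S" using Jint by (simp add: integrable_integral)
    fix v assume v: "v \<in> S"
    have "f (v $ 1, v $ 2) \<le> (cmod (deriv G (complex_vec v)))\<^sup>2"
      using hh[of "complex_vec v"] v memS by (auto simp: f_def complex_vec_def)
    moreover have "(cmod q)\<^sup>2 \<le> 1" using q by (simp add: power_le_one)
    ultimately show "(1 - (cmod q)\<^sup>2) * f (v $ 1, v $ 2) \<le> J v"
      unfolding J by (subst mult.commute) (intro mult_right_mono, auto)
  qed
  with up show ?thesis by linarith
qed

section \<open>Area theorem in the logarithmic coordinate\<close>

lemma holomorphic_remainder:
  assumes "f holomorphic_on ball 0 R"
  obtains g where "g holomorphic_on ball 0 R" "\<And>z. f z = f 0 + z * g z" "g 0 = deriv f 0"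
proof
  let ?g = "\<lambda>z. if z = 0 then deriv f 0 else (f z - f 0) / (z - 0)"
  show "?g holomorphic_on ball 0 R" by (rule pole_lemma_open[OF assms open_ball])
qed auto

lemma ball_primitive:
  fixes f :: "complex \<Rightarrow> complex"
  assumes "f holomorphic_on ball a R"
  obtains P where "\<And>z. z \<in> ball a R \<Longrightarrow> (P has_field_derivative f z) (at z)"
proof -
  obtain P where P: "\<And>z. z \<in> ball a R \<Longrightarrow> (P has_field_derivative f z) (at z within ball a R)"
    using holomorphic_convex_primitive'[OF convex_ball open_ball assms] by blast
  show thesis
  proof (rule that)
    show "(P has_field_derivative f z) (at z)" if "z \<in> ball a R" for z
      using P[OF that] unfolding at_within_open[OF that open_ball] .
  qed
qed

text \<open>On a circle about 0 the conjugate is a multiple of the inverse; this turns an integrand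
  with a conjugate into a holomorphic one, which has a primitive.\<close>

lemma cnj_exp_scaled: "cnj (exp (Complex x y)) = of_real (exp (2*x)) * exp (- Complex x y)"
proof -
  have "cnj (exp (Complex x y)) = exp (cnj (Complex x y))" by (simp add: exp_cnj)
  also have "cnj (Complex x y) = of_real (2*x) + - Complex x y" by (simp add: complex_eq_iff)
  also have "exp (of_real (2*x) + - Complex x y) = of_real (exp (2*x)) * exp (- Complex x y)"
    by (simp only: exp_add exp_of_real)
  finally show ?thesis .
qed

text \<open>An integral over a full circle in the coordinate s = log z. The primitive
  \<open>F\<close> fails to be periodic only through a linear term, whose slope \<open>c\<close> is
  the mean value of \<open>f\<close>.\<close>

lemma integral_vertical_period:
  assumes F: "\<And>y. y \<in> {0..2*pi} \<Longrightarrow> (F has_field_derivative f (Complex x y)) (at (Complex x y))"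
    and per: "F (Complex x (2*pi)) - F (Complex x 0) = of_real (2*pi) * \<i> * c"
  shows "((\<lambda>y. f (Complex x y)) has_integral of_real (2*pi) * c) {0..2*pi}"
proof -
  have "((\<lambda>y. \<i> * f (Complex x y)) has_integral F (Complex x (2*pi)) - F (Complex x 0)) {0..2*pi}"
  proof (rule fundamental_theorem_of_calculus)
    fix y assume y: "y \<in> {0..2*pi}"
    have "((\<lambda>y. Complex x y) has_vector_derivative \<i>) (at y within {0..2*pi})"
      unfolding Complex_eq by (auto intro!: derivative_eq_intros)
    from field_vector_diff_chain_within[OF this has_field_derivative_at_within[OF F[OF y]]]
    show "((\<lambda>y. F (Complex x y)) has_vector_derivative \<i> * f (Complex x y)) (at y within {0..2*pi})"
      by (simp add: o_def)
  qed (use pi_ge_zero in auto)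
  from has_integral_mult_right[OF this, of "- \<i>"]
  have H: "((\<lambda>y. - \<i> * (\<i> * f (Complex x y))) has_integral - \<i> * (of_real (2*pi) * \<i> * c)) {0..2*pi}"
    unfolding per .
  have a: "- \<i> * (\<i> * z) = z" for z by (simp add: mult.assoc[symmetric])
  have b: "- \<i> * (of_real (2*pi) * \<i> * c) = of_real (2*pi) * c"
    using i_squared by algebra
  show ?thesis using H unfolding a b .
qed

lemma exp_period_2: "exp (- 2 * Complex x (2*pi)) = exp (- 2 * Complex x 0)"
  unfolding exp_eq by (intro exI[of _ "-2"]) (simp add: complex_eq_iff)

text \<open>The cross term of the Bessel inequality on a circle, written in the logarithmic coordinate:
  \<open>F\<close> is any function with the same two leading Laurent coefficients as \<open>e\<^sup>s + b e\<^sup>-\<^sup>s\<close>.\<close>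

lemma integral_cross_term:
  fixes M :: "complex \<Rightarrow> complex"
  assumes M: "M holomorphic_on ball 0 1" "M 0 = 1" "deriv M 0 = b" and x: "x > 0"
  defines "T \<equiv> \<lambda>s. exp s + b * exp (- s)"
  shows "((\<lambda>y. Re (exp (Complex x y) * M (exp (- 2 * Complex x y)) * cnj (T (Complex x y)))) has_integral
           2 * pi * (exp (2*x) + (cmod b)\<^sup>2 * exp (- 2*x))) {0..2*pi}"
proof -
  obtain N where N: "N holomorphic_on ball 0 1" "\<And>z. M z = 1 + z * N z" "N 0 = b"
    using holomorphic_remainder[OF M(1)] M(2,3) by metis
  obtain N2 where N2: "N2 holomorphic_on ball 0 1" "\<And>z. N z = b + z * N2 z"
    using holomorphic_remainder[OF N(1)] N(3) by metis
  obtain P where P: "\<And>z. z \<in> ball 0 1 \<Longrightarrow> (P has_field_derivative N z) (at z)"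
    using ball_primitive[OF N(1)] by blast
  obtain P2 where P2: "\<And>z. z \<in> ball 0 1 \<Longrightarrow> (P2 has_field_derivative N2 z) (at z)"
    using ball_primitive[OF N2(1)] by blast
  have inball: "exp (- 2 * Complex x y) \<in> ball 0 1" for y
    using x by simp
  have e: "((\<lambda>s. exp (- 2 * s)) has_field_derivative - 2 * exp (- 2 * s)) (at s)" for s :: complex
    by (auto intro!: derivative_eq_intros)
  \<comment> \<open>Constant Laurent coefficient: z = exp (- 2 * s) gives dz = -2 z ds, so P(z) / 2
    absorbs all of \<open>M\<close> but its constant 1.\<close>
  have 1: "((\<lambda>y. M (exp (- 2 * Complex x y))) has_integral of_real (2*pi) * 1) {0..2*pi}"
  proof (rule integral_vertical_period[where F = "\<lambda>s. s - P (exp (- 2 * s)) / 2" and f = "\<lambda>s. M (exp (- 2 * s))"])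
    fix y
    have "((\<lambda>s. s - P (exp (- 2 * s)) / 2) has_field_derivative
        1 - (N (exp (- 2 * Complex x y)) * (- 2 * exp (- 2 * Complex x y))) / 2) (at (Complex x y))"
      by (intro DERIV_diff DERIV_ident DERIV_cdivide DERIV_chain2[OF P[OF inball] e])
    then show "((\<lambda>s. s - P (exp (- 2 * s)) / 2) has_field_derivative M (exp (- 2 * Complex x y))) (at (Complex x y))"
      by (simp add: N(2) mult.commute)
  next
    show "Complex x (2*pi) - P (exp (- 2 * Complex x (2*pi))) / 2 - (Complex x 0 - P (exp (- 2 * Complex x 0)) / 2)
      = of_real (2*pi) * \<i> * 1"
      unfolding exp_period_2 by (simp add: complex_eq_iff)
  qed
  \<comment> \<open>Dividing \<open>M\<close> by z makes its linear coefficient the constant one;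
    the rest after it is the second remainder \<open>N2\<close>.\<close>
  have 2: "((\<lambda>y. exp (2 * Complex x y) * M (exp (- 2 * Complex x y))) has_integral of_real (2*pi) * b) {0..2*pi}"
  proof (rule integral_vertical_period[where F = "\<lambda>s. exp (2 * s) / 2 + b * s - P2 (exp (- 2 * s)) / 2" and f = "\<lambda>s. exp (2 * s) * M (exp (- 2 * s))"])
    fix y
    let ?s = "Complex x y"
    have "((\<lambda>s. exp (2 * s) / 2 + b * s - P2 (exp (- 2 * s)) / 2) has_field_derivative
        (2 * exp (2 * ?s)) / 2 + b - (N2 (exp (- 2 * ?s)) * (- 2 * exp (- 2 * ?s))) / 2) (at ?s)"
    proof (intro DERIV_diff DERIV_add DERIV_cdivide DERIV_chain2[OF P2[OF inball] e])
      show "((\<lambda>s. exp (2 * s)) has_field_derivative 2 * exp (2 * ?s)) (at ?s)"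
        by (auto intro!: derivative_eq_intros)
      show "((*) b has_field_derivative b) (at ?s)" using DERIV_cmult_Id by blast
    qed
    moreover have "exp (2 * ?s) * M (exp (- 2 * ?s)) = (2 * exp (2 * ?s)) / 2 + b - (N2 (exp (- 2 * ?s)) * (- 2 * exp (- 2 * ?s))) / 2"
    proof -
      have "exp (2 * ?s) * exp (- 2 * ?s) = 1" by (simp add: exp_add[symmetric])
      then have "exp (2 * ?s) * (1 + exp (- 2 * ?s) * (b + exp (- 2 * ?s) * N2 (exp (- 2 * ?s)))) =
         exp (2 * ?s) + b + exp (- 2 * ?s) * N2 (exp (- 2 * ?s))" by algebra
      then show ?thesis unfolding N(2) N2(2) by simp
    qed
    ultimately show "((\<lambda>s. exp (2 * s) / 2 + b * s - P2 (exp (- 2 * s)) / 2) has_field_derivative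
        exp (2 * ?s) * M (exp (- 2 * ?s))) (at ?s)" by metis
  next
    have "exp (2 * Complex x (2*pi)) = inverse (exp (- 2 * Complex x (2*pi)))" by (simp add: exp_minus)
    also have "\<dots> = exp (2 * Complex x 0)" unfolding exp_period_2 by (simp add: exp_minus)
    finally show "exp (2 * Complex x (2*pi)) / 2 + b * Complex x (2*pi) - P2 (exp (- 2 * Complex x (2*pi))) / 2
       - (exp (2 * Complex x 0) / 2 + b * Complex x 0 - P2 (exp (- 2 * Complex x 0)) / 2) = of_real (2*pi) * \<i> * b"
      unfolding exp_period_2 by (simp add: complex_eq_iff algebra_simps)
  qed
  have eq: "exp (Complex x y) * M (exp (- 2 * Complex x y)) * cnj (T (Complex x y)) =
     of_real (exp (2*x)) * M (exp (- 2 * Complex x y))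
      + (cnj b * of_real (exp (- 2*x))) * (exp (2 * Complex x y) * M (exp (- 2 * Complex x y)))" for y
  proof -
    let ?s = "Complex x y"
    have "cnj (exp (- ?s)) = of_real (exp (- 2*x)) * exp ?s"
    proof -
      have "- ?s = Complex (-x) (-y)" by (simp add: complex_eq_iff)
      moreover have "- Complex (-x) (-y) = ?s" by (simp add: complex_eq_iff)
      ultimately show ?thesis using cnj_exp_scaled[of "-x" "-y"] by simp
    qed
    then have "cnj (T ?s) = of_real (exp (2*x)) * exp (- ?s) + cnj b * (of_real (exp (- 2*x)) * exp ?s)"
      unfolding T_def by (simp only: complex_cnj_add complex_cnj_mult cnj_exp_scaled)
    moreover have "exp ?s * exp (- ?s) = 1" by (simp add: exp_add[symmetric])
    moreover have "exp ?s * exp ?s = exp (2 * ?s)" by (simp add: exp_add[symmetric])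
    ultimately show ?thesis by algebra
  qed
  have "((\<lambda>y. exp (Complex x y) * M (exp (- 2 * Complex x y)) * cnj (T (Complex x y))) has_integral
     of_real (exp (2*x)) * (of_real (2*pi) * 1) + (cnj b * of_real (exp (- 2*x))) * (of_real (2*pi) * b)) {0..2*pi}"
    unfolding eq by (intro has_integral_add has_integral_mult_right 1 2)
  from has_integral_linear[OF this bounded_linear_Re]
  have "((\<lambda>y. Re (exp (Complex x y) * M (exp (- 2 * Complex x y)) * cnj (T (Complex x y)))) has_integral
    Re (of_real (exp (2*x)) * (of_real (2*pi) * 1) + (cnj b * of_real (exp (- 2*x))) * (of_real (2*pi) * b))) {0..2*pi}"
    by (simp add: o_def)
  moreover have "Re (of_real (exp (2*x)) * (of_real (2*pi) * 1) + (cnj b * of_real (exp (- 2*x))) * (of_real (2*pi) * b))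
    = 2 * pi * (exp (2*x) + (cmod b)\<^sup>2 * exp (- 2*x))"
    unfolding cmod_power2 by (simp add: algebra_simps power2_eq_square)
  ultimately show ?thesis by simp
qed

text \<open>For |zeta| = rho the choice q = b / rho^2 cancels the cnj zeta term, so the ellipse zeta
  + b / zeta goes to a circle of radius at most rho. For smaller tau the residual b cnj zeta (1 /
  tau^2 - 1 / rho^2) must fit into the slack rho - tau: for tau >= rho / 2 because 4 |b| <= rho^2,
  below that by the crude bound |b|.\<close>

lemma ellipse_bound:
  fixes b \<zeta> E :: complex and \<rho> K :: real
  defines "\<tau> \<equiv> cmod \<zeta>"
  assumes \<tau>: "1 \<le> \<tau>" "\<tau> \<le> \<rho>" and E: "cmod E \<le> K / \<tau> ^ 3" and K: "K \<ge> 0"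
    and \<rho>: "4 * cmod b \<le> \<rho>\<^sup>2" "2 * cmod b + 4 * K \<le> \<rho>" "cmod b \<le> \<rho>"
  defines "q \<equiv> b / of_real (\<rho>\<^sup>2)"
  defines "w \<equiv> \<zeta> + b / \<zeta> + E"
  shows "cmod (w - q * cnj w) \<le> \<rho> + 16 * K / \<rho> ^ 3"
proof -
  have \<zeta>0: "\<zeta> \<noteq> 0" using \<tau> by (auto simp: \<tau>_def)
  have pos: "\<tau> > 0" "\<rho> > 0" using \<tau> by auto
  have q1: "cmod q \<le> 1"
    using \<rho>(1) pos by (simp add: q_def norm_divide norm_power field_simps) (smt (verit) norm_ge_zero)
  define w0 where "w0 = \<zeta> + b / \<zeta>"
  have zz: "\<zeta> * cnj \<zeta> = of_real (\<tau>\<^sup>2)" by (simp only: \<tau>_def complex_norm_square)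
  have inv: "1 / \<zeta> = cnj \<zeta> / of_real (\<tau>\<^sup>2)" using \<zeta>0 zz pos
    by (metis complex_cnj_zero_iff nonzero_mult_divide_mult_cancel_right2 mult_1 mult.commute)
  have inv2: "1 / cnj \<zeta> = \<zeta> / of_real (\<tau>\<^sup>2)"
    using arg_cong[OF inv, of cnj] by simp
  have "w0 - q * cnj w0 = \<zeta> + b * (1 / \<zeta>) - q * cnj \<zeta> - q * cnj b * (1 / cnj \<zeta>)"
    by (simp add: w0_def algebra_simps)
  also have "\<dots> = \<zeta> * of_real (1 - (cmod b)\<^sup>2 / (\<rho>\<^sup>2 * \<tau>\<^sup>2)) + b * cnj \<zeta> * of_real (1 / \<tau>\<^sup>2 - 1 / \<rho>\<^sup>2)"
  proof -
    have "q * cnj b = of_real ((cmod b)\<^sup>2 / \<rho>\<^sup>2)"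
      by (simp only: q_def of_real_divide complex_norm_square times_divide_eq_left)
    then have "q * cnj b * (1 / cnj \<zeta>) = \<zeta> * of_real ((cmod b)\<^sup>2 / (\<rho>\<^sup>2 * \<tau>\<^sup>2))"
      unfolding inv2 by (simp add: field_simps)
    then show ?thesis unfolding inv by (simp add: q_def algebra_simps)
  qed
  finally have eq: "w0 - q * cnj w0 = \<dots>" .
  have c1: "\<bar>1 - (cmod b)\<^sup>2 / (\<rho>\<^sup>2 * \<tau>\<^sup>2)\<bar> \<le> 1"
  proof -
    have "(cmod b)\<^sup>2 \<le> \<rho>\<^sup>2" using \<rho>(3) by (simp add: power_mono)
    also have "\<dots> \<le> \<rho>\<^sup>2 * \<tau>\<^sup>2" using mult_left_mono[OF one_le_power[OF \<tau>(1), of 2], of "\<rho>\<^sup>2"] by simp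
    finally have "(cmod b)\<^sup>2 / (\<rho>\<^sup>2 * \<tau>\<^sup>2) \<le> 1" using pos by (simp add: divide_le_eq_1)
    moreover have "(cmod b)\<^sup>2 / (\<rho>\<^sup>2 * \<tau>\<^sup>2) \<ge> 0" by simp
    ultimately show ?thesis by linarith
  qed
  have c2: "1 / \<tau>\<^sup>2 - 1 / \<rho>\<^sup>2 \<ge> 0" using \<tau> pos by (simp add: frac_le power_mono)
  have "cmod (w0 - q * cnj w0) \<le> \<tau> * \<bar>1 - (cmod b)\<^sup>2 / (\<rho>\<^sup>2 * \<tau>\<^sup>2)\<bar> + cmod b * \<tau> * \<bar>1 / \<tau>\<^sup>2 - 1 / \<rho>\<^sup>2\<bar>"
    unfolding eq by (rule order_trans[OF norm_triangle_ineq]) (simp add: norm_mult \<tau>_def del: of_real_diff of_real_divide)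
  also have "\<dots> \<le> \<tau> * 1 + cmod b * \<tau> * (1 / \<tau>\<^sup>2 - 1 / \<rho>\<^sup>2)"
    using c1 c2 pos by (intro add_mono mult_left_mono) auto
  finally have n0: "cmod (w0 - q * cnj w0) \<le> \<tau> + cmod b * \<tau> * (1 / \<tau>\<^sup>2 - 1 / \<rho>\<^sup>2)" by simp
  have "cmod (E - q * cnj E) \<le> cmod E + cmod q * cmod E"
    by (rule order_trans[OF norm_triangle_ineq4]) (simp add: norm_mult)
  also have "\<dots> \<le> 2 * cmod E" using q1 mult_right_mono[OF q1, of "cmod E"] by simp
  also have "\<dots> \<le> 2 * K / \<tau> ^ 3" using E by simp
  finally have nE: "cmod (E - q * cnj E) \<le> 2 * K / \<tau> ^ 3" .
  have "w - q * cnj w = (w0 - q * cnj w0) + (E - q * cnj E)"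
    by (simp add: w_def w0_def algebra_simps)
  then have tot: "cmod (w - q * cnj w) \<le> \<tau> + cmod b * \<tau> * (1 / \<tau>\<^sup>2 - 1 / \<rho>\<^sup>2) + 2 * K / \<tau> ^ 3"
    using order_trans[OF norm_triangle_ineq[of "w0 - q * cnj w0" "E - q * cnj E"] add_mono[OF n0 nE]] by (simp only:)
  have f: "cmod b * \<tau> * (1 / \<tau>\<^sup>2 - 1 / \<rho>\<^sup>2) = cmod b * ((\<rho> - \<tau>) * (\<rho> + \<tau>) / (\<tau> * \<rho>\<^sup>2))"
    using pos by (simp add: field_simps power2_eq_square)
  show ?thesis
  proof (cases "\<rho> / 2 \<le> \<tau>")
    case True
    have "(\<rho> - \<tau>) * (\<rho> + \<tau>) / (\<tau> * \<rho>\<^sup>2) \<le> (\<rho> - \<tau>) * (2 * \<rho>) / (\<rho> / 2 * \<rho>\<^sup>2)"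
      using True pos \<tau> by (intro frac_le mult_mono) auto
    also have "\<dots> = (\<rho> - \<tau>) * 4 / \<rho>\<^sup>2" using pos by (simp add: field_simps power2_eq_square)
    finally have "cmod b * ((\<rho> - \<tau>) * (\<rho> + \<tau>) / (\<tau> * \<rho>\<^sup>2)) \<le> cmod b * ((\<rho> - \<tau>) * 4 / \<rho>\<^sup>2)"
      by (rule mult_left_mono) simp
    also have "\<dots> = (\<rho> - \<tau>) * (4 * cmod b / \<rho>\<^sup>2)" by simp
    also have "\<dots> \<le> (\<rho> - \<tau>) * 1"
      using \<rho>(1) \<tau> pos by (intro mult_left_mono) (auto simp: divide_le_eq_1)
    finally have 1: "\<tau> + cmod b * \<tau> * (1 / \<tau>\<^sup>2 - 1 / \<rho>\<^sup>2) \<le> \<rho>" unfolding f by simp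
    have "2 * K / \<tau> ^ 3 \<le> 2 * K / (\<rho> / 2) ^ 3"
      using True pos K by (intro divide_left_mono power_mono mult_pos_pos) auto
    also have "\<dots> = 16 * K / \<rho> ^ 3" by (simp add: power_divide)
    finally show ?thesis using tot 1 by linarith
  next
    case False
    have "(\<rho> - \<tau>) * (\<rho> + \<tau>) / (\<tau> * \<rho>\<^sup>2) \<le> \<rho>\<^sup>2 / (1 * \<rho>\<^sup>2)"
      using pos \<tau> by (intro frac_le mult_right_mono) (auto simp: algebra_simps power2_eq_square)
    then have "cmod b * ((\<rho> - \<tau>) * (\<rho> + \<tau>) / (\<tau> * \<rho>\<^sup>2)) \<le> cmod b * 1"
      using pos by (intro mult_left_mono) auto
    moreover have "2 * K / \<tau> ^ 3 \<le> 2 * K" using K \<tau>(1) mult_left_mono[OF one_le_power[OF \<tau>(1), of 3], of "2 * K"] pos by (simp add: divide_le_eq)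
    moreover have "16 * K / \<rho> ^ 3 \<ge> 0" using K pos by simp
    ultimately show ?thesis using tot f False \<rho>(2) by linarith
  qed
qed

text \<open>Gronwall's area argument for g(z) = z m(z^-2), which is odd and univalent outside the
  unit disk, with s = log z. The image of sqrt A < |z| < rho lies in an almost elliptic region of
  radius about rho; comparing areas and letting rho tend to infinity, then A to 1, bounds the
  coefficient.\<close>

lemma area_theorem_coeff:
  fixes m :: "complex \<Rightarrow> complex"
  assumes m: "m holomorphic_on ball 0 1" "m 0 = 1"
    and inj: "inj_on (\<lambda>s. exp s * m (exp (- 2 * s))) {s. 0 < Re s \<and> 0 < Im s \<and> Im s < 2 * pi}"
  shows "cmod (deriv m 0) \<le> 1"
proof -
  define b where "b = deriv m 0"
  define G where "G = (\<lambda>s. exp s * m (exp (- 2 * s)))"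
  define U where "U = {s. Re s > 0}"
  \<comment> \<open>The derivative of \<open>G\<close> is \<open>exp s * M (exp (- 2 * s))\<close>;
    differentiating the term b / z reverses the sign of its coefficient.\<close>
  define M where "M = (\<lambda>z. m z - 2 * (z * deriv m z))"
  have dm: "deriv m holomorphic_on ball 0 1" using holomorphic_deriv[OF m(1) open_ball] .
  have Mh: "M holomorphic_on ball 0 1" unfolding M_def by (intro holomorphic_intros m dm)
  have M0: "M 0 = 1" using m by (simp add: M_def)
  have dM: "deriv M 0 = - b"
  proof -
    have z0: "(0::complex) \<in> ball 0 1" by simp
    have 1: "(m has_field_derivative b) (at 0)" unfolding b_def by (rule holomorphic_derivI[OF m(1) open_ball z0])
    have 2: "(deriv m has_field_derivative deriv (deriv m) 0) (at 0)" by (rule holomorphic_derivI[OF dm open_ball z0])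
    have "(M has_field_derivative b - 2 * (1 * deriv m 0 + deriv (deriv m) 0 * 0)) (at 0)"
      unfolding M_def by (intro DERIV_diff DERIV_cmult DERIV_mult 1 2 DERIV_ident)
    then show ?thesis by (intro DERIV_imp_deriv) (simp add: b_def)
  qed
  have openU: "open U" unfolding U_def by (simp add: open_halfspace_Re_gt)
  have inball: "exp (- 2 * s) \<in> ball 0 1" if "s \<in> U" for s
    using that by (simp add: U_def)
  have Gder: "(G has_field_derivative exp s * M (exp (- 2 * s))) (at s)" if "s \<in> U" for s
  proof -
    have e: "((\<lambda>s. exp (- 2 * s)) has_field_derivative - 2 * exp (- 2 * s)) (at s)"
      by (auto intro!: derivative_eq_intros)
    have "(G has_field_derivative exp s * m (exp (- 2 * s)) + (deriv m (exp (- 2 * s)) * (- 2 * exp (- 2 * s))) * exp s) (at s)"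
      unfolding G_def
      by (intro DERIV_mult DERIV_exp DERIV_chain2[OF holomorphic_derivI[OF m(1) open_ball inball[OF that]] e])
    then show ?thesis by (simp add: M_def algebra_simps)
  qed
  have Gh: "G holomorphic_on U" using Gder openU by (auto simp: holomorphic_on_open)
  have dG: "deriv G s = exp s * M (exp (- 2 * s))" if "s \<in> U" for s
    using Gder[OF that] by (rule DERIV_imp_deriv)
  obtain m1 where m1: "m1 holomorphic_on ball 0 1" "\<And>z. m z = 1 + z * m1 z" "m1 0 = b"
    using holomorphic_remainder[OF m(1)] m(2) b_def by metis
  obtain m2 where m2: "m2 holomorphic_on ball 0 1" "\<And>z. m1 z = b + z * m2 z"
    using holomorphic_remainder[OF m1(1)] m1(3) by metis
  define T where "T = (\<lambda>s. exp s + (- b) * exp (- s))"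
  \<comment> \<open>Bessel's inequality |p|^2 >= 2 Re (p cnj T) - |T|^2, where \<open>T\<close>
    keeps the two leading Laurent terms of the derivative; no infinite series of coefficients has to
    be summed.\<close>
  define hh where "hh = (\<lambda>s. 2 * Re (exp s * M (exp (- 2 * s)) * cnj (T s)) - (cmod (T s))\<^sup>2)"
  have key: "(cmod b)\<^sup>2 / A \<le> A" if A: "A > 1" for A
  proof -
    \<comment> \<open>The inner radius sqrt A exceeds 1, which keeps exp (- 2 * s) in a compact disk
      where the remainder \<open>m2\<close> is bounded.\<close>
    define x0 where "x0 = ln A / 2"
    have x0: "x0 > 0" "exp (2 * x0) = A" using A by (auto simp: x0_def)
    define r where "r = exp (- 2 * x0)"
    have r1: "cball 0 r \<subseteq> (ball 0 1 :: complex set)" using x0 by (auto simp: r_def) (smt (verit) exp_less_one_iff)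
    have "compact (m2 ` cball 0 r)"
      using holomorphic_on_imp_continuous_on[OF holomorphic_on_subset[OF m2(1) r1]] by (intro compact_continuous_image) auto
    then obtain K where K: "K > 0" "\<And>z. z \<in> cball 0 r \<Longrightarrow> cmod (m2 z) \<le> K"
      using bounded_pos compact_imp_bounded by (metis imageI)
    define B where "B = (cmod b)\<^sup>2"
    have main: "(1 - B / \<rho> ^ 4) * (\<rho>\<^sup>2 - A + B * (1 / A - 1 / \<rho>\<^sup>2)) \<le> (\<rho> + 16 * K / \<rho> ^ 3)\<^sup>2"
      if \<rho>: "4 * cmod b \<le> \<rho>\<^sup>2" "2 * cmod b + 4 * K \<le> \<rho>" "cmod b \<le> \<rho>" "\<rho> > 1" "\<rho>\<^sup>2 > A" "cmod b < \<rho>\<^sup>2" for \<rho>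
    proof -
      define X where "X = ln \<rho>"
      have X1: "exp X = \<rho>" using \<rho>(4) by (simp add: X_def)
      have X2: "exp (2 * X) = \<rho>\<^sup>2" by (simp only: exp_double X1)
      have X3: "exp (- 2 * X) = 1 / \<rho>\<^sup>2"
        using exp_minus[of "2 * X"] by (simp add: X2 divide_inverse)
      note X = X1 X2 X3
      have x0X: "x0 < X" using \<rho>(5) x0(2) X(2) by (metis exp_less_cancel_iff mult_less_cancel_left_pos zero_less_numeral)
      define q where "q = b / of_real (\<rho>\<^sup>2)"
      have nq: "cmod q = cmod b / \<rho>\<^sup>2" by (simp add: q_def norm_divide norm_power)
      have area: "(1 - (cmod q)\<^sup>2) * integral {x0..X} (\<lambda>x. integral {0..2*pi} (\<lambda>y. hh (Complex x y))) \<le> pi * (\<rho> + 16 * K / \<rho> ^ 3)\<^sup>2"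
      proof (rule area_conformal_le[OF Gh openU])
        show sub: "cbox (Complex x0 0) (Complex X (2 * pi)) \<subseteq> U" using x0 by (auto simp: U_def in_cbox_complex_iff)
        show "inj_on G (box (Complex x0 0) (Complex X (2 * pi)))"
          using inj unfolding G_def by (rule inj_on_subset) (use x0 in \<open>auto simp: in_box_complex_iff\<close>)
        show "cmod q < 1" using \<rho> by (simp add: nq divide_less_eq_1)
        show "\<rho> + 16 * K / \<rho> ^ 3 > 0" using \<rho> K by (intro add_pos_nonneg) auto
        show "continuous_on (cbox (Complex x0 0) (Complex X (2 * pi))) hh"
          unfolding hh_def T_def
          by (intro continuous_intros continuous_on_compose2[OF holomorphic_on_imp_continuous_on[OF Mh]])
             (use inball sub in \<open>auto\<close>)
        fix s assume s: "s \<in> box (Complex x0 0) (Complex X (2 * pi))"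
        then have sU: "s \<in> U" using sub box_subset_cbox by blast
        have Re: "x0 < Re s" "Re s < X" using s by (auto simp: in_box_complex_iff)
        have "2 * Re (p * cnj t) - (cmod t)\<^sup>2 \<le> (cmod p)\<^sup>2" for p t :: complex
        proof -
          have "0 \<le> (cmod (p - t))\<^sup>2" by simp
          also have "\<dots> = (cmod p)\<^sup>2 - 2 * Re (p * cnj t) + (cmod t)\<^sup>2"
            unfolding cmod_power2 by (simp add: power2_eq_square algebra_simps)
          finally show ?thesis by simp
        qed
        then show "hh s \<le> (cmod (deriv G s))\<^sup>2" unfolding hh_def dG[OF sU] .
        define E where "E = exp s * exp (- 2 * s) * exp (- 2 * s) * m2 (exp (- 2 * s))"
        have Gs: "G s = exp s + b / exp s + E"
        proof -
          have "exp s * exp (- 2 * s) = 1 / exp s" by (simp add: exp_minus[symmetric] exp_add[symmetric] divide_inverse)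
          then have "b / exp s = b * (exp s * exp (- 2 * s))" by simp
          then show ?thesis unfolding G_def E_def m1(2) m2(2) by (simp only: algebra_simps) simp
        qed
        have nz: "cmod (exp s) = exp (Re s)" by simp
        have t1: "1 \<le> cmod (exp s)" using Re x0 by simp
        have t2: "cmod (exp s) \<le> \<rho>" using Re X(1) by (metis nz exp_le_cancel_iff less_imp_le)
        have "exp (- 2 * s) \<in> cball 0 r" using Re by (simp add: r_def)
        then have "cmod E \<le> exp (Re s) * exp (- 2 * Re s) * exp (- 2 * Re s) * K"
          unfolding E_def norm_mult using K(2) by (intro mult_mono) auto
        also have "exp (Re s) * exp (- 2 * Re s) * exp (- 2 * Re s) = 1 / exp (Re s) ^ 3"
          by (simp add: exp_add[symmetric] exp_of_nat_mult[symmetric] exp_minus[symmetric] divide_inverse)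
        finally have nE: "cmod E \<le> K / cmod (exp s) ^ 3" by simp
        show "cmod (G s - q * cnj (G s)) \<le> \<rho> + 16 * K / \<rho> ^ 3"
          unfolding Gs q_def by (rule ellipse_bound[OF t1 t2 nE _ \<rho>(1-3)]) (use K in simp)
      qed
      have inner: "integral {0..2*pi} (\<lambda>y. hh (Complex x y)) = 2 * pi * (exp (2*x) + B * exp (- 2*x))" if "x \<in> {x0..X}" for x
      proof -
        have x: "x > 0" using that x0 by auto
        have 1: "((\<lambda>y. Re (exp (Complex x y) * M (exp (- 2 * Complex x y)) * cnj (T (Complex x y)))) has_integral
           2 * pi * (exp (2*x) + B * exp (- 2*x))) {0..2*pi}"
          using integral_cross_term[OF Mh M0 dM x] unfolding T_def B_def by simp
        have h1: "(\<lambda>z. 1 + (- b) * z) holomorphic_on ball 0 1" by (intro holomorphic_intros)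
        have h2: "deriv (\<lambda>z. 1 + (- b) * z) 0 = - b"
          by (intro DERIV_imp_deriv) (auto intro!: derivative_eq_intros)
        have "exp s * (1 + (- b) * exp (- 2 * s)) = T s" for s
        proof -
          have "exp s * exp (- 2 * s) = exp (- s)" by (simp add: exp_add[symmetric])
          then show ?thesis unfolding T_def by (simp add: algebra_simps)
        qed
        moreover have "Re (T s * cnj (T s)) = (cmod (T s))\<^sup>2" for s
          by (metis complex_norm_square Re_complex_of_real)
        moreover have "((\<lambda>y. Re (exp (Complex x y) * (1 + (- b) * exp (- 2 * Complex x y)) * cnj (T (Complex x y)))) has_integral
           2 * pi * (exp (2*x) + B * exp (- 2*x))) {0..2*pi}"
          using integral_cross_term[OF h1 _ h2 x] unfolding T_def B_def by simp
        ultimately have 2: "((\<lambda>y. (cmod (T (Complex x y)))\<^sup>2) has_integral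
           2 * pi * (exp (2*x) + B * exp (- 2*x))) {0..2*pi}"
          by (simp only:)
        have "((\<lambda>y. hh (Complex x y)) has_integral
           2 * (2 * pi * (exp (2*x) + B * exp (- 2*x))) - 2 * pi * (exp (2*x) + B * exp (- 2*x))) {0..2*pi}"
          unfolding hh_def by (intro has_integral_diff has_integral_mult_right 1 2)
        then show ?thesis by (simp add: integral_unique)
      qed
      have outer: "((\<lambda>x. 2 * pi * (exp (2*x) + B * exp (- 2*x))) has_integral
         pi * (exp (2*X) - B * exp (- 2*X)) - pi * (exp (2*x0) - B * exp (- 2*x0))) {x0..X}"
        by (rule fundamental_theorem_of_calculus)
           (use x0X in \<open>auto intro!: derivative_eq_intros simp: has_real_derivative_iff_has_vector_derivative[symmetric] algebra_simps\<close>)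
      have "integral {x0..X} (\<lambda>x. integral {0..2*pi} (\<lambda>y. hh (Complex x y))) =
         integral {x0..X} (\<lambda>x. 2 * pi * (exp (2*x) + B * exp (- 2*x)))"
        by (rule integral_cong) (rule inner)
      also have "\<dots> = pi * (\<rho>\<^sup>2 - A + B * (1 / A - 1 / \<rho>\<^sup>2))"
      proof -
        have x0': "exp (- 2 * x0) = 1 / A" using exp_minus[of "2 * x0"] by (simp add: x0(2) divide_inverse)
        show ?thesis unfolding integral_unique[OF outer] X2 X3 x0(2) x0' by (simp add: algebra_simps)
      qed
      finally have I: "integral {x0..X} (\<lambda>x. integral {0..2*pi} (\<lambda>y. hh (Complex x y))) = \<dots>" .
      have "(1 - B / \<rho> ^ 4) = 1 - (cmod q)\<^sup>2" unfolding nq B_def by (simp add: power_divide power_mult[symmetric])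
      then have "pi * ((1 - B / \<rho> ^ 4) * (\<rho>\<^sup>2 - A + B * (1 / A - 1 / \<rho>\<^sup>2))) \<le> pi * (\<rho> + 16 * K / \<rho> ^ 3)\<^sup>2"
        using area unfolding I by (simp add: mult_ac)
      then show ?thesis using mult_le_cancel_left_pos[OF pi_gt_zero] by blast
    qed
    have ev: "\<forall>\<^sub>F \<rho> in at_top. 4 * cmod b \<le> \<rho>\<^sup>2 \<and> 2 * cmod b + 4 * K \<le> \<rho> \<and> cmod b \<le> \<rho> \<and> \<rho> > 1 \<and> \<rho>\<^sup>2 > A \<and> cmod b < \<rho>\<^sup>2"
      by (intro eventually_conj) real_asymp+
    \<comment> \<open>The leading rho^2 cancels between the two areas; what remains is the
      contribution of the inner circle.\<close>
    have lim: "((\<lambda>\<rho>::real. (1 - B / \<rho> ^ 4) * (\<rho>\<^sup>2 - A + B * (1 / A - 1 / \<rho>\<^sup>2)) - (\<rho> + 16 * K / \<rho> ^ 3)\<^sup>2) \<longlongrightarrow> B / A - A) at_top"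
    proof -
      have "((\<lambda>\<rho>::real. - A + B / A - (B + B) / \<rho>^2 + B * (A - B / A) / \<rho>^4 + B * B / \<rho>^6 - 32 * K / \<rho>^2 - 256 * K^2 / \<rho>^6 + B / \<rho>^2 - B / \<rho>^2 + 0)
         \<longlongrightarrow> - A + B / A - 0 + 0 + 0 - 0 - 0 + 0 - 0 + 0) at_top"
        by (intro tendsto_intros tendsto_divide_0[OF tendsto_const] filterlim_at_top_imp_at_infinity filterlim_pow_at_top filterlim_ident) auto
      moreover have "\<forall>\<^sub>F \<rho> in at_top. - A + B / A - (B + B) / \<rho>^2 + B * (A - B / A) / \<rho>^4 + B * B / \<rho>^6 - 32 * K / \<rho>^2 - 256 * K^2 / \<rho>^6 + B / \<rho>^2 - B / \<rho>^2 + 0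
        = (1 - B / \<rho> ^ 4) * (\<rho>\<^sup>2 - A + B * (1 / A - 1 / \<rho>\<^sup>2)) - (\<rho> + 16 * K / \<rho> ^ 3)\<^sup>2"
        using eventually_gt_at_top[of "0::real"]
      proof eventually_elim
        case (elim \<rho>)
        then show ?case using A by (simp add: field_simps power2_eq_square eval_nat_numeral)
      qed
      ultimately show ?thesis by (simp add: tendsto_cong)
    qed
    have "B / A - A \<le> 0"
      by (rule tendsto_upperbound[OF lim]) (use ev main in \<open>auto elim!: eventually_mono\<close>)
    then show ?thesis by (simp add: B_def)
  qed
  have "(cmod b)\<^sup>2 \<le> 1"
  proof (rule field_le_epsilon)
    fix e :: real assume "e > 0"
    then have "(cmod b)\<^sup>2 / sqrt (1 + e) \<le> sqrt (1 + e)" by (intro key) simp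
    then show "(cmod b)\<^sup>2 \<le> 1 + e" using \<open>e > 0\<close> by (simp add: divide_le_eq)
  qed
  then show ?thesis unfolding b_def by (simp add: power2_le_iff_abs_le abs_square_le_1)
qed

section \<open>Bieberbach's second coefficient and Koebe's theorems\<close>

lemma deriv_transform_ball:
  fixes f g :: "complex \<Rightarrow> complex"
  assumes "(f has_field_derivative D) (at 0)" "\<And>z. z \<in> ball 0 1 \<Longrightarrow> f z = g z"
  shows "(g has_field_derivative D) (at 0)"
  by (rule has_field_derivative_transform_within_open[OF assms(1) open_ball, of 0 1]) (use assms(2) in auto)

text \<open>Square root transform: with f(z) = z phi(z), the function z phi(z^-2)^(-1/2) is
  univalent outside the disk, because it is odd and its square is 1 / f(z^-2). The area theorem
  applied to m = phi^(-1/2) bounds m'(0) = - phi'(0) / 2, and f''(0) = 2 phi'(0).\<close>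

lemma bieberbach_second_coeff:
  assumes f: "f holomorphic_on ball 0 1" "inj_on f (ball 0 1)" "f 0 = 0" "deriv f 0 = 1"
  shows "cmod (deriv (deriv f) 0) \<le> 4"
proof -
  obtain \<phi> where \<phi>: "\<phi> holomorphic_on ball 0 1" "\<And>z. f z = z * \<phi> z" "\<phi> 0 = 1"
    using holomorphic_remainder[OF f(1)] f(3,4) by (metis add_0)
  have nz: "\<phi> z \<noteq> 0" if z: "z \<in> ball 0 1" for z
  proof (cases "z = 0")
    case False
    then have "f z \<noteq> f 0" using f(2) z unfolding inj_on_def by (metis centre_in_ball zero_less_one)
    then show ?thesis using \<phi>(2)[of z] f(3) by auto
  qed (simp add: \<phi>)
  obtain g where g: "g holomorphic_on ball 0 1" "\<And>z. z \<in> ball 0 1 \<Longrightarrow> exp (g z) = \<phi> z"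
    using holomorphic_logarithm_exists[OF convex_ball open_ball \<phi>(1) nz, of 0] by (metis centre_in_ball zero_less_one)
  \<comment> \<open>The factor \<open>exp (g 0 / 2)\<close> selects the branch of the root with
    \<open>m 0 = 1\<close>.\<close>
  define m where "m = (\<lambda>z. exp (g 0 / 2) * exp (- (g z / 2)))"
  have mh: "m holomorphic_on ball 0 1" unfolding m_def by (intro holomorphic_intros g) auto
  have m0: "m 0 = 1" by (simp add: m_def exp_add[symmetric])
  have msq: "m z * m z * \<phi> z = 1" if "z \<in> ball 0 1" for z
  proof -
    have sq: "exp (a / 2) * exp (a / 2) = exp a" for a :: complex by (simp add: exp_add[symmetric])
    have "exp (g 0) = 1" using g(2)[of 0] \<phi>(3) by simp
    moreover have "m z * m z = exp (g 0) * exp (- g z)"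
      using sq[of "g 0"] sq[of "- g z"] unfolding m_def by (simp add: mult_ac)
    ultimately show ?thesis using g(2)[OF that] by (simp add: exp_add[symmetric] flip: g(2)[OF that])
  qed
  have "cmod (deriv m 0) \<le> 1"
  proof (rule area_theorem_coeff[OF mh m0], rule inj_onI)
    fix s t
    assume s: "s \<in> {s. 0 < Re s \<and> 0 < Im s \<and> Im s < 2 * pi}" and t: "t \<in> {s. 0 < Re s \<and> 0 < Im s \<and> Im s < 2 * pi}"
      and eq: "exp s * m (exp (- 2 * s)) = exp t * m (exp (- 2 * t))"
    have sq: "(exp u * m (exp (- 2 * u)))\<^sup>2 * f (exp (- 2 * u)) = 1" if "Re u > 0" for u
    proof -
      have "exp u * exp u * exp (- 2 * u) = 1" by (simp add: exp_add[symmetric])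
      moreover have "exp (- 2 * u) \<in> ball 0 1" using that by simp
      ultimately show ?thesis using msq[of "exp (- 2 * u)"] unfolding \<phi>(2) power2_eq_square by algebra
    qed
    have "f (exp (- 2 * s)) = f (exp (- 2 * t))"
      using sq[of s] sq[of t] s t unfolding eq by (metis (no_types, lifting) mem_Collect_eq mult_cancel_left mult_zero_left zero_neq_one)
    then have e: "exp (- 2 * s) = exp (- 2 * t)"
      by (rule inj_onD[OF f(2)]) (use s t in auto)
    have "exp (- 2 * t) \<in> ball 0 1" using t by simp
    then have "m (exp (- 2 * t)) \<noteq> 0" using msq by fastforce
    then have "exp s = exp t" using eq unfolding e by simp
    then obtain n :: int where n: "s = t + (of_int (2 * n) * pi) * \<i>" unfolding exp_eq by auto
    then have "Im s = Im t + 2 * n * pi" by simp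
    moreover have "0 < Im s" "Im s < 2 * pi" "0 < Im t" "Im t < 2 * pi" using s t by auto
    ultimately have "2 * (real_of_int n * pi) < 2 * pi" "2 * (-1 * pi) < 2 * (real_of_int n * pi)" by linarith+
    then have "real_of_int n * pi < 1 * pi" "-1 * pi < real_of_int n * pi" by linarith+
    then have "real_of_int n < 1" "-1 < real_of_int n" by (simp_all only: mult_less_cancel_right_pos[OF pi_gt_zero])
    then have "n = 0" by linarith
    then show "s = t" using n by simp
  qed
  moreover have "deriv \<phi> 0 = - 2 * deriv m 0"
  proof -
    have z0: "(0::complex) \<in> ball 0 1" by simp
    have 1: "(m has_field_derivative deriv m 0) (at 0)" by (rule holomorphic_derivI[OF mh open_ball z0])
    have 2: "(\<phi> has_field_derivative deriv \<phi> 0) (at 0)" by (rule holomorphic_derivI[OF \<phi>(1) open_ball z0])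
    have "((\<lambda>z. m z * m z * \<phi> z) has_field_derivative (deriv m 0 * m 0 + deriv m 0 * m 0) * \<phi> 0 + deriv \<phi> 0 * (m 0 * m 0)) (at 0)"
      by (intro DERIV_mult 1 2)
    moreover have "((\<lambda>z. m z * m z * \<phi> z) has_field_derivative 0) (at 0)"
      by (rule deriv_transform_ball[of "\<lambda>_. 1"]) (use msq in \<open>auto simp: dist_norm\<close>)
    ultimately have "(deriv m 0 * m 0 + deriv m 0 * m 0) * \<phi> 0 + deriv \<phi> 0 * (m 0 * m 0) = 0"
      using DERIV_unique by blast
    then show ?thesis using m0 \<phi>(3) by (simp add: add_eq_0_iff2)
  qed
  moreover have "deriv (deriv f) 0 = 2 * deriv \<phi> 0"
  proof -
    have d\<phi>: "deriv \<phi> holomorphic_on ball 0 1" using holomorphic_deriv[OF \<phi>(1) open_ball] .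
    have D: "deriv f z = \<phi> z + deriv \<phi> z * z" if "z \<in> ball 0 1" for z
    proof (rule DERIV_imp_deriv)
      have "((\<lambda>z. z * \<phi> z) has_field_derivative 1 * \<phi> z + deriv \<phi> z * z) (at z)"
        by (intro DERIV_mult DERIV_ident holomorphic_derivI[OF \<phi>(1) open_ball that])
      moreover have "f = (\<lambda>z. z * \<phi> z)" using \<phi>(2) by blast
      ultimately show "(f has_field_derivative \<phi> z + deriv \<phi> z * z) (at z)" by simp
    qed
    have z0: "(0::complex) \<in> ball 0 1" by simp
    have "((\<lambda>z. \<phi> z + deriv \<phi> z * z) has_field_derivative deriv \<phi> 0 + (deriv (deriv \<phi>) 0 * 0 + 1 * deriv \<phi> 0)) (at 0)"
      by (intro DERIV_add DERIV_mult DERIV_ident holomorphic_derivI[OF \<phi>(1) open_ball z0] holomorphic_derivI[OF d\<phi> open_ball z0])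
    then have "(deriv f has_field_derivative deriv \<phi> 0 + (deriv (deriv \<phi>) 0 * 0 + 1 * deriv \<phi> 0)) (at 0)"
      by (rule deriv_transform_ball) (use D in \<open>auto simp: dist_norm\<close>)
    then show ?thesis by (intro DERIV_imp_deriv) simp
  qed
  ultimately show ?thesis by (simp add: norm_mult)
qed

lemma bieberbach:
  assumes f: "f holomorphic_on ball 0 1" "inj_on f (ball 0 1)"
  shows "cmod (deriv (deriv f) 0) \<le> 4 * cmod (deriv f 0)" "deriv f 0 \<noteq> 0"
proof -
  show nz: "deriv f 0 \<noteq> 0"
    using holomorphic_injective_imp_regular[OF f(1) open_ball f(2)] by simp
  define h where "h = (\<lambda>z. (f z - f 0) / deriv f 0)"
  have fz: "(f has_field_derivative deriv f z) (at z)" if "z \<in> ball 0 1" for z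
    by (rule holomorphic_derivI[OF f(1) open_ball that])
  have D: "deriv h z = deriv f z / deriv f 0" if "z \<in> ball 0 1" for z
  proof (rule DERIV_imp_deriv)
    show "(h has_field_derivative deriv f z / deriv f 0) (at z)"
      unfolding h_def using DERIV_cdivide[OF DERIV_diff[OF fz[OF that] DERIV_const[of "f 0"]], of "deriv f 0"] by simp
  qed
  have "deriv (deriv h) 0 = deriv (deriv f) 0 / deriv f 0"
  proof (rule DERIV_imp_deriv)
    have "(deriv f has_field_derivative deriv (deriv f) 0) (at 0)"
      by (rule holomorphic_derivI[OF holomorphic_deriv[OF f(1) open_ball] open_ball]) simp
    then have "((\<lambda>z. deriv f z / deriv f 0) has_field_derivative deriv (deriv f) 0 / deriv f 0) (at 0)"
      by (rule DERIV_cdivide)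
    then show "(deriv h has_field_derivative deriv (deriv f) 0 / deriv f 0) (at 0)"
      by (rule deriv_transform_ball) (use D in \<open>auto simp: dist_norm\<close>)
  qed
  moreover have "cmod (deriv (deriv h) 0) \<le> 4"
  proof (rule bieberbach_second_coeff)
    show "h holomorphic_on ball 0 1" unfolding h_def by (intro holomorphic_intros f nz)
    show "inj_on h (ball 0 1)" using f(2) nz unfolding h_def inj_on_def by simp
  qed (use nz D in \<open>auto simp: h_def\<close>)
  ultimately show "cmod (deriv (deriv f) 0) \<le> 4 * cmod (deriv f 0)"
    using nz by (simp add: norm_divide divide_le_eq)
qed

text \<open>If w were omitted, F = c (h - f a) / (w - h) with c = w - f a would be univalent too,
  with the same derivative at 0 and a second derivative larger by 2 h'(0)^2 / c. Bieberbach's bound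
  for both functions gives |h'(0)| <= 4 |c|.\<close>

theorem koebe_quarter:
  assumes f: "f holomorphic_on ball a r" "inj_on f (ball a r)" and r: "r > 0"
  shows "ball (f a) (r * cmod (deriv f a) / 4) \<subseteq> f ` ball a r"
proof
  fix w assume w: "w \<in> ball (f a) (r * cmod (deriv f a) / 4)"
  show "w \<in> f ` ball a r"
  proof (rule ccontr)
    assume nw: "w \<notin> f ` ball a r"
    define h where "h = (\<lambda>z. f (a + of_real r * z))"
    have im: "a + of_real r * z \<in> ball a r" if "z \<in> ball 0 1" for z
      using that r by (simp add: dist_norm norm_mult)
    have hD: "(h has_field_derivative deriv f (a + of_real r * z) * of_real r) (at z)" if "z \<in> ball 0 1" for z
    proof -
      have "((\<lambda>z. a + of_real r * z) has_field_derivative of_real r) (at z)" by (auto intro!: derivative_eq_intros)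
      from DERIV_chain2[OF holomorphic_derivI[OF f(1) open_ball im[OF that]] this] show ?thesis unfolding h_def .
    qed
    have hh: "h holomorphic_on ball 0 1" unfolding holomorphic_on_open[OF open_ball] using hD by blast
    have hinj: "inj_on h (ball 0 1)"
      unfolding h_def by (rule inj_onI) (use inj_onD[OF f(2)] im r in fastforce)
    have h0: "h 0 = f a" "deriv h 0 = deriv f a * of_real r" using DERIV_imp_deriv[OF hD[of 0]] by (auto simp: h_def)
    have hw: "w - h z \<noteq> 0" if "z \<in> ball 0 1" for z using nw im[OF that] by (auto simp: h_def)
    define c where "c = w - f a"
    have c0: "c \<noteq> 0" using hw[of 0] h0 by (simp add: c_def)
    have dh0: "deriv h 0 \<noteq> 0" using bieberbach(2)[OF hh hinj] .
    define F where "F = (\<lambda>z. c * (h z - f a) / (w - h z))"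
    have Fh: "F holomorphic_on ball 0 1" unfolding F_def by (intro holomorphic_intros hh hw)
    have Finj: "inj_on F (ball 0 1)"
    proof (rule inj_onI)
      fix x y assume xy: "x \<in> ball 0 1" "y \<in> ball 0 1" "F x = F y"
      have "c * (h x - f a) * (w - h y) = c * (h y - f a) * (w - h x)"
        using xy(3) hw[OF xy(1)] hw[OF xy(2)] by (simp add: F_def field_simps)
      then have "c * (c * (h x - h y)) = 0" unfolding c_def by algebra
      then have "h x = h y" using c0 by simp
      then show "x = y" using hinj xy by (auto dest: inj_onD)
    qed
    have hd: "(h has_field_derivative deriv h z) (at z)" if "z \<in> ball 0 1" for z
      by (rule holomorphic_derivI[OF hh open_ball that])
    have FD: "deriv F z = c * c * deriv h z / ((w - h z) * (w - h z))" if "z \<in> ball 0 1" for z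
    proof (rule DERIV_imp_deriv)
      have "(F has_field_derivative (c * (deriv h z - 0) * (w - h z) - c * (h z - f a) * (0 - deriv h z)) / ((w - h z) * (w - h z))) (at z)"
        unfolding F_def using hw[OF that] by (intro DERIV_divide DERIV_cmult DERIV_diff DERIV_const hd[OF that])
      moreover have "c * (deriv h z - 0) * (w - h z) - c * (h z - f a) * (0 - deriv h z) = c * c * deriv h z"
        unfolding c_def by algebra
      ultimately show "(F has_field_derivative c * c * deriv h z / ((w - h z) * (w - h z))) (at z)" by simp
    qed
    have F0: "deriv F 0 = deriv h 0" using FD[of 0] c0 h0(1) by (simp add: c_def)
    have FDD: "deriv (deriv F) 0 = deriv (deriv h) 0 + 2 * deriv h 0 * deriv h 0 / c"
    proof (rule DERIV_imp_deriv)
      have z0: "(0::complex) \<in> ball 0 1" by simp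
      have d2: "(deriv h has_field_derivative deriv (deriv h) 0) (at 0)"
        by (rule holomorphic_derivI[OF holomorphic_deriv[OF hh open_ball] open_ball z0])
      have "((\<lambda>z. c * c * deriv h z / ((w - h z) * (w - h z))) has_field_derivative
         (c * c * deriv (deriv h) 0 * ((w - h 0) * (w - h 0)) - c * c * deriv h 0 * ((0 - deriv h 0) * (w - h 0) + (0 - deriv h 0) * (w - h 0)))
          / ((w - h 0) * (w - h 0) * ((w - h 0) * (w - h 0)))) (at 0)"
        using hw[OF z0] by (intro DERIV_divide DERIV_cmult DERIV_mult DERIV_diff DERIV_const hd[OF z0] d2) simp
      also have "(c * c * deriv (deriv h) 0 * ((w - h 0) * (w - h 0)) - c * c * deriv h 0 * ((0 - deriv h 0) * (w - h 0) + (0 - deriv h 0) * (w - h 0)))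
          / ((w - h 0) * (w - h 0) * ((w - h 0) * (w - h 0))) = deriv (deriv h) 0 + 2 * deriv h 0 * deriv h 0 / c"
        using c0 unfolding h0(1) c_def[symmetric] by (simp add: field_simps)
      finally show "(deriv F has_field_derivative deriv (deriv h) 0 + 2 * deriv h 0 * deriv h 0 / c) (at 0)"
        by (rule deriv_transform_ball) (use FD in \<open>auto simp: dist_norm\<close>)
    qed
    have "cmod (2 * deriv h 0 * deriv h 0 / c) \<le> cmod (deriv (deriv F) 0) + cmod (deriv (deriv h) 0)"
      unfolding FDD by (metis add_diff_cancel_left' norm_triangle_ineq4)
    also have "\<dots> \<le> 4 * cmod (deriv h 0) + 4 * cmod (deriv h 0)"
      using bieberbach(1)[OF Fh Finj] bieberbach(1)[OF hh hinj] unfolding F0 by simp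
    finally have "2 * cmod (deriv h 0) * cmod (deriv h 0) \<le> 8 * cmod (deriv h 0) * cmod c"
      using c0 by (simp add: norm_mult norm_divide divide_le_eq)
    then have "cmod (deriv h 0) * cmod (deriv h 0) \<le> cmod (deriv h 0) * (4 * cmod c)" by (simp add: mult_ac)
    then have "cmod (deriv h 0) \<le> 4 * cmod c" using dh0 by (metis mult_le_cancel_left_pos zero_less_norm_iff)
    moreover have "cmod c < r * cmod (deriv f a) / 4" using w by (simp add: c_def dist_norm norm_minus_commute)
    ultimately show False using r by (simp add: h0 norm_mult mult.commute)
  qed
qed

text \<open>A disk automorphism moves the point zeta to 0; Bieberbach's bound for the composite
  controls f'' / f' at zeta, and integration of its real part along the radius controls ln
  |f'|.\<close>

theorem koebe_distortion_lower:
  assumes f: "f holomorphic_on ball 0 1" "inj_on f (ball 0 1)" and z: "cmod z < 1"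
  shows "cmod (deriv f z) \<ge> (1 - cmod z) / (1 + cmod z) ^ 3 * cmod (deriv f 0)"
proof -
  have dh: "deriv f holomorphic_on ball 0 1" using holomorphic_deriv[OF f(1) open_ball] .
  have nz: "deriv f w \<noteq> 0" if "w \<in> ball 0 1" for w
    using holomorphic_injective_imp_regular[OF f(1) open_ball f(2) that] .
  have schwarz: "cmod (of_real (1 - (cmod \<zeta>)\<^sup>2) * deriv (deriv f) \<zeta> / deriv f \<zeta> - 2 * cnj \<zeta>) \<le> 4" if \<zeta>: "\<zeta> \<in> ball 0 1" for \<zeta>
  proof -
    define T where "T = (\<lambda>z. (z + \<zeta>) / (1 + cnj \<zeta> * z))"
    define p :: complex where "p = of_real (1 - (cmod \<zeta>)\<^sup>2)"
    have pn: "p = 1 - \<zeta> * cnj \<zeta>" unfolding p_def by (simp add: complex_norm_square[symmetric])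
    have p0: "p \<noteq> 0"
    proof -
      have "(cmod \<zeta>)\<^sup>2 < 1" using \<zeta> by (simp add: abs_square_less_1)
      then show ?thesis unfolding p_def of_real_eq_0_iff by linarith
    qed
    have den: "1 + cnj \<zeta> * z \<noteq> 0" if "z \<in> ball 0 1" for z
    proof
      assume "1 + cnj \<zeta> * z = 0"
      then have "cnj \<zeta> * z = -1" by (simp add: add_eq_0_iff)
      then have "cmod \<zeta> * cmod z = 1" by (metis complex_mod_cnj norm_minus_cancel norm_mult norm_one)
      moreover have "cmod \<zeta> * cmod z < 1" using \<zeta> that mult_strict_mono'[of "cmod \<zeta>" 1 "cmod z" 1] by simp
      ultimately show False by simp
    qed
    have Tin: "T z \<in> ball 0 1" if "z \<in> ball 0 1" for z
    proof -
      have "(cmod (1 + cnj \<zeta> * z))\<^sup>2 - (cmod (z + \<zeta>))\<^sup>2 = (1 - (cmod \<zeta>)\<^sup>2) * (1 - (cmod z)\<^sup>2)"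
        unfolding cmod_power2 by (simp add: power2_eq_square algebra_simps)
      also have "\<dots> > 0" using \<zeta> that by (intro mult_pos_pos) (auto simp: power_less_one_iff)
      finally have "cmod (z + \<zeta>) < cmod (1 + cnj \<zeta> * z)" using power2_less_imp_less by force
      then show ?thesis using den[OF that] by (simp add: T_def norm_divide divide_less_eq_1)
    qed
    have TD: "(T has_field_derivative p / ((1 + cnj \<zeta> * z) * (1 + cnj \<zeta> * z))) (at z)" if "z \<in> ball 0 1" for z
    proof -
      have "(T has_field_derivative ((1 + 0) * (1 + cnj \<zeta> * z) - (z + \<zeta>) * (0 + cnj \<zeta> * 1)) / ((1 + cnj \<zeta> * z) * (1 + cnj \<zeta> * z))) (at z)"
        unfolding T_def using den[OF that] by (intro DERIV_divide DERIV_add DERIV_ident DERIV_const DERIV_cmult)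
      moreover have "(1 + 0) * (1 + cnj \<zeta> * z) - (z + \<zeta>) * (0 + cnj \<zeta> * 1) = p" unfolding pn by algebra
      ultimately show ?thesis by simp
    qed
    define h where "h = (\<lambda>z. f (T z))"
    have hD: "(h has_field_derivative deriv f (T z) * (p / ((1 + cnj \<zeta> * z) * (1 + cnj \<zeta> * z)))) (at z)" if "z \<in> ball 0 1" for z
      unfolding h_def by (rule DERIV_chain2[OF holomorphic_derivI[OF f(1) open_ball Tin[OF that]] TD[OF that]])
    have hh: "h holomorphic_on ball 0 1" unfolding holomorphic_on_open[OF open_ball] using hD by blast
    have hinj: "inj_on h (ball 0 1)"
    proof (rule inj_onI)
      fix x y assume xy: "x \<in> ball 0 1" "y \<in> ball 0 1" "h x = h y"
      then have "T x = T y" using inj_onD[OF f(2)] Tin unfolding h_def by blast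
      then have "(x + \<zeta>) * (1 + cnj \<zeta> * y) = (y + \<zeta>) * (1 + cnj \<zeta> * x)"
        using den[OF xy(1)] den[OF xy(2)] by (simp add: T_def field_simps)
      then have "p * (x - y) = 0" unfolding pn by algebra
      then show "x = y" using p0 by simp
    qed
    have z0: "(0::complex) \<in> ball 0 1" by simp
    have T0: "T 0 = \<zeta>" by (simp add: T_def)
    have h1: "deriv h 0 = deriv f \<zeta> * p" using DERIV_imp_deriv[OF hD[OF z0]] by (simp add: T0)
    have h2: "deriv (deriv h) 0 = deriv (deriv f) \<zeta> * p * p - 2 * cnj \<zeta> * p * deriv f \<zeta>"
    proof (rule DERIV_imp_deriv)
      have a: "((\<lambda>z. deriv f (T z)) has_field_derivative deriv (deriv f) (T 0) * (p / ((1 + cnj \<zeta> * 0) * (1 + cnj \<zeta> * 0)))) (at 0)"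
        by (rule DERIV_chain2[OF holomorphic_derivI[OF dh open_ball Tin[OF z0]] TD[OF z0]])
      have b: "((\<lambda>z. p / ((1 + cnj \<zeta> * z) * (1 + cnj \<zeta> * z))) has_field_derivative - 2 * cnj \<zeta> * p) (at 0)"
        by (auto intro!: derivative_eq_intros)
      show "(deriv h has_field_derivative deriv (deriv f) \<zeta> * p * p - 2 * cnj \<zeta> * p * deriv f \<zeta>) (at 0)"
      proof (rule deriv_transform_ball)
        show "((\<lambda>z. deriv f (T z) * (p / ((1 + cnj \<zeta> * z) * (1 + cnj \<zeta> * z)))) has_field_derivative
           deriv (deriv f) \<zeta> * p * p - 2 * cnj \<zeta> * p * deriv f \<zeta>) (at 0)"
          using DERIV_mult[OF a b] by (simp add: T0 algebra_simps)
      qed (use DERIV_imp_deriv[OF hD] in \<open>auto simp: dist_norm\<close>)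
    qed
    have fz: "deriv f \<zeta> \<noteq> 0" using nz[OF \<zeta>] .
    have "deriv (deriv h) 0 = (p * deriv (deriv f) \<zeta> / deriv f \<zeta> - 2 * cnj \<zeta>) * (deriv f \<zeta> * p)"
      unfolding h2 using fz by (simp add: field_simps)
    then have "cmod (p * deriv (deriv f) \<zeta> / deriv f \<zeta> - 2 * cnj \<zeta>) * cmod (deriv f \<zeta> * p) \<le> 4 * cmod (deriv f \<zeta> * p)"
      using bieberbach(1)[OF hh hinj] unfolding h1 by (simp only: norm_mult)
    then show ?thesis using fz p0 unfolding p_def[symmetric] by (simp only: mult_le_cancel_right) auto
  qed
  obtain L where L: "L holomorphic_on ball 0 1" "\<And>w. w \<in> ball 0 1 \<Longrightarrow> exp (L w) = deriv f w"
    using holomorphic_logarithm_exists[OF convex_ball open_ball dh nz, of 0] by (metis centre_in_ball zero_less_one)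
  have LD: "deriv L w = deriv (deriv f) w / deriv f w" if w: "w \<in> ball 0 1" for w
  proof -
    have "((\<lambda>w. exp (L w)) has_field_derivative exp (L w) * deriv L w) (at w)"
      by (rule DERIV_chain2[OF DERIV_exp holomorphic_derivI[OF L(1) open_ball w]])
    moreover have "((\<lambda>w. exp (L w)) has_field_derivative deriv (deriv f) w) (at w)"
      by (rule has_field_derivative_transform_within_open[OF holomorphic_derivI[OF dh open_ball w] open_ball w])
         (simp add: L)
    ultimately have "exp (L w) * deriv L w = deriv (deriv f) w" using DERIV_unique by blast
    then show ?thesis using nz[OF w] by (simp add: L(2)[OF w] field_simps)
  qed
  define t where "t = cmod z"
  have "\<exists>\<omega>. cmod \<omega> = 1 \<and> z = of_real t * \<omega>"
  proof (cases "z = 0")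
    case False
    then show ?thesis by (intro exI[of _ "z / of_real (cmod z)"]) (simp add: t_def norm_divide)
  qed (auto simp: t_def intro!: exI[of _ 1])
  then obtain \<omega> where \<omega>: "cmod \<omega> = 1" "z = of_real t * \<omega>" by blast
  \<comment> \<open>The subtracted function ln ((1 - s) / (1 + s)^3) is the extremal case: its
    derivative (2 s - 4) / (1 - s^2) is exactly the lower bound from \<open>schwarz\<close>.\<close>
  define Q where "Q = (\<lambda>s. Re (L (of_real s * \<omega>)) - (ln (1 - s) - 3 * ln (1 + s)))"
  have "Q 0 \<le> Q t"
  proof (rule DERIV_nonneg_imp_nondecreasing[of 0 t Q])
    show "0 \<le> t" by (simp add: t_def)
    fix s assume s: "0 \<le> s" "s \<le> t"
    have s1: "s < 1" using s z by (simp add: t_def)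
    define w where "w = of_real s * \<omega>"
    have nw: "cmod w = s" using s by (simp add: w_def norm_mult \<omega>)
    then have w: "w \<in> ball 0 1" using s1 by simp
    have d1: "((\<lambda>s. of_real s * \<omega>) has_vector_derivative \<omega>) (at s)"
      by (auto intro!: derivative_eq_intros)
    have d2: "((\<lambda>s. L (of_real s * \<omega>)) has_vector_derivative \<omega> * deriv L w) (at s)"
      using field_vector_diff_chain_at[OF d1, of L "deriv L w"] holomorphic_derivI[OF L(1) open_ball w]
      unfolding w_def o_def by simp
    have d3: "((\<lambda>s. Re (L (of_real s * \<omega>))) has_real_derivative Re (\<omega> * deriv L w)) (at s)"
      using bounded_linear.has_vector_derivative[OF bounded_linear_Re d2]
      by (simp add: has_real_derivative_iff_has_vector_derivative)
    have d4: "((\<lambda>s. ln (1 - s) - 3 * ln (1 + s)) has_real_derivative (2 * s - 4) / (1 - s\<^sup>2)) (at s)"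
    proof -
      have "((\<lambda>s. ln (1 - s) - 3 * ln (1 + s)) has_real_derivative (- 1 / (1 - s) - 3 * (1 / (1 + s)))) (at s)"
        using s s1 by (auto intro!: derivative_eq_intros simp: divide_inverse)
      moreover have "- 1 / (1 - s) - 3 * (1 / (1 + s)) = (2 * s - 4) / (1 - s\<^sup>2)"
        using s s1 by (simp add: field_simps power2_eq_square)
      ultimately show ?thesis by simp
    qed
    have "(Q has_real_derivative Re (\<omega> * deriv L w) - (2 * s - 4) / (1 - s\<^sup>2)) (at s)"
      unfolding Q_def by (rule DERIV_diff[OF d3 d4])
    moreover have "Re (\<omega> * deriv L w) - (2 * s - 4) / (1 - s\<^sup>2) \<ge> 0"
    proof -
      have pos: "1 - s\<^sup>2 > 0" using s s1 by (simp add: power_less_one_iff)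
      define Z where "Z = of_real (1 - s\<^sup>2) * deriv L w - 2 * cnj w"
      have Z: "cmod Z \<le> 4" using schwarz[OF w] unfolding Z_def LD[OF w] nw by simp
      have "\<omega> * cnj w = of_real s"
        using \<omega>(1) by (simp add: w_def complex_norm_square[symmetric] mult.left_commute)
      then have "\<omega> * Z = of_real (1 - s\<^sup>2) * (\<omega> * deriv L w) - 2 * of_real s"
        unfolding Z_def by (simp add: algebra_simps)
      moreover have "Re (of_real c * u - 2 * of_real s) = c * Re u - 2 * s" for c s u by simp
      ultimately have "Re (\<omega> * Z) = (1 - s\<^sup>2) * Re (\<omega> * deriv L w) - 2 * s" by (simp only:)
      moreover have "Re (\<omega> * Z) \<ge> - 4"
        using complex_Re_le_cmod[of "- (\<omega> * Z)"] Z \<omega>(1) by (simp add: norm_mult)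
      ultimately have "(1 - s\<^sup>2) * Re (\<omega> * deriv L w) \<ge> 2 * s - 4" by linarith
      then show ?thesis using pos by (simp add: divide_le_eq mult.commute)
    qed
    ultimately show "\<exists>y. (Q has_real_derivative y) (at s) \<and> 0 \<le> y" by blast
  qed
  then have "Re (L 0) + (ln (1 - t) - 3 * ln (1 + t)) \<le> Re (L z)" unfolding Q_def \<omega>(2) by simp
  then have "exp (Re (L 0) + (ln (1 - t) - 3 * ln (1 + t))) \<le> exp (Re (L z))" by simp
  moreover have "exp (Re (L 0)) = cmod (deriv f 0)" "exp (Re (L z)) = cmod (deriv f z)"
    using L(2)[of 0] L(2)[of z] z by (metis norm_exp_eq_Re centre_in_ball zero_less_one, metis norm_exp_eq_Re mem_ball_0)
  moreover have "exp (ln (1 - t) - 3 * ln (1 + t)) = (1 - t) / (1 + t) ^ 3"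
  proof -
    have "t \<ge> 0" "t < 1" using z by (auto simp: t_def)
    then have "exp (3 * ln (1 + t)) = (1 + t) ^ 3"
      using exp_of_nat_mult[of 3 "ln (1 + t)"] by simp
    then show ?thesis using \<open>t \<ge> 0\<close> \<open>t < 1\<close> by (simp add: exp_diff)
  qed
  ultimately show ?thesis by (simp add: exp_add t_def mult.commute)
qed

section \<open>Lattice Taylor expansion of holomorphic functions\<close>

text \<open>Harnack's inequality for p itself instead of Re p. The Cayley transform vanishing at w
  maps into the unit disk, and the Schwarz lemma at half the radius gives |p z - p w| < (|p z - p w|
  + 2 Re (p w)) / 2.\<close>

lemma positive_real_part_half_ball:
  assumes p: "p holomorphic_on ball w d" and pos: "\<And>z. z \<in> ball w d \<Longrightarrow> Re (p z) > 0"
    and z: "z \<in> ball w (d/2)" and d: "d > 0"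
  shows "cmod (p z - p w) < 2 * Re (p w)"
proof -
  define F where "F = (\<lambda>z. (p (w + of_real d * z) - p w) / (p (w + of_real d * z) + cnj (p w)))"
  have im: "w + of_real d * z \<in> ball w d" if "z \<in> ball 0 1" for z
    using that d by (simp add: dist_norm norm_mult)
  have w0: "Re (p w) > 0" using pos d by simp
  have den: "p (w + of_real d * z) + cnj (p w) \<noteq> 0" if "z \<in> ball 0 1" for z
  proof
    assume "p (w + of_real d * z) + cnj (p w) = 0"
    then have "Re (p (w + of_real d * z)) + Re (p w) = 0" by (metis plus_complex.sel(1) complex_cnj(1) cnj.sel(1) zero_complex.sel(1))
    then show False using pos[OF im[OF that]] w0 by simp
  qed
  have Fh: "F holomorphic_on ball 0 1"
  proof -
    have "(p \<circ> (\<lambda>z. w + of_real d * z)) holomorphic_on ball 0 1"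
      by (rule holomorphic_on_compose_gen[OF _ p]) (use im in \<open>auto intro!: holomorphic_intros\<close>)
    then show ?thesis unfolding F_def o_def by (intro holomorphic_intros) (use den in auto)
  qed
  have Fn: "norm (F z) < 1" if "norm z < 1" for z
  proof -
    let ?q = "p (w + of_real d * z)"
    have q: "Re ?q > 0" using pos im that by simp
    have "(cmod (?q + cnj (p w)))\<^sup>2 - (cmod (?q - p w))\<^sup>2 = 4 * Re ?q * Re (p w)"
      unfolding cmod_power2 by (simp add: power2_eq_square algebra_simps)
    also have "\<dots> > 0" using q w0 by simp
    finally have "cmod (?q - p w) < cmod (?q + cnj (p w))" using power2_less_imp_less by force
    then show ?thesis using den[of z] that by (simp add: F_def norm_divide divide_less_eq_1)
  qed
  define u where "u = (z - w) / of_real d"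
  have u: "cmod u < 1/2" using z d by (simp add: u_def norm_divide dist_norm norm_minus_commute divide_less_eq)
  have zu: "z = w + of_real d * u" using d by (simp add: u_def)
  have Fu: "cmod (F u) \<le> cmod u" using Schwarz_Lemma(1)[OF Fh _ Fn, of u] u by (simp add: F_def)
  have "p z - p w = F u * (p z + cnj (p w))" using den[of u] u zu by (simp add: F_def)
  also have "p z + cnj (p w) = (p z - p w) + of_real (2 * Re (p w))" by (simp add: complex_eq_iff)
  finally have "cmod (p z - p w) \<le> cmod (F u) * (cmod (p z - p w) + 2 * Re (p w))"
    by (metis (no_types, lifting) abs_of_pos mult_left_mono norm_ge_zero norm_mult norm_of_real norm_triangle_ineq w0 zero_less_mult_iff zero_less_numeral)
  also have "\<dots> \<le> cmod u * (cmod (p z - p w) + 2 * Re (p w))"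
    using Fu w0 by (intro mult_right_mono) auto
  also have "\<dots> < 1/2 * (cmod (p z - p w) + 2 * Re (p w))"
    using u w0 by (intro mult_strict_right_mono) (auto intro: add_nonneg_pos)
  finally show ?thesis by (simp add: field_simps)
qed

text \<open>Cauchy's estimate for f - f w, whose derivatives of positive order are those of
  f.\<close>

lemma half_ball_coeff:
  assumes f: "f holomorphic_on ball w d" and bnd: "\<And>z. z \<in> ball w (d/2) \<Longrightarrow> cmod (f z - f w) < B"
    and d: "d > 0" and n: "n > 0"
  shows "cmod ((deriv ^^ n) f w / fact n) \<le> B * (2 / d) ^ n"
proof -
  have "cmod ((deriv ^^ n) f w) \<le> fact n * B / (d / 2) ^ n"
  proof (rule Cauchy_higher_deriv_bound[where y = "f w"])
    show "f holomorphic_on ball w (d / 2)" using f by (rule holomorphic_on_subset) (use d in auto)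
    show "continuous_on (cball w (d / 2)) f"
      using holomorphic_on_imp_continuous_on[OF f] by (rule continuous_on_subset) (use d in auto)
    show "f z \<in> ball (f w) B" if "z \<in> ball w (d / 2)" for z
      using bnd[OF that] by (simp add: dist_norm norm_minus_commute)
  qed (use d n in auto)
  then show ?thesis by (simp add: norm_divide divide_le_eq power_divide field_simps)
qed

lemma tail_bound:
  fixes c :: "nat \<Rightarrow> complex"
  assumes s: "c sums S" and c: "\<And>n. n \<ge> k \<Longrightarrow> cmod (c n) \<le> B * q ^ n" and q: "0 \<le> q" "q \<le> 1/2" and B: "B \<ge> 0"
  shows "cmod (S - (\<Sum>n<k. c n)) \<le> 2 * B * q ^ k"
proof -
  have sk: "(\<lambda>n. c (n + k)) sums (S - (\<Sum>n<k. c n))" using s by (rule sums_split_initial_segment)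
  have g: "(\<lambda>n. B * q ^ k * q ^ n) sums (B * q ^ k * (1 / (1 - q)))"
    using q by (intro sums_mult geometric_sums) auto
  have "cmod (S - (\<Sum>n<k. c n)) \<le> B * q ^ k * (1 / (1 - q))"
  proof -
    have "norm (\<Sum>n. c (n + k)) \<le> (\<Sum>n. B * q ^ k * q ^ n)"
    proof (rule norm_suminf_le)
      show "norm (c (n + k)) \<le> B * q ^ k * q ^ n" for n
        using c[of "n + k"] by (simp add: power_add mult_ac)
      show "summable (\<lambda>n. B * q ^ k * q ^ n)" using g by (rule sums_summable)
    qed
    then show ?thesis using sums_unique[OF sk] sums_unique[OF g] by simp
  qed
  also have "\<dots> \<le> B * q ^ k * 2"
    using q B by (intro mult_left_mono) (auto simp: divide_le_eq)
  finally show ?thesis by (simp add: mult_ac)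
qed

abbreviation cmean :: "(complex \<Rightarrow> complex) \<Rightarrow> complex \<Rightarrow> complex" where
  "cmean f w \<equiv> (f (w + 1) + f (w - 1) + f (w + \<i>) + f (w - \<i>)) / 4"

text \<open>The sum 1 + (-1)^n + i^n + (-i)^n vanishes unless 4 divides n, so the lattice mean sees
  no term of order 1, 2 or 3 and its error starts at d^-4. For d >= 4 the ratio 2 / d is at most
  1/2, and each tail is at most twice its first term.\<close>

lemma lattice_taylor:
  fixes f :: "complex \<Rightarrow> complex"
  assumes f: "f holomorphic_on ball w d" and d: "d \<ge> 4" and B: "B \<ge> 0"
    and c: "\<And>n. n > 0 \<Longrightarrow> cmod ((deriv ^^ n) f w / fact n) \<le> B * (2 / d) ^ n"
  shows "cmod e = 1 \<Longrightarrow> cmod (f (w + e) - f w) \<le> 4 * B / d"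
    and "cmod e = 1 \<Longrightarrow> cmod (f (w + e) - f w - deriv f w * e) \<le> 8 * B / d\<^sup>2"
    and "cmod (cmean f w - f w) \<le> 32 * B / d ^ 4"
proof -
  define a where "a = (\<lambda>n. (deriv ^^ n) f w / fact n)"
  have q: "0 \<le> 2 / d" "2 / d \<le> 1/2" using d by auto
  have s: "(\<lambda>n. a n * e ^ n) sums f (w + e)" if "cmod e = 1" for e
    using holomorphic_power_series[OF f, of "w + e"] that d by (simp add: a_def dist_norm)
  have an: "cmod (a n) \<le> B * (2 / d) ^ n" if "n > 0" for n using c[OF that] by (simp add: a_def)
  have ae: "cmod (a n * e ^ n) \<le> B * (2 / d) ^ n" if "cmod e = 1" "n > 0" for e n
    using an[OF that(2)] that(1) by (simp add: norm_mult norm_power)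
  show "cmod (f (w + e) - f w) \<le> 4 * B / d" if "cmod e = 1"
    using tail_bound[OF s[OF that], of 1 B "2 / d"] ae[OF that] q B by (simp add: a_def)
  show "cmod (f (w + e) - f w - deriv f w * e) \<le> 8 * B / d\<^sup>2" if "cmod e = 1"
    using tail_bound[OF s[OF that], of 2 B "2 / d"] ae[OF that] q B
    by (simp add: a_def numeral_2_eq_2 power_divide diff_diff_eq)
  define b where "b = (\<lambda>n. a n * ((1 + (-1) ^ n + \<i> ^ n + (- \<i>) ^ n) / 4))"
  have "(\<lambda>n. (a n * 1 ^ n + a n * (-1) ^ n + a n * \<i> ^ n + a n * (- \<i>) ^ n) / 4) sums cmean f w"
    using s[of 1] s[of "-1"] s[of \<i>] s[of "-\<i>"] by (intro sums_divide sums_add) auto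
  then have sb: "b sums cmean f w" by (simp add: b_def algebra_simps add_divide_distrib)
  have bn: "cmod (b n) \<le> B * (2 / d) ^ n" if "n \<ge> 4" for n
  proof -
    have "cmod (1 + (-1) ^ n + \<i> ^ n + (- \<i>) ^ n) \<le> 1 + 1 + 1 + 1"
      by (intro norm_triangle_le add_mono) (auto simp: norm_power)
    then have "cmod ((1 + (-1) ^ n + \<i> ^ n + (- \<i>) ^ n) / 4) \<le> 1" by simp
    then have "cmod (b n) \<le> cmod (a n) * 1" unfolding b_def norm_mult by (intro mult_left_mono) auto
    then show ?thesis using an[of n] that by simp
  qed
  have "cmod (cmean f w - (\<Sum>n<4. b n)) \<le> 2 * B * (2 / d) ^ 4"
    by (rule tail_bound[OF sb bn q B])
  moreover have "(\<Sum>n<4. b n) = f w"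
    by (simp add: eval_nat_numeral b_def a_def)
  ultimately show "cmod (cmean f w - f w) \<le> 32 * B / d ^ 4" by (simp add: power_divide)
qed

section \<open>Conformal maps onto the disk\<close>

definition bdist :: "complex set \<Rightarrow> complex \<Rightarrow> real" where
  "bdist D w = infdist w (- D)"

lemma ball_bdist_subset: "ball w (bdist D w) \<subseteq> D"
proof
  fix z assume z: "z \<in> ball w (bdist D w)"
  show "z \<in> D"
  proof (rule ccontr)
    assume "z \<notin> D"
    then have "infdist w (- D) \<le> dist w z" by (intro infdist_le) auto
    with z show False by (simp add: bdist_def)
  qed
qed

lemma bdist_ge:
  assumes "D \<noteq> UNIV" "ball w s \<subseteq> D" shows "s \<le> bdist D w"
  unfolding bdist_def infdist_def using assms
  by (auto intro!: cINF_greatest simp: subset_iff not_less)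

lemma bdist_pos: "open D \<Longrightarrow> D \<noteq> UNIV \<Longrightarrow> w \<in> D \<Longrightarrow> bdist D w > 0"
  by (meson bdist_ge less_le_trans open_contains_ball)

lemma bdist_triangle: "bdist D w \<le> bdist D z + dist w z"
  unfolding bdist_def by (rule infdist_triangle)

text \<open>Normalised at a general point and without a condition on the derivative, because two
  instances occur: the Riemann map with \<open>x = 0\<close>, and its Moebius recentring at the
  pole.\<close>

locale conformal_disk =
  fixes D :: "complex set" and \<psi> :: "complex \<Rightarrow> complex" and x :: complex
  assumes openD: "open D" and holo: "\<psi> holomorphic_on D" and bij: "bij_betw \<psi> D (ball 0 1)"
    and xD: "x \<in> D" and \<psi>x: "\<psi> x = 0" and nonfull: "D \<noteq> UNIV"
begin

text \<open>Unlike 1 - |psi| this is smooth at the zero of psi, with Laplacian -4 |psi'|^2; the two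
  differ by a factor of at most 2.\<close>

definition v :: "complex \<Rightarrow> real" where "v w = 1 - (cmod (\<psi> w))\<^sup>2"

lemma injD: "inj_on \<psi> D" using bij by (simp add: bij_betw_def)

lemma \<psi>_in: "w \<in> D \<Longrightarrow> cmod (\<psi> w) < 1"
  using bij by (auto simp: bij_betw_def)

lemma v_pos: "w \<in> D \<Longrightarrow> v w > 0"
  using \<psi>_in[of w] by (simp add: v_def abs_square_less_1)

lemma v_le_1: "v w \<le> 1" by (simp add: v_def)

lemma v_bounds: "w \<in> D \<Longrightarrow> 1 - cmod (\<psi> w) \<le> v w" "w \<in> D \<Longrightarrow> v w \<le> 2 * (1 - cmod (\<psi> w))"
proof -
  assume w: "w \<in> D"
  have e: "v w = (1 - cmod (\<psi> w)) * (1 + cmod (\<psi> w))" by (simp add: v_def power2_eq_square algebra_simps)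
  have "(1 - cmod (\<psi> w)) * 1 \<le> (1 - cmod (\<psi> w)) * (1 + cmod (\<psi> w))"
    using \<psi>_in[OF w] by (intro mult_left_mono) auto
  then show "1 - cmod (\<psi> w) \<le> v w" unfolding e by simp
  have "(1 - cmod (\<psi> w)) * (1 + cmod (\<psi> w)) \<le> (1 - cmod (\<psi> w)) * 2"
    using \<psi>_in[OF w] by (intro mult_left_mono) auto
  then show "v w \<le> 2 * (1 - cmod (\<psi> w))" unfolding e by simp
qed

lemma inverse_map:
  obtains f where "f holomorphic_on ball 0 1" "inj_on f (ball 0 1)" "f ` ball 0 1 = D"
    "\<And>w. w \<in> D \<Longrightarrow> f (\<psi> w) = w" "\<And>w. w \<in> D \<Longrightarrow> deriv \<psi> w * deriv f (\<psi> w) = 1"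
proof -
  have im: "\<psi> ` D = ball 0 1" using bij by (simp add: bij_betw_def)
  obtain f where f: "f holomorphic_on \<psi> ` D" "\<And>z. z \<in> D \<Longrightarrow> deriv \<psi> z * deriv f (\<psi> z) = 1" "\<And>z. z \<in> D \<Longrightarrow> f (\<psi> z) = z"
    using holomorphic_has_inverse[OF holo openD injD] by metis
  have "inj_on f (ball 0 1)" unfolding im[symmetric] by (rule inj_onI) (use f(3) in auto)
  moreover have "f ` ball 0 1 = D" unfolding im[symmetric] image_image using f(3) by simp
  ultimately show thesis using that[of f] f unfolding im by blast
qed

lemma bdist_pos': "w \<in> D \<Longrightarrow> bdist D w > 0" using bdist_pos[OF openD nonfull] .

text \<open>The quarter theorem for the inverse map on the disk of radius 1 - |psi w| about psi w:
  its image contains a ball about w, whose radius is at most the distance of w from the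
  complement.\<close>

lemma koebe_deriv_lower: assumes w: "w \<in> D" shows "v w \<le> 8 * bdist D w * cmod (deriv \<psi> w)"
proof -
  obtain f where f: "f holomorphic_on ball 0 1" "inj_on f (ball 0 1)" "f ` ball 0 1 = D"
    "\<And>w. w \<in> D \<Longrightarrow> f (\<psi> w) = w" "\<And>w. w \<in> D \<Longrightarrow> deriv \<psi> w * deriv f (\<psi> w) = 1" using inverse_map by metis
  define s where "s = 1 - cmod (\<psi> w)"
  have s: "s > 0" using \<psi>_in[OF w] by (simp add: s_def)
  have sub: "ball (\<psi> w) s \<subseteq> ball 0 1" unfolding s_def
    by (intro subsetI) (simp add: dist_norm, smt (verit) norm_triangle_sub norm_minus_commute)
  have "ball (f (\<psi> w)) (s * cmod (deriv f (\<psi> w)) / 4) \<subseteq> f ` ball (\<psi> w) s"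
    by (rule koebe_quarter[OF holomorphic_on_subset[OF f(1) sub] inj_on_subset[OF f(2) sub] s])
  also have "\<dots> \<subseteq> D" using sub f(3) by blast
  finally have "s * cmod (deriv f (\<psi> w)) / 4 \<le> bdist D w"
    unfolding f(4)[OF w] by (rule bdist_ge[OF nonfull])
  then have "s * (cmod (deriv f (\<psi> w)) * cmod (deriv \<psi> w)) \<le> 4 * bdist D w * cmod (deriv \<psi> w)"
    using mult_right_mono[of "s * cmod (deriv f (\<psi> w))" "4 * bdist D w" "cmod (deriv \<psi> w)"] by (simp add: mult.assoc)
  moreover have "cmod (deriv f (\<psi> w)) * cmod (deriv \<psi> w) = 1"
    using f(5)[OF w] by (metis mult.commute norm_mult norm_one)
  ultimately show ?thesis using v_bounds(2)[OF w] unfolding s_def by simp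
qed

lemma schwarz_near: assumes "w \<in> ball x (bdist D x)" shows "cmod (\<psi> w) \<le> dist w x / bdist D x"
  and schwarz_deriv: "cmod (deriv \<psi> x) \<le> 1 / bdist D x"
proof -
  define r where "r = bdist D x"
  have r: "r > 0" using bdist_pos'[OF xD] by (simp add: r_def)
  define h where "h = (\<lambda>z. \<psi> (x + of_real r * z))"
  have im: "x + of_real r * z \<in> ball x r" if "z \<in> ball 0 1" for z
    using that r by (simp add: dist_norm norm_mult)
  have sub: "ball x r \<subseteq> D" unfolding r_def by (rule ball_bdist_subset)
  have hD: "(h has_field_derivative deriv \<psi> (x + of_real r * z) * of_real r) (at z)" if "z \<in> ball 0 1" for z
  proof -
    have a: "((\<lambda>z. x + of_real r * z) has_field_derivative of_real r) (at z)" by (auto intro!: derivative_eq_intros)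
    have "x + of_real r * z \<in> D" using im[OF that] sub by blast
    from DERIV_chain2[OF holomorphic_derivI[OF holo openD this] a] show ?thesis unfolding h_def .
  qed
  have hh: "h holomorphic_on ball 0 1" unfolding holomorphic_on_open[OF open_ball] using hD by blast
  have h0: "h 0 = 0" by (simp add: h_def \<psi>x)
  have hn: "norm (h z) < 1" if "norm z < 1" for z
    unfolding h_def using \<psi>_in im sub that by (meson mem_ball_0 subsetD)
  have "cmod (deriv h 0) \<le> 1" using Schwarz_Lemma(2)[OF hh h0 hn, of 0] by simp
  then show "cmod (deriv \<psi> x) \<le> 1 / bdist D x"
    using DERIV_imp_deriv[OF hD[of 0]] r by (simp add: norm_mult r_def[symmetric] field_simps)
  define u where "u = (w - x) / of_real r"
  have u: "cmod u = dist w x / r" using r by (simp add: u_def norm_divide dist_norm)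
  have u1: "cmod u < 1" using assms r unfolding u by (simp add: r_def dist_commute)
  have "cmod (h u) \<le> cmod u" by (rule Schwarz_Lemma(1)[OF hh h0 hn u1])
  moreover have "h u = \<psi> w" using r by (simp add: h_def u_def)
  ultimately show "cmod (\<psi> w) \<le> dist w x / bdist D x" using u by (simp add: r_def)
qed

lemma v_x: "v x = 1" by (simp add: v_def \<psi>x)

lemma deriv_lower: "1 \<le> 8 * bdist D x * cmod (deriv \<psi> x)"
  using koebe_deriv_lower[OF xD] by (simp add: v_x)

text \<open>Let f be the inverse map and s = 1 - |psi w|. Distortion gives |f'(psi w)| >= s |f'(0)|
  / 8 >= s r / 8, and \<open>koebe_deriv_lower\<close> gives s |f'(psi w)| <= 8 d. Hence s^2 r <= 64
  d, and v <= 2 s.\<close>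

lemma beurling: assumes w: "w \<in> D" shows "(v w)\<^sup>2 \<le> 256 * bdist D w / bdist D x"
proof -
  obtain f where f: "f holomorphic_on ball 0 1" "inj_on f (ball 0 1)" "f ` ball 0 1 = D"
    "\<And>w. w \<in> D \<Longrightarrow> f (\<psi> w) = w" "\<And>w. w \<in> D \<Longrightarrow> deriv \<psi> w * deriv f (\<psi> w) = 1" using inverse_map by metis
  define s where "s = 1 - cmod (\<psi> w)"
  have s: "s > 0" "s \<le> 1" using \<psi>_in[OF w] by (auto simp: s_def)
  define r where "r = bdist D x"
  have r: "r > 0" using bdist_pos'[OF xD] by (simp add: r_def)
  have "1 = cmod (deriv \<psi> x) * cmod (deriv f 0)" using f(5)[OF xD] by (metis \<psi>x norm_mult norm_one)
  also have "\<dots> \<le> 1 / r * cmod (deriv f 0)"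
    using schwarz_deriv[of x] r unfolding r_def by (intro mult_right_mono) auto
  finally have f0: "r \<le> cmod (deriv f 0)" using r by (simp add: field_simps)
  have "s / 8 * r \<le> s / (1 + cmod (\<psi> w)) ^ 3 * cmod (deriv f 0)"
  proof (intro mult_mono divide_left_mono)
    show "(1 + cmod (\<psi> w)) ^ 3 \<le> 8" using power_mono[of "1 + cmod (\<psi> w)" 2 3] \<psi>_in[OF w] by simp
  qed (use s r f0 in \<open>auto intro!: mult_pos_pos zero_less_power add_pos_nonneg\<close>)
  also have "\<dots> \<le> cmod (deriv f (\<psi> w))"
    using koebe_distortion_lower[OF f(1,2) \<psi>_in[OF w]] by (simp add: s_def)
  finally have fw: "s / 8 * r \<le> cmod (deriv f (\<psi> w))" .
  have inv: "cmod (deriv f (\<psi> w)) * cmod (deriv \<psi> w) = 1"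
    using f(5)[OF w] by (metis mult.commute norm_mult norm_one)
  have "s * cmod (deriv f (\<psi> w)) \<le> v w * cmod (deriv f (\<psi> w))"
    using v_bounds(1)[OF w] by (intro mult_right_mono) (auto simp: s_def)
  also have "\<dots> \<le> 8 * bdist D w * cmod (deriv \<psi> w) * cmod (deriv f (\<psi> w))"
    by (rule mult_right_mono[OF koebe_deriv_lower[OF w]]) simp
  also have "\<dots> = 8 * bdist D w" using inv by (simp add: mult_ac)
  finally have "s * (s / 8 * r) \<le> 8 * bdist D w"
    using mult_left_mono[OF fw, of s] s by linarith
  then have "s\<^sup>2 * r \<le> 64 * bdist D w" by (simp add: power2_eq_square)
  then have s2: "s\<^sup>2 \<le> 64 * bdist D w / r" using r by (simp add: field_simps)
  have "v w \<le> 2 * s" using v_bounds(2)[OF w] by (simp add: s_def)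
  then have "(v w)\<^sup>2 \<le> (2 * s)\<^sup>2" using v_pos[OF w] by (intro power_mono) auto
  also have "\<dots> = 4 * s\<^sup>2" by (simp add: power2_eq_square)
  finally show ?thesis using s2 by (simp add: r_def)
qed

text \<open>The image of \<open>ball x s\<close> contains a disk of radius s |psi'(x)| / 4 about 0,
  and by injectivity no other point of D is mapped there; \<open>deriv_lower\<close> bounds this
  radius from below.\<close>

lemma far_from_pole:
  assumes s: "0 < s" "s \<le> bdist D x" and w: "w \<in> D" "dist w x \<ge> s"
  shows "s / (32 * bdist D x) \<le> cmod (\<psi> w)"
proof (rule ccontr)
  assume c: "\<not> ?thesis"
  have sub: "ball x s \<subseteq> D" using ball_bdist_subset[of x D] s by (meson dual_order.trans subset_ball)
  have r: "bdist D x > 0" using s by simp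
  have "s / (32 * bdist D x) \<le> s * cmod (deriv \<psi> x) / 4"
  proof -
    have "s / (32 * bdist D x) * 1 \<le> s / (32 * bdist D x) * (8 * bdist D x * cmod (deriv \<psi> x))"
      using deriv_lower s r by (intro mult_left_mono) auto
    then show ?thesis using r by simp
  qed
  then have "\<psi> w \<in> ball (\<psi> x) (s * cmod (deriv \<psi> x) / 4)" using c by (simp add: \<psi>x dist_norm)
  then have "\<psi> w \<in> \<psi> ` ball x s"
    using koebe_quarter[OF holomorphic_on_subset[OF holo sub] inj_on_subset[OF injD sub] s(1)] by blast
  then obtain z where "z \<in> ball x s" "\<psi> z = \<psi> w" by auto
  then have "z = w" using inj_onD[OF injD] sub w by blast
  with \<open>z \<in> ball x s\<close> w show False by (simp add: dist_commute)
qed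

text \<open>The rotation makes psi w nonnegative, so that 1 - c psi has positive real part on D and
  at w takes the value 1 - |psi w|. Harnack's inequality then measures the oscillation of psi near w
  in units of v w.\<close>

lemma rotation_positive:
  assumes w: "w \<in> D"
  obtains c where "cmod c = 1" "(\<lambda>z. 1 - c * \<psi> z) holomorphic_on D" "\<And>z. z \<in> D \<Longrightarrow> Re (1 - c * \<psi> z) \<ge> 1 - cmod (\<psi> z)"
    "Re (1 - c * \<psi> w) = 1 - cmod (\<psi> w)"
proof -
  have "\<exists>c. cmod c = 1 \<and> c * \<psi> w = of_real (cmod (\<psi> w))"
  proof (cases "\<psi> w = 0")
    case False
    have "cnj (\<psi> w) * \<psi> w = of_real (cmod (\<psi> w)) * of_real (cmod (\<psi> w))"
      by (simp add: complex_norm_square[symmetric] power2_eq_square mult.commute[of "cnj _"] flip: of_real_mult)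
    with False show ?thesis
      by (intro exI[of _ "cnj (\<psi> w) / of_real (cmod (\<psi> w))"]) (simp add: norm_divide)
  qed (auto intro: exI[of _ 1])
  then obtain c where c: "cmod c = 1" "c * \<psi> w = of_real (cmod (\<psi> w))" by blast
  show thesis
  proof (rule that[of c])
    show "Re (1 - c * \<psi> z) \<ge> 1 - cmod (\<psi> z)" for z
      using complex_Re_le_cmod[of "c * \<psi> z"] c(1) by (simp add: norm_mult)
  qed (use c in \<open>auto intro!: holomorphic_intros holo\<close>)
qed

lemma step_half:
  assumes sub: "ball m \<rho> \<subseteq> D" and z: "dist z m < \<rho> / 2"
  shows "1 - cmod (\<psi> z) \<le> 3 * (1 - cmod (\<psi> m))"
proof -
  have \<rho>: "\<rho> > 0" using z zero_le_dist[of z m] by linarith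
  have m: "m \<in> D" using sub \<rho> by auto
  obtain c where c: "cmod c = 1" "(\<lambda>z. 1 - c * \<psi> z) holomorphic_on D" "\<And>z. z \<in> D \<Longrightarrow> Re (1 - c * \<psi> z) \<ge> 1 - cmod (\<psi> z)"
    "Re (1 - c * \<psi> m) = 1 - cmod (\<psi> m)" using rotation_positive[OF m] by metis
  have pos: "Re (1 - c * \<psi> z) > 0" if "z \<in> ball m \<rho>" for z
    using c(3)[of z] \<psi>_in[of z] that sub by fastforce
  have zin: "z \<in> ball m (\<rho> / 2)" using z by (simp add: dist_commute)
  then have zD: "z \<in> D" using sub \<rho> by auto
  have "cmod ((1 - c * \<psi> z) - (1 - c * \<psi> m)) < 2 * Re (1 - c * \<psi> m)"
    by (rule positive_real_part_half_ball[OF holomorphic_on_subset[OF c(2) sub] pos zin \<rho>])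
  then have "Re ((1 - c * \<psi> z) - (1 - c * \<psi> m)) < 2 * Re (1 - c * \<psi> m)"
    using complex_Re_le_cmod le_less_trans by blast
  then show ?thesis using c(3)[OF zD] c(4) by (simp del: one_complex.simps)
qed

text \<open>A Harnack chain along the edge that uses nothing but the two unit balls, so it remains
  valid for lattice points next to the boundary.\<close>

lemma v_step:
  assumes "ball w 1 \<subseteq> D" "ball (w + e) 1 \<subseteq> D" "cmod e = 1"
  shows "v (w + e) \<le> 54 * v w"
proof -
  have wD: "w \<in> D" "w + e \<in> D" using assms by auto
  define p where "p = (\<lambda>t::real. w + of_real t * e)"
  have dp: "dist (p s) (p t) = \<bar>s - t\<bar>" for s t
    using assms(3) by (simp add: p_def dist_norm norm_mult flip: left_diff_distrib of_real_diff)
  have p0: "p 0 = w" "p 1 = w + e" by (simp_all add: p_def)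
  have b0: "ball (p t) (1 - \<bar>t\<bar>) \<subseteq> D" for t
  proof -
    have "ball (p t) (1 - \<bar>t\<bar>) \<subseteq> ball w 1" using dp[of t 0] unfolding p0
      by (intro subsetI) (simp, smt (verit) dist_commute dist_triangle2)
    then show ?thesis using assms(1) by blast
  qed
  have b1: "ball (p t) (1 - \<bar>1 - t\<bar>) \<subseteq> D" for t
  proof -
    have "ball (p t) (1 - \<bar>1 - t\<bar>) \<subseteq> ball (w + e) 1" using dp[of t 1] unfolding p0
      by (intro subsetI) (simp, smt (verit) dist_commute dist_triangle2)
    then show ?thesis using assms(2) by blast
  qed
  \<comment> \<open>The balls at \<open>w\<close>, \<open>m1\<close>, \<open>m2\<close> have radii
    1, 11/20 and 7/10, and the hops 9/20, 1/4 and 3/10 stay below half of these. Three factors 3,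
    and a factor 2 for passing from 1 - |psi| to v, make 54.\<close>
  define m1 m2 where "m1 = p (9/20)" and "m2 = p (7/10)"
  have 1: "1 - cmod (\<psi> m1) \<le> 3 * (1 - cmod (\<psi> w))"
    unfolding p0(1)[symmetric] m1_def by (rule step_half[OF b0[of 0]]) (simp add: dp)
  have 2: "1 - cmod (\<psi> m2) \<le> 3 * (1 - cmod (\<psi> m1))"
    unfolding m1_def m2_def by (rule step_half[OF b0[of "9/20"]]) (simp add: dp)
  have 3: "1 - cmod (\<psi> (w + e)) \<le> 3 * (1 - cmod (\<psi> m2))"
    unfolding p0(2)[symmetric] m2_def by (rule step_half[OF b1[of "7/10"]]) (simp add: dp)
  have "1 - cmod (\<psi> (w + e)) \<le> 27 * (1 - cmod (\<psi> w))" using 1 2 3 by argo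
  then show ?thesis using v_bounds(2)[OF wD(2)] v_bounds(1)[OF wD(1)] by argo
qed

end

text \<open>Combine ln (1 + t) <= t - t^2 / 4 with exp s <= 1 + s + s^2 and |s| <= 2 alpha |t|. The
  error 4 alpha^2 t^2 uses up at most half of the gain alpha t^2 / 4, because alpha <= 1/32.\<close>

lemma powr_concave_gain:
  fixes t \<alpha> :: real
  assumes t: "\<bar>t\<bar> \<le> 1/2" and \<alpha>: "0 < \<alpha>" "\<alpha> \<le> 1/32"
  shows "(1 + t) powr \<alpha> \<le> 1 + \<alpha> * t - \<alpha> * t\<^sup>2 / 8"
proof -
  define s where "s = \<alpha> * (t - t\<^sup>2 / 4)"
  have t2: "t\<^sup>2 \<le> \<bar>t\<bar> / 2" using mult_left_mono[OF t, of "\<bar>t\<bar>"] by (simp add: power2_eq_square abs_mult_self_eq)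
  have "ln (1 + t) \<le> t - t\<^sup>2 / 4"
  proof -
    define g where "g = (\<lambda>t::real. t - t\<^sup>2 / 4 - ln (1 + t))"
    have D: "(g has_real_derivative u * (1 - u) / (2 * (1 + u))) (at u)" if "u > -1" for u
    proof -
      have "(g has_real_derivative 1 - 2 * u / 4 - 1 / (1 + u)) (at u)"
        unfolding g_def using that by (auto intro!: derivative_eq_intros)
      moreover have "1 - 2 * u / 4 - 1 / (1 + u) = u * (1 - u) / (2 * (1 + u))"
      proof -
        define i where "i = 1 / (1 + u)"
        have i: "i * (1 + u) = 1" using that by (simp add: i_def)
        have "(1 - 2 * u / 4 - i) * (2 * (1 + u)) = 2 * (1 + u) - u * (1 + u) - 2 * (i * (1 + u))"
          by (simp add: algebra_simps)
        also have "\<dots> = u * (1 - u)" unfolding i by (simp add: algebra_simps)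
        finally show ?thesis using that unfolding i_def[symmetric] by (subst nonzero_eq_divide_eq) auto
      qed
      ultimately show ?thesis by simp
    qed
    have "g 0 \<le> g t"
    proof (cases "t \<ge> 0")
      case True
      show ?thesis
      proof (rule DERIV_nonneg_imp_nondecreasing[OF True])
        fix u assume u: "0 \<le> u" "u \<le> t"
        then have "0 \<le> u * (1 - u) / (2 * (1 + u))" using t by simp
        then show "\<exists>y. (g has_real_derivative y) (at u) \<and> 0 \<le> y" using D[of u] u by auto
      qed
    next
      case False
      show ?thesis
      proof (rule DERIV_nonpos_imp_nonincreasing[of t 0])
        show "t \<le> 0" using False by simp
        fix u assume u: "t \<le> u" "u \<le> 0"
        then have "u * (1 - u) \<le> 0" "2 * (1 + u) > 0" using t by (auto intro: mult_nonpos_nonneg)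
        then have "u * (1 - u) / (2 * (1 + u)) \<le> 0" by (rule divide_nonpos_pos)
        then show "\<exists>y. (g has_real_derivative y) (at u) \<and> y \<le> 0" using D[of u] u t by auto
      qed
    qed
    then show ?thesis by (simp add: g_def)
  qed
  then have "(1 + t) powr \<alpha> \<le> exp s"
    using t \<alpha> by (simp add: powr_def s_def mult_left_mono)
  also have "\<bar>t - t\<^sup>2 / 4\<bar> \<le> 2 * \<bar>t\<bar>" using t2 zero_le_power2[of t] by linarith
  then have sab: "\<bar>s\<bar> \<le> \<alpha> * (2 * \<bar>t\<bar>)" using \<alpha> by (simp add: s_def abs_mult)
  have "\<alpha> * (2 * \<bar>t\<bar>) \<le> 1 * 1" using \<alpha> t by (intro mult_mono) auto
  then have s1: "\<bar>s\<bar> \<le> 1" using sab by simp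
  have "exp s \<le> 1 + s + s\<^sup>2"
  proof (cases "s \<ge> 0")
    case True
    then show ?thesis using exp_bound[of s] s1 by simp
  next
    case False
    define u where "u = - s"
    have u: "u > 0" "u \<le> 1" using False s1 by (auto simp: u_def)
    have "1 \<le> (1 - u + u\<^sup>2) * (1 + u + u\<^sup>2 / 2)"
    proof -
      have "(1 - u + u\<^sup>2) * (1 + u + u\<^sup>2 / 2) = 1 + (u\<^sup>2 + u ^ 3 + u ^ 4) / 2"
        by (simp add: field_simps power2_eq_square eval_nat_numeral)
      then show ?thesis using u by simp
    qed
    also have "\<dots> \<le> (1 - u + u\<^sup>2) * exp u"
      using u exp_lower_Taylor_quadratic[of u] by (intro mult_left_mono) auto
    finally have "exp (- u) \<le> 1 - u + u\<^sup>2" by (simp add: exp_minus field_simps)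
    then show ?thesis by (simp add: u_def)
  qed
  also have "s\<^sup>2 \<le> (\<alpha> * (2 * \<bar>t\<bar>))\<^sup>2" using sab by (metis abs_ge_zero abs_le_square_iff abs_of_nonneg order_trans)
  also have "(\<alpha> * (2 * \<bar>t\<bar>))\<^sup>2 = (4 * \<alpha>) * (\<alpha> * t\<^sup>2)" by (simp add: power_mult_distrib power2_eq_square abs_mult_self_eq)
  also have "\<dots> \<le> (1/8) * (\<alpha> * t\<^sup>2)" using \<alpha> by (intro mult_right_mono) auto
  finally show ?thesis using \<open>(1 + t) powr \<alpha> \<le> exp s\<close> by (simp add: s_def algebra_simps)
qed

section \<open>Superharmonicity of powers of \<open>v\<close>\<close>

definition mean4 :: "(complex \<Rightarrow> real) \<Rightarrow> real" where
  "mean4 h = (h 1 + h (-1) + h \<i> + h (-\<i>)) / 4"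

lemma nmean_mean4: "nmean F w = mean4 (\<lambda>e. F (w + e))"
  by (simp add: nmean_def mean4_def)

lemma mean4_mono: "(\<And>e. cmod e = 1 \<Longrightarrow> f e \<le> g e) \<Longrightarrow> mean4 f \<le> mean4 g"
  unfolding mean4_def by (intro divide_right_mono add_mono) auto

lemma mean4_simps:
  "mean4 (\<lambda>e. f e + g e) = mean4 f + mean4 g" "mean4 (\<lambda>e. f e - g e) = mean4 f - mean4 g"
  "mean4 (\<lambda>e. c * f e) = c * mean4 f" "mean4 (\<lambda>e. c) = c"
  by (simp_all add: mean4_def field_simps)

lemma mean4_Re_square: "mean4 (\<lambda>e. (Re (z * e))\<^sup>2) = (cmod z)\<^sup>2 / 2"
  by (simp add: mean4_def cmod_power2 field_simps)

lemma half_square_le: fixes a b :: real shows "a\<^sup>2 / 2 - b\<^sup>2 \<le> (a + b)\<^sup>2"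
proof -
  have "0 \<le> (a + 2 * b)\<^sup>2" by simp
  then show ?thesis by (simp add: power2_eq_square algebra_simps)
qed

context conformal_disk
begin

lemma \<psi>_coeff:
  assumes sub: "ball w d \<subseteq> D" and d: "d > 0" and n: "n > 0"
  shows "cmod ((deriv ^^ n) \<psi> w / fact n) \<le> 2 * v w * (2 / d) ^ n"
proof -
  have w: "w \<in> D" using sub d by auto
  obtain c where c: "cmod c = 1" "(\<lambda>z. 1 - c * \<psi> z) holomorphic_on D" "\<And>z. z \<in> D \<Longrightarrow> Re (1 - c * \<psi> z) \<ge> 1 - cmod (\<psi> z)"
    "Re (1 - c * \<psi> w) = 1 - cmod (\<psi> w)" using rotation_positive[OF w] by metis
  have pos: "Re (1 - c * \<psi> z) > 0" if "z \<in> ball w d" for z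
    using c(3)[of z] \<psi>_in[of z] that sub by fastforce
  have bnd: "cmod (\<psi> z - \<psi> w) < 2 * (1 - cmod (\<psi> w))" if "z \<in> ball w (d/2)" for z
  proof -
    have "cmod ((1 - c * \<psi> z) - (1 - c * \<psi> w)) < 2 * (1 - cmod (\<psi> w))"
      using positive_real_part_half_ball[OF holomorphic_on_subset[OF c(2) sub] pos that d] unfolding c(4) .
    moreover have "(1 - c * \<psi> z) - (1 - c * \<psi> w) = c * (\<psi> w - \<psi> z)" by (simp add: algebra_simps)
    ultimately show ?thesis using c(1) by (simp add: norm_mult norm_minus_commute)
  qed
  have "cmod ((deriv ^^ n) \<psi> w / fact n) \<le> 2 * (1 - cmod (\<psi> w)) * (2 / d) ^ n"
    by (rule half_ball_coeff[OF holomorphic_on_subset[OF holo sub] bnd d n])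
  also have "\<dots> \<le> 2 * v w * (2 / d) ^ n"
    using v_bounds(1)[OF w] d by (intro mult_right_mono mult_left_mono) auto
  finally show ?thesis .
qed

text \<open>Two gains complement each other. The mean of v drops by about |psi'|^2, a relative gain
  of order V / d^2, which fades at the boundary. Concavity of the power gains the variance of delta
  / V, of order (1 - V) / d^2, which fades where psi is close to 0 and v is stationary.\<close>

lemma v_powr_superharmonic:
  assumes w: "w \<in> D" and d1: "bdist D w \<ge> 1300" and \<alpha>: "0 < \<alpha>" "\<alpha> \<le> 1/32"
  shows "nmean (\<lambda>z. v z powr \<alpha>) w \<le> v w powr \<alpha> * (1 - \<alpha> / (1024 * (bdist D w)\<^sup>2))"
proof -
  define d where "d = bdist D w"
  have d: "d \<ge> 1300" using d1 by (simp add: d_def)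
  have sub: "ball w d \<subseteq> D" unfolding d_def by (rule ball_bdist_subset)
  define V where "V = v w"
  have V: "0 < V" "V \<le> 1" using v_pos[OF w] v_le_1 by (auto simp: V_def)
  define S where "S = (\<lambda>e. \<psi> (w + e) - \<psi> w)"
  define c0 c1 where "c0 = \<psi> w" and "c1 = deriv \<psi> w"
  define rem where "rem = (\<lambda>e. S e - c1 * e)"
  have B: "2 * V \<ge> 0" using V by simp
  have coeff: "cmod ((deriv ^^ n) \<psi> w / fact n) \<le> 2 * V * (2 / d) ^ n" if "n > 0" for n
    unfolding V_def by (rule \<psi>_coeff[OF sub _ that]) (use d in simp)
  have d4: "d \<ge> 4" using d by simp
  note T = lattice_taylor[OF holomorphic_on_subset[OF holo sub] d4 B coeff]
  have S: "cmod (S e) \<le> 8 * V / d" if "cmod e = 1" for e using T(1)[OF _ that] by (simp add: S_def)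
  have rem: "cmod (rem e) \<le> 16 * V / d\<^sup>2" if "cmod e = 1" for e using T(2)[OF _ that] by (simp add: S_def rem_def c1_def)
  have cm: "cmod (cmean \<psi> w - \<psi> w) \<le> 64 * V / d ^ 4" using T(3) by simp
  have c0: "(cmod c0)\<^sup>2 = 1 - V" by (simp add: c0_def V_def v_def)
  have c0_1: "cmod c0 \<le> 1" using \<psi>_in[OF w] by (simp add: c0_def)
  have c1: "V\<^sup>2 / (64 * d\<^sup>2) \<le> (cmod c1)\<^sup>2"
  proof -
    have "V / (8 * d) \<le> cmod c1" using koebe_deriv_lower[OF w] d by (simp add: V_def d_def[symmetric] c1_def divide_le_eq mult_ac)
    then have "(V / (8 * d))\<^sup>2 \<le> (cmod c1)\<^sup>2" using V d by (intro power_mono) auto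
    then show ?thesis by (simp add: power_divide power_mult_distrib)
  qed
  define \<delta> where "\<delta> = (\<lambda>e. v (w + e) - V)"
  have \<delta>: "\<delta> e = - 2 * Re (cnj c0 * S e) - (cmod (S e))\<^sup>2" for e
  proof -
    have "\<psi> (w + e) = c0 + S e" by (simp add: S_def c0_def)
    then show ?thesis unfolding \<delta>_def V_def v_def c0_def[symmetric] cmod_power2
      by (simp add: power2_eq_square algebra_simps)
  qed
  have Re_le: "\<bar>Re (cnj c0 * z)\<bar> \<le> cmod z" for z
    using abs_Re_le_cmod[of "cnj c0 * z"] mult_right_mono[OF c0_1, of "cmod z"] by (simp add: norm_mult)
  have S2: "(cmod (S e))\<^sup>2 \<le> 64 * V / d\<^sup>2" if "cmod e = 1" for e
  proof -
    have "(cmod (S e))\<^sup>2 \<le> (8 * V / d)\<^sup>2" using S[OF that] by (intro power_mono) auto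
    also have "\<dots> = 64 * (V * V) / d\<^sup>2" by (simp add: power2_eq_square)
    also have "\<dots> \<le> 64 * (V * 1) / d\<^sup>2" using V by (intro divide_right_mono mult_left_mono) auto
    finally show ?thesis by simp
  qed
  have \<delta>_small: "\<bar>\<delta> e / V\<bar> \<le> 1/2" if "cmod e = 1" for e
  proof -
    have "\<bar>\<delta> e\<bar> \<le> 2 * (8 * V / d) + 64 * V / d\<^sup>2"
      using Re_le[of "S e"] S[OF that] S2[OF that] zero_le_power2[of "cmod (S e)"] unfolding \<delta> by linarith
    also have "64 * V / d\<^sup>2 \<le> 64 * V / d" using V d by (intro divide_left_mono) (auto simp: power2_eq_square)
    finally have "\<bar>\<delta> e\<bar> \<le> 80 * V / d" by simp
    also have "\<dots> \<le> 80 * V / 160" using V d by (intro divide_left_mono) auto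
    finally show ?thesis using V by (simp add: divide_le_eq)
  qed
  have M1: "mean4 (\<lambda>e. \<delta> e / V) \<le> 384 / d ^ 4 - V / (128 * d\<^sup>2)"
  proof -
    have a: "- mean4 (\<lambda>e. Re (cnj c0 * S e)) \<le> 64 * V / d ^ 4"
    proof -
      have "mean4 (\<lambda>e. Re (cnj c0 * S e)) = Re (cnj c0 * (cmean \<psi> w - \<psi> w))"
        by (simp add: mean4_def S_def field_simps)
      then show ?thesis using Re_le[of "cmean \<psi> w - \<psi> w"] cm by linarith
    qed
    have b: "(cmod c1)\<^sup>2 / 2 - 256 * V / d ^ 4 \<le> mean4 (\<lambda>e. (cmod (S e))\<^sup>2)"
    proof -
      have "(cmod c1)\<^sup>2 / 2 - 256 * V / d ^ 4 \<le> (cmod (S e))\<^sup>2" if "cmod e = 1" for e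
      proof -
        have "S e = c1 * e + rem e" by (simp add: rem_def)
        then have "cmod c1 \<le> cmod (S e) + cmod (rem e)"
          using that by (metis add_diff_cancel_right' mult.right_neutral norm_mult norm_triangle_ineq4)
        then have "(cmod c1)\<^sup>2 \<le> (cmod (S e) + cmod (rem e))\<^sup>2" by (intro power_mono) auto
        also have "\<dots> \<le> 2 * (cmod (S e))\<^sup>2 + 2 * (cmod (rem e))\<^sup>2"
          using sum_squares_bound[of "cmod (S e)" "cmod (rem e)"] by (simp add: power2_sum)
        also have "(cmod (rem e))\<^sup>2 \<le> (16 * V / d\<^sup>2)\<^sup>2" using rem[OF that] by (intro power_mono) auto
        also have "(16 * V / d\<^sup>2)\<^sup>2 = 256 * (V * V) / d ^ 4" by (simp add: power2_eq_square eval_nat_numeral)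
        also have "\<dots> \<le> 256 * (V * 1) / d ^ 4" using V by (intro divide_right_mono mult_left_mono) auto
        finally show ?thesis by simp
      qed
      then have "mean4 (\<lambda>e. (cmod c1)\<^sup>2 / 2 - 256 * V / d ^ 4) \<le> mean4 (\<lambda>e. (cmod (S e))\<^sup>2)" by (rule mean4_mono)
      then show ?thesis by (simp only: mean4_simps)
    qed
    have "mean4 \<delta> = - 2 * mean4 (\<lambda>e. Re (cnj c0 * S e)) - mean4 (\<lambda>e. (cmod (S e))\<^sup>2)"
      unfolding \<delta>[abs_def] by (simp only: mean4_simps)
    also have "\<dots> \<le> 2 * (64 * V / d ^ 4) - ((cmod c1)\<^sup>2 / 2 - 256 * V / d ^ 4)" using a b by linarith
    also have "\<dots> \<le> 2 * (64 * V / d ^ 4) - (V\<^sup>2 / (64 * d\<^sup>2) / 2 - 256 * V / d ^ 4)" using c1 by argo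
    also have "\<dots> = V * (384 / d ^ 4 - V / (128 * d\<^sup>2))" by (simp add: algebra_simps power2_eq_square)
    finally have "mean4 \<delta> / V \<le> 384 / d ^ 4 - V / (128 * d\<^sup>2)" using V by (simp add: divide_le_eq mult.commute)
    moreover have "mean4 (\<lambda>e. \<delta> e / V) = mean4 \<delta> / V" by (simp add: mean4_def add_divide_distrib)
    ultimately show ?thesis by simp
  qed
  have M2: "(1 - V) / (64 * d\<^sup>2) - 9216 / d ^ 4 \<le> mean4 (\<lambda>e. (\<delta> e / V)\<^sup>2)"
  proof -
    have "2 * (Re (cnj c0 * c1 * e))\<^sup>2 - 9216 * V\<^sup>2 / d ^ 4 \<le> (\<delta> e)\<^sup>2" if "cmod e = 1" for e
    proof -
      define r where "r = - (2 * Re (cnj c0 * rem e) + (cmod (S e))\<^sup>2)"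
      have de: "\<delta> e = - 2 * Re (cnj c0 * c1 * e) + r"
      proof -
        have "S e = c1 * e + rem e" by (simp add: rem_def)
        then have "Re (cnj c0 * S e) = Re (cnj c0 * c1 * e) + Re (cnj c0 * rem e)"
          by (simp only: distrib_left plus_complex.sel mult.assoc)
        then show ?thesis unfolding \<delta> r_def by simp
      qed
      have "\<bar>r\<bar> \<le> 2 * (16 * V / d\<^sup>2) + 64 * V / d\<^sup>2"
        using Re_le[of "rem e"] rem[OF that] S2[OF that] zero_le_power2[of "cmod (S e)"] unfolding r_def by linarith
      then have "\<bar>r\<bar> \<le> 96 * V / d\<^sup>2" by simp
      then have "r\<^sup>2 \<le> (96 * V / d\<^sup>2)\<^sup>2" by (metis abs_ge_zero abs_le_square_iff abs_of_nonneg order_trans)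
      also have "\<dots> = 9216 * V\<^sup>2 / d ^ 4" by (simp add: power2_eq_square eval_nat_numeral)
      finally have r2: "r\<^sup>2 \<le> 9216 * V\<^sup>2 / d ^ 4" .
      define A where "A = Re (cnj c0 * c1 * e)"
      have "(- 2 * A)\<^sup>2 / 2 = 2 * A\<^sup>2" by (simp add: power2_eq_square)
      then show ?thesis using half_square_le[of "- 2 * A" r] r2 unfolding de A_def[symmetric] by argo
    qed
    then have "mean4 (\<lambda>e. 2 * (Re (cnj c0 * c1 * e))\<^sup>2 - 9216 * V\<^sup>2 / d ^ 4) \<le> mean4 (\<lambda>e. (\<delta> e)\<^sup>2)" by (rule mean4_mono)
    then have "(cmod (cnj c0 * c1))\<^sup>2 - 9216 * V\<^sup>2 / d ^ 4 \<le> mean4 (\<lambda>e. (\<delta> e)\<^sup>2)"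
      by (simp only: mean4_simps mean4_Re_square)
    moreover have "(1 - V) * (V\<^sup>2 / (64 * d\<^sup>2)) \<le> (cmod (cnj c0 * c1))\<^sup>2"
      unfolding norm_mult power_mult_distrib complex_mod_cnj c0 using c1 V by (intro mult_left_mono) auto
    ultimately have "V\<^sup>2 * ((1 - V) / (64 * d\<^sup>2) - 9216 / d ^ 4) \<le> mean4 (\<lambda>e. (\<delta> e)\<^sup>2)"
      by (simp add: algebra_simps)
    then have "(1 - V) / (64 * d\<^sup>2) - 9216 / d ^ 4 \<le> mean4 (\<lambda>e. (\<delta> e)\<^sup>2) / V\<^sup>2"
      using V by (simp add: le_divide_eq mult.commute)
    also have "mean4 (\<lambda>e. (\<delta> e)\<^sup>2) / V\<^sup>2 = mean4 (\<lambda>e. (\<delta> e / V)\<^sup>2)"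
      by (simp add: mean4_def power_divide add_divide_distrib)
    finally show ?thesis .
  qed
  \<comment> \<open>The gains V / 128 and (1 - V) / 512 add up to at least 1 / 512 in units of d^-2.
    The Taylor errors total 1536 / d^4, at most half of this because 1300^2 >= 1536 * 1024.\<close>
  have gain: "384 / d ^ 4 - V / (128 * d\<^sup>2) - ((1 - V) / (64 * d\<^sup>2) - 9216 / d ^ 4) / 8 \<le> - 1 / (1024 * d\<^sup>2)"
  proof -
    define h k p where "h = 1 / d ^ 4" and "k = 1 / d\<^sup>2" and "p = V * k"
    have "1300\<^sup>2 \<le> d\<^sup>2" using d by (intro power_mono) auto
    then have "1536 * 1024 \<le> d\<^sup>2" by simp
    then have "1536 * 1024 * d\<^sup>2 \<le> d\<^sup>2 * d\<^sup>2" by (rule mult_right_mono) simp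
    then have a: "1536 * 1024 * d\<^sup>2 \<le> d ^ 4" by (simp add: power_add[symmetric])
    have h: "h \<ge> 0" "h * d ^ 4 = 1" using d by (auto simp: h_def)
    have "h * (1536 * 1024 * d\<^sup>2) \<le> 1" using mult_left_mono[OF a h(1)] unfolding h(2) .
    then have hk: "1536 * 1024 * h \<le> k" unfolding k_def using d by (subst pos_le_divide_eq) (auto simp: mult_ac)
    have p0: "p \<ge> 0" using V by (simp add: p_def k_def)
    have e: "384 / d ^ 4 = 384 * h" "V / (128 * d\<^sup>2) = p / 128" "(1 - V) / (64 * d\<^sup>2) = (k - p) / 64"
      "9216 / d ^ 4 = 9216 * h" "- 1 / (1024 * d\<^sup>2) = - k / 1024"
      by (simp_all add: h_def k_def p_def diff_divide_distrib)
    show ?thesis unfolding e using hk p0 by argo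
  qed
  have "nmean (\<lambda>z. v z powr \<alpha>) w = mean4 (\<lambda>e. v (w + e) powr \<alpha>)" by (simp add: nmean_mean4)
  also have "\<dots> \<le> mean4 (\<lambda>e. V powr \<alpha> * (1 + \<alpha> * (\<delta> e / V) - \<alpha> / 8 * (\<delta> e / V)\<^sup>2))"
  proof (rule mean4_mono)
    fix e :: complex assume e: "cmod e = 1"
    have "v (w + e) = V * (1 + \<delta> e / V)" using V by (simp add: \<delta>_def field_simps)
    then have "v (w + e) powr \<alpha> = V powr \<alpha> * (1 + \<delta> e / V) powr \<alpha>"
      using V \<delta>_small[OF e] by (simp add: powr_mult)
    also have "\<dots> \<le> V powr \<alpha> * (1 + \<alpha> * (\<delta> e / V) - \<alpha> * (\<delta> e / V)\<^sup>2 / 8)"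
      by (intro mult_left_mono powr_concave_gain \<delta>_small e \<alpha>) simp
    finally show "v (w + e) powr \<alpha> \<le> V powr \<alpha> * (1 + \<alpha> * (\<delta> e / V) - \<alpha> / 8 * (\<delta> e / V)\<^sup>2)" by simp
  qed
  also have "\<dots> = V powr \<alpha> * (1 + \<alpha> * (mean4 (\<lambda>e. \<delta> e / V) - mean4 (\<lambda>e. (\<delta> e / V)\<^sup>2) / 8))"
    by (simp only: mean4_simps) (simp add: algebra_simps)
  also have "\<dots> \<le> V powr \<alpha> * (1 + \<alpha> * (- 1 / (1024 * d\<^sup>2)))"
  proof -
    have "mean4 (\<lambda>e. \<delta> e / V) - mean4 (\<lambda>e. (\<delta> e / V)\<^sup>2) / 8 \<le> - 1 / (1024 * d\<^sup>2)"
      using M1 M2 gain by argo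
    then show ?thesis using \<alpha>(1) by (intro mult_left_mono add_left_mono) auto
  qed
  finally show ?thesis by (simp add: V_def d_def)
qed

end

section \<open>Comparison principle for the killed Green's function\<close>

lemma lattice_add: "z \<in> square_lattice \<Longrightarrow> w \<in> square_lattice \<Longrightarrow> z + w \<in> square_lattice"
  and lattice_diff: "z \<in> square_lattice \<Longrightarrow> w \<in> square_lattice \<Longrightarrow> z - w \<in> square_lattice"
  by (auto simp: square_lattice_def)

lemma lattice_units: "e \<in> {1, -1, \<i>, -\<i>} \<Longrightarrow> e \<in> square_lattice"
  by (auto simp: square_lattice_def)

lemma lattice_coords:
  assumes "z \<in> square_lattice" obtains m n :: int where "z = Complex (of_int m) (of_int n)"
proof -
  obtain m n where "Re z = of_int m" "Im z = of_int n"
    using assms by (auto simp: square_lattice_def elim!: Ints_cases)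
  then show thesis by (intro that[of m n]) (simp add: complex_eq_iff)
qed

lemma lattice_Complex: "Complex (of_int m) (of_int n) \<in> square_lattice"
  by (simp add: square_lattice_def)

lemma finite_lattice_cball: "finite (square_lattice \<inter> cball a r)"
proof -
  define N where "N = \<lceil>norm a + r\<rceil>"
  have "square_lattice \<inter> cball a r \<subseteq> (\<lambda>(m, n). Complex (of_int m) (of_int n)) ` ({-N..N} \<times> {-N..N})"
  proof
    fix z assume z: "z \<in> square_lattice \<inter> cball a r"
    then obtain m n where mn: "z = Complex (of_int m) (of_int n)" using lattice_coords by blast
    have "cmod z \<le> norm a + r" using z norm_triangle_ineq2[of z a] by (simp add: dist_norm norm_minus_commute)
    then have "\<bar>real_of_int m\<bar> \<le> norm a + r" "\<bar>real_of_int n\<bar> \<le> norm a + r"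
      using abs_Re_le_cmod[of z] abs_Im_le_cmod[of z] by (auto simp: mn)
    then have "m \<in> {-N..N}" "n \<in> {-N..N}" unfolding N_def by (auto simp: abs_le_iff) linarith+
    then show "z \<in> (\<lambda>(m, n). Complex (of_int m) (of_int n)) ` ({-N..N} \<times> {-N..N})" using mn by force
  qed
  then show ?thesis by (rule finite_subset) simp
qed

text \<open>A subharmonic function attaining its maximum over a finite set can be followed to the right
  along maximum points until the set is left.\<close>

lemma discrete_max_principle:
  fixes f :: "complex \<Rightarrow> real"
  assumes fin: "finite A" and sub: "\<And>w. w \<in> A \<Longrightarrow> f w \<le> nmean f w"
    and bd: "\<And>w e. w \<in> A \<Longrightarrow> e \<in> {1, -1, \<i>, -\<i>} \<Longrightarrow> w + e \<notin> A \<Longrightarrow> f (w + e) \<le> b" and w: "w \<in> A"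
  shows "f w \<le> b"
proof (rule ccontr)
  assume "\<not> f w \<le> b"
  define m where "m = Max (f ` A)"
  have m: "\<And>z. z \<in> A \<Longrightarrow> f z \<le> m" using fin by (auto simp: m_def)
  have mA: "m \<in> f ` A" unfolding m_def using fin w by (intro Max_in) auto
  have mb: "m > b" using m[OF w] \<open>\<not> f w \<le> b\<close> by simp
  define S where "S = {z \<in> A. f z = m}"
  have S: "finite S" "S \<noteq> {}" using fin mA by (auto simp: S_def)
  have "Max (Re ` S) \<in> Re ` S" using S by (intro Max_in) auto
  then obtain z where "z \<in> S" "Max (Re ` S) = Re z" by blast
  moreover have "Re u \<le> Max (Re ` S)" if "u \<in> S" for u using S that by (intro Max_ge) auto
  ultimately have z: "z \<in> S" "\<And>u. u \<in> S \<Longrightarrow> Re u \<le> Re z" by auto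
  have le: "f (z + e) \<le> m" if "e \<in> {1, -1, \<i>, -\<i>}" for e
    using bd[of z e] m[of "z + e"] z(1) mb that unfolding S_def by (cases "z + e \<in> A") force+
  have "f z \<le> nmean f z" by (rule sub) (use z(1) in \<open>simp add: S_def\<close>)
  then have "4 * m \<le> f (z + 1) + f (z + (-1)) + f (z + \<i>) + f (z + (-\<i>))"
    using z(1) by (simp add: S_def nmean_def)
  then have eq: "f (z + 1) = m" using le[of 1] le[of "-1"] le[of \<i>] le[of "-\<i>"] by simp
  show False
  proof (cases "z + 1 \<in> A")
    case True
    then have "z + 1 \<in> S" using eq by (simp add: S_def)
    then show False using z(2)[of "z + 1"] by simp
  next
    case False
    then show False using bd[of z 1] z(1) eq mb by (simp add: S_def)
  qed
qed

text \<open>Finite speed of the walk; it makes partial sums of the Green's function finitely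
  supported even when \<open>V\<close> is infinite.\<close>

lemma killed_prob_far:
  assumes "V \<in> sets borel" "killed_prob V j x w \<noteq> 0" shows "dist w x \<le> real j"
  using assms(2)
proof (induction j arbitrary: w)
  case 0 then show ?case by (auto simp: killed_prob_0 split: if_splits)
next
  case (Suc j)
  have "nmean (killed_prob V j x) w \<noteq> 0" using Suc.prems unfolding killed_prob_last_step[OF assms(1)] by (auto split: if_splits)
  then have "\<not> (killed_prob V j x (w + 1) = 0 \<and> killed_prob V j x (w + (-1)) = 0 \<and>
      killed_prob V j x (w + \<i>) = 0 \<and> killed_prob V j x (w + (-\<i>)) = 0)"
    by (auto simp: nmean_def)
  then have "\<exists>e\<in>{1, -1, \<i>, -\<i>}. killed_prob V j x (w + e) \<noteq> 0"
    by simp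
  then obtain e where e: "e \<in> {1, -1, \<i>, -\<i>}" "killed_prob V j x (w + e) \<noteq> 0" by (elim bexE)
  have "dist w x \<le> dist w (w + e) + dist (w + e) x" by (rule dist_triangle)
  also have "dist w (w + e) = 1" using e(1) by (elim insertE) (simp_all add: dist_norm)
  finally show ?case using Suc.IH[OF e(2)] by simp
qed

text \<open>\<open>\<Gamma>\<close> is an approximate Green's function and \<open>\<Phi>\<close> a
  supersolution dominating its defect. The upper bound is proved for the partial sums: they increase
  in \<open>J\<close>, so their recursion is an inequality in the right direction. This also yields
  summability, after which the limit satisfies the exact equation needed for the lower
  bound.\<close>

theorem killed_green_comparison:
  fixes \<Gamma> \<Phi> :: "complex \<Rightarrow> real"
  assumes V: "V \<subseteq> square_lattice" and x: "x \<in> V"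
    and \<Phi>0: "\<And>w. \<Phi> w \<ge> 0"
    and src: "\<And>w. w \<in> V \<Longrightarrow> \<bar>(if w = x then 1 else 0) - (\<Gamma> w - nmean \<Gamma> w)\<bar> \<le> \<Phi> w - nmean \<Phi> w"
    and \<Gamma>out: "\<And>w. w \<notin> V \<Longrightarrow> \<Gamma> w = 0"
    and \<Gamma>far: "\<And>\<delta>. \<delta> > 0 \<Longrightarrow> \<exists>n. \<forall>w\<in>V. cmod w > n \<longrightarrow> 0 \<le> \<Gamma> w \<and> \<Gamma> w \<le> \<delta>"
    and y: "y \<in> V"
  shows "summable (\<lambda>j. killed_prob V j x y)" "\<bar>(\<Sum>j. killed_prob V j x y) - \<Gamma> y\<bar> \<le> \<Phi> y"
proof -
  have Vb: "V \<in> sets borel" by (rule borel_subset_lattice[OF V])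
  define U where "U = (\<lambda>J w. \<Sum>j<J. killed_prob V j x w)"
  have Urec: "U (Suc J) w = (if w = x then 1 else 0) + nmean (U J) w" if "w \<in> V" for J w
  proof -
    have "U (Suc J) w = killed_prob V 0 x w + (\<Sum>j<J. killed_prob V (Suc j) x w)"
      unfolding U_def by (rule sum.lessThan_Suc_shift)
    also have "(\<Sum>j<J. killed_prob V (Suc j) x w) = nmean (U J) w"
      unfolding U_def killed_prob_last_step[OF Vb] nmean_sum using that by simp
    finally show ?thesis using x by (auto simp: killed_prob_0)
  qed
  have Umono: "U J w \<le> U (Suc J) w" for J w by (simp add: U_def killed_prob_nonneg)
  have Uout: "U J w = 0" if "w \<notin> V" for J w using killed_prob_outside[OF that] by (simp add: U_def)
  have upper: "U J w \<le> \<Gamma> w + \<Phi> w" if w: "w \<in> V" for J w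
  proof -
    obtain n where n: "\<And>w. w \<in> V \<Longrightarrow> cmod w > n \<Longrightarrow> 0 \<le> \<Gamma> w" using \<Gamma>far[of 1] by auto
    \<comment> \<open>Outside this ball \<open>U J\<close> vanishes by finite speed and
      \<open>\<Gamma>\<close> is nonnegative, so the difference is at most 0 there.\<close>
    define A where "A = V \<inter> cball 0 (max (max n (cmod x + real J)) (cmod w))"
    have "U J w - \<Gamma> w - \<Phi> w \<le> 0"
    proof (rule discrete_max_principle[of A])
      show "finite A" unfolding A_def by (rule finite_subset[OF Int_mono[OF V order_refl] finite_lattice_cball])
      show "w \<in> A" using w by (simp add: A_def)
      show "U J z - \<Gamma> z - \<Phi> z \<le> nmean (\<lambda>z. U J z - \<Gamma> z - \<Phi> z) z" if "z \<in> A" for z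
        using that Umono[of J z] Urec[of z J] src[of z] by (simp add: nmean_diff A_def)
      show "U J (z + e) - \<Gamma> (z + e) - \<Phi> (z + e) \<le> 0" if "z + e \<notin> A" for z e
      proof (cases "z + e \<in> V")
        case False then show ?thesis using \<Gamma>out Uout \<Phi>0 by simp
      next
        case True
        then have far: "cmod (z + e) > n" "cmod (z + e) > cmod x + real J" using that by (auto simp: A_def)
        have "killed_prob V j x (z + e) = 0" if "j < J" for j
        proof (rule ccontr)
          assume "killed_prob V j x (z + e) \<noteq> 0"
          then have "cmod (z + e - x) \<le> real j" using killed_prob_far[OF Vb] by (simp add: dist_norm)
          then show False using far(2) \<open>j < J\<close> norm_triangle_ineq2[of "z + e" x] by simp
        qed
        then have "U J (z + e) = 0" by (simp add: U_def)
        then show ?thesis using n[OF True far(1)] \<Phi>0[of "z + e"] by simp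
      qed
    qed
    then show ?thesis by simp
  qed
  have summ: "summable (\<lambda>j. killed_prob V j x w)" if "w \<in> V" for w
    using upper[OF that] killed_prob_nonneg
    by (intro bounded_imp_summable[where B = "\<Gamma> w + \<Phi> w"]) (auto simp: U_def lessThan_Suc_atMost[symmetric] simp del: sum.lessThan_Suc)
  then show "summable (\<lambda>j. killed_prob V j x y)" using y by blast
  define G where "G = (\<lambda>w. \<Sum>j. killed_prob V j x w)"
  have Gout: "G w = 0" if "w \<notin> V" for w using killed_prob_outside[OF that] by (simp add: G_def)
  have lim: "(\<lambda>J. U J w) \<longlonglongrightarrow> G w" for w
  proof (cases "w \<in> V")
    case True then show ?thesis unfolding U_def G_def using summ summable_LIMSEQ by blast
  next
    case False then show ?thesis by (simp add: Uout Gout)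
  qed
  have Grec: "G w = (if w = x then 1 else 0) + nmean G w" if "w \<in> V" for w
  proof (rule LIMSEQ_unique)
    show "(\<lambda>J. U (Suc J) w) \<longlonglongrightarrow> G w" using lim by (rule LIMSEQ_Suc)
    show "(\<lambda>J. U (Suc J) w) \<longlonglongrightarrow> (if w = x then 1 else 0) + nmean G w"
      unfolding Urec[OF that] nmean_def by (intro tendsto_intros lim) simp
  qed
  have G0: "G w \<ge> 0" for w
    by (rule LIMSEQ_le_const[OF lim]) (auto simp: U_def intro!: sum_nonneg killed_prob_nonneg)
  have "G y \<le> \<Gamma> y + \<Phi> y" by (rule LIMSEQ_le_const2[OF lim]) (use upper[OF y] in auto)
  moreover have "\<Gamma> y - \<Phi> y \<le> G y"
  proof (rule field_le_epsilon)
    fix \<delta> :: real assume "\<delta> > 0"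
    then obtain n where n: "\<And>w. w \<in> V \<Longrightarrow> cmod w > n \<Longrightarrow> \<Gamma> w \<le> \<delta>" using \<Gamma>far by blast
    \<comment> \<open>In the lower bound the sign of \<open>G\<close> and the decay of
      \<open>\<Gamma>\<close> take over the role of finite speed, at the price of \<delta>.\<close>
    define A where "A = V \<inter> cball 0 (max n (cmod y))"
    have "\<Gamma> y - G y - \<Phi> y \<le> \<delta>"
    proof (rule discrete_max_principle[of A])
      show "finite A" unfolding A_def by (rule finite_subset[OF Int_mono[OF V order_refl] finite_lattice_cball])
      show "y \<in> A" using y by (simp add: A_def)
      show "\<Gamma> z - G z - \<Phi> z \<le> nmean (\<lambda>z. \<Gamma> z - G z - \<Phi> z) z" if "z \<in> A" for z
        using that Grec[of z] src[of z] by (simp add: nmean_diff A_def)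
      show "\<Gamma> (z + e) - G (z + e) - \<Phi> (z + e) \<le> \<delta>" if "z + e \<notin> A" for z e
      proof (cases "z + e \<in> V")
        case False then show ?thesis using \<Gamma>out Gout \<Phi>0[of "z + e"] \<open>\<delta> > 0\<close> by simp
      next
        case True
        then have "cmod (z + e) > n" using that by (auto simp: A_def)
        then show ?thesis using n[OF True] G0[of "z + e"] \<Phi>0[of "z + e"] by simp
      qed
    qed
    then show "\<Gamma> y - \<Phi> y \<le> G y + \<delta>" by simp
  qed
  ultimately show "\<bar>(\<Sum>j. killed_prob V j x y) - \<Gamma> y\<bar> \<le> \<Phi> y" by (simp add: G_def)
qed

subsection \<open>Survival probabilities\<close>

text \<open>The probability of staying in \<open>V\<close> at the times 0, ..., k, in the form of
  its first-step recursion.\<close>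

primrec survival :: "complex set \<Rightarrow> nat \<Rightarrow> complex \<Rightarrow> real" where
  "survival V 0 = (\<lambda>w. if w \<in> V then 1 else 0)"
| "survival V (Suc k) = (\<lambda>w. if w \<in> V then nmean (survival V k) w else 0)"

lemma survival_range: "0 \<le> survival V k w" "survival V k w \<le> 1"
proof (induction k arbitrary: w)
  case (Suc k)
  { case 1 show ?case using Suc(1) by (simp add: nmean_def) }
  { case 2 show ?case using nmean_mono[of "survival V k" w "\<lambda>_. 1"] Suc(2) by (simp add: nmean_const) }
qed auto

lemma survival_antimono: "survival V (Suc k) w \<le> survival V k w"
proof (induction k arbitrary: w)
  case 0
  show ?case
  proof (cases "w \<in> V")
    case True
    then have "survival V 0 w = 1" by simp
    then show ?thesis using survival_range(2) by metis
  qed simp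
next
  case (Suc k)
  show ?case using nmean_mono[of "survival V (Suc k)" w "survival V k"] Suc by (simp only: survival.simps) simp
qed

lemma survival_neighbours:
  assumes "survival V (Suc k) w = 1" "e \<in> {1, -1, \<i>, -\<i>}" shows "w \<in> V" "survival V k (w + e) = 1"
proof -
  show w: "w \<in> V" using assms(1) by (auto split: if_splits)
  then have "survival V k (w + 1) + survival V k (w + (-1)) + survival V k (w + \<i>) + survival V k (w + (-\<i>)) = 4"
    using assms(1) by (simp add: nmean_def)
  then show "survival V k (w + e) = 1"
    using survival_range(2)[of V k "w + 1"] survival_range(2)[of V k "w + (-1)"]
      survival_range(2)[of V k "w + \<i>"] survival_range(2)[of V k "w + (-\<i>)"] assms(2)
    by (elim insertE) auto
qed

text \<open>A single path of length k has probability 4^-k, and survival that is not certain fails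
  along at least one path.\<close>

lemma survival_gap: "survival V k w = 1 \<or> survival V k w \<le> 1 - (1/4) ^ k"
proof (induction k arbitrary: w)
  case (Suc k)
  show ?case
  proof (cases "w \<in> V \<and> (\<forall>e\<in>{1, -1, \<i>, -\<i>}. survival V k (w + e) = 1)")
    case True then show ?thesis by (simp add: nmean_def)
  next
    case False
    have p: "(1/4::real) ^ Suc k \<le> 1" by (rule power_le_one) auto
    show ?thesis
    proof (cases "w \<in> V")
      case True
      then obtain e where e: "e \<in> {1, -1, \<i>, -\<i>}" "survival V k (w + e) \<noteq> 1" using False by blast
      then have "survival V k (w + e) \<le> 1 - (1/4) ^ k" using Suc by blast
      then have "survival V k (w + 1) + survival V k (w + (-1)) + survival V k (w + \<i>) + survival V k (w + (-\<i>)) \<le> 4 - (1/4) ^ k"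
        using survival_range(2)[of V k "w + 1"] survival_range(2)[of V k "w + (-1)"]
          survival_range(2)[of V k "w + \<i>"] survival_range(2)[of V k "w + (-\<i>)"] e(1)
        by (elim insertE) auto
      then show ?thesis using True by (simp add: nmean_def)
    next
      case False then show ?thesis using p by simp
    qed
  qed
qed auto

text \<open>Certain survival means that no path of length k leaves \<open>V\<close>, and such paths
  visit every point of this l1 ball.\<close>

lemma survival_diamond:
  assumes "survival V k w = 1" "\<bar>m\<bar> + \<bar>n\<bar> \<le> int k"
  shows "w + Complex (of_int m) (of_int n) \<in> V"
  using assms
proof (induction k arbitrary: w m n)
  case 0
  then have "m = 0" "n = 0" by auto
  then show ?case using 0(1) by (auto simp: Complex_eq split: if_splits)
next
  case (Suc k)
  show ?case
  proof (cases "m = 0 \<and> n = 0")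
    case True then show ?thesis using survival_neighbours(1)[OF Suc.prems(1), of 1] by (simp add: Complex_eq)
  next
    case False
    then consider "m > 0" | "m < 0" | "n > 0" | "n < 0" by linarith
    then show ?thesis
    proof cases
      case 1
      have "w + 1 + Complex (of_int (m - 1)) (of_int n) \<in> V"
        by (rule Suc.IH[OF survival_neighbours(2)[OF Suc.prems(1)]]) (use Suc.prems 1 in auto)
      then show ?thesis by (simp add: Complex_eq algebra_simps)
    next
      case 2
      have "w + (-1) + Complex (of_int (m + 1)) (of_int n) \<in> V"
        by (rule Suc.IH[OF survival_neighbours(2)[OF Suc.prems(1)]]) (use Suc.prems 2 in auto)
      then show ?thesis by (simp add: Complex_eq algebra_simps)
    next
      case 3
      have "w + \<i> + Complex (of_int m) (of_int (n - 1)) \<in> V"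
        by (rule Suc.IH[OF survival_neighbours(2)[OF Suc.prems(1)]]) (use Suc.prems 3 in auto)
      then show ?thesis by (simp add: Complex_eq algebra_simps)
    next
      case 4
      have "w + (-\<i>) + Complex (of_int m) (of_int (n + 1)) \<in> V"
        by (rule Suc.IH[OF survival_neighbours(2)[OF Suc.prems(1)]]) (use Suc.prems 4 in auto)
      then show ?thesis by (simp add: Complex_eq algebra_simps)
    qed
  qed
qed

section \<open>Geometry of grid domains\<close>

lemma segment_frontier:
  fixes D :: "complex set"
  assumes "open D" "w \<in> D" "z \<notin> D"
  obtains \<zeta> where "\<zeta> \<in> frontier D" "dist w \<zeta> \<le> dist w z"
proof -
  have "closed_segment w z \<inter> frontier D \<noteq> {}"
    by (rule connected_Int_frontier) (use assms in auto)
  then obtain \<zeta> where "\<zeta> \<in> closed_segment w z" "\<zeta> \<in> frontier D" by blast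
  then show thesis using that[of \<zeta>] dist_in_closed_segment[of \<zeta> w z] by (simp add: dist_commute)
qed

lemma grid_frontier_edge:
  assumes "grid_domain D" "\<zeta> \<in> frontier D"
  obtains p q where "p \<in> square_lattice" "q \<in> square_lattice" "dist p q = 1" "\<zeta> \<in> closed_segment p q"
    "closed_segment p q \<inter> D = {}"
proof -
  obtain E where E: "E \<subseteq> lattice_edges" "frontier D = \<Union>E" "open D"
    using assms(1) by (auto simp: grid_domain_def)
  then obtain s where s: "s \<in> E" "\<zeta> \<in> s" using assms(2) by auto
  then obtain p q where "s = closed_segment p q" "p \<in> square_lattice" "q \<in> square_lattice" "dist p q = 1"
    using E(1) by (auto simp: lattice_edges_def)
  moreover have "s \<inter> D = {}"
    using E s(1) frontier_disjoint_eq[of D] by blast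
  ultimately show thesis using that s(2) by blast
qed

lemma lattice_unit_edge:
  assumes "p \<in> square_lattice" "q \<in> square_lattice" "dist p q = 1"
  shows "q - p \<in> {1, -1, \<i>, -\<i>}"
proof -
  obtain m n where mn: "q - p = Complex (of_int m) (of_int n)"
    using lattice_coords[OF lattice_diff[OF assms(2,1)]] by blast
  have "cmod (q - p) = 1" using assms(3) by (simp add: dist_norm norm_minus_commute)
  then have "(cmod (q - p))\<^sup>2 = 1" by simp
  then have "of_int (m\<^sup>2 + n\<^sup>2) = (1::real)" unfolding cmod_power2 mn by simp
  then have e: "m\<^sup>2 + n\<^sup>2 = 1" by linarith
  then have "m\<^sup>2 \<le> 1" "n\<^sup>2 \<le> 1" using zero_le_power2[of m] zero_le_power2[of n] by linarith+
  then have "\<bar>m\<bar> \<le> 1" "\<bar>n\<bar> \<le> 1" by (auto simp: abs_square_le_1)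
  then have "m \<in> {-1, 0, 1}" "n \<in> {-1, 0, 1}" by auto
  then show ?thesis using e mn by (auto simp: complex_eq_iff)
qed

text \<open>Otherwise both coordinates of w differ from those of zeta by less than 1. The difference
  orthogonal to the edge is an integer, hence 0, and along the edge only its endpoints are left for
  w.\<close>

lemma lattice_edge_far:
  assumes w: "w \<in> square_lattice" and p: "p \<in> square_lattice" and e: "e \<in> {1, -1, \<i>, -\<i>}"
    and \<zeta>: "\<zeta> \<in> closed_segment p (p + e)" and nw: "w \<noteq> p" "w \<noteq> p + e"
  shows "dist w \<zeta> \<ge> 1"
proof (rule ccontr)
  assume "\<not> dist w \<zeta> \<ge> 1"
  then have d: "cmod (w - \<zeta>) < 1" by (simp add: dist_norm)
  obtain u where u: "0 \<le> u" "u \<le> 1" "\<zeta> = (1 - u) *\<^sub>R p + u *\<^sub>R (p + e)"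
    using \<zeta> by (auto simp: in_segment)
  have z: "\<zeta> = p + of_real u * e" unfolding u(3) by (simp add: scaleR_conv_of_real algebra_simps)
  obtain m n where mn: "w - p = Complex (of_int m) (of_int n)"
    using lattice_coords[OF lattice_diff[OF w p]] by blast
  have wz: "w - \<zeta> = Complex (of_int m) (of_int n) - of_real u * e" using mn z by (simp add: algebra_simps)
  have b: "\<bar>Re (w - \<zeta>)\<bar> < 1" "\<bar>Im (w - \<zeta>)\<bar> < 1"
    using abs_Re_le_cmod[of "w - \<zeta>"] abs_Im_le_cmod[of "w - \<zeta>"] d by linarith+
  have n1: "w - p \<noteq> 0" "w - p \<noteq> e" using nw by auto
  from e consider "e = 1" | "e = -1" | "e = \<i>" | "e = -\<i>" by blast
  then show False
  proof cases
    case 1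
    then have "n = 0" "\<bar>of_int m - u\<bar> < 1" using b unfolding wz by auto
    then have "m = 0 \<or> m = 1" using u by linarith
    then show False using n1 \<open>n = 0\<close> 1 mn by (auto simp: complex_eq_iff)
  next
    case 2
    then have "n = 0" "\<bar>of_int m + u\<bar> < 1" using b unfolding wz by auto
    then have "m = 0 \<or> m = -1" using u by linarith
    then show False using n1 \<open>n = 0\<close> 2 mn by (auto simp: complex_eq_iff)
  next
    case 3
    then have "m = 0" "\<bar>of_int n - u\<bar> < 1" using b unfolding wz by auto
    then have "n = 0 \<or> n = 1" using u by linarith
    then show False using n1 \<open>m = 0\<close> 3 mn by (auto simp: complex_eq_iff)
  next
    case 4
    then have "m = 0" "\<bar>of_int n + u\<bar> < 1" using b unfolding wz by auto
    then have "n = 0 \<or> n = -1" using u by linarith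
    then show False using n1 \<open>m = 0\<close> 4 mn by (auto simp: complex_eq_iff)
  qed
qed

text \<open>The grid structure at work: a boundary point close to w lies on an edge disjoint from D,
  so w is not an endpoint and the whole edge keeps distance 1.\<close>

lemma grid_domain_unit_ball:
  assumes D: "grid_domain D" and w: "w \<in> D" "w \<in> square_lattice"
  shows "ball w 1 \<subseteq> D"
proof
  fix z assume z: "z \<in> ball w 1"
  show "z \<in> D"
  proof (rule ccontr)
    assume "z \<notin> D"
    have "open D" using D by (simp add: grid_domain_def)
    then obtain \<zeta> where \<zeta>: "\<zeta> \<in> frontier D" "dist w \<zeta> \<le> dist w z"
      using segment_frontier w(1) \<open>z \<notin> D\<close> by blast
    obtain p q where pq: "p \<in> square_lattice" "q \<in> square_lattice" "dist p q = 1" "\<zeta> \<in> closed_segment p q"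
      "closed_segment p q \<inter> D = {}" using grid_frontier_edge[OF D \<zeta>(1)] by blast
    have "w \<noteq> p" "w \<noteq> q" using pq(5) w(1) by auto
    then have "dist w \<zeta> \<ge> 1"
      using lattice_edge_far[OF w(2) pq(1) lattice_unit_edge[OF pq(1-3)], of \<zeta>] pq(4) by simp
    then show False using \<zeta>(2) z by simp
  qed
qed

text \<open>A point outside D produces a boundary edge on the way to it, and an endpoint of that
  edge, at the cost of 1, is a lattice point outside D within distance k / 2. Its l1 distance is at
  most k, so a path of length k reaches it.\<close>

lemma grid_domain_survival_ball:
  assumes D: "grid_domain D" and w: "survival (D \<inter> square_lattice) k w = 1"
  shows "ball w (real k / 2 - 1) \<subseteq> D"
proof
  fix z assume z: "z \<in> ball w (real k / 2 - 1)"
  show "z \<in> D"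
  proof (rule ccontr)
    assume "z \<notin> D"
    have wV: "w \<in> D" "w \<in> square_lattice" using survival_diamond[OF w, of 0 0] by (auto simp: Complex_eq)
    have "open D" using D by (simp add: grid_domain_def)
    then obtain \<zeta> where \<zeta>: "\<zeta> \<in> frontier D" "dist w \<zeta> \<le> dist w z"
      using segment_frontier wV(1) \<open>z \<notin> D\<close> by blast
    obtain p q where pq: "p \<in> square_lattice" "q \<in> square_lattice" "dist p q = 1" "\<zeta> \<in> closed_segment p q"
      "closed_segment p q \<inter> D = {}" using grid_frontier_edge[OF D \<zeta>(1)] by blast
    have "dist \<zeta> p \<le> 1" using dist_in_closed_segment(1)[OF pq(4)] pq(3) by (simp add: dist_commute)
    then have pw: "cmod (p - w) < real k / 2"
      using dist_triangle[of w p \<zeta>] \<zeta>(2) z by (simp add: dist_norm norm_minus_commute)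
    obtain m n where mn: "p - w = Complex (of_int m) (of_int n)"
      using lattice_coords[OF lattice_diff[OF pq(1) wV(2)]] by blast
    have "\<bar>real_of_int m\<bar> < real k / 2" "\<bar>real_of_int n\<bar> < real k / 2"
      using abs_Re_le_cmod[of "p - w"] abs_Im_le_cmod[of "p - w"] pw by (auto simp: mn)
    then have "\<bar>real_of_int m\<bar> + \<bar>real_of_int n\<bar> \<le> real k" by simp
    then have "\<bar>m\<bar> + \<bar>n\<bar> \<le> int k" by linarith
    then have "w + (p - w) \<in> D" using survival_diamond[OF w] unfolding mn by blast
    then show False using pq(5) by auto
  qed
qed

text \<open>A walk surviving \<open>k\<close> steps with certainty keeps the ball of radius \<open>k / 2 - 1\<close> inside the
  domain; 2701 makes this radius exceed the 1300 needed for superharmonicity of \<open>v powr \<alpha>\<close>.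
  Otherwise at least one of the \<open>4 ^ horizon\<close> paths exits.\<close>

definition horizon :: nat where "horizon = 2701"

definition gap :: real where "gap = (1/4) ^ horizon"

lemma gap_pos: "gap > 0" by (simp add: gap_def)

section \<open>The supersolution from conformal map and survival time\<close>

locale grid_disk = conformal_disk +
  assumes grid: "grid_domain D" and x_lattice: "x \<in> square_lattice"
begin

definition V :: "complex set" where "V = D \<inter> square_lattice"

text \<open>The sum of survival probabilities is the expectation of the minimum of the exit time and
  \<open>horizon\<close>. It is constant deep inside, where the power of v does the work, and drops
  strictly near the boundary, where the power need not.\<close>

definition barrier :: "real \<Rightarrow> complex \<Rightarrow> real" where
  "barrier \<alpha> w = (if w \<in> V then v w powr \<alpha> * (\<Sum>k<horizon. survival V k w) else 0)"

lemma V_D: "w \<in> V \<Longrightarrow> w \<in> D" by (simp add: V_def)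

lemma x_V: "x \<in> V" using xD x_lattice by (simp add: V_def)

lemma V_unit_ball: "w \<in> V \<Longrightarrow> ball w 1 \<subseteq> D"
  using grid_domain_unit_ball[OF grid] by (simp add: V_def)

lemma bdist_V: "w \<in> V \<Longrightarrow> bdist D w \<ge> 1"
  by (rule bdist_ge[OF nonfull V_unit_ball])

lemma V_step: "w \<in> V \<Longrightarrow> w + e \<in> V \<Longrightarrow> cmod e = 1 \<Longrightarrow> v (w + e) \<le> 54 * v w"
  by (rule v_step) (auto dest!: V_unit_ball)

lemma barrier_nonneg: "barrier \<alpha> w \<ge> 0"
  by (simp add: barrier_def sum_nonneg survival_range)

lemma barrier_le: "\<alpha> > 0 \<Longrightarrow> barrier \<alpha> w \<le> horizon"
proof (cases "w \<in> V")
  case True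
  assume \<alpha>: "\<alpha> > 0"
  have "v w powr \<alpha> \<le> 1" using v_pos[OF V_D[OF True]] v_le_1 \<alpha> by (intro powr_le1) auto
  moreover have "(\<Sum>k<horizon. survival V k w) \<le> (\<Sum>k<horizon. 1)"
    by (intro sum_mono survival_range)
  ultimately have "v w powr \<alpha> * (\<Sum>k<horizon. survival V k w) \<le> 1 * real horizon"
    by (intro mult_mono) (auto simp: sum_nonneg survival_range)
  then show ?thesis using True by (simp add: barrier_def)
qed (simp add: barrier_def)

lemma barrier_supersolution:
  assumes \<alpha>: "0 < \<alpha>" "\<alpha> \<le> 1/32" "54 powr \<alpha> \<le> 1 + gap / (2 * horizon)" and w: "w \<in> V"
  shows "min (\<alpha> / 1024) (gap / 2) * (v w powr \<alpha> / (bdist D w)\<^sup>2) \<le> barrier \<alpha> w - nmean (barrier \<alpha>) w"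
proof -
  define M where "M = (\<lambda>w. \<Sum>k<horizon. survival V k w)"
  define d where "d = bdist D w"
  have d: "d \<ge> 1" using bdist_V[OF w] by (simp add: d_def)
  have va: "v w powr \<alpha> > 0" using v_pos[OF V_D[OF w]] by simp
  have M0: "0 \<le> M z" for z unfolding M_def by (intro sum_nonneg survival_range)
  have MN: "M z \<le> horizon" for z
  proof -
    have "M z \<le> (\<Sum>k<horizon. 1)" unfolding M_def by (intro sum_mono survival_range)
    then show ?thesis by simp
  qed
  have Mout: "M z = 0" if "z \<notin> V" for z
  proof -
    have "survival V k z = 0" for k using that by (cases k) auto
    then show ?thesis by (simp add: M_def)
  qed
  have barrier: "barrier \<alpha> z = (if z \<in> V then v z powr \<alpha> * M z else 0)" for z by (simp add: barrier_def M_def)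
  have unit: "cmod e = 1" if "e \<in> {1, -1, \<i>, -\<i>}" for e using that by auto
  show ?thesis
  proof (cases "survival V horizon w = 1")
    \<comment> \<open>Deep inside, the truncated survival time has its largest possible value at w,
      so the mean of v^alpha alone decides.\<close>
    case True
    have "decseq (\<lambda>k. survival V k w)" by (rule decseq_SucI, rule survival_antimono)
    then have mono: "survival V horizon w \<le> survival V k w" if "k \<le> horizon" for k
      using that by (rule decseqD)
    have "survival V k w = 1" if "k < horizon" for k
      using mono[of k] True that survival_range(2)[of V k w] by simp
    then have Mw: "M w = horizon" by (simp add: M_def)
    have "ball w (real horizon / 2 - 1) \<subseteq> D"
      using grid_domain_survival_ball[OF grid] True by (simp add: V_def)
    then have "real horizon / 2 - 1 \<le> bdist D w" by (rule bdist_ge[OF nonfull])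
    then have d1: "bdist D w \<ge> 1300" by (simp add: horizon_def)
    have "nmean (barrier \<alpha>) w \<le> nmean (\<lambda>z. horizon * v z powr \<alpha>) w"
    proof (rule nmean_mono)
      fix e :: complex assume "e \<in> {1, -1, \<i>, -\<i>}"
      show "barrier \<alpha> (w + e) \<le> horizon * v (w + e) powr \<alpha>"
        unfolding barrier using mult_right_mono[OF MN[of "w + e"], of "v (w + e) powr \<alpha>"] by (simp add: mult.commute)
    qed
    also have "\<dots> \<le> horizon * (v w powr \<alpha> * (1 - \<alpha> / (1024 * d\<^sup>2)))"
      unfolding nmean_cmult d_def by (intro mult_left_mono v_powr_superharmonic V_D[OF w] d1 \<alpha>) simp
    finally have "horizon * (\<alpha> / 1024 * (v w powr \<alpha> / d\<^sup>2)) \<le> barrier \<alpha> w - nmean (barrier \<alpha>) w"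
      using w by (simp add: barrier Mw algebra_simps)
    moreover have "1 * (\<alpha> / 1024 * (v w powr \<alpha> / d\<^sup>2)) \<le> horizon * (\<alpha> / 1024 * (v w powr \<alpha> / d\<^sup>2))"
      using \<alpha> by (intro mult_right_mono) (auto simp: horizon_def)
    moreover have "min (\<alpha> / 1024) (gap / 2) * (v w powr \<alpha> / d\<^sup>2) \<le> \<alpha> / 1024 * (v w powr \<alpha> / d\<^sup>2)"
      by (intro mult_right_mono) auto
    ultimately show ?thesis unfolding d_def by linarith
  next
    case False
    then have sg: "survival V horizon w \<le> 1 - gap" using survival_gap[of V horizon w] by (simp add: gap_def)
    \<comment> \<open>The mean shifts the index of survival by one: the sum loses its first term 1
      and gains the last one, at most 1 - gap.\<close>
    have nM: "nmean M w \<le> M w - gap"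
    proof -
      have "nmean M w = (\<Sum>k<horizon. survival V (Suc k) w)"
        unfolding M_def nmean_sum using w by simp
      also have "\<dots> = (\<Sum>k<Suc horizon. survival V k w) - survival V 0 w"
        by (simp only: sum.lessThan_Suc_shift)
      also have "\<dots> = M w + survival V horizon w - 1" using w by (simp add: M_def)
      finally show ?thesis using sg by simp
    qed
    define q where "q = 54 powr \<alpha>"
    have q: "1 \<le> q" "q \<le> 1 + gap / (2 * horizon)" using \<alpha> by (auto simp: q_def ge_one_powr_ge_zero)
    have "nmean (barrier \<alpha>) w \<le> nmean (\<lambda>z. (q * v w powr \<alpha>) * M z) w"
    proof (rule nmean_mono)
      fix e :: complex assume e: "e \<in> {1, -1, \<i>, -\<i>}"
      show "barrier \<alpha> (w + e) \<le> (q * v w powr \<alpha>) * M (w + e)"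
      proof (cases "w + e \<in> V")
        case True
        have "v (w + e) powr \<alpha> \<le> (54 * v w) powr \<alpha>"
          using V_step[OF w True unit[OF e]] v_pos[OF V_D[OF True]] \<alpha> by (intro powr_mono2) auto
        then show ?thesis unfolding barrier q_def using True M0[of "w + e"] v_pos[OF V_D[OF w]]
          by (simp add: powr_mult mult_right_mono)
      qed (simp add: barrier Mout)
    qed
    also have "\<dots> = (q * v w powr \<alpha>) * nmean M w" by (rule nmean_cmult)
    also have "\<dots> \<le> (q * v w powr \<alpha>) * (M w - gap)" using q nM by (intro mult_left_mono) auto
    \<comment> \<open>The smallness of alpha: since M is at most \<open>horizon\<close>, the growth
      factor q costs at most gap / 2, half of the drop.\<close>
    also have "q * (M w - gap) \<le> M w - gap / 2"
    proof -
      have "(q - 1) * M w \<le> gap / (2 * horizon) * horizon" using q M0 MN by (intro mult_mono) auto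
      also have "\<dots> = gap / 2" by (simp add: horizon_def)
      finally have "(q - 1) * M w \<le> gap / 2" .
      moreover have "gap \<le> q * gap" using mult_right_mono[OF q(1), of gap] gap_pos by simp
      moreover have "q * (M w - gap) = (q - 1) * M w + M w - q * gap" by (simp add: algebra_simps)
      ultimately show ?thesis by argo
    qed
    then have "(q * v w powr \<alpha>) * (M w - gap) \<le> v w powr \<alpha> * (M w - gap / 2)"
      using va by (simp add: mult.assoc mult.left_commute[of q])
    finally have "v w powr \<alpha> * (gap / 2) \<le> barrier \<alpha> w - nmean (barrier \<alpha>) w"
      using w by (simp add: barrier algebra_simps)
    moreover have "min (\<alpha> / 1024) (gap / 2) * (v w powr \<alpha> / d\<^sup>2) \<le> gap / 2 * (v w powr \<alpha> / 1)"
      using d va gap_pos \<alpha> by (intro mult_mono divide_left_mono) (auto simp: one_le_power)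
    ultimately show ?thesis unfolding d_def by (simp add: mult.commute)
  qed
qed

end

section \<open>Uniqueness of the continuous Green's function\<close>

lemma harmonic_onE:
  assumes "harmonic_on u A"
  obtains ux uy uxx uxy uyy where "open A"
    "\<And>z. z \<in> A \<Longrightarrow> (u has_derivative (\<lambda>h. ux z * Re h + uy z * Im h)) (at z)"
    "\<And>z. z \<in> A \<Longrightarrow> (ux has_derivative (\<lambda>h. uxx z * Re h + uxy z * Im h)) (at z)"
    "\<And>z. z \<in> A \<Longrightarrow> (uy has_derivative (\<lambda>h. uxy z * Re h + uyy z * Im h)) (at z)"
    "\<And>z. z \<in> A \<Longrightarrow> uxx z + uyy z = 0"
    "continuous_on A uxx" "continuous_on A uxy" "continuous_on A uyy"
proof -
  obtain ux uy uxx uxy uyy where U: "\<forall>z\<in>A. (u has_derivative (\<lambda>h. ux z * Re h + uy z * Im h)) (at z) \<and>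
               (ux has_derivative (\<lambda>h. uxx z * Re h + uxy z * Im h)) (at z) \<and>
               (uy has_derivative (\<lambda>h. uxy z * Re h + uyy z * Im h)) (at z) \<and> uxx z + uyy z = 0"
    and "open A" "continuous_on A uxx" "continuous_on A uxy" "continuous_on A uyy"
    using assms unfolding harmonic_on_def by (elim conjE exE)
  moreover have "\<And>z. z \<in> A \<Longrightarrow> (u has_derivative (\<lambda>h. ux z * Re h + uy z * Im h)) (at z)"
    "\<And>z. z \<in> A \<Longrightarrow> (ux has_derivative (\<lambda>h. uxx z * Re h + uxy z * Im h)) (at z)"
    "\<And>z. z \<in> A \<Longrightarrow> (uy has_derivative (\<lambda>h. uxy z * Re h + uyy z * Im h)) (at z)"
    "\<And>z. z \<in> A \<Longrightarrow> uxx z + uyy z = 0" using U by blast+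
  ultimately show thesis by (intro that)
qed

lemma harmonic_on_lincomb:
  assumes "harmonic_on u A" "harmonic_on w A"
  shows "harmonic_on (\<lambda>z. a * u z + b * w z) A"
proof -
  obtain ux uy uxx uxy uyy where u: "open A"
    "\<And>z. z \<in> A \<Longrightarrow> (u has_derivative (\<lambda>h. ux z * Re h + uy z * Im h)) (at z)"
    "\<And>z. z \<in> A \<Longrightarrow> (ux has_derivative (\<lambda>h. uxx z * Re h + uxy z * Im h)) (at z)"
    "\<And>z. z \<in> A \<Longrightarrow> (uy has_derivative (\<lambda>h. uxy z * Re h + uyy z * Im h)) (at z)"
    "\<And>z. z \<in> A \<Longrightarrow> uxx z + uyy z = 0"
    "continuous_on A uxx" "continuous_on A uxy" "continuous_on A uyy"
    by (rule harmonic_onE[OF assms(1)], rule that)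
  obtain wx wy wxx wxy wyy where w: "open A"
    "\<And>z. z \<in> A \<Longrightarrow> (w has_derivative (\<lambda>h. wx z * Re h + wy z * Im h)) (at z)"
    "\<And>z. z \<in> A \<Longrightarrow> (wx has_derivative (\<lambda>h. wxx z * Re h + wxy z * Im h)) (at z)"
    "\<And>z. z \<in> A \<Longrightarrow> (wy has_derivative (\<lambda>h. wxy z * Re h + wyy z * Im h)) (at z)"
    "\<And>z. z \<in> A \<Longrightarrow> wxx z + wyy z = 0"
    "continuous_on A wxx" "continuous_on A wxy" "continuous_on A wyy"
    by (rule harmonic_onE[OF assms(2)], rule that)
  have D: "((\<lambda>z. a * p z + b * q z) has_derivative (\<lambda>h. (a * p1 + b * q1) * Re h + (a * p2 + b * q2) * Im h)) (at z)"
    if "(p has_derivative (\<lambda>h. p1 * Re h + p2 * Im h)) (at z)" "(q has_derivative (\<lambda>h. q1 * Re h + q2 * Im h)) (at z)"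
    for p q :: "complex \<Rightarrow> real" and p1 p2 q1 q2 z
  proof -
    have "((\<lambda>z. a * p z + b * q z) has_derivative (\<lambda>h. a * (p1 * Re h + p2 * Im h) + b * (q1 * Re h + q2 * Im h))) (at z)"
      by (intro has_derivative_add has_derivative_mult_right that)
    then show ?thesis by (simp add: algebra_simps)
  qed
  show ?thesis unfolding harmonic_on_def
  proof (intro conjI u(1) exI ballI)
    fix z assume z: "z \<in> A"
    show "((\<lambda>z. a * u z + b * w z) has_derivative (\<lambda>h. (a * ux z + b * wx z) * Re h + (a * uy z + b * wy z) * Im h)) (at z)"
      by (intro D u(2) w(2) z)
    show "((\<lambda>z. a * ux z + b * wx z) has_derivative (\<lambda>h. (a * uxx z + b * wxx z) * Re h + (a * uxy z + b * wxy z) * Im h)) (at z)"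
      by (intro D u(3) w(3) z)
    show "((\<lambda>z. a * uy z + b * wy z) has_derivative (\<lambda>h. (a * uxy z + b * wxy z) * Re h + (a * uyy z + b * wyy z) * Im h)) (at z)"
      by (intro D u(4) w(4) z)
    have "uyy z = - uxx z" "wyy z = - wxx z" using u(5)[OF z] w(5)[OF z] by linarith+
    then show "(a * uxx z + b * wxx z) + (a * uyy z + b * wyy z) = 0" by simp
  qed (intro continuous_intros u w)+
qed

lemma second_derivative_local_max:
  fixes f f' :: "real \<Rightarrow> real"
  assumes r: "r > 0" and f: "\<And>s. \<bar>s\<bar> < r \<Longrightarrow> (f has_real_derivative f' s) (at s)"
    and f': "(f' has_real_derivative c) (at 0)" and mx: "\<And>s. \<bar>s\<bar> < r \<Longrightarrow> f s \<le> f 0"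
  shows "c \<le> 0"
proof (rule ccontr)
  assume "\<not> c \<le> 0"
  have "f' 0 = 0" by (rule DERIV_local_max[OF f r]) (use mx r in auto)
  obtain d where d: "d > 0" "\<And>h. 0 < h \<Longrightarrow> h < d \<Longrightarrow> f' 0 < f' (0 + h)"
    using DERIV_pos_inc_right[OF f'] \<open>\<not> c \<le> 0\<close> by auto
  define s where "s = min d r / 2"
  have s: "0 < s" "s < d" "s < r" using d(1) r by (auto simp: s_def)
  have "f 0 < f s"
  proof (rule DERIV_pos_imp_increasing_open[OF s(1)])
    fix h assume "0 < h" "h < s"
    then show "\<exists>y. (f has_real_derivative y) (at h) \<and> 0 < y"
      using f[of h] d(2)[of h] s \<open>f' 0 = 0\<close> by auto
  next
    show "continuous_on {0..s} f"
      by (intro continuous_at_imp_continuous_on ballI DERIV_isCont[OF f]) (use s in auto)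
  qed
  then show False using mx[of s] s by simp
qed

text \<open>If u were positive somewhere, u + kappa |z|^2 would have an interior maximum although
  its Laplacian is positive. Compact superlevel sets stand in for boundary values, so unbounded
  domains need no separate treatment.\<close>

lemma harmonic_le_zero:
  fixes u :: "complex \<Rightarrow> real"
  assumes u: "harmonic_on u W" and cpt: "\<And>t. t > 0 \<Longrightarrow> compact {w \<in> W. u w \<ge> t}" and w: "w \<in> W"
  shows "u w \<le> 0"
proof (rule ccontr)
  assume "\<not> u w \<le> 0"
  obtain ux uy uxx uxy uyy where U: "open W"
    "\<And>z. z \<in> W \<Longrightarrow> (u has_derivative (\<lambda>h. ux z * Re h + uy z * Im h)) (at z)"
    "\<And>z. z \<in> W \<Longrightarrow> (ux has_derivative (\<lambda>h. uxx z * Re h + uxy z * Im h)) (at z)"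
    "\<And>z. z \<in> W \<Longrightarrow> (uy has_derivative (\<lambda>h. uxy z * Re h + uyy z * Im h)) (at z)"
    "\<And>z. z \<in> W \<Longrightarrow> uxx z + uyy z = 0"
    "continuous_on W uxx" "continuous_on W uxy" "continuous_on W uyy"
    by (rule harmonic_onE[OF u], rule that)
  have cont: "continuous_on W u"
    using U(2) by (intro continuous_at_imp_continuous_on ballI has_derivative_continuous) blast
  define t where "t = u w / 2"
  have t: "t > 0" using \<open>\<not> u w \<le> 0\<close> by (simp add: t_def)
  define K where "K = {w \<in> W. u w \<ge> t}"
  have K: "compact K" "w \<in> K" "K \<subseteq> W" using cpt[OF t] w t by (auto simp: K_def t_def)
  obtain B where B: "\<And>z. z \<in> K \<Longrightarrow> cmod z \<le> B" using compact_imp_bounded[OF K(1)] by (auto simp: bounded_iff)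
  \<comment> \<open>The added 1 avoids division by 0. With kappa |z|^2 <= t / 2 on \<open>K\<close>,
    the maximiser satisfies u > t and is therefore interior.\<close>
  define b where "b = B\<^sup>2 + 1"
  have B1: "b > 0" unfolding b_def by (rule add_nonneg_pos) auto
  define \<kappa> where "\<kappa> = t / (2 * b)"
  have \<kappa>: "\<kappa> > 0" using t B1 by (simp add: \<kappa>_def)
  define \<phi> where "\<phi> = (\<lambda>z. u z + \<kappa> * (cmod z)\<^sup>2)"
  have "continuous_on K \<phi>" unfolding \<phi>_def using continuous_on_subset[OF cont K(3)] by (intro continuous_intros)
  then obtain q where q: "q \<in> K" "\<And>z. z \<in> K \<Longrightarrow> \<phi> z \<le> \<phi> q"
    using continuous_attains_sup[OF K(1), of \<phi>] K(2) by auto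
  have "\<kappa> * (cmod q)\<^sup>2 \<le> \<kappa> * B\<^sup>2" using B[OF q(1)] \<kappa> by (intro mult_left_mono power_mono) auto
  also have "\<dots> \<le> \<kappa> * b" using \<kappa> by (simp add: b_def)
  also have "\<dots> = t / 2" using B1 by (simp add: \<kappa>_def)
  finally have "\<kappa> * (cmod q)\<^sup>2 \<le> t / 2" .
  moreover have "u w \<le> \<phi> w" using \<kappa> by (simp add: \<phi>_def)
  ultimately have uq: "u q > t" using q(2)[OF K(2)] t unfolding \<phi>_def t_def by argo
  have qW: "q \<in> W" using q(1) K(3) by blast
  have "open {z \<in> W. u z > t}" using continuous_open_preimage[OF cont U(1), of "{t<..}"] by (simp add: vimage_def Int_def)
  then obtain r where r: "r > 0" "ball q r \<subseteq> {z \<in> W. u z > t}" using qW uq open_contains_ball by blast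
  have loc: "\<phi> z \<le> \<phi> q" "z \<in> W" if "dist q z < r" for z
    using r(2) that by (auto intro!: q(2) simp: K_def)
  have dir: "(uxx q * Re e + uxy q * Im e) * Re e + (uxy q * Re e + uyy q * Im e) * Im e + 2 * \<kappa> \<le> 0"
    if e: "cmod e = 1" for e
  proof (rule second_derivative_local_max[OF r(1)])
    define p where "p = (\<lambda>s::real. q + of_real s * e)"
    have pd: "dist q (p s) = \<bar>s\<bar>" for s using e by (simp add: p_def dist_norm norm_mult)
    have pder: "(p has_derivative (\<lambda>h. of_real h * e)) (at s)" for s
      unfolding p_def by (auto intro!: derivative_eq_intros)
    have comp: "((\<lambda>s. F (p s)) has_real_derivative F1 * Re e + F2 * Im e) (at s)"
      if "(F has_derivative (\<lambda>h. F1 * Re h + F2 * Im h)) (at (p s))" for F F1 F2 s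
      by (rule has_derivative_imp_has_field_derivative[OF has_derivative_compose[OF pder that]])
         (simp add: algebra_simps)
    have sq: "(cmod (p s))\<^sup>2 = (cmod q)\<^sup>2 + 2 * s * Re (q * cnj e) + s\<^sup>2" for s
    proof -
      have e1: "(Re e)\<^sup>2 + (Im e)\<^sup>2 = 1" using e cmod_power2[of e] by simp
      have "(cmod (p s))\<^sup>2 = (cmod q)\<^sup>2 + 2 * s * Re (q * cnj e) + s\<^sup>2 * ((Re e)\<^sup>2 + (Im e)\<^sup>2)"
        unfolding cmod_power2 p_def by (simp add: power2_eq_square algebra_simps)
      then show ?thesis unfolding e1 by simp
    qed
    show "((\<lambda>s. \<phi> (p s)) has_real_derivative (ux (p s) * Re e + uy (p s) * Im e + \<kappa> * (2 * Re (q * cnj e) + 2 * s))) (at s)"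
      if "\<bar>s\<bar> < r" for s
    proof -
      have quad: "((\<lambda>s. (cmod q)\<^sup>2 + 2 * s * Re (q * cnj e) + s\<^sup>2) has_real_derivative (2 * Re (q * cnj e) + 2 * s)) (at s)"
        by (auto intro!: derivative_eq_intros)
      show ?thesis unfolding \<phi>_def sq
        by (rule DERIV_add[OF comp[OF U(2)[OF loc(2)]] DERIV_cmult[OF quad]]) (use pd that in auto)
    qed
    show "((\<lambda>s. ux (p s) * Re e + uy (p s) * Im e + \<kappa> * (2 * Re (q * cnj e) + 2 * s)) has_real_derivative
        (uxx q * Re e + uxy q * Im e) * Re e + (uxy q * Re e + uyy q * Im e) * Im e + 2 * \<kappa>) (at 0)"
    proof -
      have p0: "p 0 = q" by (simp add: p_def)
      have a: "((\<lambda>s. ux (p s)) has_real_derivative uxx q * Re e + uxy q * Im e) (at 0)"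
        using comp[of ux _ _ 0] U(3)[OF qW] unfolding p0 by blast
      have b: "((\<lambda>s. uy (p s)) has_real_derivative uxy q * Re e + uyy q * Im e) (at 0)"
        using comp[of uy _ _ 0] U(4)[OF qW] unfolding p0 by blast
      have c: "((\<lambda>s. \<kappa> * (2 * Re (q * cnj e) + 2 * s)) has_real_derivative 2 * \<kappa>) (at 0)"
        by (auto intro!: derivative_eq_intros)
      show ?thesis by (intro DERIV_add DERIV_cmult_right a b c)
    qed
    show "\<phi> (p s) \<le> \<phi> (p 0)" if "\<bar>s\<bar> < r" for s
      using loc(1)[of "p s"] pd[of s] that by (simp add: p_def)
  qed
  have "uxx q + uyy q = 0" using U(5)[OF qW] .
  moreover have "uxx q + 2 * \<kappa> \<le> 0" using dir[of 1] by simp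
  moreover have "uyy q + 2 * \<kappa> \<le> 0" using dir[of \<i>] by simp
  ultimately show False using \<kappa> by linarith
qed

text \<open>The limit of points of a superlevel set is neither a frontier point nor the pole, and
  the set is bounded by the behaviour at infinity; so it is compact.\<close>

lemma harmonic_le_zero_filter:
  fixes u :: "complex \<Rightarrow> real"
  assumes D: "open D" and u: "harmonic_on u (D - {x})" and x: "x \<in> D"
    and bdry: "\<And>\<zeta> t. \<zeta> \<in> frontier D \<Longrightarrow> t > 0 \<Longrightarrow> \<forall>\<^sub>F w in at \<zeta> within D. u w < t"
    and inft: "\<And>t. t > 0 \<Longrightarrow> \<forall>\<^sub>F w in inf at_infinity (principal D). u w < t"
    and pole: "\<And>t. t > 0 \<Longrightarrow> \<forall>\<^sub>F w in at x. u w < t"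
    and w: "w \<in> D - {x}"
  shows "u w \<le> 0"
proof (rule harmonic_le_zero[OF u _ w])
  fix t :: real assume t: "t > 0"
  define K where "K = {w \<in> D - {x}. u w \<ge> t}"
  have "\<exists>ux uy. \<forall>z\<in>D - {x}. (u has_derivative (\<lambda>h. ux z * Re h + uy z * Im h)) (at z)"
  proof (rule harmonic_onE[OF u])
    fix ux uy
    assume "\<And>z. z \<in> D - {x} \<Longrightarrow> (u has_derivative (\<lambda>h. ux z * Re h + uy z * Im h)) (at z)"
    then show ?thesis by blast
  qed
  then obtain ux uy where ud: "\<And>z. z \<in> D - {x} \<Longrightarrow> (u has_derivative (\<lambda>h. ux z * Re h + uy z * Im h)) (at z)" by blast
  have cont: "continuous_on (D - {x}) u"
    by (intro continuous_at_imp_continuous_on ballI has_derivative_continuous[OF ud])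
  obtain B where B: "\<And>w. w \<in> D \<Longrightarrow> cmod w \<ge> B \<Longrightarrow> u w < t"
    using inft[OF t] unfolding eventually_inf_principal eventually_at_infinity by blast
  have "cmod w \<le> B" if "w \<in> K" for w using B[of w] that unfolding K_def by force
  then have "bounded K" unfolding bounded_iff by blast
  moreover have "closed K"
    unfolding closed_sequential_limits
  proof (intro allI impI, elim conjE)
    fix s l assume s: "\<forall>n. s n \<in> K" "s \<longlonglongrightarrow> l"
    have sD: "s n \<in> D" "s n \<noteq> x" "u (s n) \<ge> t" for n using s(1) by (auto simp: K_def)
    have no: False if ne: "\<And>n. s n \<noteq> l" and ev: "\<forall>\<^sub>F w in at l within D. u w < t"
    proof -
      have "filterlim s (at l within D) sequentially"
        unfolding filterlim_at using s(2) sD ne by auto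
      then have "\<forall>\<^sub>F n in sequentially. u (s n) < t" using ev by (rule eventually_compose_filterlim[rotated])
      then obtain n where "u (s n) < t" unfolding eventually_sequentially by blast
      then show False using sD(3)[of n] by simp
    qed
    have "l \<in> closure D" using closure_sequential s(2) sD(1) by blast
    moreover have "l \<notin> frontier D"
    proof
      assume l: "l \<in> frontier D"
      then have "l \<notin> D" using D frontier_disjoint_eq[of D] by blast
      then show False using no[OF _ bdry[OF l t]] sD(1) by metis
    qed
    ultimately have lD: "l \<in> D" using D by (simp add: frontier_def interior_open)
    have lx: "l \<noteq> x"
    proof
      assume l: "l = x"
      have "\<forall>\<^sub>F w in at l within D. u w < t" using pole[OF t] at_le[of D UNIV x] unfolding l by (auto elim: filter_leD)
      then show False using no sD(2) unfolding l by blast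
    qed
    have "isCont u l" using cont lD lx D by (simp add: continuous_on_eq_continuous_at open_delete)
    then have "(\<lambda>n. u (s n)) \<longlonglongrightarrow> u l" using s(2) isCont_tendsto_compose by blast
    then have "u l \<ge> t" using sD(3) by (intro LIMSEQ_le_const) auto
    then show "l \<in> K" using lD lx by (simp add: K_def)
  qed
  ultimately show "compact {w \<in> D - {x}. u w \<ge> t}" by (simp add: compact_eq_bounded_closed K_def)
qed

text \<open>The differential of ln |f| is Re (f' h / f). Its coefficients are parts of a holomorphic
  function, from which the second derivatives can be read off.\<close>

lemma ln_norm_has_derivative:
  fixes f :: "complex \<Rightarrow> complex"
  assumes f: "(f has_field_derivative f') (at z)" and nz: "f z \<noteq> 0"
  shows "((\<lambda>z. - ln (cmod (f z))) has_derivative (\<lambda>h. - Re (f' / f z) * Re h + Im (f' / f z) * Im h)) (at z)"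
proof -
  have 1: "(f has_derivative (\<lambda>h. f' * h)) (at z)" using f by (simp add: has_field_derivative_def)
  have 2: "((\<lambda>w. norm w) has_derivative (\<lambda>h. inner h (sgn (f z)))) (at (f z))"
    using has_derivative_norm[OF nz] by simp
  have 3: "((\<lambda>z. cmod (f z)) has_derivative (\<lambda>h. inner (f' * h) (sgn (f z)))) (at z)"
    using has_derivative_compose[OF 1 2] by simp
  have 4: "((\<lambda>z. - ln (cmod (f z))) has_derivative (\<lambda>h. - (inverse (cmod (f z)) * inner (f' * h) (sgn (f z))))) (at z)"
  proof (rule has_derivative_minus)
    have "(ln has_real_derivative inverse (cmod (f z))) (at (cmod (f z)))" using nz by (intro DERIV_ln) simp
    then have "(ln has_derivative (\<lambda>h. inverse (cmod (f z)) * h)) (at (cmod (f z)))"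
      by (simp add: has_field_derivative_def)
    from has_derivative_compose[OF 3 this]
    show "((\<lambda>z. ln (cmod (f z))) has_derivative (\<lambda>h. inverse (cmod (f z)) * inner (f' * h) (sgn (f z)))) (at z)" .
  qed
  have "- (inverse (cmod (f z)) * inner (f' * h) (sgn (f z))) = - Re (f' / f z) * Re h + Im (f' / f z) * Im h" for h
  proof -
    have "inverse (cmod (f z)) * inner (f' * h) (sgn (f z)) = Re (f' * h / f z)"
    proof -
      have "Re (f' * h / f z) = inner (f' * h) (f z) / (cmod (f z))\<^sup>2"
        by (simp add: Re_divide inner_complex_def cmod_power2)
      moreover have "inner (f' * h) (sgn (f z)) = inner (f' * h) (f z) / cmod (f z)"
        by (simp add: sgn_div_norm divide_inverse mult.commute)
      ultimately show ?thesis by (simp add: power2_eq_square divide_inverse)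
    qed
    also have "f' * h / f z = (f' / f z) * h" by simp
    also have "Re ((f' / f z) * h) = Re (f' / f z) * Re h - Im (f' / f z) * Im h" by (rule times_complex.sel)
    finally show ?thesis by argo
  qed
  then show ?thesis using 4 by simp
qed

section \<open>The Green's function of the conformal map\<close>

context conformal_disk
begin

definition g0 :: "complex \<Rightarrow> real" where "g0 w = - ln (cmod (\<psi> w))"

lemma \<psi>_nz: "w \<in> D \<Longrightarrow> w \<noteq> x \<Longrightarrow> \<psi> w \<noteq> 0"
  using inj_onD[OF injD, of w x] xD \<psi>x by auto

lemma g0_nonneg: "w \<in> D \<Longrightarrow> g0 w \<ge> 0"
  using \<psi>_in[of w] by (cases "\<psi> w = 0") (auto simp: g0_def ln_le_zero_iff)

text \<open>The set is the image of a closed disk under the inverse map. Its compactness gives the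
  decay of \<open>g0\<close> both at the frontier and at infinity, without any boundary continuity
  of psi.\<close>

lemma g0_level_compact: assumes "t > 0" shows "compact {w \<in> D. cmod (\<psi> w) \<le> exp (- t)}"
proof -
  obtain f where f: "f holomorphic_on ball 0 1" "f ` ball 0 1 = D" "\<And>w. w \<in> D \<Longrightarrow> f (\<psi> w) = w"
    using inverse_map by metis
  have sub: "cball 0 (exp (- t)) \<subseteq> (ball 0 1 :: complex set)" using assms by auto (smt (verit) exp_less_one_iff)
  have \<psi>f: "\<psi> (f z) = z" if "z \<in> ball 0 1" for z
    using bij f(3) that unfolding bij_betw_def by (metis imageE)
  have "{w \<in> D. cmod (\<psi> w) \<le> exp (- t)} = f ` cball 0 (exp (- t))"
  proof (intro equalityI subsetI)
    fix w assume "w \<in> {w \<in> D. cmod (\<psi> w) \<le> exp (- t)}"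
    then show "w \<in> f ` cball 0 (exp (- t))" using f(3)[of w] by (intro image_eqI[of _ _ "\<psi> w"]) auto
  next
    fix w assume "w \<in> f ` cball 0 (exp (- t))"
    then obtain z where z: "z \<in> cball 0 (exp (- t))" "w = f z" by blast
    then have "z \<in> ball 0 1" using sub by blast
    then show "w \<in> {w \<in> D. cmod (\<psi> w) \<le> exp (- t)}" using z f(2) \<psi>f by auto
  qed
  also have "compact \<dots>"
    by (intro compact_continuous_image continuous_on_subset[OF holomorphic_on_imp_continuous_on[OF f(1)] sub]) auto
  finally show ?thesis .
qed

lemma g0_small_outside: assumes "t > 0" "w \<in> D" "w \<notin> {w \<in> D. cmod (\<psi> w) \<le> exp (- t)}" shows "g0 w < t"
proof -
  have "exp (- t) < cmod (\<psi> w)" using assms by auto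
  then have "- t < ln (cmod (\<psi> w))" by (metis exp_gt_zero less_trans ln_exp ln_less_cancel_iff)
  then show ?thesis by (simp add: g0_def)
qed

lemma g0_frontier: assumes "\<zeta> \<in> frontier D" "t > 0" shows "\<forall>\<^sub>F w in at \<zeta> within D. g0 w < t"
proof -
  let ?K = "{w \<in> D. cmod (\<psi> w) \<le> exp (- t)}"
  have "open (- ?K)" using g0_level_compact[OF assms(2)] compact_imp_closed by blast
  moreover have "\<zeta> \<in> - ?K" using assms(1) openD frontier_disjoint_eq[of D] by blast
  ultimately have "\<forall>\<^sub>F w in at \<zeta> within D. w \<in> - ?K" by (meson eventually_at_topological)
  moreover have "\<forall>\<^sub>F w in at \<zeta> within D. w \<in> D" by (simp add: eventually_at_filter)
  ultimately show ?thesis by eventually_elim (use g0_small_outside[OF assms(2)] in blast)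
qed

lemma g0_infinity: assumes "t > 0" shows "\<exists>B. \<forall>w\<in>D. cmod w > B \<longrightarrow> g0 w < t"
proof -
  obtain B where "\<And>w. w \<in> {w \<in> D. cmod (\<psi> w) \<le> exp (- t)} \<Longrightarrow> cmod w \<le> B"
    using compact_imp_bounded[OF g0_level_compact[OF assms]] unfolding bounded_iff by blast
  then show ?thesis using g0_small_outside[OF assms] by (metis not_less)
qed

lemma g0_infinity': assumes "t > 0" shows "\<forall>\<^sub>F w in inf at_infinity (principal D). g0 w < t"
proof -
  obtain B where "\<forall>w\<in>D. cmod w > B \<longrightarrow> g0 w < t" using g0_infinity[OF assms] by blast
  then show ?thesis unfolding eventually_inf_principal eventually_at_infinity
    by (intro exI[of _ "B + 1"]) force
qed

lemma deriv_\<psi>_x: "deriv \<psi> x \<noteq> 0"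
  using holomorphic_injective_imp_regular[OF holo openD injD xD] .

lemma pole_quotient: "((\<lambda>y. ln (cmod (\<psi> y)) - ln (cmod (x - y))) \<longlongrightarrow> ln (cmod (deriv \<psi> x))) (at x)"
proof -
  have "(\<psi> has_field_derivative deriv \<psi> x) (at x)" by (rule holomorphic_derivI[OF holo openD xD])
  then have "((\<lambda>y. (\<psi> y - \<psi> x) / (y - x)) \<longlongrightarrow> deriv \<psi> x) (at x)" by (simp add: has_field_derivative_iff)
  then have "((\<lambda>y. ln (cmod ((\<psi> y - \<psi> x) / (y - x)))) \<longlongrightarrow> ln (cmod (deriv \<psi> x))) (at x)"
    using deriv_\<psi>_x by (intro tendsto_ln tendsto_norm) auto
  moreover have "\<forall>\<^sub>F y in at x. ln (cmod ((\<psi> y - \<psi> x) / (y - x))) = ln (cmod (\<psi> y)) - ln (cmod (x - y))"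
  proof -
    have "\<forall>\<^sub>F y in at x. y \<in> D - {x}" using openD xD by (auto simp: eventually_at_topological)
    then show ?thesis by eventually_elim (use \<psi>_nz in \<open>auto simp: \<psi>x norm_divide ln_div norm_minus_commute\<close>)
  qed
  ultimately show ?thesis by (simp add: tendsto_cong)
qed

lemma harmonic_g0: "harmonic_on g0 (D - {x})"
proof -
  define L where "L = (\<lambda>z. deriv \<psi> z / \<psi> z)"
  have oW: "open (D - {x})" using openD by (simp add: open_delete)
  have Lh: "L holomorphic_on D - {x}" unfolding L_def
    by (intro holomorphic_on_divide holomorphic_on_subset[OF holo] holomorphic_on_subset[OF holomorphic_deriv[OF holo openD]])
       (use \<psi>_nz in auto)
  have dL: "(L has_field_derivative deriv L z) (at z)" if "z \<in> D - {x}" for z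
    by (rule holomorphic_derivI[OF Lh oW that])
  have Ld: "(L has_derivative (\<lambda>h. deriv L z * h)) (at z)" if "z \<in> D - {x}" for z
    using dL[OF that] by (simp add: has_field_derivative_def)
  have cL: "continuous_on (D - {x}) (deriv L)"
    using holomorphic_on_imp_continuous_on[OF holomorphic_deriv[OF Lh oW]] .
  show ?thesis unfolding harmonic_on_def
  proof (rule conjI[OF oW], rule exI[of _ "\<lambda>z. - Re (L z)"], rule exI[of _ "\<lambda>z. Im (L z)"], rule exI[of _ "\<lambda>z. - Re (deriv L z)"],
      rule exI[of _ "\<lambda>z. Im (deriv L z)"], rule exI[of _ "\<lambda>z. Re (deriv L z)"], intro conjI ballI)
    fix z assume z: "z \<in> D - {x}"
    show "(g0 has_derivative (\<lambda>h. - Re (L z) * Re h + Im (L z) * Im h)) (at z)"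
      unfolding g0_def[abs_def] L_def using z \<psi>_nz
      by (intro ln_norm_has_derivative holomorphic_derivI[OF holo openD]) auto
    have "((\<lambda>z. Re (L z)) has_derivative (\<lambda>h. Re (deriv L z * h))) (at z)"
      by (rule bounded_linear.has_derivative[OF bounded_linear_Re Ld[OF z]])
    from has_derivative_minus[OF this]
    show "((\<lambda>z. - Re (L z)) has_derivative (\<lambda>h. - Re (deriv L z) * Re h + Im (deriv L z) * Im h)) (at z)"
      by (simp add: algebra_simps)
    have "((\<lambda>z. Im (L z)) has_derivative (\<lambda>h. Im (deriv L z * h))) (at z)"
      by (rule bounded_linear.has_derivative[OF bounded_linear_Im Ld[OF z]])
    then show "((\<lambda>z. Im (L z)) has_derivative (\<lambda>h. Im (deriv L z) * Re h + Re (deriv L z) * Im h)) (at z)"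
      by (simp add: algebra_simps)
  qed (auto intro!: continuous_intros cL)
qed

lemma is_green_g0: "is_green D x g0"
  unfolding is_green_def
proof (intro conjI harmonic_g0 ballI)
  fix \<zeta> assume \<zeta>: "\<zeta> \<in> frontier D"
  have inD: "\<forall>\<^sub>F w in at \<zeta> within D. w \<in> D" by (simp add: eventually_at_filter)
  show "(g0 \<longlongrightarrow> 0) (at \<zeta> within D)"
  proof (rule tendstoI)
    fix e :: real assume "e > 0"
    from g0_frontier[OF \<zeta> this] inD show "\<forall>\<^sub>F w in at \<zeta> within D. dist (g0 w) 0 < e"
      by eventually_elim (use g0_nonneg in auto)
  qed
next
  have inD: "\<forall>\<^sub>F w in inf at_infinity (principal D). w \<in> D" by (simp add: eventually_inf_principal)
  show "(g0 \<longlongrightarrow> 0) (inf at_infinity (principal D))"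
  proof (rule tendstoI)
    fix e :: real assume "e > 0"
    from g0_infinity'[OF this] inD show "\<forall>\<^sub>F w in inf at_infinity (principal D). dist (g0 w) 0 < e"
      by eventually_elim (use g0_nonneg in auto)
  qed
next
  have "((\<lambda>y. g0 y + ln (cmod (x - y))) \<longlongrightarrow> - ln (cmod (deriv \<psi> x))) (at x)"
    using tendsto_minus[OF pole_quotient] by (simp add: g0_def)
  then show "(\<lambda>y. g0 y + ln (cmod (x - y))) \<in> O[at x](\<lambda>_. 1)"
    by (intro bigoI_tendsto[where c = "- ln (cmod (deriv \<psi> x))"]) auto
qed

text \<open>The difference of two Green's functions is bounded at the pole, hence dominated there by
  \<open>\<eta> g0\<close> for every \<open>\<eta> > 0\<close>; no removable singularity theorem is needed.\<close>

lemma is_green_difference: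
  assumes g: "harmonic_on h (D - {x})"
    and b: "\<And>\<zeta>. \<zeta> \<in> frontier D \<Longrightarrow> (h \<longlongrightarrow> 0) (at \<zeta> within D)" "(h \<longlongrightarrow> 0) (inf at_infinity (principal D))"
    and p: "\<forall>\<^sub>F y in at x. h y \<le> C" and w: "w \<in> D - {x}"
  shows "h w \<le> 0"
proof (rule field_le_epsilon)
  fix e :: real assume e: "e > 0"
  \<comment> \<open>Small enough that eta * g0 w <= e at the given point, yet positive, so that eta
    * g0 still tends to infinity at the pole.\<close>
  define \<eta> where "\<eta> = e / (g0 w + 1)"
  have gw: "g0 w \<ge> 0" using w g0_nonneg by auto
  have \<eta>: "\<eta> > 0" using e gw by (simp add: \<eta>_def)
  have "1 * h w + (- \<eta>) * g0 w \<le> 0"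
  proof (rule harmonic_le_zero_filter[OF openD harmonic_on_lincomb[OF g harmonic_g0] xD _ _ _ w])
    fix \<zeta> t assume \<zeta>: "\<zeta> \<in> frontier D" and t: "(t::real) > 0"
    have "\<forall>\<^sub>F w in at \<zeta> within D. h w < t" using b(1)[OF \<zeta>] t by (rule order_tendstoD)
    moreover have "\<forall>\<^sub>F w in at \<zeta> within D. w \<in> D" by (simp add: eventually_at_filter)
    ultimately show "\<forall>\<^sub>F w in at \<zeta> within D. 1 * h w + - \<eta> * g0 w < t"
    proof eventually_elim
      case (elim w)
      have "\<eta> * g0 w \<ge> 0" using g0_nonneg[OF elim(2)] \<eta> by simp
      then show ?case using elim(1) by simp
    qed
  next
    fix t :: real assume t: "t > 0"
    have "\<forall>\<^sub>F w in inf at_infinity (principal D). h w < t" using b(2) t by (rule order_tendstoD)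
    moreover have "\<forall>\<^sub>F w in inf at_infinity (principal D). w \<in> D" by (simp add: eventually_inf_principal)
    ultimately show "\<forall>\<^sub>F w in inf at_infinity (principal D). 1 * h w + - \<eta> * g0 w < t"
    proof eventually_elim
      case (elim w)
      have "\<eta> * g0 w \<ge> 0" using g0_nonneg[OF elim(2)] \<eta> by simp
      then show ?case using elim(1) by simp
    qed
  next
    fix t :: real assume t: "t > 0"
    have "filterlim g0 at_top (at x)"
    proof -
      have "(\<psi> \<longlongrightarrow> 0) (at x)"
        using holomorphic_on_imp_continuous_on[OF holo] openD xD \<psi>x
        by (simp add: continuous_on_eq_continuous_at isCont_def) metis
      then have "((\<lambda>y. cmod (\<psi> y)) \<longlongrightarrow> 0) (at x)" by (rule tendsto_norm_zero)
      moreover have "\<forall>\<^sub>F y in at x. cmod (\<psi> y) > 0"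
      proof -
        have "\<forall>\<^sub>F y in at x. y \<in> D - {x}" using openD xD by (auto simp: eventually_at_topological)
        then show ?thesis by eventually_elim (use \<psi>_nz in auto)
      qed
      ultimately have "filterlim (\<lambda>y. cmod (\<psi> y)) (at_right 0) (at x)" by (simp add: filterlim_at eventually_conj_iff)
      then have "filterlim (\<lambda>y. ln (cmod (\<psi> y))) at_bot (at x)" using ln_at_0 filterlim_compose by blast
      then show ?thesis unfolding g0_def[abs_def] by (simp add: filterlim_uminus_at_top)
    qed
    then have "\<forall>\<^sub>F y in at x. g0 y > C / \<eta>" by (simp add: filterlim_at_top_dense)
    with p show "\<forall>\<^sub>F w in at x. 1 * h w + - \<eta> * g0 w < t"
    proof eventually_elim
      case (elim y)
      then have "C < \<eta> * g0 y" using \<eta> by (simp add: divide_less_eq mult.commute)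
      then show ?case using elim(1) t by simp
    qed
  qed
  then have "h w \<le> \<eta> * g0 w" by simp
  also have "\<dots> \<le> e" using e gw by (simp add: \<eta>_def divide_le_eq mult_left_mono)
  finally show "h w \<le> 0 + e" by simp
qed

lemma green_eq: assumes w: "w \<in> D" "w \<noteq> x" shows "green D x w = g0 w"
proof -
  have "is_green D x (green D x)" unfolding green_def by (rule someI[of "is_green D x", OF is_green_g0])
  then have G: "harmonic_on (green D x) (D - {x})" "\<And>\<zeta>. \<zeta> \<in> frontier D \<Longrightarrow> (green D x \<longlongrightarrow> 0) (at \<zeta> within D)"
    "(green D x \<longlongrightarrow> 0) (inf at_infinity (principal D))" "(\<lambda>y. green D x y + ln (cmod (x - y))) \<in> O[at x](\<lambda>_. 1)"
    by (auto simp: is_green_def)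
  have H: "(g0 \<longlongrightarrow> 0) (at \<zeta> within D)" if "\<zeta> \<in> frontier D" for \<zeta> using is_green_g0 that by (auto simp: is_green_def)
  have H': "(g0 \<longlongrightarrow> 0) (inf at_infinity (principal D))" "(\<lambda>y. g0 y + ln (cmod (x - y))) \<in> O[at x](\<lambda>_. 1)"
    using is_green_g0 by (auto simp: is_green_def)
  have "(\<lambda>y. (green D x y + ln (cmod (x - y))) - (g0 y + ln (cmod (x - y)))) \<in> O[at x](\<lambda>_. 1)"
    using sum_in_bigo(2)[OF G(4) H'(2)] .
  then have "(\<lambda>y. green D x y - g0 y) \<in> O[at x](\<lambda>_. 1)" by simp
  then obtain c where c: "\<forall>\<^sub>F y in at x. norm (green D x y - g0 y) \<le> c * norm (1::real)" by (rule landau_o.bigE)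
  have 1: "1 * green D x w + (-1) * g0 w \<le> 0"
  proof (rule is_green_difference[OF harmonic_on_lincomb[OF G(1) harmonic_g0]])
    show "((\<lambda>w. 1 * green D x w + (-1) * g0 w) \<longlongrightarrow> 0) (at \<zeta> within D)" if "\<zeta> \<in> frontier D" for \<zeta>
      using tendsto_diff[OF G(2)[OF that] H[OF that]] by simp
    show "((\<lambda>w. 1 * green D x w + (-1) * g0 w) \<longlongrightarrow> 0) (inf at_infinity (principal D))"
      using tendsto_diff[OF G(3) H'(1)] by simp
    show "\<forall>\<^sub>F y in at x. 1 * green D x y + (-1) * g0 y \<le> c" using c by eventually_elim auto
  qed (use w in auto)
  have 2: "(-1) * green D x w + 1 * g0 w \<le> 0"
  proof (rule is_green_difference[OF harmonic_on_lincomb[OF G(1) harmonic_g0]])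
    show "((\<lambda>w. (-1) * green D x w + 1 * g0 w) \<longlongrightarrow> 0) (at \<zeta> within D)" if "\<zeta> \<in> frontier D" for \<zeta>
      using tendsto_diff[OF H[OF that] G(2)[OF that]] by simp
    show "((\<lambda>w. (-1) * green D x w + 1 * g0 w) \<longlongrightarrow> 0) (inf at_infinity (principal D))"
      using tendsto_diff[OF H'(1) G(3)] by simp
    show "\<forall>\<^sub>F y in at x. (-1) * green D x y + 1 * g0 y \<le> c" using c by eventually_elim auto
  qed (use w in auto)
  show ?thesis using 1 2 by simp
qed

end

section \<open>Transition probabilities of the free walk\<close>

primrec walk1 :: "nat \<Rightarrow> int \<Rightarrow> real" where
  "walk1 0 = (\<lambda>k. if k = 0 then 1 else 0)"
| "walk1 (Suc j) = (\<lambda>k. (walk1 j (k + 1) + walk1 j (k - 1)) / 2)"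

abbreviation lat :: "int \<Rightarrow> int \<Rightarrow> complex" where
  "lat m n \<equiv> Complex (of_int m) (of_int n)"

lemma lat_steps: "lat m n + 1 = lat (m + 1) n" "lat m n - 1 = lat (m - 1) n"
  "lat m n + \<i> = lat m (n + 1)" "lat m n - \<i> = lat m (n - 1)"
  by (simp_all add: complex_eq_iff)

lemma lat_eq_0: "lat m n = 0 \<longleftrightarrow> m = 0 \<and> n = 0" by (simp add: complex_eq_iff)

lemma nmean_lat: "nmean f (lat m n) = (f (lat (m + 1) n) + f (lat (m - 1) n) + f (lat m (n + 1)) + f (lat m (n - 1))) / 4"
  unfolding nmean_def lat_steps ..

abbreviation free_prob :: "nat \<Rightarrow> complex \<Rightarrow> real" where
  "free_prob j z \<equiv> killed_prob UNIV j z 0"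

lemma free_prob_Suc: "free_prob (Suc j) z = nmean (free_prob j) z"
  by (subst killed_prob_first_step) auto

text \<open>In the coordinates \<open>m + n\<close>, \<open>m - n\<close> the walk consists of two independent one-dimensional walks.\<close>

lemma free_prob_walk1: "free_prob j (lat m n) = walk1 j (m + n) * walk1 j (m - n)"
proof (induction j arbitrary: m n)
  case 0 then show ?case by (auto simp: killed_prob_0 complex_eq_iff)
next
  case (Suc j)
  have "free_prob (Suc j) (lat m n) =
     (walk1 j (m + n + 1) * walk1 j (m - n + 1) + walk1 j (m + n - 1) * walk1 j (m - n - 1)
      + walk1 j (m + n + 1) * walk1 j (m - n - 1) + walk1 j (m + n - 1) * walk1 j (m - n + 1)) / 4"
    unfolding free_prob_Suc nmean_lat Suc by (simp add: algebra_simps)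
  then show ?case by (simp add: field_simps)
qed

lemma walk1_nonneg: "walk1 j k \<ge> 0"
  by (induction j arbitrary: k) auto

lemma walk1_sym: "walk1 j (- k) = walk1 j k"
proof (induction j arbitrary: k)
  case (Suc j)
  have "walk1 j (- k + 1) = walk1 j (k - 1)" "walk1 j (- k - 1) = walk1 j (k + 1)"
  proof -
    have "- k + 1 = - (k - 1)" "- k - 1 = - (k + 1)" by simp_all
    then show "walk1 j (- k + 1) = walk1 j (k - 1)" "walk1 j (- k - 1) = walk1 j (k + 1)" by (simp_all only: Suc)
  qed
  then show ?case by simp
qed auto

lemma walk1_parity: "odd (int j + k) \<Longrightarrow> walk1 j k = 0"
proof (induction j arbitrary: k)
  case (Suc j)
  then have "odd (int j + (k + 1))" "odd (int j + (k - 1))" by auto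
  then have "walk1 j (k + 1) = 0" "walk1 j (k - 1) = 0" using Suc.IH by blast+
  then show ?case by simp
qed auto

text \<open>The range starts at -1 to close the induction: the step for k refers to k - 1, and at k
  = -1 symmetry makes both sides equal.\<close>

lemma walk1_decreasing: "k \<ge> -1 \<Longrightarrow> walk1 j (k + 2) \<le> walk1 j k"
proof (induction j arbitrary: k)
  case (Suc j)
  show ?case
  proof (cases "k = -1")
    case True then show ?thesis using walk1_sym[of "Suc j" 1] by simp
  next
    case False
    then have "walk1 j (k + 1 + 2) \<le> walk1 j (k + 1)" "walk1 j (k - 1 + 2) \<le> walk1 j (k - 1)"
      using Suc by (intro Suc.IH, simp)+
    then show ?thesis by (simp add: algebra_simps)
  qed
qed auto

lemma walk1_even_mono: "walk1 j (2 * int (a + b)) \<le> walk1 j (2 * int a)"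
proof (induction b)
  case (Suc b)
  have "walk1 j (2 * int (a + b) + 2) \<le> walk1 j (2 * int (a + b))" by (rule walk1_decreasing) simp
  then show ?case using Suc by (simp add: algebra_simps)
qed auto

lemma walk1_le_even: assumes "even k" "\<bar>k\<bar> \<le> 2 * int a" shows "walk1 j (2 * int a) \<le> walk1 j k"
proof -
  obtain b where b: "k = 2 * b" using assms(1) by (auto simp: dvd_def)
  define c where "c = nat \<bar>b\<bar>"
  have c: "\<bar>k\<bar> = 2 * int c" by (simp add: b c_def)
  have "walk1 j (2 * int (c + (a - c))) \<le> walk1 j (2 * int c)" by (rule walk1_even_mono)
  moreover have "c + (a - c) = a" using c assms(2) by simp
  moreover have "walk1 j (2 * int c) = walk1 j k" using c walk1_sym[of j k] by (cases "k \<ge> 0") auto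
  ultimately show ?thesis by simp
qed

lemma walk1_binomial: "walk1 j (2 * int i - int j) = real (j choose i) / 2 ^ j"
proof (induction j arbitrary: i)
  case 0 then show ?case by (cases i) auto
next
  case (Suc j)
  have low: "walk1 j k = 0" if "k < - int j" for j k
    using that by (induction j arbitrary: k) auto
  show ?case
  proof (cases i)
    case 0
    have "walk1 j (- int j - 2) = 0" by (rule low) simp
    then show ?thesis using Suc[of 0] 0 by (simp add: algebra_simps)
  next
    case (Suc i')
    have "2 * int i - int (Suc j) + 1 = 2 * int i - int j" "2 * int i - int (Suc j) - 1 = 2 * int i' - int j"
      using Suc by auto
    then show ?thesis using Suc.IH[of i] Suc.IH[of i'] unfolding walk1.simps Suc by (simp add: field_simps)
  qed
qed

text \<open>The normalised central binomial coefficient (2 j choose j) / 4^j, at the same time the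
  coefficient of z^j in (1 - z)^(-1/2).\<close>

definition cbin :: "nat \<Rightarrow> real" where "cbin j = walk1 (2 * j) 0"

lemma cbin_nonneg: "cbin j \<ge> 0" by (simp add: cbin_def walk1_nonneg)

lemma cbin_0: "cbin 0 = 1" by (simp add: cbin_def)

lemma cbin_Suc: "cbin (Suc j) = cbin j * (2 * real j + 1) / (2 * real j + 2)"
proof -
  have e: "cbin j = fact (2 * j) / (fact j * fact j) / 4 ^ j" for j
  proof -
    have "walk1 (2 * j) (2 * int j - int (2 * j)) = real (2 * j choose j) / 2 ^ (2 * j)" by (rule walk1_binomial)
    then have "cbin j = real (2 * j choose j) / 4 ^ j" by (simp add: cbin_def power_mult)
    also have "real (2 * j choose j) = fact (2 * j) / (fact j * fact j)"
      using binomial_fact[of j "2 * j", where 'a = real] by (simp add: mult_2)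
    finally show ?thesis .
  qed
  have f: "(fact (2 * Suc j) :: real) = (2 * real j + 2) * ((2 * real j + 1) * fact (2 * j))"
    by (simp add: fact_Suc algebra_simps)
  have g: "(fact (Suc j) :: real) = (real j + 1) * fact j" by (simp add: fact_Suc algebra_simps)
  define F G P r q where "F = (fact (2 * j) :: real)" and "G = (fact j :: real)" and "P = (4 ^ j :: real)"
    and "r = real j + 1" and "q = 2 * real j + 1"
  have nz: "G \<noteq> 0" "P \<noteq> 0" "r \<noteq> 0" by (auto simp: G_def P_def r_def)
  have r2: "2 * real j + 2 = 2 * r" by (simp add: r_def)
  have "cbin (Suc j) = (2 * r) * (q * F) / ((r * G) * (r * G)) / (4 * P)"
    unfolding e f g r2 power_Suc F_def[symmetric] G_def[symmetric] P_def[symmetric] r_def[symmetric] q_def[symmetric] ..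
  also have "\<dots> = (F / (G * G) / P) * q / (2 * r)" using nz by (simp add: field_simps)
  finally show ?thesis unfolding e r2 F_def G_def P_def q_def .
qed

lemma cbin_gbinomial: "cbin j = (-1) ^ j * ((- 1 / 2) gchoose j)"
proof (induction j)
  case (Suc j)
  have "((- 1 / 2 :: real) gchoose Suc j) = (- 1 / 2 gchoose j) * ((- 1 / 2) - real j) / (real j + 1)"
    using gbinomial_absorb_comp[of "- 1 / 2 :: real" j] gbinomial_absorption[of j "- 1 / 2 :: real"]
    by (simp add: gbinomial_prod_rev field_simps)
  moreover have "s * g * (2 * t + 1) / (2 * t + 2) = (-1) * s * (g * ((- 1 / 2) - t) / (t + 1))" if "t \<ge> 0" for s g t :: real
    using that by (simp add: field_simps)
  ultimately show ?case unfolding cbin_Suc Suc power_Suc by simp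
qed (simp add: cbin_0)

lemma cbin_sums: assumes "\<bar>z\<bar> < 1" shows "(\<lambda>j. cbin j * z ^ j) sums (1 - z) powr (- 1 / 2)"
proof -
  have "(\<lambda>n. ((- 1 / 2) gchoose n) * (- z) ^ n) sums (1 + (- z)) powr (- 1 / 2)"
    by (rule gen_binomial_real) (use assms in simp)
  moreover have "((- 1 / 2) gchoose n) * (- z) ^ n = cbin n * z ^ n" for n
    unfolding cbin_gbinomial by (simp add: power_minus[of z] mult_ac)
  ultimately show ?thesis by simp
qed

text \<open>The left side decreases in j because (2 j + 1) (2 j + 3) <= (2 j + 2)^2. In the plane
  this is the decay of the return probability.\<close>

lemma cbin_square_le: "(cbin j)\<^sup>2 * (2 * real j + 1) \<le> 1"
proof (induction j)
  case (Suc j)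
  have "(cbin (Suc j))\<^sup>2 * (2 * real (Suc j) + 1) =
     ((cbin j)\<^sup>2 * (2 * real j + 1)) * ((2 * real j + 1) * (2 * real j + 3) / (2 * real j + 2)\<^sup>2)"
    unfolding cbin_Suc by (simp add: power2_eq_square field_simps)
  also have "\<dots> \<le> 1 * 1"
  proof (intro mult_mono Suc)
    have "(2 * real j + 1) * (2 * real j + 3) \<le> (2 * real j + 2)\<^sup>2" by (simp add: power2_eq_square algebra_simps)
    then show "(2 * real j + 1) * (2 * real j + 3) / (2 * real j + 2)\<^sup>2 \<le> 1" by (simp add: divide_le_eq_1)
  qed auto
  finally show ?case by simp
qed (simp add: cbin_0)

lemma free_prob_0_tendsto: "(\<lambda>j. free_prob j 0) \<longlonglongrightarrow> 0"
proof (rule tendsto_sandwich[where f = "\<lambda>_. 0" and h = "\<lambda>j. 1 / (real j + 1)"])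
  have z: "free_prob j 0 = (walk1 j 0)\<^sup>2" for j
    using free_prob_walk1[of j 0 0] by (simp add: power2_eq_square Complex_eq)
  have "free_prob j 0 \<le> 1 / (real j + 1)" for j
  proof (cases "even j")
    case True
    then obtain i where i: "j = 2 * i" by (elim evenE)
    show ?thesis using cbin_square_le[of i] unfolding cbin_def by (simp add: z i field_simps)
  next
    case False then show ?thesis using walk1_parity[of j 0] by (simp add: z)
  qed
  then show "\<forall>\<^sub>F j in sequentially. free_prob j 0 \<le> 1 / (real j + 1)" by simp
  show "(\<lambda>j. 1 / (real j + 1)) \<longlonglongrightarrow> 0" by real_asymp
qed (auto simp: killed_prob_nonneg)

text \<open>The characteristic function of a step is cos, and symmetry reduces Fourier inversion to
  half a period; the product formula for cosines is the recursion of \<open>walk1\<close>.\<close>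

lemma walk1_fourier: "((\<lambda>\<theta>. cos \<theta> ^ j * cos (of_int k * \<theta>)) has_integral pi * walk1 j k) {0..pi}"
proof (induction j arbitrary: k)
  case 0
  show ?case
  proof (cases "k = 0")
    case True then show ?thesis using has_integral_const_real[of "1::real" 0 pi] by simp
  next
    case False
    have "((\<lambda>\<theta>. cos (of_int k * \<theta>)) has_integral sin (of_int k * pi) / of_int k - sin (of_int k * 0) / of_int k) {0..pi}"
      by (rule fundamental_theorem_of_calculus)
         (use False in \<open>auto intro!: derivative_eq_intros simp: has_real_derivative_iff_has_vector_derivative[symmetric]\<close>)
    moreover have "sin (of_int k * pi) = 0" using sin_npi_int[of k] by (simp add: mult.commute)
    ultimately show ?thesis using False by simp
  qed
next
  case (Suc j)
  have "((\<lambda>\<theta>. (cos \<theta> ^ j * cos (of_int (k + 1) * \<theta>) + cos \<theta> ^ j * cos (of_int (k - 1) * \<theta>)) / 2) has_integral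
      (pi * walk1 j (k + 1) + pi * walk1 j (k - 1)) / 2) {0..pi}"
    by (intro has_integral_divide has_integral_add Suc)
  moreover have "(cos \<theta> ^ j * cos (of_int (k + 1) * \<theta>) + cos \<theta> ^ j * cos (of_int (k - 1) * \<theta>)) / 2
      = cos \<theta> ^ Suc j * cos (of_int k * \<theta>)" for \<theta> :: real
  proof -
    have "of_int (k + 1) * \<theta> = of_int k * \<theta> + \<theta>" "of_int (k - 1) * \<theta> = of_int k * \<theta> - \<theta>"
      by (simp_all add: algebra_simps)
    then show ?thesis by (simp only: cos_add cos_diff) (simp add: field_simps)
  qed
  ultimately show ?case by (simp add: algebra_simps add_divide_distrib)
qed

section \<open>Diagonal values of the potential kernel by Fourier series\<close>

definition odd_harm :: "nat \<Rightarrow> real" where "odd_harm n = (\<Sum>k<n. 1 / (2 * real k + 1))"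

lemma sine_sum: "(\<Sum>k<n. 2 * sin ((2 * real k + 1) * \<theta>)) * sin \<theta> = 1 - cos (2 * real n * \<theta>)"
proof (induction n)
  case (Suc n)
  have "2 * sin ((2 * real n + 1) * \<theta>) * sin \<theta> = cos (2 * real n * \<theta>) - cos (2 * real (Suc n) * \<theta>)"
  proof -
    have "2 * real n * \<theta> = (2 * real n + 1) * \<theta> - \<theta>" "2 * real (Suc n) * \<theta> = (2 * real n + 1) * \<theta> + \<theta>"
      by (simp_all add: algebra_simps)
    then show ?thesis by (simp only: cos_add cos_diff)
  qed
  then show ?case using Suc by (simp add: distrib_right)
qed simp

text \<open>Under the Fourier integral the sum of cbin j cos^(2 j) is 1 / sin; times 1 - cos (2 n
  theta) it becomes the polynomial \<open>g\<close> of \<open>sine_sum\<close>, with integral 4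
  \<open>odd_harm n\<close>. The partial sums increase to \<open>g\<close>, which thus dominates
  them.\<close>

lemma diagonal_sums: "(\<lambda>j. cbin j * (cbin j - walk1 (2 * j) (2 * int n))) sums (4 / pi * odd_harm n)"
proof -
  define g where "g = (\<lambda>\<theta>::real. \<Sum>k<n. 2 * sin ((2 * real k + 1) * \<theta>))"
  define f where "f = (\<lambda>J \<theta>. \<Sum>j<J. cbin j * (cos \<theta> ^ (2 * j) * cos (of_int 0 * \<theta>) - cos \<theta> ^ (2 * j) * cos (of_int (2 * int n) * \<theta>)))"
  have fI: "(f J has_integral (\<Sum>j<J. cbin j * (pi * walk1 (2 * j) 0 - pi * walk1 (2 * j) (2 * int n)))) {0..pi}" for J
    unfolding f_def by (intro has_integral_sum has_integral_mult_right has_integral_diff walk1_fourier) auto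
  have f: "f J \<theta> = (\<Sum>j<J. cbin j * (cos \<theta>)\<^sup>2 ^ j) * (1 - cos (2 * real n * \<theta>))" for J \<theta>
  proof -
    have al: "c * (X * 1 - X * u) = c * X * (1 - u)" for c X u :: real by algebra
    have "of_int (2 * int n) = 2 * real n" by simp
    then show ?thesis unfolding f_def sum_distrib_right
      by (intro sum.cong refl) (simp only: power_mult of_int_0 mult_zero_left cos_zero al)
  qed
  have gI: "(g has_integral 4 * odd_harm n) {0..pi}"
  proof -
    have "((\<lambda>\<theta>. 2 * sin ((2 * real k + 1) * \<theta>)) has_integral 4 * (1 / (2 * real k + 1))) {0..pi}" for k
    proof -
      define a where "a = 2 * real k + 1"
      have a: "a \<noteq> 0" by (simp add: a_def)
      have "((\<lambda>\<theta>. 2 * sin (a * \<theta>)) has_integral - 2 * cos (a * pi) / a - (- 2 * cos (a * 0) / a)) {0..pi}"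
        by (rule fundamental_theorem_of_calculus)
           (use a in \<open>auto intro!: derivative_eq_intros simp: has_real_derivative_iff_has_vector_derivative[symmetric]\<close>)
      moreover have "cos (a * pi) = -1"
      proof -
        have "a = real (2 * k + 1)" by (simp add: a_def)
        then show ?thesis by (simp only: cos_npi) simp
      qed
      ultimately show ?thesis by (simp add: a_def)
    qed
    then show ?thesis unfolding g_def odd_harm_def sum_distrib_left by (intro has_integral_sum) auto
  qed
  have conv: "(\<lambda>J. f J \<theta>) \<longlonglongrightarrow> g \<theta>" if \<theta>: "\<theta> \<in> {0..pi}" for \<theta>
  proof (cases "\<theta> = 0 \<or> \<theta> = pi")
    \<comment> \<open>At the end points the binomial series diverges, but the factor 1 - cos (2 n
      theta) is 0 there.\<close>
    case True
    have "cos (2 * real n * \<theta>) = 1" using True cos_npi[of "2 * n"] by (auto simp: mult_ac)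
    then have "f J \<theta> = 0" for J by (simp add: f)
    moreover have "sin ((2 * real k + 1) * \<theta>) = 0" for k
    proof -
      have "2 * real k + 1 = real (2 * k + 1)" by simp
      then show ?thesis using True by (elim disjE) (simp, simp only: sin_npi)
    qed
    then have "g \<theta> = 0" by (simp add: g_def)
    ultimately show ?thesis by simp
  next
    case False
    then have s: "sin \<theta> > 0" using \<theta> by (intro sin_gt_zero) auto
    have c: "(cos \<theta>)\<^sup>2 = 1 - (sin \<theta>)\<^sup>2" by (simp add: cos_squared_eq)
    have "(sin \<theta>)\<^sup>2 > 0" using s by simp
    then have "(cos \<theta>)\<^sup>2 < 1" using c by linarith
    then have "\<bar>(cos \<theta>)\<^sup>2\<bar> < 1" by simp
    from cbin_sums[OF this] have "(\<lambda>J. \<Sum>j<J. cbin j * (cos \<theta>)\<^sup>2 ^ j) \<longlonglongrightarrow> (1 - (cos \<theta>)\<^sup>2) powr (- 1 / 2)"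
      unfolding sums_def .
    also have "(1 - (cos \<theta>)\<^sup>2) powr (- 1 / 2) = 1 / sin \<theta>"
    proof -
      have "(1 - (cos \<theta>)\<^sup>2) powr (- 1 / 2) = ((sin \<theta>)\<^sup>2) powr (- 1 / 2)" by (simp add: c)
      also have "(sin \<theta>)\<^sup>2 = sin \<theta> powr 2" using s by (simp add: powr_numeral)
      also have "(sin \<theta> powr 2) powr (- 1 / 2) = sin \<theta> powr (- 1)" by (simp add: powr_powr)
      also have "\<dots> = 1 / sin \<theta>" using s by (simp add: powr_minus divide_inverse)
      finally show ?thesis .
    qed
    finally have "(\<lambda>J. f J \<theta>) \<longlonglongrightarrow> 1 / sin \<theta> * (1 - cos (2 * real n * \<theta>))" unfolding f by (intro tendsto_intros)
    moreover have "1 / sin \<theta> * (1 - cos (2 * real n * \<theta>)) = g \<theta>"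
      using sine_sum[where n = n and \<theta> = \<theta>] s by (simp add: g_def field_simps)
    ultimately show ?thesis by simp
  qed
  have mono: "f J \<theta> \<le> f (Suc J) \<theta>" "0 \<le> f J \<theta>" for J \<theta>
    unfolding f by (auto intro!: mult_right_mono mult_nonneg_nonneg sum_nonneg simp: cbin_nonneg)
  have "f J \<theta> \<le> g \<theta>" if "\<theta> \<in> {0..pi}" for J \<theta>
    by (rule incseq_le[OF incseq_SucI conv[OF that]]) (rule mono)
  then have "(\<lambda>J. integral {0..pi} (f J)) \<longlonglongrightarrow> integral {0..pi} g"
    using fI gI mono(2) by (intro dominated_convergence(2)[where h = g] conv) (auto simp: has_integral_integrable)
  then have "(\<lambda>J. (1 / pi) * (\<Sum>j<J. cbin j * (pi * walk1 (2 * j) 0 - pi * walk1 (2 * j) (2 * int n)))) \<longlonglongrightarrow> (1 / pi) * (4 * odd_harm n)"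
    unfolding integral_unique[OF fI] integral_unique[OF gI] by (intro tendsto_intros)
  moreover have "(1 / pi) * (\<Sum>j<J. cbin j * (pi * walk1 (2 * j) 0 - pi * walk1 (2 * j) (2 * int n)))
     = (\<Sum>j<J. cbin j * (cbin j - walk1 (2 * j) (2 * int n)))" for J
    unfolding sum_distrib_left by (intro sum.cong) (auto simp: cbin_def field_simps)
  ultimately show ?thesis unfolding sums_def by simp
qed

section \<open>Existence and harmonicity of the potential kernel\<close>

text \<open>At points of even parity all odd times contribute 0, which leaves a series of
  nonnegative terms over the even times.\<close>

lemma pk_even_reindex:
  assumes "even (m + n)"
  shows "(\<lambda>j. (cbin j)\<^sup>2 - walk1 (2 * j) (m + n) * walk1 (2 * j) (m - n)) sums s \<longleftrightarrow>
    (\<lambda>j. free_prob j 0 - free_prob j (lat m n)) sums s"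
proof -
  have t: "free_prob j 0 - free_prob j (lat m n) = walk1 j 0 * walk1 j 0 - walk1 j (m + n) * walk1 j (m - n)" for j
    using free_prob_walk1[of j 0 0] free_prob_walk1[of j m n] by (simp add: Complex_eq)
  have "(\<lambda>j. free_prob (2 * j) 0 - free_prob (2 * j) (lat m n)) sums s \<longleftrightarrow>
    (\<lambda>j. free_prob j 0 - free_prob j (lat m n)) sums s"
  proof (rule sums_mono_reindex)
    show "strict_mono (\<lambda>j::nat. 2 * j)" by (simp add: strict_mono_def)
    fix j :: nat assume j: "j \<notin> range (\<lambda>j. 2 * j)"
    then have "odd j" by (auto elim!: evenE)
    then show "free_prob j 0 - free_prob j (lat m n) = 0"
      unfolding t using assms walk1_parity[of j 0] walk1_parity[of j "m + n"] by simp
  qed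
  then show ?thesis unfolding t cbin_def power2_eq_square .
qed

text \<open>With c = \<open>cbin j\<close> and q the value of the walk at 2 K, monotonicity bounds
  the product of the two walks below by q^2, and c^2 - q^2 <= 2 c (c - q) is the summable diagonal
  series.\<close>

lemma pk_even:
  assumes e: "even (m + n)" and K: "\<bar>m + n\<bar> \<le> 2 * int K" "\<bar>m - n\<bar> \<le> 2 * int K"
  shows "summable (\<lambda>j. free_prob j 0 - free_prob j (lat m n))"
    and "0 \<le> potential_kernel (lat m n)" and "potential_kernel (lat m n) \<le> 8 / pi * odd_harm K"
proof -
  define u where "u = (\<lambda>j. (cbin j)\<^sup>2 - walk1 (2 * j) (m + n) * walk1 (2 * j) (m - n))"
  define w where "w = (\<lambda>j. 2 * (cbin j * (cbin j - walk1 (2 * j) (2 * int K))))"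
  have e': "even (m - n)" using e by simp
  have le0: "walk1 (2 * j) k \<le> cbin j" if ek: "even k" for j k
  proof -
    obtain b where b: "k = 2 * b" using ek by (auto simp: dvd_def)
    define c where "c = nat \<bar>b\<bar>"
    have c: "\<bar>k\<bar> = 2 * int c" by (simp add: b c_def)
    have "walk1 (2 * j) (2 * int (0 + c)) \<le> walk1 (2 * j) (2 * int 0)" by (rule walk1_even_mono)
    moreover have "walk1 (2 * j) (2 * int c) = walk1 (2 * j) k" using c walk1_sym[of "2 * j" k] by (cases "k \<ge> 0") auto
    ultimately show ?thesis by (simp add: cbin_def)
  qed
  have u: "0 \<le> u j" "u j \<le> w j" for j
  proof -
    have "walk1 (2 * j) (m + n) * walk1 (2 * j) (m - n) \<le> cbin j * cbin j"
      by (intro mult_mono le0 e e' walk1_nonneg cbin_nonneg)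
    then show "0 \<le> u j" by (simp add: u_def power2_eq_square)
    define q where "q = walk1 (2 * j) (2 * int K)"
    have "q * q \<le> walk1 (2 * j) (m + n) * walk1 (2 * j) (m - n)"
      unfolding q_def by (intro mult_mono walk1_le_even e e' K walk1_nonneg)
    moreover have "cbin j * cbin j - q * q \<le> w j"
    proof -
      have "0 \<le> (cbin j - q) * (cbin j - q)" by simp
      then show ?thesis unfolding w_def q_def[symmetric] by (simp add: algebra_simps)
    qed
    ultimately show "u j \<le> w j" by (simp add: u_def power2_eq_square)
  qed
  have w: "w sums (2 * (4 / pi * odd_harm K))" unfolding w_def by (intro sums_mult diagonal_sums)
  have su: "summable u" by (rule summable_comparison_test'[OF sums_summable[OF w], of 0]) (use u in auto)
  then have "u sums suminf u" by (rule summable_sums)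
  then have s: "(\<lambda>j. free_prob j 0 - free_prob j (lat m n)) sums suminf u"
    using pk_even_reindex[OF e] unfolding u_def by blast
  then show "summable (\<lambda>j. free_prob j 0 - free_prob j (lat m n))" by (rule sums_summable)
  have a: "potential_kernel (lat m n) = suminf u" unfolding potential_kernel_eq using s by (rule sums_unique[symmetric])
  show "0 \<le> potential_kernel (lat m n)" unfolding a using u su by (intro suminf_nonneg) auto
  have "suminf u \<le> suminf w" using u su w by (intro suminf_le) (auto simp: sums_summable)
  also have "\<dots> = 8 / pi * odd_harm K" using sums_unique[OF w] by simp
  finally show "potential_kernel (lat m n) \<le> 8 / pi * odd_harm K" unfolding a .
qed

lemma pk_diagonal: "potential_kernel (lat (int n) (int n)) = 4 / pi * odd_harm n"
proof -
  have "(\<lambda>j. (cbin j)\<^sup>2 - walk1 (2 * j) (int n + int n) * walk1 (2 * j) (int n - int n)) sums (4 / pi * odd_harm n)"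
  proof -
    have "int n + int n = 2 * int n" "int n - int n = 0" by simp_all
    then have "(cbin j)\<^sup>2 - walk1 (2 * j) (int n + int n) * walk1 (2 * j) (int n - int n) = cbin j * (cbin j - walk1 (2 * j) (2 * int n))" for j
      by (simp only: cbin_def power2_eq_square right_diff_distrib mult.commute)
    then show ?thesis using diagonal_sums[of n] by (simp only:)
  qed
  then have "(\<lambda>j. free_prob j 0 - free_prob j (lat (int n) (int n))) sums (4 / pi * odd_harm n)"
    by (subst (asm) pk_even_reindex) auto
  then show ?thesis unfolding potential_kernel_eq by (rule sums_unique[symmetric])
qed

definition pk_partial :: "nat \<Rightarrow> complex \<Rightarrow> real" where
  "pk_partial N z = (\<Sum>j<N. free_prob j 0 - free_prob j z)"

lemma pk_partial_rec: "pk_partial (Suc N) z = nmean (pk_partial N) z + free_prob N 0 - (if z = 0 then 1 else 0)"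
proof -
  have "nmean (pk_partial N) z = (\<Sum>j<N. free_prob j 0 - free_prob (Suc j) z)"
    unfolding pk_partial_def nmean_sum nmean_diff nmean_const free_prob_Suc ..
  also have "\<dots> = (\<Sum>j<N. free_prob j 0) - (\<Sum>j<N. free_prob (Suc j) z)" by (simp add: sum_subtractf)
  also have "(\<Sum>j<N. free_prob (Suc j) z) = (\<Sum>j<Suc N. free_prob j z) - free_prob 0 z"
    by (simp only: sum.lessThan_Suc_shift)
  finally have nm: "nmean (pk_partial N) z = (\<Sum>j<N. free_prob j 0) - ((\<Sum>j<Suc N. free_prob j z) - free_prob 0 z)" .
  have "pk_partial (Suc N) z = (\<Sum>j<N. free_prob j 0) + free_prob N 0 - (\<Sum>j<Suc N. free_prob j z)"
    by (simp only: pk_partial_def sum_subtractf sum.lessThan_Suc)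
  then show ?thesis unfolding nm killed_prob_0 by simp
qed

text \<open>At odd points the terms change sign with the parity of time and convergence is only
  conditional. The recursion of the partial sums expresses such a point through its four even
  neighbours and the vanishing return probability.\<close>

lemma pk_partial_tendsto:
  assumes "z \<in> square_lattice" shows "(\<lambda>N. pk_partial N z) \<longlonglongrightarrow> potential_kernel z"
proof -
  have ev: "(\<lambda>N. pk_partial N (lat m n)) \<longlonglongrightarrow> potential_kernel (lat m n)" if "even (m + n)" for m n
    unfolding pk_partial_def potential_kernel_eq
    by (rule summable_LIMSEQ[OF pk_even(1)[OF that, of "nat (\<bar>m + n\<bar> + \<bar>m - n\<bar>)"]]) auto
  obtain m n where mn: "z = lat m n" using lattice_coords[OF assms] by blast
  show ?thesis
  proof (cases "even (m + n)")
    case True then show ?thesis using ev mn by simp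
  next
    case False
    have z0: "z \<noteq> 0" using False mn by (auto simp: lat_eq_0)
    have "(\<lambda>N. nmean (pk_partial N) z + free_prob N 0 - 0) \<longlonglongrightarrow> nmean potential_kernel z + 0 - 0"
      unfolding mn nmean_lat
      by (intro tendsto_intros ev free_prob_0_tendsto) (use False in auto)
    then have "(\<lambda>N. pk_partial (Suc N) z) \<longlonglongrightarrow> nmean potential_kernel z" using z0 by (simp add: pk_partial_rec)
    then have "(\<lambda>N. pk_partial N z) \<longlonglongrightarrow> nmean potential_kernel z" by (rule LIMSEQ_imp_Suc)
    moreover from this have "potential_kernel z = nmean potential_kernel z"
      unfolding potential_kernel_eq[of z] pk_partial_def sums_def[symmetric] by (rule sums_unique[symmetric])
    ultimately show ?thesis by simp
  qed
qed

theorem pk_harmonic: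
  assumes "z \<in> square_lattice"
  shows "nmean potential_kernel z = potential_kernel z + (if z = 0 then 1 else 0)"
proof -
  have "(\<lambda>N. pk_partial (Suc N) z) \<longlonglongrightarrow> potential_kernel z"
    using pk_partial_tendsto[OF assms] by (rule LIMSEQ_Suc)
  moreover have "(\<lambda>N. pk_partial (Suc N) z) \<longlonglongrightarrow> nmean potential_kernel z + 0 - (if z = 0 then 1 else 0)"
    unfolding pk_partial_rec nmean_def
    by (intro tendsto_intros pk_partial_tendsto free_prob_0_tendsto lattice_add lattice_diff assms lattice_units) auto
  ultimately show ?thesis using LIMSEQ_unique by fastforce
qed

lemma pk_0: "potential_kernel 0 = 0"
  by (simp add: potential_kernel_eq)

text \<open>Odd points inherit the bounds from their even neighbours by harmonicity; the extra 1 in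
  the hypothesis makes room for these neighbours.\<close>

lemma pk_nonneg_le:
  assumes K: "\<bar>m\<bar> + \<bar>n\<bar> + 1 \<le> 2 * int K"
  shows "0 \<le> potential_kernel (lat m n)" "potential_kernel (lat m n) \<le> 8 / pi * odd_harm K"
proof -
  have ev: "0 \<le> potential_kernel (lat m' n') \<and> potential_kernel (lat m' n') \<le> 8 / pi * odd_harm K"
    if "even (m' + n')" "\<bar>m'\<bar> + \<bar>n'\<bar> \<le> 2 * int K" for m' n'
    using pk_even(2,3)[OF that(1), of K] that(2) by auto
  have "0 \<le> potential_kernel (lat m n) \<and> potential_kernel (lat m n) \<le> 8 / pi * odd_harm K"
  proof (cases "even (m + n)")
    case True then show ?thesis using ev K by simp
  next
    case False
    then have "lat m n \<noteq> 0" by (auto simp: lat_eq_0)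
    then have "potential_kernel (lat m n) = nmean potential_kernel (lat m n)" using pk_harmonic[OF lattice_Complex] by simp
    moreover have "0 \<le> potential_kernel (lat (m+1) n) \<and> potential_kernel (lat (m+1) n) \<le> 8 / pi * odd_harm K"
      by (rule ev) (use False K in auto)
    moreover have "0 \<le> potential_kernel (lat (m-1) n) \<and> potential_kernel (lat (m-1) n) \<le> 8 / pi * odd_harm K"
      by (rule ev) (use False K in auto)
    moreover have "0 \<le> potential_kernel (lat m (n+1)) \<and> potential_kernel (lat m (n+1)) \<le> 8 / pi * odd_harm K"
      by (rule ev) (use False K in auto)
    moreover have "0 \<le> potential_kernel (lat m (n-1)) \<and> potential_kernel (lat m (n-1)) \<le> 8 / pi * odd_harm K"
      by (rule ev) (use False K in auto)
    ultimately show ?thesis unfolding nmean_lat by argo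
  qed
  then show "0 \<le> potential_kernel (lat m n)" "potential_kernel (lat m n) \<le> 8 / pi * odd_harm K" by auto
qed

lemma pk_symmetries:
  "potential_kernel (lat n m) = potential_kernel (lat m n)"
  "potential_kernel (lat (- m) n) = potential_kernel (lat m n)"
proof -
  have s: "walk1 j (m - n) = walk1 j (n - m)" for j using walk1_sym[of j "m - n"] by simp
  have "free_prob j (lat n m) = free_prob j (lat m n)" for j
    unfolding free_prob_walk1 s by (simp add: add.commute)
  then show "potential_kernel (lat n m) = potential_kernel (lat m n)" unfolding potential_kernel_eq by simp
  have "walk1 j (- m - n) = walk1 j (m + n)" "walk1 j (- m + n) = walk1 j (m - n)" for j
    using walk1_sym[of j "m + n"] walk1_sym[of j "m - n"] by (simp_all add: algebra_simps)
  then have "free_prob j (lat (- m) n) = free_prob j (lat m n)" for j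
    unfolding free_prob_walk1 by (simp only: mult.commute)
  then show "potential_kernel (lat (- m) n) = potential_kernel (lat m n)" unfolding potential_kernel_eq by simp
qed

section \<open>Odd harmonic sums and Euler's constant\<close>

lemma odd_harm_eq: "odd_harm n = harm (2 * n) - harm n / 2"
proof (induction n)
  case 0 then show ?case by (simp add: odd_harm_def harm_def)
next
  case (Suc n)
  have A: "harm (2 * Suc n) = (harm (2 * n) + inverse (2 * real n + 1) + inverse (2 * real n + 2) :: real)"
    by (simp add: harm_Suc add_ac)
  have B: "harm (Suc n) = (harm n + inverse (real n + 1) :: real)" by (simp add: harm_Suc add_ac)
  have C: "inverse (2 * real n + 2) = inverse (real n + 1) / 2" by (simp add: field_simps)
  have "odd_harm (Suc n) = odd_harm n + inverse (2 * real n + 1)" by (simp add: odd_harm_def inverse_eq_divide)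
  then show ?case unfolding A B C Suc by argo
qed

text \<open>Times 4 / pi, and diminished by (2 / pi) ln (sqrt 2) because (n, n) has modulus sqrt 2
  n, this is \<open>k_zero\<close>; the term 3 ln 2 there is 4 ln 2 - ln 2.\<close>

definition odd_harm_const :: real where "odd_harm_const = ln 2 + euler_mascheroni / 2"

lemma odd_harm_limit: "(\<lambda>n. odd_harm n - ln (real n) / 2) \<longlonglongrightarrow> odd_harm_const"
proof -
  have 1: "(\<lambda>n. harm n - ln (real n)) \<longlonglongrightarrow> euler_mascheroni" by (rule euler_mascheroni_LIMSEQ)
  have "strict_mono (\<lambda>n::nat. 2 * n)" by (simp add: strict_mono_def)
  from LIMSEQ_subseq_LIMSEQ[OF 1 this] have 2: "(\<lambda>n. harm (2 * n) - ln (real (2 * n))) \<longlonglongrightarrow> euler_mascheroni"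
    by (simp add: o_def)
  have "(\<lambda>n. (harm (2 * n) - ln (real (2 * n))) - (harm n - ln (real n)) / 2 + ln 2) \<longlonglongrightarrow> euler_mascheroni - euler_mascheroni / 2 + ln 2"
    by (intro tendsto_intros 1 2) auto
  moreover have "\<forall>\<^sub>F n in sequentially. (harm (2 * n) - ln (real (2 * n))) - (harm n - ln (real n)) / 2 + ln 2 = odd_harm n - ln (real n) / 2"
    using eventually_gt_at_top[of 0]
    by eventually_elim (simp add: odd_harm_eq ln_mult field_simps)
  ultimately have "(\<lambda>n. odd_harm n - ln (real n) / 2) \<longlonglongrightarrow> euler_mascheroni - euler_mascheroni / 2 + ln 2"
    by (rule Lim_transform_eventually)
  then show ?thesis by (simp add: odd_harm_const_def add.commute)
qed

text \<open>For u = 1 / (2 N + 1) the expression in the middle is ln ((N + 1) / N) / 2, so an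
  increment of \<open>odd_harm\<close> is compared with one of the logarithm up to third
  order.\<close>

lemma artanh_bounds:
  fixes u :: real assumes u: "0 \<le> u" "u \<le> 1/2"
  shows "u \<le> (ln (1 + u) - ln (1 - u)) / 2" "(ln (1 + u) - ln (1 - u)) / 2 \<le> u + u ^ 3"
proof -
  have D: "((\<lambda>u. (ln (1 + u) - ln (1 - u)) / 2) has_real_derivative 1 / (1 - t\<^sup>2)) (at t)" if "0 \<le> t" "t \<le> u" for t
  proof -
    have "((\<lambda>u. (ln (1 + u) - ln (1 - u)) / 2) has_real_derivative (1 / (1 + t) + 1 / (1 - t)) / 2) (at t)"
      using that u by (auto intro!: derivative_eq_intros)
    moreover have "(1 / (1 + t) + 1 / (1 - t)) / 2 = 1 / (1 - t\<^sup>2)"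
    proof -
      have "1 + t \<noteq> 0" "1 - t \<noteq> 0" using that u by auto
      then have "1 / (1 + t) + 1 / (1 - t) = ((1 - t) + (1 + t)) / ((1 + t) * (1 - t))"
        by (simp add: add_frac_eq)
      moreover have "(1 + t) * (1 - t) = 1 - t\<^sup>2" "(1 - t) + (1 + t) = 2" by (simp_all add: power2_eq_square algebra_simps)
      moreover have "2 / c / 2 = 1 / c" for c :: real by simp
      ultimately show ?thesis by (simp only:)
    qed
    ultimately show ?thesis by simp
  qed
  have t2: "t\<^sup>2 \<le> 1/4" if "0 \<le> t" "t \<le> u" for t
    using power_mono[of t "1/2" 2] that u by (simp add: power2_eq_square)
  have "(ln (1 + 0) - ln (1 - 0)) / 2 - 0 \<le> (ln (1 + u) - ln (1 - u)) / 2 - u"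
  proof (rule DERIV_nonneg_imp_nondecreasing[OF u(1)])
    fix t assume t: "0 \<le> t" "t \<le> u"
    have "1 - t\<^sup>2 > 0" "1 - t\<^sup>2 \<le> 1" using t2[OF t] by auto
    then have "1 / (1 - t\<^sup>2) - 1 \<ge> 0" by simp
    then show "\<exists>y. ((\<lambda>u. (ln (1 + u) - ln (1 - u)) / 2 - u) has_real_derivative y) (at t) \<and> 0 \<le> y"
      using DERIV_diff[OF D[OF t] DERIV_ident] by blast
  qed
  then show "u \<le> (ln (1 + u) - ln (1 - u)) / 2" by simp
  have "0 + 0 ^ 3 - (ln (1 + 0) - ln (1 - 0)) / 2 \<le> u + u ^ 3 - (ln (1 + u) - ln (1 - u)) / 2"
  proof (rule DERIV_nonneg_imp_nondecreasing[OF u(1)])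
    fix t assume t: "0 \<le> t" "t \<le> u"
    have p: "1 - t\<^sup>2 > 0" using t2[OF t] by auto
    have "0 \<le> t\<^sup>2 * (2 - 3 * t\<^sup>2)" using t2[OF t] by (intro mult_nonneg_nonneg) auto
    then have "1 \<le> (1 + 3 * t\<^sup>2) * (1 - t\<^sup>2)" by (simp add: algebra_simps)
    then have "1 / (1 - t\<^sup>2) \<le> 1 + 3 * t\<^sup>2" using p by (simp add: divide_le_eq)
    moreover have "((\<lambda>t. t + t ^ 3) has_real_derivative 1 + 3 * t\<^sup>2) (at t)"
      by (auto intro!: derivative_eq_intros)
    ultimately show "\<exists>y. ((\<lambda>u. u + u ^ 3 - (ln (1 + u) - ln (1 - u)) / 2) has_real_derivative y) (at t) \<and> 0 \<le> y"
      using DERIV_diff[OF _ D[OF t], of "\<lambda>t. t + t ^ 3"] by force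
  qed
  then show "(ln (1 + u) - ln (1 - u)) / 2 \<le> u + u ^ 3" by simp
qed

lemma odd_harm_asymp:
  assumes "n \<ge> 1"
  shows "0 \<le> odd_harm n - ln (real n) / 2 - odd_harm_const" "odd_harm n - ln (real n) / 2 - odd_harm_const \<le> 1 / (real n)\<^sup>2"
proof -
  define e where "e = (\<lambda>n. odd_harm (Suc n) - ln (real (Suc n)) / 2)"
  have lim: "e \<longlonglongrightarrow> odd_harm_const" unfolding e_def using odd_harm_limit by (rule LIMSEQ_Suc)
  have step: "e (Suc k) \<le> e k" "e k - e (Suc k) \<le> 1 / (real (Suc k))\<^sup>2 - 1 / (real (Suc (Suc k)))\<^sup>2" for k
  proof -
    define N where "N = real (Suc k)"
    have N: "N \<ge> 1" by (simp add: N_def)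
    define u where "u = 1 / (2 * N + 1)"
    have u: "0 \<le> u" "u \<le> 1/2" using N by (auto simp: u_def)
    define N1 where "N1 = N + 1"
    have N1: "N1 > 0" using N by (simp add: N1_def)
    have "1 + u = (2 * N1) * u" "1 - u = (2 * N) * u" using N by (simp_all add: u_def N1_def field_simps)
    moreover have "u > 0" using N by (simp add: u_def)
    ultimately have "ln (1 + u) = ln 2 + ln N1 + ln u" "ln (1 - u) = ln 2 + ln N + ln u"
      using N N1 by (simp_all add: ln_mult)
    then have l: "(ln (1 + u) - ln (1 - u)) / 2 = ln N1 / 2 - ln N / 2" by simp
    have oh: "odd_harm (Suc (Suc k)) = odd_harm (Suc k) + u" by (simp add: odd_harm_def u_def N_def)
    have rN: "real (Suc (Suc k)) = N1" by (simp add: N1_def N_def)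
    have d: "e k - e (Suc k) = (ln (1 + u) - ln (1 - u)) / 2 - u"
      unfolding l e_def oh rN N_def[symmetric] by simp
    show "e (Suc k) \<le> e k" using d artanh_bounds(1)[OF u] by argo
    have "e k - e (Suc k) \<le> u ^ 3" using d artanh_bounds(2)[OF u] by argo
    \<comment> \<open>The bound is made to telescope: once u^3 is at most 1 / N^2 - 1 / (N + 1)^2,
      the sequence e decreases and its correction by 1 / n^2 increases to the same limit.\<close>
    also have "u ^ 3 = (2 * N + 1) / (2 * N + 1) ^ 4" using N by (simp add: u_def power_divide eval_nat_numeral)
    also have "\<dots> \<le> (2 * N + 1) / (N\<^sup>2 * (N + 1)\<^sup>2)"
    proof (rule divide_left_mono)
      have "N * (N + 1) \<le> (2 * N + 1)\<^sup>2" using N by (simp add: power2_eq_square algebra_simps)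
      then have "(N * (N + 1))\<^sup>2 \<le> ((2 * N + 1)\<^sup>2)\<^sup>2" using N by (intro power_mono) auto
      then show "N\<^sup>2 * (N + 1)\<^sup>2 \<le> (2 * N + 1) ^ 4" by (simp add: power_mult_distrib)
    qed (use N in auto)
    also have "\<dots> = 1 / N\<^sup>2 - 1 / (N + 1)\<^sup>2"
    proof -
      have "1 / N\<^sup>2 - 1 / (N + 1)\<^sup>2 = ((N + 1)\<^sup>2 - N\<^sup>2) / (N\<^sup>2 * (N + 1)\<^sup>2)" using N by (simp add: diff_frac_eq)
      moreover have "(N + 1)\<^sup>2 - N\<^sup>2 = 2 * N + 1" by (simp add: power2_eq_square algebra_simps)
      ultimately show ?thesis by simp
    qed
    finally show "e k - e (Suc k) \<le> 1 / (real (Suc k))\<^sup>2 - 1 / (real (Suc (Suc k)))\<^sup>2" by (simp add: N_def add_ac)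
  qed
  have ge: "odd_harm_const \<le> e k" for k by (rule decseq_ge[OF decseq_SucI lim]) (rule step)
  have lim2: "(\<lambda>k. e k - 1 / (real (Suc k))\<^sup>2) \<longlonglongrightarrow> odd_harm_const - 0"
    by (intro tendsto_intros lim) real_asymp
  have inc: "incseq (\<lambda>k. e k - 1 / (real (Suc k))\<^sup>2)"
    by (rule incseq_SucI) (use step(2) in \<open>smt (verit)\<close>)
  have le: "e k - 1 / (real (Suc k))\<^sup>2 \<le> odd_harm_const" for k using incseq_le[OF inc lim2] by simp
  obtain k where "n = Suc k" using assms by (cases n) auto
  then show "0 \<le> odd_harm n - ln (real n) / 2 - odd_harm_const" "odd_harm n - ln (real n) / 2 - odd_harm_const \<le> 1 / (real n)\<^sup>2"
    using ge[of k] le[of k] by (auto simp: e_def)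
qed

section \<open>The error of the logarithmic asymptotics and its lattice Laplacian\<close>

definition pk_err :: "complex \<Rightarrow> real" where
  "pk_err z = potential_kernel z - (2 / pi * ln (cmod z) + k_zero)"

lemma cmod_lat: "(cmod (lat m n))\<^sup>2 = (of_int m)\<^sup>2 + (of_int n)\<^sup>2" by (simp add: cmod_power2)

lemma pk_err_symmetries: "pk_err (lat n m) = pk_err (lat m n)" "pk_err (lat (- m) n) = pk_err (lat m n)"
proof -
  have "cmod (lat n m) = cmod (lat m n)" by (simp add: cmod_def add.commute)
  then show "pk_err (lat n m) = pk_err (lat m n)" unfolding pk_err_def pk_symmetries(1)[of n m] by simp
  have "cmod (lat (- m) n) = cmod (lat m n)" by (simp add: cmod_def)
  then show "pk_err (lat (- m) n) = pk_err (lat m n)" unfolding pk_err_def pk_symmetries(2)[of m n] by simp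
qed

lemma pk_err_sym3: "pk_err (lat m (- n)) = pk_err (lat m n)"
  using pk_err_symmetries(1)[of m "- n"] pk_err_symmetries(2)[of n m] pk_err_symmetries(1)[of n m] by simp

lemma pk_err_diagonal:
  assumes "n \<ge> 1" shows "\<bar>pk_err (lat (int n) (int n))\<bar> \<le> 4 / (cmod (lat (int n) (int n)))\<^sup>2"
proof -
  have n: "real n > 0" using assms by simp
  have c2: "(cmod (lat (int n) (int n)))\<^sup>2 = 2 * (real n)\<^sup>2" using cmod_lat[of "int n" "int n"] by simp
  have "cmod (lat (int n) (int n)) = sqrt (2 * (real n)\<^sup>2)" using c2 by (metis norm_ge_zero real_sqrt_unique)
  then have "ln (cmod (lat (int n) (int n))) = ln 2 / 2 + ln (real n)"
    using n by (simp add: real_sqrt_mult ln_mult ln_sqrt)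
  then have "pk_err (lat (int n) (int n)) = 4 / pi * (odd_harm n - ln (real n) / 2 - odd_harm_const)"
    unfolding pk_err_def pk_diagonal k_zero_def odd_harm_const_def by (simp add: field_simps)
  moreover have "\<bar>4 / pi * (odd_harm n - ln (real n) / 2 - odd_harm_const)\<bar> \<le> 2 * (1 / (real n)\<^sup>2)"
    unfolding abs_mult using odd_harm_asymp[OF assms] pi_gt3
    by (intro mult_mono) (auto simp: divide_le_eq)
  ultimately show ?thesis unfolding c2 by simp
qed

text \<open>Far out this is Taylor expansion of the branch Ln (w / z). For |z| < 4 both terms lie
  between 0 and 2, while 512 / |z|^4 >= 2. The condition |z| > 1 keeps the neighbours away from 0,
  where \<open>ln\<close> has a default value.\<close>

lemma nmean_ln:
  assumes z: "z \<in> square_lattice" "cmod z > 1"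
  shows "\<bar>nmean (\<lambda>w. ln (cmod w)) z - ln (cmod z)\<bar> \<le> 512 / cmod z ^ 4"
proof (cases "cmod z \<ge> 4")
  case True
  define d where "d = cmod z"
  have d: "d \<ge> 4" "d > 0" using True by (auto simp: d_def)
  have z0: "z \<noteq> 0" using z by auto
  define f where "f = (\<lambda>w. Ln (w / z))"
  have w1: "w / z = 1 + (w - z) / z" for w using z0 by (simp add: field_simps)
  have lt: "cmod ((w - z) / z) < 1" if "w \<in> ball z d" for w
    using that z0 by (simp add: norm_divide d_def dist_norm norm_minus_commute)
  have Re: "Re (w / z) > 0" if "w \<in> ball z d" for w
    unfolding w1[of w] using abs_Re_le_cmod[of "(w - z) / z"] lt[OF that] by simp
  have fh: "f holomorphic_on ball z d" unfolding f_def
  proof (intro holomorphic_intros z0)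
    fix w assume "w \<in> ball z d"
    then show "w / z \<notin> \<real>\<^sub>\<le>\<^sub>0" using Re[of w] by (auto simp: complex_nonpos_Reals_iff)
  qed
  have bnd: "cmod (f w - f z) < 1" if "w \<in> ball z (d / 2)" for w
  proof -
    have h: "cmod ((w - z) / z) < 1/2" using that z0 d by (simp add: norm_divide d_def dist_norm norm_minus_commute field_simps)
    have "cmod (f w - f z) = cmod (Ln (1 + (w - z) / z))" using z0 by (simp add: f_def w1[of w])
    also have "\<dots> \<le> 2 * cmod ((w - z) / z)" by (rule norm_Ln_le[OF h])
    finally show ?thesis using h by linarith
  qed
  have "cmod (cmean f z - f z) \<le> 32 * 1 / d ^ 4"
    by (rule lattice_taylor(3)[OF fh d(1) _ half_ball_coeff[OF fh bnd d(2)]]) auto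
  moreover have "nmean (\<lambda>w. ln (cmod w)) z - ln (cmod z) = Re (cmean f z - f z)"
  proof -
    have Ref: "Re (f w) = ln (cmod w) - ln (cmod z)" if "w \<noteq> 0" for w
      using that z0 by (simp add: f_def norm_divide ln_div)
    have nz: "z + e \<noteq> 0" if "cmod e = 1" for e
    proof
      assume "z + e = 0"
      then have "z = - e" by (simp add: eq_neg_iff_add_eq_0)
      then have "cmod z = 1" using that by simp
      then show False using z by simp
    qed
    have "Re (cmean f z - f z) = (Re (f (z + 1)) + Re (f (z - 1)) + Re (f (z + \<i>)) + Re (f (z - \<i>))) / 4 - Re (f z)"
      by simp
    also have "\<dots> = nmean (\<lambda>w. ln (cmod w)) z - ln (cmod z)"
      using Ref[OF nz[of 1]] Ref[OF nz[of "-1"]] Ref[OF nz[of \<i>]] Ref[OF nz[of "-\<i>"]] Ref[OF z0]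
      by (simp add: nmean_def field_simps)
    finally show ?thesis by simp
  qed
  ultimately have "\<bar>nmean (\<lambda>w. ln (cmod w)) z - ln (cmod z)\<bar> \<le> 32 / d ^ 4"
    using abs_Re_le_cmod[of "cmean f z - f z"] by simp
  also have "\<dots> \<le> 512 / d ^ 4" using d by (intro divide_right_mono) auto
  finally show ?thesis by (simp add: d_def)
next
  case False
  have lnb: "0 \<le> ln (cmod w) \<and> ln (cmod w) \<le> 2" if wh: "w \<in> square_lattice" "w \<noteq> 0" "cmod w \<le> 5" for w
  proof -
    obtain m n where mn: "w = lat m n" using lattice_coords[OF wh(1)] by blast
    then have "m \<noteq> 0 \<or> n \<noteq> 0" using wh(2) lat_eq_0 by blast
    then have "1 \<le> m\<^sup>2 + n\<^sup>2" by (smt (verit) zero_eq_power2 zero_le_power2)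
    then have "1 \<le> real_of_int (m\<^sup>2 + n\<^sup>2)" by linarith
    then have "1 \<le> (cmod w)\<^sup>2" unfolding mn cmod_lat by simp
    then have c: "1 \<le> cmod w" using power2_le_imp_le[of 1 "cmod w"] by simp
    have "ln (cmod w) \<le> ln (exp 2)"
    proof (subst ln_le_cancel_iff)
      have "(5::real) \<le> 1 + 2 + 2\<^sup>2 / 2" by simp
      also have "\<dots> \<le> exp 2" by (rule exp_lower_Taylor_quadratic) simp
      finally show "cmod w \<le> exp 2" using wh(3) by simp
    qed (use c in auto)
    then show ?thesis using c by simp
  qed
  have nb: "0 \<le> ln (cmod (z + e)) \<and> ln (cmod (z + e)) \<le> 2" if e: "e \<in> {1, -1, \<i>, -\<i>}" for e
  proof (rule lnb)
    have ce: "cmod e = 1" using e by auto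
    show "z + e \<in> square_lattice" by (intro lattice_add z lattice_units e)
    show "z + e \<noteq> 0"
    proof
      assume "z + e = 0"
      then have "z = - e" by (simp add: eq_neg_iff_add_eq_0)
      then show False using z ce by simp
    qed
    show "cmod (z + e) \<le> 5" using norm_triangle_ineq[of z e] ce False by simp
  qed
  have "z \<noteq> 0" using z by auto
  then have z2: "0 \<le> ln (cmod z) \<and> ln (cmod z) \<le> 2" using lnb[OF z(1)] False by simp
  have "0 \<le> nmean (\<lambda>w. ln (cmod w)) z" "nmean (\<lambda>w. ln (cmod w)) z \<le> 2"
    using nmean_mono[of "\<lambda>_. 0" z "\<lambda>w. ln (cmod w)"] nmean_mono[of "\<lambda>w. ln (cmod w)" z "\<lambda>_. 2"] nb
    unfolding nmean_const by blast+
  then have "\<bar>nmean (\<lambda>w. ln (cmod w)) z - ln (cmod z)\<bar> \<le> 2" using z2 by linarith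
  also have "2 \<le> 512 / cmod z ^ 4"
  proof -
    have "cmod z ^ 4 \<le> 4 ^ 4" using False by (intro power_mono) auto
    then show ?thesis using z by (subst le_divide_eq) auto
  qed
  finally show ?thesis .
qed

lemma pk_err_laplacian:
  assumes z: "z \<in> square_lattice" "cmod z > 1"
  shows "\<bar>nmean pk_err z - pk_err z\<bar> \<le> 512 / cmod z ^ 4"
proof -
  have z0: "z \<noteq> 0" using z by auto
  have "nmean pk_err z = nmean potential_kernel z - (2 / pi * nmean (\<lambda>w. ln (cmod w)) z + k_zero)"
    unfolding pk_err_def[abs_def] nmean_diff nmean_add nmean_cmult nmean_const ..
  then have "nmean pk_err z - pk_err z = - (2 / pi) * (nmean (\<lambda>w. ln (cmod w)) z - ln (cmod z))"
    using pk_harmonic[OF z(1)] z0 by (simp add: pk_err_def algebra_simps)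
  moreover have "\<bar>- (2 / pi) * X\<bar> = 2 / pi * \<bar>X\<bar>" for X :: real by (simp add: abs_mult)
  ultimately have "\<bar>nmean pk_err z - pk_err z\<bar> = 2 / pi * \<bar>nmean (\<lambda>w. ln (cmod w)) z - ln (cmod z)\<bar>"
    by (simp only:)
  also have "\<dots> \<le> 1 * (512 / cmod z ^ 4)"
    by (intro mult_mono nmean_ln z) (use pi_gt3 in \<open>auto simp: divide_le_eq\<close>)
  finally show ?thesis by simp
qed

section \<open>Asymptotics in a quarter plane\<close>

text \<open>Despite its name this is z^(-3/2), in the branch that is positive on the positive
  axis.\<close>

definition cube_root_inv :: "complex \<Rightarrow> complex" where "cube_root_inv z = 1 / (z * csqrt z)"

lemma cube_root_inv_norm: "cmod (cube_root_inv z) = 1 / (cmod z * sqrt (cmod z))"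
  by (simp add: cube_root_inv_def norm_divide norm_mult)

text \<open>In the quarter plane z^(-3/2) has argument at most 3 pi / 8 in modulus, so its real part
  is comparable to its modulus. For the square root q = a + i b this means |b| <= a / 2 and Re (q^3)
  = a (a^2 - 3 b^2) >= a^3 / 4.\<close>

lemma cube_root_inv_lower:
  assumes "\<bar>Im z\<bar> \<le> Re z" "z \<noteq> 0"
  shows "1 / (8 * (cmod z * sqrt (cmod z))) \<le> Re (cube_root_inv z)"
proof -
  define q a b s where "q = csqrt z" and "a = Re q" and "b = Im q" and "s = cmod q"
  have q2: "q\<^sup>2 = z" by (simp add: q_def)
  have q0: "q \<noteq> 0" using q2 assms(2) by auto
  have Rez: "Re z = a\<^sup>2 - b\<^sup>2" "Im z = 2 * a * b" using q2 by (auto simp: a_def b_def power2_eq_square)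
  have s2: "s\<^sup>2 = a\<^sup>2 + b\<^sup>2" by (simp add: s_def cmod_power2 a_def b_def)
  have s0: "s > 0" using q0 by (simp add: s_def)
  have cz: "cmod z = s\<^sup>2" using q2 by (metis norm_power s_def)
  have a0: "a \<ge> 0" by (simp add: a_def q_def csqrt_principal less_imp_le del: csqrt.simps) (metis csqrt_principal less_eq_real_def)
  have ab: "2 * a * \<bar>b\<bar> \<le> a\<^sup>2 - b\<^sup>2" using assms(1) a0 unfolding Rez by (simp add: abs_mult)
  have ap: "a > 0"
  proof (rule ccontr)
    assume "\<not> a > 0"
    then have "a = 0" using a0 by simp
    then have "b = 0" using ab by simp
    then show False using \<open>a = 0\<close> s2 s0 by simp
  qed
  have "2 * a * \<bar>b\<bar> \<le> a\<^sup>2" using ab zero_le_power2[of b] by argo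
  then have "a * (2 * \<bar>b\<bar>) \<le> a * a" by (simp add: power2_eq_square)
  then have "2 * \<bar>b\<bar> \<le> a" using ap by (simp only: mult_le_cancel_left_pos)
  then have hb: "\<bar>b\<bar> \<le> a / 2" by simp
  have b2: "b\<^sup>2 \<le> a\<^sup>2 / 4" using power_mono[OF hb, of 2] by (simp add: power_divide)
  have "(5 / 4 * a)\<^sup>2 = 25 / 16 * a\<^sup>2" by (simp add: power_mult_distrib power_divide)
  then have "s\<^sup>2 \<le> (5 / 4 * a)\<^sup>2" using s2 b2 zero_le_power2[of a] by argo
  then have s54: "s \<le> 5 / 4 * a" by (rule power2_le_imp_le) (use ap in auto)
  have "s ^ 3 \<le> (5 / 4 * a) ^ 3" using s54 s0 by (intro power_mono) auto
  also have "\<dots> \<le> 2 * a ^ 3" using ap by (simp add: power_mult_distrib power_divide)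
  finally have s3: "s ^ 3 / 8 \<le> a ^ 3 / 4" by simp
  have "a ^ 3 / 4 = a * (a\<^sup>2 / 4)" by (simp add: power3_eq_cube power2_eq_square)
  also have "\<dots> \<le> a * (a\<^sup>2 - 3 * b\<^sup>2)" using b2 ap by (intro mult_left_mono) auto
  also have "\<dots> = Re (q ^ 3)" unfolding power3_eq_cube power2_eq_square by (simp add: a_def[symmetric] b_def[symmetric] algebra_simps del: csqrt.simps)
  finally have R: "s ^ 3 / 8 \<le> Re (q ^ 3)" using s3 by simp
  have "cube_root_inv z = 1 / q ^ 3" unfolding cube_root_inv_def q_def[symmetric] using q2 by (metis power2_eq_square power3_eq_cube)
  then have "Re (cube_root_inv z) = Re (q ^ 3) / (cmod (q ^ 3))\<^sup>2"
    by (simp add: Re_divide cmod_power2)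
  also have "cmod (q ^ 3) = s ^ 3" by (simp add: s_def norm_power)
  also have "(s ^ 3 / 8) / (s ^ 3)\<^sup>2 \<le> Re (q ^ 3) / (s ^ 3)\<^sup>2" using R by (intro divide_right_mono) auto
  then have "1 / (8 * s ^ 3) \<le> Re (q ^ 3) / (s ^ 3)\<^sup>2"
  proof -
    have "s ^ 3 > 0" using s0 by simp
    moreover have "(t / 8) / t\<^sup>2 = 1 / (8 * t)" if "t > 0" for t :: real using that by (simp add: power2_eq_square)
    ultimately have "(s ^ 3 / 8) / (s ^ 3)\<^sup>2 = 1 / (8 * s ^ 3)" by blast
    then show ?thesis using \<open>(s ^ 3 / 8) / (s ^ 3)\<^sup>2 \<le> Re (q ^ 3) / (s ^ 3)\<^sup>2\<close> by simp
  qed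
  moreover have "cmod z * sqrt (cmod z) = s ^ 3" unfolding cz using s0 by (simp add: power3_eq_cube power2_eq_square)
  ultimately show ?thesis by simp
qed

lemma cube_root_inv_laplacian:
  assumes z: "\<bar>Im z\<bar> \<le> Re z" "cmod z \<ge> 8"
  shows "\<bar>nmean (\<lambda>w. Re (cube_root_inv w)) z - Re (cube_root_inv z)\<bar> \<le> 2048 / (cmod z ^ 5 * sqrt (cmod z))"
proof -
  define r d where "r = cmod z" and "d = cmod z / 2"
  have r: "r \<ge> 8" using z(2) by (simp add: r_def)
  have d: "d \<ge> 4" "d > 0" using z(2) by (auto simp: d_def)
  have zRe: "cmod z \<le> 2 * Re z" using cmod_le[of z] z(1) by linarith
  have inb: "Re w > 0" if "w \<in> ball z d" for w
  proof -
    have "\<bar>Re (z - w)\<bar> < d" using abs_Re_le_cmod[of "z - w"] that by (simp add: dist_norm)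
    then have "Re z - Re w < d" by (simp add: abs_less_iff)
    then show ?thesis using zRe unfolding d_def by argo
  qed
  have fh: "cube_root_inv holomorphic_on ball z d"
    unfolding cube_root_inv_def[abs_def]
    by (intro holomorphic_intros) (auto dest: inb simp: complex_nonpos_Reals_iff simp del: mem_ball)
  have bnd: "cmod (cube_root_inv w - cube_root_inv z) < 4 / (r * sqrt r)" if w: "w \<in> ball z (d / 2)" for w
  proof -
    have "cmod z - cmod w \<le> cmod (z - w)" by (rule norm_triangle_ineq2)
    then have cw: "3 / 4 * r \<le> cmod w" using w by (simp add: dist_norm d_def r_def)
    have "r * sqrt r / 2 \<le> cmod w * sqrt (cmod w)"
    proof -
      have "sqrt (9 / 16 * r) \<le> sqrt (cmod w)" using cw r by (intro real_sqrt_le_mono) linarith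
      moreover have "sqrt (9 / 16 * r) = 3 / 4 * sqrt r" by (simp add: real_sqrt_mult real_sqrt_divide)
      ultimately have "3 / 4 * sqrt r \<le> sqrt (cmod w)" by metis
      then have "3 / 4 * r * (3 / 4 * sqrt r) \<le> cmod w * sqrt (cmod w)" using cw r by (intro mult_mono) auto
      moreover have "r * sqrt r \<ge> 0" using r by simp
      moreover have "3 / 4 * r * (3 / 4 * sqrt r) = 9 / 16 * (r * sqrt r)" by simp
      ultimately show ?thesis by argo
    qed
    then have "1 / (cmod w * sqrt (cmod w)) \<le> 1 / (r * sqrt r / 2)" using r by (intro divide_left_mono mult_pos_pos) (use cw in auto)
    then have "cmod (cube_root_inv w) \<le> 2 / (r * sqrt r)" by (simp add: cube_root_inv_norm)
    moreover have "cmod (cube_root_inv z) = 1 / (r * sqrt r)" by (simp add: cube_root_inv_norm r_def)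
    moreover have "1 / (r * sqrt r) > 0" using r by simp
    moreover have "2 / (r * sqrt r) = 2 * (1 / (r * sqrt r))" "4 / (r * sqrt r) = 4 * (1 / (r * sqrt r))" by simp_all
    ultimately show ?thesis using norm_triangle_ineq4[of "cube_root_inv w" "cube_root_inv z"] by linarith
  qed
  have "cmod (cmean cube_root_inv z - cube_root_inv z) \<le> 32 * (4 / (r * sqrt r)) / d ^ 4"
    by (rule lattice_taylor(3)[OF fh d(1) _ half_ball_coeff[OF fh bnd d(2)]]) (use r in auto)
  also have "\<dots> = 2048 / (r ^ 5 * sqrt r)" by (simp add: d_def r_def power_divide eval_nat_numeral)
  finally have "\<bar>Re (cmean cube_root_inv z - cube_root_inv z)\<bar> \<le> 2048 / (r ^ 5 * sqrt r)"
    using abs_Re_le_cmod order_trans by blast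
  moreover have "Re (cmean cube_root_inv z - cube_root_inv z) = nmean (\<lambda>w. Re (cube_root_inv w)) z - Re (cube_root_inv z)"
    by (simp add: nmean_def)
  ultimately show ?thesis by (simp add: r_def)
qed

text \<open>The continuous Laplacian of |z|^-2 is 4 |z|^-4. On the lattice opposite neighbours
  combine to exact fractions 2 P / X and 2 P / Y; the harmonic-arithmetic mean inequality reduces
  them to X + Y, which depends on |z| alone.\<close>

lemma inverse_square_laplacian:
  assumes z: "cmod z \<ge> 2"
  shows "1 / (cmod z)\<^sup>2 + 1 / (4 * cmod z ^ 4) \<le> nmean (\<lambda>w. 1 / (cmod w)\<^sup>2) z"
proof -
  define m n s P where "m = Re z" and "n = Im z" and "s = (cmod z)\<^sup>2" and "P = s + 1"
  have s: "s = m\<^sup>2 + n\<^sup>2" by (simp add: s_def m_def n_def cmod_power2)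
  have s4: "s \<ge> 4" using power_mono[OF z, of 2] by (simp add: s_def)
  have e: "(cmod (z + 1))\<^sup>2 = P + 2 * m" "(cmod (z - 1))\<^sup>2 = P - 2 * m"
    "(cmod (z + \<i>))\<^sup>2 = P + 2 * n" "(cmod (z - \<i>))\<^sup>2 = P - 2 * n"
    unfolding P_def s cmod_power2 by (simp_all add: m_def n_def power2_eq_square algebra_simps)
  have pair: "1 / (P + 2 * t) + 1 / (P - 2 * t) = 2 * P / (P\<^sup>2 - 4 * t\<^sup>2)" and pos: "P\<^sup>2 - 4 * t\<^sup>2 > 0" if t: "t\<^sup>2 \<le> s" for t
  proof -
    have "(s - 1)\<^sup>2 > 0" using s4 by simp
    moreover have "P\<^sup>2 - 4 * s = (s - 1)\<^sup>2" by (simp add: P_def power2_eq_square algebra_simps)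
    ultimately show pos: "P\<^sup>2 - 4 * t\<^sup>2 > 0" using t by linarith
    have f: "P\<^sup>2 - 4 * t\<^sup>2 = (P + 2 * t) * (P - 2 * t)" by (simp add: power2_eq_square algebra_simps)
    then have "P + 2 * t \<noteq> 0" "P - 2 * t \<noteq> 0" using pos by auto
    then show "1 / (P + 2 * t) + 1 / (P - 2 * t) = 2 * P / (P\<^sup>2 - 4 * t\<^sup>2)" unfolding f by (simp add: add_frac_eq)
  qed
  define X Y where "X = P\<^sup>2 - 4 * m\<^sup>2" and "Y = P\<^sup>2 - 4 * n\<^sup>2"
  have mn: "m\<^sup>2 \<le> s" "n\<^sup>2 \<le> s" by (auto simp: s)
  have XY: "X > 0" "Y > 0" unfolding X_def Y_def using pos mn by auto
  define Q where "Q = s\<^sup>2 + 1"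
  have sum: "X + Y = 2 * Q" unfolding Q_def by (simp add: X_def Y_def P_def s power2_eq_square algebra_simps)
  have amhm: "4 / (X + Y) \<le> 1 / X + 1 / Y"
  proof -
    have "4 * (X * Y) \<le> (X + Y) * (X + Y)" using sum_squares_bound[of X Y] by (simp add: power2_eq_square algebra_simps)
    then have "4 / (X + Y) \<le> (X + Y) / (X * Y)" using XY by (simp add: divide_le_eq le_divide_eq field_simps)
    also have "\<dots> = 1 / X + 1 / Y" using XY by (simp add: field_simps)
    finally show ?thesis .
  qed
  have "nmean (\<lambda>w. 1 / (cmod w)\<^sup>2) z = (2 * P / X + 2 * P / Y) / 4"
    unfolding nmean_def e X_def Y_def using pair[OF mn(1)] pair[OF mn(2)] by simp
  also have "\<dots> = P / 2 * (1 / X + 1 / Y)" by (simp add: field_simps)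
  also have "P / 2 * (1 / X + 1 / Y) \<ge> P / 2 * (4 / (X + Y))" using amhm s4 by (intro mult_left_mono) (auto simp: P_def)
  finally have "P / Q \<le> nmean (\<lambda>w. 1 / (cmod w)\<^sup>2) z" unfolding sum by simp
  then have "P / (s\<^sup>2 + 1) \<le> nmean (\<lambda>w. 1 / (cmod w)\<^sup>2) z" unfolding Q_def .
  moreover have "1 / s + 1 / (4 * s\<^sup>2) \<le> P / (s\<^sup>2 + 1)"
  proof -
    have "0 \<le> (3 * s + 1) * (s - 4)" using s4 by (intro mult_nonneg_nonneg) auto
    then have "(4 * s + 1) * (s\<^sup>2 + 1) \<le> P * (4 * s\<^sup>2)"
    proof -
      have "P * (4 * s\<^sup>2) - (4 * s + 1) * (s\<^sup>2 + 1) = 3 * s\<^sup>2 - 4 * s - 1"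
        by (simp add: P_def power2_eq_square algebra_simps)
      moreover have "3 * s\<^sup>2 - 4 * s - 1 \<ge> 0"
      proof -
        have "3 * s\<^sup>2 - 4 * s - 1 = (3 * s + 1) * (s - 4) + 7 * s + 3" by (simp add: power2_eq_square algebra_simps)
        then show ?thesis using \<open>0 \<le> (3 * s + 1) * (s - 4)\<close> s4 by linarith
      qed
      ultimately show ?thesis by linarith
    qed
    then have A: "(4 * s + 1) * Q \<le> P * (4 * s\<^sup>2)" by (simp only: Q_def)
    have Qp: "Q > 0" unfolding Q_def by (rule add_nonneg_pos) auto
    have "(4 * s + 1) / (4 * s\<^sup>2) \<le> P / Q"
    proof (rule mult_imp_div_pos_le)
      show "0 < 4 * s\<^sup>2" using s4 by simp
      show "4 * s + 1 \<le> P / Q * (4 * s\<^sup>2)"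
        using A by (simp add: pos_le_divide_eq[OF Qp])
    qed
    then have "(4 * s + 1) / (4 * s\<^sup>2) \<le> P / (s\<^sup>2 + 1)" by (simp only: Q_def)
    moreover have "(4 * s + 1) / (4 * s\<^sup>2) = 1 / s + 1 / (4 * s\<^sup>2)" using s4 by (simp add: add_divide_distrib power2_eq_square)
    ultimately show ?thesis by simp
  qed
  moreover have "s\<^sup>2 = cmod z ^ 4" by (simp add: s_def)
  ultimately show ?thesis by (simp add: s_def)
qed

text \<open>The first term carries the decay and is lattice harmonic up to high order; subtracting
  the subharmonic |z|^-2 makes the difference strictly superharmonic. The factor 16 turns the lower
  bound 1/8 into 2, one unit of which pays for the subtraction.\<close>

definition wedge_barrier :: "complex \<Rightarrow> real" where
  "wedge_barrier z = 16 * Re (cube_root_inv z) - 1 / (cmod z)\<^sup>2"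

lemma wedge_barrier_lower:
  assumes "\<bar>Im z\<bar> \<le> Re z" "cmod z \<ge> 1"
  shows "1 / (cmod z * sqrt (cmod z)) \<le> wedge_barrier z"
proof -
  define r where "r = cmod z"
  have r: "r \<ge> 1" using assms by (simp add: r_def)
  have z0: "z \<noteq> 0" using assms by auto
  have "sqrt r \<le> r" using r by (simp add: real_le_lsqrt power2_eq_square real_sqrt_le_iff' mult_left_mono)
  then have "r * sqrt r \<le> r\<^sup>2" using r by (simp add: power2_eq_square)
  then have "1 / r\<^sup>2 \<le> 1 / (r * sqrt r)" using r by (intro divide_left_mono) auto
  moreover have "1 / (8 * (r * sqrt r)) \<le> Re (cube_root_inv z)" unfolding r_def by (rule cube_root_inv_lower[OF assms(1) z0])
  moreover have "1 / (8 * (r * sqrt r)) = (1 / (r * sqrt r)) / 8" by simp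
  moreover have "a \<le> 16 * c - b" if "b \<le> a" "a / 8 \<le> c" for a b c :: real using that by simp
  ultimately show ?thesis unfolding wedge_barrier_def r_def[symmetric] by metis
qed

lemma wedge_barrier_upper: "wedge_barrier z \<le> 16 / (cmod z * sqrt (cmod z))"
proof -
  have "Re (cube_root_inv z) \<le> 1 / (cmod z * sqrt (cmod z))"
    using complex_Re_le_cmod[of "cube_root_inv z"] by (simp add: cube_root_inv_norm)
  moreover have "1 / (cmod z)\<^sup>2 \<ge> 0" by simp
  moreover have "16 / (cmod z * sqrt (cmod z)) = 16 * (1 / (cmod z * sqrt (cmod z)))" by simp
  ultimately show ?thesis unfolding wedge_barrier_def by linarith
qed

lemma wedge_barrier_laplacian:
  assumes "\<bar>Im z\<bar> \<le> Re z" "cmod z \<ge> 4096"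
  shows "nmean wedge_barrier z \<le> wedge_barrier z - 1 / (8 * cmod z ^ 4)"
proof -
  define r where "r = cmod z"
  have r: "r \<ge> 4096" using assms by (simp add: r_def)
  have "nmean wedge_barrier z = 16 * nmean (\<lambda>w. Re (cube_root_inv w)) z - nmean (\<lambda>w. 1 / (cmod w)\<^sup>2) z"
    unfolding wedge_barrier_def[abs_def] nmean_diff nmean_cmult ..
  moreover have "1 / r\<^sup>2 + 1 / (4 * r ^ 4) \<le> nmean (\<lambda>w. 1 / (cmod w)\<^sup>2) z"
    unfolding r_def by (rule inverse_square_laplacian) (use r in \<open>simp add: r_def\<close>)
  moreover have "nmean (\<lambda>w. Re (cube_root_inv w)) z - Re (cube_root_inv z) \<le> 2048 / (r ^ 5 * sqrt r)"
    using cube_root_inv_laplacian[OF assms(1)] r unfolding r_def by auto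
  moreover have "2048 / (r ^ 5 * sqrt r) \<le> 1 / (128 * r ^ 4)"
  proof -
    \<comment> \<open>This is the origin of the threshold 4096 = 64^2: r sqrt r >= 2^18 makes the
      Taylor error, times 16, at most half of the gain 1 / (4 r^4).\<close>
    have "sqrt 4096 \<le> sqrt r" by (rule real_sqrt_le_mono[OF r])
    moreover have "sqrt 4096 = (64::real)" using real_sqrt_unique[of 64 4096] by simp
    ultimately have "64 \<le> sqrt r" by metis
    then have "4096 * 64 \<le> r * sqrt r" using r by (intro mult_mono) auto
    then have "262144 * r ^ 4 \<le> (r * sqrt r) * r ^ 4" using r by (intro mult_right_mono) auto
    then have "2048 * (128 * r ^ 4) \<le> 1 * (r ^ 5 * sqrt r)" by (simp add: eval_nat_numeral mult_ac)
    then show ?thesis using r by (subst frac_le_eq) (auto simp: divide_le_0_iff mult_pos_pos)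
  qed
  moreover have "m \<le> 16 * c - b - X8"
    if "m = 16 * m1 - m2" "b + X4 \<le> m2" "m1 - c \<le> Y" "Y \<le> X128" "X4 = 2 * X8" "X128 = X8 / 16" for m c b X8 m1 m2 X4 Y X128 :: real
    using that by simp
  moreover have "1 / (4 * r ^ 4) = 2 * (1 / (8 * r ^ 4))" "1 / (128 * r ^ 4) = 1 / (8 * r ^ 4) / 16" by simp_all
  ultimately have "nmean wedge_barrier z \<le> 16 * Re (cube_root_inv z) - 1 / r\<^sup>2 - 1 / (8 * r ^ 4)" by blast
  then show ?thesis unfolding wedge_barrier_def[of z] r_def .
qed

section \<open>Comparison of Phragmen-Lindelof type in the quarter plane\<close>

lemma odd_harm_le: assumes "n \<ge> 1" shows "odd_harm n \<le> ln (real n) / 2 + (odd_harm_const + 1)"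
proof -
  have "1 / (real n)\<^sup>2 \<le> 1" using assms by (simp add: divide_le_eq)
  then show ?thesis using odd_harm_asymp(2)[OF assms] by simp
qed

text \<open>The crude logarithmic bound of \<open>pk_nonneg_le\<close> is enough, since it competes
  with a square root at infinity.\<close>

lemma pk_err_growth:
  assumes "\<eta> > 0"
  shows "\<exists>N. \<forall>z\<in>square_lattice. cmod z > N \<longrightarrow> \<bar>pk_err z\<bar> \<le> \<eta> * sqrt (cmod z)"
proof -
  define C where "C = odd_harm_const + 1"
  define k where "k = \<bar>k_zero\<bar>"
  define F where "F = (\<lambda>r::real. 8 / pi * (ln (3 * r) / 2 + C) + 2 / pi * ln r + k)"
  have pp: "8 / pi > 0" "2 / pi > (0::real)" by auto
  have "((\<lambda>r. F r / sqrt r) \<longlongrightarrow> 0) at_top"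
    unfolding F_def by real_asymp
  then have "\<forall>\<^sub>F r in at_top. F r / sqrt r < \<eta>" using assms by (rule order_tendstoD)
  then obtain N0 where N0: "\<And>r. r \<ge> N0 \<Longrightarrow> F r / sqrt r < \<eta>" unfolding eventually_at_top_linorder by blast
  show ?thesis
  proof (intro exI[of _ "max N0 1"] ballI impI)
    fix z assume z: "z \<in> square_lattice" "cmod z > max N0 1"
    define r where "r = cmod z"
    have r: "r > N0" "r > 1" using z by (auto simp: r_def)
    obtain m n where mn: "z = lat m n" using lattice_coords[OF z(1)] by blast
    define K where "K = nat (\<bar>m\<bar> + \<bar>n\<bar>) + 1"
    have "real_of_int \<bar>m\<bar> \<le> r" "real_of_int \<bar>n\<bar> \<le> r"
      using abs_Re_le_cmod[of z] abs_Im_le_cmod[of z] by (auto simp: r_def mn)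
    then have K: "K \<ge> 1" "real K \<le> 3 * r" using r by (auto simp: K_def)
    have b: "0 \<le> potential_kernel z" "potential_kernel z \<le> 8 / pi * odd_harm K"
      using pk_nonneg_le[of m n K] by (auto simp: mn K_def)
    have "odd_harm K \<le> ln (real K) / 2 + C" unfolding C_def by (rule odd_harm_le[OF K(1)])
    also have "ln (real K) \<le> ln (3 * r)" using K r by (subst ln_le_cancel_iff) auto
    finally have "odd_harm K \<le> ln (3 * r) / 2 + C" by simp
    then have "8 / pi * odd_harm K \<le> 8 / pi * (ln (3 * r) / 2 + C)" by (intro mult_left_mono) auto
    moreover have "0 \<le> 2 / pi * ln r" using r by simp
    moreover have "pk_err z = potential_kernel z - (2 / pi * ln r + k_zero)" by (simp add: pk_err_def r_def)
    ultimately have "\<bar>pk_err z\<bar> \<le> F r" using b unfolding F_def k_def by linarith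
    also have "F r \<le> \<eta> * sqrt r"
      using N0[of r] r by (simp add: divide_less_eq less_imp_le)
    finally show "\<bar>pk_err z\<bar> \<le> \<eta> * sqrt (cmod z)" by (simp add: r_def)
  qed
qed

lemma sqrt_mean_le: fixes m :: real assumes "m \<ge> 1" shows "sqrt (m + 1) + sqrt (m - 1) \<le> 2 * sqrt m"
proof -
  have "(sqrt (m + 1) + sqrt (m - 1))\<^sup>2 \<le> 2 * ((sqrt (m + 1))\<^sup>2 + (sqrt (m - 1))\<^sup>2)"
    using sum_squares_bound[of "sqrt (m + 1)" "sqrt (m - 1)"] by (simp add: power2_sum)
  also have "\<dots> = (2 * sqrt m)\<^sup>2" using assms by (simp add: power_mult_distrib)
  finally show ?thesis by (rule power2_le_imp_le) (use assms in auto)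
qed

text \<open>The maximum principle needs control on three sides: the diagonals, where the kernel is
  explicit; bounded distance, where a finite maximum serves; and infinity, where eta sqrt (Re z)
  dominates. The latter is concave, hence superharmonic for the walk, and eta tends to 0 at the
  end.\<close>

lemma pk_err_wedge:
  "\<exists>K>0. \<forall>z\<in>square_lattice. \<bar>Im z\<bar> < Re z \<and> 4096 \<le> cmod z \<longrightarrow> \<bar>pk_err z\<bar> \<le> K * wedge_barrier z"
proof -
  define F where "F = square_lattice \<inter> cball 0 4096"
  have "finite F" unfolding F_def by (rule finite_lattice_cball)
  then have "finite ((\<lambda>z. \<bar>pk_err z\<bar>) ` F)" by simp
  then have E0: "\<bar>pk_err z\<bar> \<le> Max ((\<lambda>z. \<bar>pk_err z\<bar>) ` F)" if "z \<in> F" for z using that by (intro Max_ge) auto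
  define E where "E = max (Max ((\<lambda>z. \<bar>pk_err z\<bar>) ` F)) 0"
  have E: "E \<ge> 0" "\<And>z. z \<in> F \<Longrightarrow> \<bar>pk_err z\<bar> \<le> E" using E0 unfolding E_def by (simp, meson le_max_iff_disj)
  \<comment> \<open>4096 / 8 = 512 absorbs the Laplacian of \<open>pk_err\<close>, and 262144 = 4096
    * 64 bounds the reciprocal of the barrier at modulus below 4096.\<close>
  define K where "K = 4096 + E * 262144"
  have K: "K \<ge> 4096" "K \<ge> E * 262144" using E by (auto simp: K_def)
  have main: "\<sigma> * pk_err z0 \<le> K * wedge_barrier z0 + \<eta> * sqrt (Re z0)"
    if \<sigma>: "\<sigma> = 1 \<or> \<sigma> = -1" and \<eta>: "\<eta> > 0" and z0: "z0 \<in> square_lattice" "\<bar>Im z0\<bar> < Re z0" "4096 \<le> cmod z0" for \<sigma> \<eta> z0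
  proof -
    have \<sigma>le: "\<sigma> * t \<le> \<bar>t\<bar>" for t using \<sigma> by auto
    obtain N where N: "\<And>z. z \<in> square_lattice \<Longrightarrow> cmod z > N \<Longrightarrow> \<bar>pk_err z\<bar> \<le> \<eta> / 2 * sqrt (cmod z)"
      using pk_err_growth[of "\<eta> / 2"] \<eta> by auto
    define A where "A = {z \<in> square_lattice. \<bar>Im z\<bar> < Re z \<and> 4096 \<le> cmod z \<and> cmod z \<le> max N (cmod z0)}"
    define f where "f = (\<lambda>z. \<sigma> * pk_err z - K * wedge_barrier z - \<eta> * sqrt (Re z))"
    have "f z0 \<le> 0"
    proof (rule discrete_max_principle[of A])
      show "finite A" by (rule finite_subset[OF _ finite_lattice_cball[of 0 "max N (cmod z0)"]]) (auto simp: A_def)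
      show "z0 \<in> A" using z0 by (simp add: A_def)
    next
      fix z assume "z \<in> A"
      then have z: "z \<in> square_lattice" "\<bar>Im z\<bar> < Re z" "4096 \<le> cmod z" by (auto simp: A_def)
      have r0: "cmod z > 0" using z(3) by linarith
      obtain m n where mn: "z = lat m n" using lattice_coords[OF z(1)] by blast
      have m1: "Re z \<ge> 1" using z(2) by (simp add: mn)
      have 1: "\<sigma> * nmean pk_err z - \<sigma> * pk_err z \<ge> - (512 / cmod z ^ 4)"
      proof -
        have "- \<sigma> * (nmean pk_err z - pk_err z) \<le> \<bar>nmean pk_err z - pk_err z\<bar>" using \<sigma> by auto
        then show ?thesis using pk_err_laplacian[OF z(1)] z(3) by (simp add: algebra_simps)
      qed
      have 2: "K * nmean wedge_barrier z \<le> K * wedge_barrier z - K * (1 / (8 * cmod z ^ 4))"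
        using mult_left_mono[OF wedge_barrier_laplacian[of z], of K] z K by (simp add: right_diff_distrib)
      have "4096 * (1 / (8 * cmod z ^ 4)) \<le> K * (1 / (8 * cmod z ^ 4))" using K by (intro mult_right_mono) auto
      then have 3: "512 / cmod z ^ 4 \<le> K * (1 / (8 * cmod z ^ 4))" by simp
      have "nmean (\<lambda>z. sqrt (Re z)) z = (sqrt (Re z + 1) + sqrt (Re z - 1) + 2 * sqrt (Re z)) / 4"
        by (simp add: nmean_def)
      then have "nmean (\<lambda>z. sqrt (Re z)) z \<le> sqrt (Re z)" using sqrt_mean_le[OF m1] by simp
      then have 4: "\<eta> * nmean (\<lambda>z. sqrt (Re z)) z \<le> \<eta> * sqrt (Re z)" using \<eta> by (intro mult_left_mono) auto
      have "nmean f z = \<sigma> * nmean pk_err z - K * nmean wedge_barrier z - \<eta> * nmean (\<lambda>z. sqrt (Re z)) z"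
        unfolding f_def nmean_diff nmean_cmult ..
      then show "f z \<le> nmean f z" using 1 2 3 4 unfolding f_def by linarith
    next
      fix z e assume zA: "z \<in> A" and e: "e \<in> {1, -1, \<i>, -\<i>}" and out: "z + e \<notin> A"
      have z: "z \<in> square_lattice" "\<bar>Im z\<bar> < Re z" "4096 \<le> cmod z" using zA by (auto simp: A_def)
      define w where "w = z + e"
      have ce: "cmod e = 1" using e by auto
      have wl: "w \<in> square_lattice" unfolding w_def by (intro lattice_add z lattice_units e)
      have wc: "cmod w \<ge> 4095" using norm_triangle_ineq4[of "z + e" e] ce z(3) by (simp add: w_def)
      obtain m n where mn: "z = lat m n" using lattice_coords[OF z(1)] by blast
      obtain m' n' where mn': "w = lat m' n'" using lattice_coords[OF wl] by blast
      have "\<bar>n\<bar> < m" using z(2) by (simp add: mn)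
      moreover have "(m' = m \<and> \<bar>n' - n\<bar> = 1) \<or> (n' = n \<and> \<bar>m' - m\<bar> = 1)"
      proof -
        have "Complex (of_int (m' - m)) (of_int (n' - n)) = e" using mn mn' by (simp add: w_def complex_eq_iff)
        then show ?thesis using e by (auto simp: complex_eq_iff)
      qed
      \<comment> \<open>A unit step from the open wedge cannot jump over a diagonal, so a neighbour
        outside the wedge lies exactly on one.\<close>
      ultimately have mw: "\<bar>n'\<bar> \<le> m'" by linarith
      then have wcl: "\<bar>Im w\<bar> \<le> Re w" by (simp add: mn')
      have w1: "cmod w \<ge> 1" using wc by simp
      have bl: "1 / (cmod w * sqrt (cmod w)) \<le> wedge_barrier w" by (rule wedge_barrier_lower[OF wcl w1])
      have bpos: "wedge_barrier w \<ge> 0" by (rule order_trans[OF _ bl]) simp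
      have sq: "\<eta> * sqrt (Re w) \<ge> 0" using \<eta> wcl by simp
      have "\<sigma> * pk_err w \<le> K * wedge_barrier w + \<eta> * sqrt (Re w)"
      proof -
        consider "\<bar>n'\<bar> = m'" | "\<bar>n'\<bar> < m'" "cmod w < 4096" | "cmod w > max N (cmod z0)"
        proof -
          have "\<not> (\<bar>n'\<bar> < m' \<and> 4096 \<le> cmod w \<and> cmod w \<le> max N (cmod z0))"
            using out wl unfolding w_def[symmetric] A_def by (auto simp: mn')
          then show thesis using that mw by linarith
        qed
        then show ?thesis
        proof cases
          case 1
          define k where "k = nat m'"
          have k: "m' = int k" using 1 by (simp add: k_def)
          have "k \<ge> 1"
          proof (rule ccontr)
            assume "\<not> k \<ge> 1"
            then have "w = 0" using 1 k by (simp add: mn' complex_eq_iff)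
            then show False using w1 by simp
          qed
          have "w = lat (int k) (int k) \<or> w = lat (int k) (- int k)" using 1 k by (auto simp: mn')
          then have ee: "pk_err w = pk_err (lat (int k) (int k))" "cmod w = cmod (lat (int k) (int k))"
            using pk_err_sym3[of "int k" "int k"] by (auto simp: cmod_def)
          have "\<bar>pk_err w\<bar> \<le> 4 / (cmod w)\<^sup>2" unfolding ee by (rule pk_err_diagonal) fact
          also have "\<dots> \<le> 4 / (cmod w * sqrt (cmod w))"
          proof (rule divide_left_mono)
            have "sqrt (cmod w) \<le> sqrt ((cmod w)\<^sup>2)" using w1 self_le_power[of "cmod w" 2] by (intro real_sqrt_le_mono) simp
            then have "cmod w * sqrt (cmod w) \<le> cmod w * cmod w" by (intro mult_left_mono) auto
            then show "cmod w * sqrt (cmod w) \<le> (cmod w)\<^sup>2" by (simp add: power2_eq_square)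
            have "cmod w > 0" using w1 by linarith
            then show "0 < (cmod w)\<^sup>2 * (cmod w * sqrt (cmod w))" by (intro mult_pos_pos) auto
          qed auto
          also have "\<dots> = 4 * (1 / (cmod w * sqrt (cmod w)))" by simp
          also have "\<dots> \<le> K * wedge_barrier w" using bl K by (intro mult_mono) auto
          finally show ?thesis using \<sigma>le[of "pk_err w"] sq by linarith
        next
          case 2
          have "w \<in> F" using wl 2 by (simp add: F_def)
          then have "\<bar>pk_err w\<bar> \<le> E" by (rule E)
          moreover have "E \<le> E * 262144 * wedge_barrier w"
          proof -
            have "cmod w > 0" using w1 by linarith
            then have wp: "cmod w * sqrt (cmod w) > 0" by simp
            have "cmod w * sqrt (cmod w) \<le> 4096 * 64"
            proof (intro mult_mono)
              have "sqrt (cmod w) \<le> sqrt (64\<^sup>2)" using 2 by (intro real_sqrt_le_mono) simp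
              then show "sqrt (cmod w) \<le> 64" by simp
            qed (use 2 in auto)
            then have "1 / 262144 \<le> 1 / (cmod w * sqrt (cmod w))" using wp by (intro divide_left_mono) auto
            then have "1 / 262144 \<le> wedge_barrier w" using bl by linarith
            then have "E * 262144 * (1 / 262144) \<le> E * 262144 * wedge_barrier w" using E by (intro mult_left_mono) auto
            then show ?thesis by simp
          qed
          moreover have "E * 262144 * wedge_barrier w \<le> K * wedge_barrier w" using K bpos by (intro mult_right_mono) auto
          ultimately show ?thesis using \<sigma>le[of "pk_err w"] sq by linarith
        next
          case 3
          have "\<bar>pk_err w\<bar> \<le> \<eta> / 2 * sqrt (cmod w)" by (rule N[OF wl]) (use 3 in simp)
          also have "\<dots> \<le> \<eta> * sqrt (Re w)"
          proof -
            have "cmod w \<le> 2 * Re w" using cmod_le[of w] wcl by linarith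
            then have "cmod w \<le> 2\<^sup>2 * Re w" using wcl by simp
            then have "sqrt (cmod w) \<le> sqrt (2\<^sup>2 * Re w)" by (rule real_sqrt_le_mono)
            also have "\<dots> = 2 * sqrt (Re w)" by (simp only: real_sqrt_mult) simp
            finally have "\<eta> / 2 * sqrt (cmod w) \<le> \<eta> / 2 * (2 * sqrt (Re w))" using \<eta> by (intro mult_left_mono) auto
            then show ?thesis by simp
          qed
          moreover have "K * wedge_barrier w \<ge> 0" using K bpos by simp
          ultimately show ?thesis using \<sigma>le[of "pk_err w"] by linarith
        qed
      qed
      then show "f (z + e) \<le> 0" unfolding f_def w_def[symmetric] by linarith
    qed
    then show ?thesis by (simp add: f_def)
  qed
  have lim: "\<sigma> * pk_err z \<le> K * wedge_barrier z"
    if \<sigma>: "\<sigma> = 1 \<or> \<sigma> = -1" and z: "z \<in> square_lattice" "\<bar>Im z\<bar> < Re z" "4096 \<le> cmod z" for \<sigma> z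
  proof (rule field_le_epsilon)
    fix e :: real assume e: "e > 0"
    define \<eta> where "\<eta> = e / (sqrt (Re z) + 1)"
    have s: "sqrt (Re z) \<ge> 0" using z by simp
    have \<eta>: "\<eta> > 0" unfolding \<eta>_def by (rule divide_pos_pos) (use e s in linarith)+
    have "\<eta> * sqrt (Re z) \<le> \<eta> * (sqrt (Re z) + 1)" using \<eta> by (intro mult_left_mono) auto
    also have "\<dots> = e"
    proof -
      have "sqrt (Re z) + 1 \<noteq> 0" using s by linarith
      then show ?thesis by (simp add: \<eta>_def)
    qed
    finally show "\<sigma> * pk_err z \<le> K * wedge_barrier z + e" using main[OF \<sigma> \<eta> z] by linarith
  qed
  show ?thesis
  proof (intro exI[of _ K] conjI ballI impI)
    show "K > 0" using K by simp
    fix z assume "z \<in> square_lattice" "\<bar>Im z\<bar> < Re z \<and> 4096 \<le> cmod z"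
    then show "\<bar>pk_err z\<bar> \<le> K * wedge_barrier z" using lim[of 1 z] lim[of "-1" z] by simp
  qed
qed

text \<open>Reflections of the lattice reduce the claim to 0 <= n <= m, where the wedge estimate,
  the diagonal values or a finite maximum apply.\<close>

theorem potential_kernel_asymptotics:
  "\<exists>K>0. \<forall>z\<in>square_lattice. z \<noteq> 0 \<longrightarrow> \<bar>pk_err z\<bar> \<le> K / (cmod z * sqrt (cmod z))"
proof -
  obtain K1 where K1: "K1 > 0" "\<And>z. z \<in> square_lattice \<Longrightarrow> \<bar>Im z\<bar> < Re z \<Longrightarrow> 4096 \<le> cmod z \<Longrightarrow> \<bar>pk_err z\<bar> \<le> K1 * wedge_barrier z"
    using pk_err_wedge by blast
  define F where "F = square_lattice \<inter> cball 0 4096"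
  have "finite F" unfolding F_def by (rule finite_lattice_cball)
  then have "finite ((\<lambda>z. \<bar>pk_err z\<bar>) ` F)" by simp
  then have E0: "\<bar>pk_err z\<bar> \<le> Max ((\<lambda>z. \<bar>pk_err z\<bar>) ` F)" if "z \<in> F" for z using that by (intro Max_ge) auto
  define E where "E = max (Max ((\<lambda>z. \<bar>pk_err z\<bar>) ` F)) 0"
  have E: "E \<ge> 0" "\<And>z. z \<in> F \<Longrightarrow> \<bar>pk_err z\<bar> \<le> E" using E0 unfolding E_def by (simp, meson le_max_iff_disj)
  define K where "K = 4 + 16 * K1 + E * 262144"
  have K: "K > 0" "4 \<le> K" "16 * K1 \<le> K" "E * 262144 \<le> K" using K1(1) E by (auto simp: K_def)
  have closed_wedge: "\<bar>pk_err z\<bar> \<le> K / (cmod z * sqrt (cmod z))"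
    if z: "z = lat m n" "z \<noteq> 0" "0 \<le> n" "n \<le> m" for z m n
  proof -
    have zl: "z \<in> square_lattice" using z lattice_Complex by simp
    have m1: "m \<ge> 1" using z by (auto simp: lat_eq_0)
    have c1: "cmod z \<ge> 1" using abs_Re_le_cmod[of z] m1 z(1) by simp
    have p: "cmod z * sqrt (cmod z) > 0" using z by simp
    show ?thesis
    proof (cases "cmod z < 4096")
      case True
      have "\<bar>pk_err z\<bar> \<le> E" using E(2)[of z] zl True by (simp add: F_def)
      also have "E \<le> K / (cmod z * sqrt (cmod z))"
      proof -
        have "cmod z * sqrt (cmod z) \<le> 4096 * 64"
        proof (intro mult_mono)
          have "sqrt (cmod z) \<le> sqrt (64\<^sup>2)" using True by (intro real_sqrt_le_mono) simp
          then show "sqrt (cmod z) \<le> 64" by simp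
        qed (use True in auto)
        then have "E * (cmod z * sqrt (cmod z)) \<le> E * (4096 * 64)" using E by (intro mult_left_mono)
        also have "\<dots> \<le> K" using K by simp
        finally show ?thesis using p by (simp add: le_divide_eq)
      qed
      finally show ?thesis .
    next
      case False
      show ?thesis
      proof (cases "n = m")
        case True
        define k where "k = nat m"
        have k: "z = lat (int k) (int k)" "k \<ge> 1" using m1 True z(1) by (auto simp: k_def)
        have "\<bar>pk_err z\<bar> \<le> 4 / (cmod z)\<^sup>2" unfolding k(1) by (rule pk_err_diagonal[OF k(2)])
        also have "\<dots> \<le> 4 / (cmod z * sqrt (cmod z))"
        proof (rule divide_left_mono)
          have "sqrt (cmod z) \<le> sqrt ((cmod z)\<^sup>2)" using c1 self_le_power[of "cmod z" 2] by (intro real_sqrt_le_mono) simp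
          then have "cmod z * sqrt (cmod z) \<le> cmod z * cmod z" by (intro mult_left_mono) auto
          then show "cmod z * sqrt (cmod z) \<le> (cmod z)\<^sup>2" by (simp add: power2_eq_square)
        qed (use p c1 in \<open>auto intro!: mult_pos_pos\<close>)
        also have "\<dots> \<le> K / (cmod z * sqrt (cmod z))" using K p by (intro divide_right_mono) auto
        finally show ?thesis .
      next
        case F2: False
        have "\<bar>pk_err z\<bar> \<le> K1 * wedge_barrier z" by (rule K1(2)[OF zl]) (use z F2 False in auto)
        also have "\<dots> \<le> K1 * (16 / (cmod z * sqrt (cmod z)))" using K1(1) wedge_barrier_upper by (intro mult_left_mono) auto
        also have "\<dots> = 16 * K1 / (cmod z * sqrt (cmod z))" by simp
        also have "\<dots> \<le> K / (cmod z * sqrt (cmod z))" using K p by (intro divide_right_mono) auto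
        finally show ?thesis .
      qed
    qed
  qed
  have quadrant: "\<bar>pk_err z\<bar> \<le> K / (cmod z * sqrt (cmod z))" if z: "z = lat m n" "z \<noteq> 0" "0 \<le> n" "0 \<le> m" for z m n
  proof (cases "n \<le> m")
    case True then show ?thesis using closed_wedge z by blast
  next
    case False
    have "cmod (lat n m) = cmod z" using z(1) by (simp add: cmod_def add.commute)
    moreover have "lat n m \<noteq> 0" using z lat_eq_0 by blast
    ultimately show ?thesis using closed_wedge[of "lat n m" n m] pk_err_symmetries(1)[of n m] z False by simp
  qed
  show ?thesis
  proof (intro exI[of _ K] conjI ballI impI K(1))
    fix z assume z: "z \<in> square_lattice" "z \<noteq> 0"
    obtain m n where mn: "z = lat m n" using lattice_coords[OF z(1)] by blast
    have e1: "pk_err (lat \<bar>m\<bar> \<bar>n\<bar>) = pk_err z"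
      using pk_err_symmetries(2)[of m n] pk_err_sym3[of m n] pk_err_sym3[of "- m" n] unfolding mn by (auto simp: abs_if)
    have e2: "cmod (lat \<bar>m\<bar> \<bar>n\<bar>) = cmod z" by (simp add: mn cmod_def)
    have "lat \<bar>m\<bar> \<bar>n\<bar> \<noteq> 0" using z(2) mn lat_eq_0 by (metis abs_eq_0)
    then have "\<bar>pk_err (lat \<bar>m\<bar> \<bar>n\<bar>)\<bar> \<le> K / (cmod (lat \<bar>m\<bar> \<bar>n\<bar>) * sqrt (cmod (lat \<bar>m\<bar> \<bar>n\<bar>)))"
      by (rule quadrant[OF refl]) auto
    then show "\<bar>pk_err z\<bar> \<le> K / (cmod z * sqrt (cmod z))" unfolding e1 e2 .
  qed
qed

section \<open>The parametrix\<close>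

lemma nmean_Re: "Re (cmean p w) = nmean (\<lambda>u. Re (p u)) w"
  by (simp add: nmean_def)

lemma nmean_Re_holomorphic:
  assumes p: "p holomorphic_on ball w d" and d: "d \<ge> 4" and B: "B \<ge> 0"
    and bnd: "\<And>z. z \<in> ball w (d / 2) \<Longrightarrow> cmod (p z - p w) < B"
  shows "\<bar>nmean (\<lambda>u. Re (p u)) w - Re (p w)\<bar> \<le> 32 * B / d ^ 4"
proof -
  have d0: "d > 0" using d by simp
  have "cmod (cmean p w - p w) \<le> 32 * B / d ^ 4"
    by (rule lattice_taylor(3)[OF p d B half_ball_coeff[OF p bnd d0]])
  moreover have "\<bar>Re (cmean p w - p w)\<bar> \<le> cmod (cmean p w - p w)" by (rule abs_Re_le_cmod)
  ultimately show ?thesis unfolding nmean_Re[symmetric] by simp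
qed

lemma holomorphic_log_ball:
  fixes f :: "complex \<Rightarrow> complex"
  assumes "f holomorphic_on ball w d" "\<And>z. z \<in> ball w d \<Longrightarrow> f z \<noteq> 0"
  obtains p where "p holomorphic_on ball w d" "\<And>z. z \<in> ball w d \<Longrightarrow> Re (p z) = - ln (cmod (f z))"
proof -
  obtain g where g: "g holomorphic_on ball w d" "\<And>z. z \<in> ball w d \<Longrightarrow> f z = exp (g z)"
    using contractible_imp_holomorphic_log[OF assms(1) convex_imp_contractible[OF convex_ball] assms(2)] by blast
  show ?thesis
  proof (rule that[of "\<lambda>z. - g z"])
    show "(\<lambda>z. - g z) holomorphic_on ball w d" by (intro holomorphic_intros g)
    show "Re (- g z) = - ln (cmod (f z))" if "z \<in> ball w d" for z using g(2)[OF that] by simp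
  qed
qed

context conformal_disk
begin

text \<open>\<open>g0\<close> is the real part of a holomorphic function on the ball, and its
  positivity lets Harnack's inequality work in units of \<open>g0 w\<close>. The error thus inherits
  the decay of \<open>g0\<close> at the boundary.\<close>

lemma g0_laplacian:
  assumes sub: "ball w d \<subseteq> D - {x}" and d: "d \<ge> 4"
  shows "\<bar>nmean g0 w - g0 w\<bar> \<le> 64 * g0 w / d ^ 4"
proof -
  have "w \<in> ball w d" using d by simp
  then have w: "w \<in> D" "w \<noteq> x" using sub by blast+
  have hb: "\<psi> holomorphic_on ball w d" using holo by (rule holomorphic_on_subset) (use sub in auto)
  have nz: "\<psi> z \<noteq> 0" if "z \<in> ball w d" for z using that sub by (intro \<psi>_nz) auto
  obtain p where p: "p holomorphic_on ball w d" "\<And>z. z \<in> ball w d \<Longrightarrow> Re (p z) = g0 z"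
    unfolding g0_def by (rule holomorphic_log_ball[OF hb nz]) auto
  have pos: "Re (p z) > 0" if "z \<in> ball w d" for z
  proof -
    have "z \<in> D" using that sub by auto
    then have "cmod (\<psi> z) < 1" by (rule \<psi>_in)
    then show ?thesis unfolding p(2)[OF that] g0_def using nz[OF that] by simp
  qed
  have d0: "d > 0" using d by simp
  have wb: "w \<in> ball w d" using d0 by simp
  have "\<bar>nmean (\<lambda>u. Re (p u)) w - Re (p w)\<bar> \<le> 32 * (2 * Re (p w)) / d ^ 4"
    by (rule nmean_Re_holomorphic[OF p(1) d]) (use pos[OF wb] positive_real_part_half_ball[OF p(1) pos _ d0] in auto)
  moreover have "nmean (\<lambda>u. Re (p u)) w = nmean g0 w"
    by (rule nmean_cong) (use p(2) d in \<open>auto simp: dist_norm\<close>)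
  ultimately show ?thesis unfolding p(2)[OF wb] by simp
qed

lemma g0_le:
  assumes w: "w \<in> D" and lo: "1 / 2048 \<le> cmod (\<psi> w)"
  shows "g0 w \<le> 2048 * v w"
proof -
  define t where "t = cmod (\<psi> w)"
  have t: "1 / 2048 \<le> t" "t > 0" "t < 1" using lo \<psi>_in[OF w] by (auto simp: t_def)
  have "ln (1 / t) \<le> 1 / t - 1" by (rule ln_le_minus_one) (use t in simp)
  then have "- ln t \<le> (1 - t) * (1 / t)" using t by (simp add: ln_div field_simps)
  also have "\<dots> \<le> (1 - t) * 2048" using t by (intro mult_left_mono) (auto simp: divide_le_eq)
  also have "\<dots> \<le> v w * 2048" using v_bounds(1)[OF w] by (simp add: t_def)
  finally show ?thesis by (simp add: g0_def t_def)
qed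

text \<open>The case s = r / 64 of \<open>far_from_pole\<close>, with 64 * 32 = 2048.\<close>

lemma far_\<psi>:
  assumes w: "w \<in> D" "dist w x \<ge> bdist D x / 64"
  shows "1 / 2048 \<le> cmod (\<psi> w)"
proof -
  have r: "bdist D x > 0" by (rule bdist_pos'[OF xD])
  then show ?thesis using far_from_pole[OF _ _ w] by simp
qed

end

context grid_disk
begin

text \<open>The extension by 0 is what the parametrix sees outside \<open>V\<close>. For d >= 520
  the ball of radius d / 130 >= 4 avoids the pole, since d <= 65 |w - x|, and Taylor expansion
  applies. For d < 520 Harnack between neighbours suffices, powers of d being bounded.\<close>

lemma g0_far_laplacian:
  assumes w: "w \<in> V" and far: "\<And>e. e \<in> {0, 1, -1, \<i>, -\<i>} \<Longrightarrow> dist (w + e) x \<ge> bdist D x / 64"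
  shows "\<bar>nmean (\<lambda>u. if u \<in> V then g0 u else 0) w - g0 w\<bar> \<le> 2048 * 64 * 130 ^ 4 * (v w / bdist D w ^ 3)"
proof -
  define d r where "d = bdist D w" and "r = bdist D x"
  have r: "r \<ge> 1" unfolding r_def by (rule bdist_V[OF x_V])
  have d: "d \<ge> 1" unfolding d_def by (rule bdist_V[OF w])
  have wD: "w \<in> D" using w by (rule V_D)
  have vw: "v w > 0" by (rule v_pos[OF wD])
  have wf: "dist w x \<ge> r / 64" using far[of 0] by (simp add: r_def)
  have gw: "0 \<le> g0 w" "g0 w \<le> 2048 * v w"
    using g0_nonneg[OF wD] g0_le[OF wD far_\<psi>[OF wD]] wf unfolding r_def by auto
  show ?thesis
  proof (cases "d \<ge> 520")
    case True
    have dx: "d \<le> 65 * dist w x" using bdist_triangle[of D w x] wf unfolding d_def r_def by simp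
    have s: "ball w (d / 130) \<subseteq> D - {x}"
    proof -
      have "ball w (d / 130) \<subseteq> ball w d" using d by (intro subset_ball) simp
      moreover have "x \<notin> ball w (d / 130)" using dx d by simp
      ultimately show ?thesis using ball_bdist_subset[of w D] unfolding d_def by blast
    qed
    have "nmean (\<lambda>u. if u \<in> V then g0 u else 0) w = nmean g0 w"
    proof (rule nmean_cong)
      fix e :: complex assume e: "e \<in> {1, -1, \<i>, -\<i>}"
      then have "cmod e = 1" by auto
      then have "w + e \<in> ball w d" using True by (simp add: dist_norm)
      then have "w + e \<in> D" using ball_bdist_subset[of w D] unfolding d_def by blast
      moreover have "w + e \<in> square_lattice" using w lattice_units[OF e] by (intro lattice_add) (auto simp: V_def)
      ultimately show "(if w + e \<in> V then g0 (w + e) else 0) = g0 (w + e)" by (simp add: V_def)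
    qed
    then have "\<bar>nmean (\<lambda>u. if u \<in> V then g0 u else 0) w - g0 w\<bar> \<le> 64 * g0 w / (d / 130) ^ 4"
      using g0_laplacian[OF s] True by simp
    also have "\<dots> \<le> 64 * (2048 * v w) / (d / 130) ^ 4" using gw by (intro divide_right_mono) auto
    also have "\<dots> = 2048 * 64 * 130 ^ 4 * (v w / d ^ 4)" by (simp add: power_divide)
    also have "\<dots> \<le> 2048 * 64 * 130 ^ 4 * (v w / d ^ 3)"
      using vw d by (intro mult_left_mono divide_left_mono) (auto intro: power_increasing)
    finally show ?thesis by (simp only: d_def)
  next
    case False
    have n: "\<bar>nmean (\<lambda>u. if u \<in> V then g0 u else 0) w\<bar> \<le> 2048 * (54 * v w)"
    proof (rule nmean_abs_le)
      fix e :: complex assume e: "e \<in> {1, -1, \<i>, -\<i>}"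
      then have ce: "cmod e = 1" by auto
      show "\<bar>if w + e \<in> V then g0 (w + e) else 0\<bar> \<le> 2048 * (54 * v w)"
      proof (cases "w + e \<in> V")
        case True
        have D: "w + e \<in> D" by (rule V_D[OF True])
        have "dist (w + e) x \<ge> bdist D x / 64" using far[of e] e by auto
        then have "g0 (w + e) \<le> 2048 * v (w + e)" by (intro g0_le[OF D] far_\<psi>[OF D])
        moreover have "v (w + e) \<le> 54 * v w" by (rule V_step[OF w True ce])
        ultimately show ?thesis using True g0_nonneg[OF D] by simp
      next
        case False then show ?thesis using vw by simp
      qed
    qed
    have "d ^ 3 \<le> 520 ^ 3" using False d by (intro power_mono) auto
    have "v w \<le> 520 ^ 3 * (v w / d ^ 3)"
    proof -
      have "v w * d ^ 3 \<le> v w * 520 ^ 3" using \<open>d ^ 3 \<le> 520 ^ 3\<close> vw by (intro mult_left_mono) auto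
      then show ?thesis using d by (simp add: le_divide_eq mult.commute)
    qed
    then have "2048 * 56 * v w \<le> 2048 * 56 * (520 ^ 3 * (v w / d ^ 3))" by simp
    also have "\<dots> = (2048 * 56 * 520 ^ 3) * (v w / d ^ 3)" by simp
    also have "\<dots> \<le> (2048 * 64 * 130 ^ 4) * (v w / d ^ 3)" using vw d by (intro mult_right_mono) auto
    finally show ?thesis using n gw vw unfolding d_def abs_le_iff by argo
  qed
qed

text \<open>Beurling's estimate spends the factor \<open>v powr (1 - \<alpha>)\<close> of the error on the power of
  \<open>bdist D x\<close>; what remains is matched to the gain of the barrier.\<close>

definition weight :: "real \<Rightarrow> complex \<Rightarrow> real" where
  "weight \<alpha> w = bdist D x powr (- (1 - \<alpha>) / 2) * (v w powr \<alpha> / (bdist D w)\<^sup>2)"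

text \<open>Since d >= 1, Beurling's factor (d / r)^((1 - alpha) / 2) is at most d r^(-(1 - alpha) /
  2); the spare d lowers d^-3 to the d^-2 of the weight.\<close>

lemma v_le_weight:
  assumes w: "w \<in> V" and \<alpha>: "0 < \<alpha>" "\<alpha> < 1"
  shows "v w / bdist D w ^ 3 \<le> 16 * weight \<alpha> w"
proof -
  define d r where "d = bdist D w" and "r = bdist D x"
  have r: "r \<ge> 1" unfolding r_def by (rule bdist_V[OF x_V])
  have d: "d \<ge> 1" unfolding d_def by (rule bdist_V[OF w])
  have vw: "v w > 0" by (rule v_pos[OF V_D[OF w]])
  define A where "A = r powr (- (1 - \<alpha>) / 2)"
  have "(v w)\<^sup>2 \<le> 256 * d / r" unfolding d_def r_def by (rule beurling[OF V_D[OF w]])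
  then have "sqrt ((v w)\<^sup>2) \<le> sqrt (256 * d / r)" by (rule real_sqrt_le_mono)
  moreover have "sqrt (256::real) = 16" using real_sqrt_unique[of 16 256] by simp
  ultimately have "v w \<le> 16 * sqrt (d / r)" using vw by (simp add: real_sqrt_mult real_sqrt_divide)
  then have b: "v w \<le> 16 * (d / r) powr (1/2)" using r d by (simp add: powr_half_sqrt)
  have "v w powr (1 - \<alpha>) \<le> (16 * (d / r) powr (1/2)) powr (1 - \<alpha>)"
    using b vw \<alpha> by (intro powr_mono2) auto
  also have "\<dots> = 16 powr (1 - \<alpha>) * (d / r) powr ((1 - \<alpha>) / 2)"
    using r d by (simp add: powr_mult powr_powr)
  also have "\<dots> = 16 powr (1 - \<alpha>) * (d powr ((1 - \<alpha>) / 2) * A)"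
    proof -
    have "r powr (- (1 - \<alpha>) / 2) = 1 / r powr ((1 - \<alpha>) / 2)"
      using powr_minus_divide[of r "(1 - \<alpha>) / 2"] by (simp only: minus_divide_left)
    then show ?thesis using r d by (simp add: powr_divide A_def)
  qed
  also have "\<dots> \<le> 16 powr 1 * (d powr 1 * A)"
    using \<alpha> d by (intro mult_mono powr_mono) (auto simp: A_def)
  finally have k: "v w powr (1 - \<alpha>) \<le> 16 * (d * A)" using d by simp
  have "v w = v w powr ((1 - \<alpha>) + \<alpha>)" using vw by simp
  also have "\<dots> = v w powr (1 - \<alpha>) * v w powr \<alpha>" by (rule powr_add)
  also have "\<dots> \<le> 16 * (d * A) * v w powr \<alpha>" using k by (intro mult_right_mono) auto
  finally have "v w / d ^ 3 \<le> 16 * (d * A) * v w powr \<alpha> / d ^ 3" using d by (intro divide_right_mono) auto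
  also have "\<dots> = 16 * (A * (v w powr \<alpha> / d\<^sup>2))" using d by (simp add: power2_eq_square power3_eq_cube)
  finally show ?thesis by (simp add: weight_def d_def r_def A_def)
qed

text \<open>Where v is bounded below and d is at most 3 r, the weight is at least of order r^(-5/2);
  errors near the pole are measured against this. The constant is 72 * 9.\<close>

lemma near_le_weight:
  assumes w: "w \<in> V" and \<alpha>: "0 < \<alpha>" "\<alpha> < 1" and lo: "1 / 72 \<le> v w" and near: "bdist D w \<le> 3 * bdist D x"
  shows "1 / ((bdist D x)\<^sup>2 * sqrt (bdist D x)) \<le> 648 * weight \<alpha> w"
proof -
  define d r where "d = bdist D w" and "r = bdist D x"
  have r: "r \<ge> 1" unfolding r_def by (rule bdist_V[OF x_V])
  have d: "d \<ge> 1" unfolding d_def by (rule bdist_V[OF w])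
  have "v w powr 1 \<le> v w powr \<alpha>" using \<alpha> lo v_le_1[of w] by (intro powr_mono') auto
  then have va: "1 / 72 \<le> v w powr \<alpha>" using lo by simp
  have "d\<^sup>2 \<le> (3 * r)\<^sup>2" using near d unfolding d_def r_def by (intro power_mono) auto
  then have d2: "d\<^sup>2 \<le> 9 * r\<^sup>2" by (simp add: power_mult_distrib)
  have A: "1 / sqrt r \<le> r powr (- (1 - \<alpha>) / 2)"
  proof -
    have "1 / sqrt r = r powr (- (1/2))" using r by (simp add: powr_minus_divide powr_half_sqrt)
    also have "\<dots> \<le> r powr (- (1 - \<alpha>) / 2)" using r \<alpha> by (intro powr_mono) (auto simp: field_simps)
    finally show ?thesis .
  qed
  have "(1 / 72) / (9 * r\<^sup>2) \<le> v w powr \<alpha> / d\<^sup>2" using va d2 d r by (intro frac_le) auto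
  then have "(1 / sqrt r) * ((1 / 72) / (9 * r\<^sup>2)) \<le> weight \<alpha> w"
    unfolding weight_def d_def[symmetric] r_def[symmetric] using A r by (intro mult_mono) auto
  moreover have "(1 / sqrt r) * ((1 / 72) / (9 * r\<^sup>2)) = (1 / (r\<^sup>2 * sqrt r)) / 648" by simp
  ultimately have "(1 / (r\<^sup>2 * sqrt r)) / 648 \<le> weight \<alpha> w" by (simp only:)
  moreover have "a \<le> 648 * c" if "a / 648 \<le> c" for a c :: real using that by simp
  ultimately show ?thesis unfolding r_def[symmetric] by blast
qed

end

section \<open>Cut-off of the kernel error and local estimates of the parametrix\<close>

definition pk_const :: real where
  "pk_const = (SOME K. K > 0 \<and> (\<forall>z\<in>square_lattice. z \<noteq> 0 \<longrightarrow> \<bar>pk_err z\<bar> \<le> K / (cmod z * sqrt (cmod z))))"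

lemma pk_const: "pk_const > 0"
  and pk_err_le: "z \<in> square_lattice \<Longrightarrow> z \<noteq> 0 \<Longrightarrow> \<bar>pk_err z\<bar> \<le> pk_const / (cmod z * sqrt (cmod z))"
  using someI_ex[OF potential_kernel_asymptotics[unfolded Bex_def]] unfolding pk_const_def[symmetric] by auto

lemma lattice_cmod_ge_1: assumes "z \<in> square_lattice" "z \<noteq> 0" shows "cmod z \<ge> 1"
proof -
  obtain m n where z: "z = lat m n" using lattice_coords[OF assms(1)] by blast
  then have "m \<noteq> 0 \<or> n \<noteq> 0" using assms(2) by (auto simp: complex_eq_iff)
  then have "\<bar>Re z\<bar> \<ge> 1 \<or> \<bar>Im z\<bar> \<ge> 1" using z by (simp, linarith)
  then show ?thesis using abs_Re_le_cmod[of z] abs_Im_le_cmod[of z] by linarith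
qed

lemma pk_err_bounded: assumes "z \<in> square_lattice" "z \<noteq> 0" shows "\<bar>pk_err z\<bar> \<le> pk_const"
proof -
  have 1: "cmod z \<ge> 1" by (rule lattice_cmod_ge_1[OF assms])
  then have "1 * 1 \<le> cmod z * sqrt (cmod z)" by (intro mult_mono) auto
  then have "pk_const / (cmod z * sqrt (cmod z)) \<le> pk_const / 1" using pk_const by (intro divide_left_mono) auto
  then show ?thesis using pk_err_le[OF assms] by simp
qed

lemma pk_err_far:
  assumes z: "z \<in> square_lattice" "z \<noteq> 0" and r: "r > 0" "cmod z \<ge> r / 64"
  shows "\<bar>pk_err z\<bar> \<le> 512 * pk_const / (r * sqrt r)"
proof -
  have "sqrt (r / 64) \<le> sqrt (cmod z)" using r by (intro real_sqrt_le_mono)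
  moreover have "sqrt 64 = (8::real)" using real_sqrt_unique[of 8 64] by simp
  ultimately have "sqrt r / 8 \<le> sqrt (cmod z)" by (simp add: real_sqrt_divide)
  then have "(r / 64) * (sqrt r / 8) \<le> cmod z * sqrt (cmod z)" using r by (intro mult_mono) auto
  then have "pk_const / (cmod z * sqrt (cmod z)) \<le> pk_const / ((r / 64) * (sqrt r / 8))"
  proof (rule divide_left_mono)
    have "cmod z > 0" using z by simp
    then show "0 < cmod z * sqrt (cmod z) * (r / 64 * (sqrt r / 8))" using r by (intro mult_pos_pos) auto
  qed (use pk_const in auto)
  also have "\<dots> = 512 * pk_const / (r * sqrt r)" by simp
  finally show ?thesis using pk_err_le[OF z] by linarith
qed

lemma nmean_shift: "nmean (\<lambda>u. f (u - x)) w = nmean f (w - x)"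
proof -
  have "w + 1 - x = w - x + 1" "w - 1 - x = w - x - 1" "w + \<i> - x = w - x + \<i>" "w - \<i> - x = w - x - \<i>" by simp_all
  then show ?thesis unfolding nmean_def by (simp only:)
qed

context grid_disk
begin

text \<open>A Lipschitz cut-off is smooth enough: its first differences 4 / r multiply a kernel
  error that is already of order r^(-3/2).\<close>

definition cutoff :: "complex \<Rightarrow> real" where
  "cutoff w = max 0 (min 1 (2 - 4 * dist w x / bdist D x))"

lemma cutoff_range: "0 \<le> cutoff w" "cutoff w \<le> 1" by (auto simp: cutoff_def)

lemma r_ge_1: "bdist D x \<ge> 1" by (rule bdist_V[OF x_V])

lemma cutoff_near: assumes "dist w x \<le> bdist D x / 4" shows "cutoff w = 1"
proof -
  have "4 * dist w x / bdist D x \<le> 1" using assms r_ge_1 by (subst divide_le_eq) auto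
  then show ?thesis unfolding cutoff_def by linarith
qed

lemma cutoff_far: assumes "dist w x \<ge> bdist D x / 2" shows "cutoff w = 0"
proof -
  have "4 * dist w x / bdist D x \<ge> 2" using assms r_ge_1 by (subst le_divide_eq) auto
  then show ?thesis unfolding cutoff_def by linarith
qed

lemma cutoff_lipschitz: assumes "cmod e = 1" shows "\<bar>cutoff (w + e) - cutoff w\<bar> \<le> 4 / bdist D x"
proof -
  define r where "r = bdist D x"
  have r: "r > 0" using r_ge_1 by (simp add: r_def)
  have "\<bar>dist (w + e) x - dist w x\<bar> \<le> 1"
    using norm_triangle_ineq3[of "w + e - x" "w - x"] assms by (simp add: dist_norm)
  then have "\<bar>4 * (dist (w + e) x - dist w x)\<bar> / r \<le> 4 / r" using r by (intro divide_right_mono) auto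
  then have "\<bar>4 * dist (w + e) x / r - 4 * dist w x / r\<bar> \<le> 4 / r"
  proof -
    have "\<bar>4 * dist (w + e) x / r - 4 * dist w x / r\<bar> = \<bar>4 * (dist (w + e) x - dist w x)\<bar> / \<bar>r\<bar>"
      by (simp only: diff_divide_distrib right_diff_distrib abs_divide[symmetric])
    then show ?thesis using \<open>\<bar>4 * (dist (w + e) x - dist w x)\<bar> / r \<le> 4 / r\<close> r by simp
  qed
  moreover have "\<bar>max 0 (min 1 (2 - a)) - max 0 (min 1 (2 - b))\<bar> \<le> \<bar>a - b\<bar>" for a b :: real by linarith
  ultimately show ?thesis unfolding cutoff_def r_def[symmetric] by (meson order_trans)
qed

definition corrector :: "complex \<Rightarrow> real" where
  "corrector u = cutoff u * pk_err (u - x)"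

text \<open>Within distance \<open>bdist D x / 4\<close> of \<open>x\<close> the logarithms cancel and the parametrix is a harmonic
  function minus the potential kernel; the value at \<open>x\<close> is the one making this true at the pole too.\<close>

definition parametrix :: "complex \<Rightarrow> real" where
  "parametrix u = (if u \<notin> V then 0 else if u = x then - (2 / pi) * ln (cmod (deriv \<psi> x)) + k_zero
     else 2 / pi * g0 u - corrector u)"

lemma V_lattice: "u \<in> V \<Longrightarrow> u \<in> square_lattice" by (simp add: V_def)

lemma lattice_near_V: "u \<in> square_lattice \<Longrightarrow> dist u x < bdist D x \<Longrightarrow> u \<in> V"
  using ball_bdist_subset[of x D] by (auto simp: V_def dist_commute)

lemma v_near: assumes "dist u x \<le> bdist D x / 2" shows "3/4 \<le> v u"
proof -
  have r: "bdist D x > 0" using r_ge_1 by simp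
  then have "u \<in> ball x (bdist D x)" using assms by (simp add: dist_commute)
  then have "cmod (\<psi> u) \<le> dist u x / bdist D x" by (rule schwarz_near)
  also have "\<dots> \<le> 1 / 2" using assms r by (simp add: divide_le_eq)
  finally have "(cmod (\<psi> u))\<^sup>2 \<le> (1 / 2)\<^sup>2" by (intro power_mono) auto
  then show ?thesis by (simp add: v_def power_divide)
qed

text \<open>The singularity divides out: ln |psi u| - ln |u - x| is ln |q u| with a zero-free
  holomorphic q. The parametrix is then a harmonic function minus the potential kernel, whose
  lattice Laplacian is exactly the point mass, and only the Taylor error of the harmonic part is
  left.\<close>

lemma parametrix_near_pole:
  assumes r: "bdist D x \<ge> 64" and w: "w \<in> V" "dist w x \<le> bdist D x / 16"
  shows "\<bar>(if w = x then 1 else 0) - (parametrix w - nmean parametrix w)\<bar> \<le> 33280 / bdist D x ^ 4"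
proof -
  define r where "r = bdist D x"
  have r: "r \<ge> 64" using r by (simp add: r_def)
  have wl: "w \<in> square_lattice" by (rule V_lattice[OF w(1)])
  have bx: "ball x r \<subseteq> D" unfolding r_def by (rule ball_bdist_subset)
  define q where "q = (\<lambda>u. if u = x then deriv \<psi> x else (\<psi> u - \<psi> x) / (u - x))"
  have qh: "q holomorphic_on D" unfolding q_def by (rule pole_lemma_open[OF holo openD])
  have qnz: "q u \<noteq> 0" if "u \<in> D" for u
    using deriv_\<psi>_x \<psi>_nz[OF that] by (simp add: q_def \<psi>x)
  have qle: "r * cmod (q u) \<le> 1" if "u \<in> ball x r" for u
  proof (cases "u = x")
    case True then show ?thesis using schwarz_deriv[of x] r unfolding r_def by (simp add: q_def le_divide_eq mult.commute)
  next
    case False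
    have "cmod (\<psi> u) \<le> dist u x / r" unfolding r_def by (rule schwarz_near) (use that in \<open>simp add: r_def\<close>)
    then show ?thesis using False r by (simp add: q_def \<psi>x norm_divide dist_norm field_simps)
  qed
  \<comment> \<open>By Schwarz the factor r / 2 brings |f| down to at most 1/2, so -ln |f| is
    positive and Harnack's inequality applies; Koebe bounds its value at x by 16.\<close>
  define f where "f = (\<lambda>u. of_real (r / 2) * q u)"
  have fh: "f holomorphic_on ball x r" unfolding f_def by (intro holomorphic_intros holomorphic_on_subset[OF qh bx])
  have fnz: "f u \<noteq> 0" if "u \<in> ball x r" for u using qnz[of u] that bx r by (auto simp: f_def)
  have fn: "cmod (f u) = r / 2 * cmod (q u)" for u using r by (simp add: f_def norm_mult)
  obtain p where p: "p holomorphic_on ball x r" "\<And>u. u \<in> ball x r \<Longrightarrow> Re (p u) = - ln (cmod (f u))"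
    using holomorphic_log_ball[OF fh fnz] by metis
  have pos: "Re (p u) > 0" if "u \<in> ball x r" for u
  proof -
    have "cmod (f u) < 1" using qle[OF that] unfolding fn by argo
    then show ?thesis unfolding p(2)[OF that] using fnz[OF that] by simp
  qed
  have r0: "r > 0" using r by simp
  have px: "Re (p x) \<le> 16"
  proof -
    have "1 \<le> 8 * (r * cmod (deriv \<psi> x))" using deriv_lower by (simp add: r_def mult.assoc)
    then have lo: "1 / 16 \<le> cmod (f x)" unfolding fn q_def by simp
    then have "ln (1 / 16) \<le> ln (cmod (f x))" by (subst ln_le_cancel_iff) auto
    moreover have "ln (1 / 16) = - ln (16::real)" by (simp add: ln_div)
    moreover have "ln 16 \<le> (16::real) - 1" by (rule ln_le_minus_one) simp
    ultimately show ?thesis using p(2)[of x] r0 by simp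
  qed
  have half: "cmod (p u - p x) < 32" if "u \<in> ball x (r / 2)" for u
    using positive_real_part_half_ball[OF p(1) pos that r0] px by simp
  have wr: "dist w x \<le> r / 16" using w by (simp add: r_def)
  have sub: "ball w (r / 2) \<subseteq> ball x r" "ball w (r / 2 / 2) \<subseteq> ball x (r / 2)"
    unfolding ball_subset_ball_iff using wr r by auto
  have wb: "w \<in> ball x (r / 2)" using wr r by (simp add: dist_commute)
  have L: "\<bar>nmean (\<lambda>u. Re (p u)) w - Re (p w)\<bar> \<le> 32 * 65 / (r / 2) ^ 4"
  proof (rule nmean_Re_holomorphic)
    show "p holomorphic_on ball w (r / 2)" using p(1) sub(1) by (rule holomorphic_on_subset)
    \<comment> \<open>The oscillation about x is below 32 = 2 * 16 and is counted twice.\<close>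
    show "cmod (p z - p w) < 65" if "z \<in> ball w (r / 2 / 2)" for z
    proof -
      have "cmod (p z - p w) \<le> cmod (p z - p x) + cmod (p w - p x)"
        using norm_triangle_ineq4[of "p z - p x" "p w - p x"] by simp
      then show ?thesis using half[of z] half[OF wb] that sub(2) by fastforce
    qed
  qed (use r in auto)
  define h where "h = (\<lambda>u. 2 / pi * (Re (p u) + ln (r / 2)) + k_zero)"
  have eq: "parametrix u = h u - potential_kernel (u - x)" if ul: "u \<in> square_lattice" and ud: "dist u x \<le> r / 4" for u
  proof -
    have ub: "u \<in> ball x r" using ud r by (simp add: dist_commute)
    have uV: "u \<in> V" by (rule lattice_near_V[OF ul]) (use ud r in \<open>simp add: r_def\<close>)
    have "Re (p u) = - (ln (r / 2) + ln (cmod (q u)))"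
      unfolding p(2)[OF ub] fn using qnz[of u] ub bx r by (subst ln_mult) auto
    then have h: "h u = - (2 / pi) * ln (cmod (q u)) + k_zero" by (simp add: h_def)
    show ?thesis
    proof (cases "u = x")
      case True
      have "parametrix u = - (2 / pi) * ln (cmod (q u)) + k_zero" using True uV by (simp add: parametrix_def q_def)
      then have "parametrix u = h u" by (simp only: h)
      then show ?thesis using True by (simp add: pk_0)
    next
      case False
      have "ln (cmod (q u)) = ln (cmod (\<psi> u)) - ln (cmod (u - x))"
        using False \<psi>_nz[OF V_D[OF uV] False] by (simp add: q_def \<psi>x norm_divide ln_div)
      moreover have "corrector u = pk_err (u - x)" using cutoff_near[of u] ud by (simp add: corrector_def r_def)
      ultimately show ?thesis using False uV
        by (simp add: parametrix_def h g0_def pk_err_def right_diff_distrib)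
    qed
  qed
  have n: "nmean parametrix w = nmean h w - nmean potential_kernel (w - x)"
    unfolding nmean_shift[symmetric] nmean_diff[symmetric]
  proof (rule nmean_cong, rule eq)
    fix e :: complex assume e: "e \<in> {1, -1, \<i>, -\<i>}"
    show "w + e \<in> square_lattice" by (rule lattice_add[OF wl lattice_units[OF e]])
    have "cmod e = 1" using e by auto
    then have "dist (w + e) x \<le> dist w x + 1" using norm_triangle_ineq[of "w - x" e] by (simp add: dist_norm diff_add_eq)
    then show "dist (w + e) x \<le> r / 4" using wr r by simp
  qed
  have "nmean potential_kernel (w - x) = potential_kernel (w - x) + (if w - x = 0 then 1 else 0)"
    by (rule pk_harmonic[OF lattice_diff[OF wl x_lattice]])
  moreover have "parametrix w = h w - potential_kernel (w - x)" by (rule eq[OF wl]) (use wr r in simp)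
  ultimately have "(if w = x then 1 else 0) - (parametrix w - nmean parametrix w) = nmean h w - h w"
    unfolding n by simp
  also have "\<dots> = 2 / pi * (nmean (\<lambda>u. Re (p u)) w - Re (p w))"
    unfolding h_def nmean_add nmean_cmult nmean_const by (simp add: algebra_simps)
  finally have "\<bar>(if w = x then 1 else 0) - (parametrix w - nmean parametrix w)\<bar> = 2 / pi * \<bar>nmean (\<lambda>u. Re (p u)) w - Re (p w)\<bar>"
    proof -
    assume *: "(if w = x then 1 else 0) - (parametrix w - nmean parametrix w) = 2 / pi * (nmean (\<lambda>u. Re (p u)) w - Re (p w))"
    have "\<bar>2 / pi * t\<bar> = 2 / pi * \<bar>t\<bar>" for t :: real unfolding abs_mult by simp
    then show ?thesis unfolding * by blast
  qed
  also have "\<dots> \<le> 1 * (32 * 65 / (r / 2) ^ 4)" by (intro mult_mono L) (use pi_gt3 in \<open>auto simp: divide_le_eq\<close>)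
  also have "\<dots> = 33280 / r ^ 4" by (simp add: power_divide)
  finally show ?thesis by (simp only: r_def)
qed

lemma corrector_laplacian:
  assumes w: "w \<in> V" "dist w x > 1" and far: "\<And>e. e \<in> {0, 1, -1, \<i>, -\<i>} \<Longrightarrow> dist (w + e) x \<ge> bdist D x / 64"
  shows "\<bar>nmean corrector w - corrector w\<bar> \<le> (512 * 64 ^ 4 + 2048 * pk_const) / ((bdist D x)\<^sup>2 * sqrt (bdist D x))"
proof -
  define r where "r = bdist D x"
  have r: "r \<ge> 1" using r_ge_1 by (simp add: r_def)
  have wl: "w \<in> square_lattice" by (rule V_lattice[OF w(1)])
  define b where "b = (\<lambda>u. pk_err (u - x))"
  \<comment> \<open>Discrete product rule: the Laplacian of the kernel error is of order r^-4, and
    differences of the cut-off times the error itself are of order r^(-5/2).\<close>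
  have "nmean corrector w - corrector w = cutoff w * (nmean b w - b w) + nmean (\<lambda>u. (cutoff u - cutoff w) * b u) w"
    unfolding corrector_def[abs_def] b_def nmean_def by (simp add: algebra_simps add_divide_distrib diff_divide_distrib)
  moreover have "\<bar>cutoff w * (nmean b w - b w)\<bar> \<le> 512 * 64 ^ 4 / r ^ 4"
  proof -
    have "\<bar>nmean b w - b w\<bar> = \<bar>nmean pk_err (w - x) - pk_err (w - x)\<bar>" unfolding b_def nmean_shift ..
    also have "\<dots> \<le> 512 / cmod (w - x) ^ 4"
      by (rule pk_err_laplacian[OF lattice_diff[OF wl x_lattice]]) (use w(2) in \<open>simp add: dist_norm\<close>)
    also have "\<dots> \<le> 512 / (r / 64) ^ 4"
    proof (rule divide_left_mono)
      have "cmod (w - x) > 0" using w(2) unfolding dist_norm by linarith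
      then show "0 < cmod (w - x) ^ 4 * (r / 64) ^ 4" using r by (intro mult_pos_pos zero_less_power) auto
    qed (use far[of 0] r in \<open>auto simp: r_def dist_norm intro!: power_mono\<close>)
    also have "\<dots> = 512 * 64 ^ 4 / r ^ 4" by (simp add: power_divide)
    finally have "\<bar>nmean b w - b w\<bar> \<le> 512 * 64 ^ 4 / r ^ 4" .
    then have "\<bar>cutoff w\<bar> * \<bar>nmean b w - b w\<bar> \<le> 1 * (512 * 64 ^ 4 / r ^ 4)"
      using cutoff_range[of w] by (intro mult_mono) auto
    then show ?thesis by (simp add: abs_mult)
  qed
  moreover have "512 * 64 ^ 4 / r ^ 4 \<le> 512 * 64 ^ 4 / (r\<^sup>2 * sqrt r)"
  proof (rule divide_left_mono)
    have "sqrt r \<le> r\<^sup>2" by (rule real_le_lsqrt) (use r self_le_power[of r 4] in \<open>auto simp: power_mult[symmetric]\<close>)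
    then have "r\<^sup>2 * sqrt r \<le> r\<^sup>2 * r\<^sup>2" using r by (intro mult_left_mono) auto
    then show "r\<^sup>2 * sqrt r \<le> r ^ 4" by (simp add: power_add[symmetric])
  qed (use r in auto)
  moreover have "\<bar>nmean (\<lambda>u. (cutoff u - cutoff w) * b u) w\<bar> \<le> 2048 * pk_const / (r\<^sup>2 * sqrt r)"
  proof (rule nmean_abs_le)
    fix e :: complex assume e: "e \<in> {1, -1, \<i>, -\<i>}"
    then have ce: "cmod e = 1" by auto
    have f: "dist (w + e) x \<ge> r / 64" using far[of e] e by (auto simp: r_def)
    have "\<bar>b (w + e)\<bar> \<le> 512 * pk_const / (r * sqrt r)" unfolding b_def
    proof (rule pk_err_far)
      show "w + e - x \<in> square_lattice" by (rule lattice_diff[OF lattice_add[OF wl lattice_units[OF e]] x_lattice])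
    qed (use f r in \<open>auto simp: dist_norm\<close>)
    then have "\<bar>cutoff (w + e) - cutoff w\<bar> * \<bar>b (w + e)\<bar> \<le> (4 / r) * (512 * pk_const / (r * sqrt r))"
      using cutoff_lipschitz[OF ce, of w] r unfolding r_def[symmetric] by (intro mult_mono) auto
    then show "\<bar>(cutoff (w + e) - cutoff w) * b (w + e)\<bar> \<le> 2048 * pk_const / (r\<^sup>2 * sqrt r)"
      by (simp add: abs_mult power2_eq_square mult.assoc)
  qed
  ultimately show ?thesis unfolding r_def[symmetric] add_divide_distrib by linarith
qed

lemma corrector_laplacian_zero:
  assumes "\<And>e. e \<in> {0, 1, -1, \<i>, -\<i>} \<Longrightarrow> dist (w + e) x \<ge> bdist D x / 2"
  shows "nmean corrector w - corrector w = 0"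
proof -
  have "nmean corrector w = nmean (\<lambda>u. 0) w"
    by (rule nmean_cong) (use assms cutoff_far in \<open>auto simp: corrector_def\<close>)
  moreover have "cutoff w = 0" using assms[of 0] by (intro cutoff_far) simp
  ultimately show ?thesis by (simp add: corrector_def nmean_const)
qed

end

section \<open>Source estimate for the parametrix and the final comparison\<close>

definition crude_const :: real where "crude_const = 4096 + pk_const + \<bar>k_zero\<bar>"

text \<open>The summands belong to the far field, the pole, the corrector and small radii. The
  factors 16 and 648 come from \<open>v_le_weight\<close> and \<open>near_le_weight\<close>; 64^3
  turns a bounded quantity into a multiple of r^(-5/2) when r < 64.\<close>

definition source_const :: real where
  "source_const = 16 * (2048 * 64 * 130 ^ 4)
     + 648 * (33280 + (512 * 64 ^ 4 + 2048 * pk_const) + 64 ^ 3 * (1 + 2 * crude_const))"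

lemma source_const_ge:
  "16 * (2048 * 64 * 130 ^ 4) + 648 * (512 * 64 ^ 4 + 2048 * pk_const) \<le> source_const"
  "648 * 33280 \<le> source_const" "648 * (64 ^ 3 * (1 + 2 * crude_const)) \<le> source_const" "0 \<le> source_const"
  using pk_const unfolding source_const_def crude_const_def by auto

context grid_disk
begin

lemma weight_nonneg: "weight \<alpha> w \<ge> 0" by (simp add: weight_def)

text \<open>For r < 64 nothing has to be small. Lattice points other than x are at distance at least
  r / 64 from it, and at x itself Schwarz and Koebe enclose |psi'(x)|.\<close>

lemma parametrix_small_domain:
  assumes r: "bdist D x < 64" and u: "u \<in> V"
  shows "\<bar>parametrix u\<bar> \<le> crude_const"
proof (cases "u = x")
  case True
  define t r where "t = cmod (deriv \<psi> x)" and "r = bdist D x"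
  have r: "1 \<le> r" "r < 64" using r r_ge_1 by (auto simp: r_def)
  have "t \<le> 1 / r" unfolding t_def r_def by (rule schwarz_deriv[of x]) (use r in \<open>simp add: r_def\<close>)
  also have "\<dots> \<le> 1" using r by simp
  finally have t1: "t \<le> 1" .
  have "1 \<le> 8 * r * t" using deriv_lower by (simp add: r_def t_def)
  also have "8 * r * t \<le> 512 * t" using r by (intro mult_right_mono) (auto simp: t_def)
  finally have t2: "1 / 512 \<le> t" by simp
  have "ln (1 / t) \<le> 1 / t - 1" by (rule ln_le_minus_one) (use t2 in simp)
  moreover have "1 / t \<le> 512" using t2 by (subst divide_le_eq) auto
  moreover have "ln (1 / t) = - ln t" using t2 by (simp add: ln_div)
  ultimately have "0 \<le> - ln t" "- ln t \<le> 512" using t1 t2 by auto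
  then have "2 / pi * (- ln t) \<le> 1 * 512" "0 \<le> 2 / pi * (- ln t)"
    using pi_gt3 \<open>0 \<le> - ln t\<close> \<open>- ln t \<le> 512\<close> mult_mono[of "2 / pi" 1 "- ln t" 512] mult_nonneg_nonneg[of "2 / pi" "- ln t"]
    by (simp_all only: divide_le_eq) auto
  then have "\<bar>2 / pi * (- ln t)\<bar> \<le> 512" by linarith
  then have "\<bar>- (2 / pi) * ln t\<bar> \<le> 512" by simp
  moreover have "parametrix u = - (2 / pi) * ln t + k_zero" using True u by (simp add: parametrix_def t_def)
  ultimately show ?thesis using pk_const unfolding crude_const_def by linarith
next
  case False
  have uD: "u \<in> D" by (rule V_D[OF u])
  have l: "u - x \<in> square_lattice" "u - x \<noteq> 0" using lattice_diff[OF V_lattice[OF u] x_lattice] False by auto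
  have "dist u x \<ge> bdist D x / 64" using lattice_cmod_ge_1[OF l] r by (simp add: dist_norm)
  then have "g0 u \<le> 2048 * v u" by (intro g0_le[OF uD] far_\<psi>[OF uD])
  also have "\<dots> \<le> 2048 * 1" by (intro mult_left_mono v_le_1) simp
  finally have "2 / pi * g0 u \<le> 1 * 2048" using pi_gt3 g0_nonneg[OF uD] by (intro mult_mono) (auto simp: divide_le_eq)
  moreover have "0 \<le> 2 / pi * g0 u" using g0_nonneg[OF uD] by simp
  moreover have "\<bar>cutoff u\<bar> * \<bar>pk_err (u - x)\<bar> \<le> 1 * pk_const"
    using cutoff_range[of u] pk_err_bounded[OF l] by (intro mult_mono) auto
  then have "\<bar>corrector u\<bar> \<le> pk_const" by (simp add: corrector_def abs_mult)
  moreover have "parametrix u = 2 / pi * g0 u - corrector u" using u False by (simp add: parametrix_def)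
  ultimately show ?thesis unfolding crude_const_def by linarith
qed

lemma parametrix_far:
  assumes w: "w \<in> V" "dist w x > 1" and far: "\<And>e. e \<in> {0, 1, -1, \<i>, -\<i>} \<Longrightarrow> dist (w + e) x \<ge> bdist D x / 64"
    and \<alpha>: "0 < \<alpha>" "\<alpha> < 1"
  shows "\<bar>parametrix w - nmean parametrix w\<bar> \<le> source_const * weight \<alpha> w"
proof -
  define r W where "r = bdist D x" and "W = weight \<alpha> w"
  have r: "r \<ge> 1" using r_ge_1 by (simp add: r_def)
  have wl: "w \<in> square_lattice" by (rule V_lattice[OF w(1)])
  define G where "G = (\<lambda>u. if u \<in> V then g0 u else 0)"
  have wx: "w \<noteq> x" using w(2) by auto
  have off: "corrector u = 0" if "u \<in> square_lattice" "u \<notin> V" for u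
  proof -
    have "dist u x \<ge> bdist D x" using lattice_near_V[OF that(1)] that(2) not_le by blast
    then have "cutoff u = 0" using r_ge_1 by (intro cutoff_far) simp
    then show ?thesis by (simp add: corrector_def)
  qed
  have pw: "parametrix w = 2 / pi * g0 w - corrector w" using w wx by (simp add: parametrix_def)
  have "nmean parametrix w = nmean (\<lambda>u. 2 / pi * G u - corrector u) w"
  proof (rule nmean_cong)
    fix e :: complex assume e: "e \<in> {1, -1, \<i>, -\<i>}"
    have l: "w + e \<in> square_lattice" by (rule lattice_add[OF wl lattice_units[OF e]])
    have "dist (w + e) x \<ge> r / 64" using far[of e] e by (auto simp: r_def)
    then have "w + e \<noteq> x" using r by auto
    then show "parametrix (w + e) = 2 / pi * G (w + e) - corrector (w + e)"
      using off[OF l] by (simp add: parametrix_def G_def)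
  qed
  then have "nmean parametrix w = 2 / pi * nmean G w - nmean corrector w"
    unfolding nmean_diff nmean_cmult .
  then have eq: "parametrix w - nmean parametrix w = - (2 / pi * (nmean G w - g0 w)) + (nmean corrector w - corrector w)"
    unfolding pw by (simp add: right_diff_distrib)
  have "\<bar>nmean G w - g0 w\<bar> \<le> 2048 * 64 * 130 ^ 4 * (v w / bdist D w ^ 3)"
    unfolding G_def by (rule g0_far_laplacian[OF w(1) far])
  also have "\<dots> \<le> 2048 * 64 * 130 ^ 4 * (16 * W)"
    unfolding W_def by (intro mult_left_mono v_le_weight[OF w(1) \<alpha>]) auto
  finally have "2 / pi * \<bar>nmean G w - g0 w\<bar> \<le> 1 * (2048 * 64 * 130 ^ 4 * (16 * W))"
    using pi_gt3 by (intro mult_mono) (auto simp: divide_le_eq)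
  moreover have "\<bar>2 / pi * t\<bar> = 2 / pi * \<bar>t\<bar>" for t :: real unfolding abs_mult by simp
  ultimately have "\<bar>2 / pi * (nmean G w - g0 w)\<bar> \<le> 1 * (2048 * 64 * 130 ^ 4 * (16 * W))" by metis
  then have g: "\<bar>2 / pi * (nmean G w - g0 w)\<bar> \<le> 16 * (2048 * 64 * 130 ^ 4) * W" by (simp only: mult_1 mult_ac)
  have W0: "W \<ge> 0" unfolding W_def by (rule weight_nonneg)
  define C where "C = 512 * 64 ^ 4 + 2048 * pk_const"
  have C: "C \<ge> 0" using pk_const by (simp add: C_def)
  have c: "\<bar>nmean corrector w - corrector w\<bar> \<le> 648 * C * W"
  \<comment> \<open>If w or a neighbour lies within r / 2 of x, then v >= 3/4 there and v w >= (3/4)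
    / 54 = 1/72, so \<open>near_le_weight\<close> applies. Otherwise the corrector vanishes at w and
    all its neighbours.\<close>
  proof (cases "\<exists>e\<in>{0, 1, -1, \<i>, -\<i>}. dist (w + e) x < r / 2")
    case True
    then obtain e where e: "e \<in> {0, 1, -1, \<i>, -\<i>}" "dist (w + e) x < r / 2" by blast
    have v34: "3 / 4 \<le> v (w + e)" using e(2) by (intro v_near) (simp add: r_def)
    have "v (w + e) \<le> 54 * v w"
    proof (cases "e = 0")
      case True then show ?thesis using v_pos[OF V_D[OF w(1)]] by simp
    next
      case False
      then have e': "e \<in> {1, -1, \<i>, -\<i>}" using e(1) by blast
      then have ce: "cmod e = 1" by auto
      have "w + e \<in> V"
        by (rule lattice_near_V[OF lattice_add[OF wl lattice_units[OF e']]]) (use e(2) r in \<open>simp add: r_def\<close>)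
      then show ?thesis by (rule V_step[OF w(1) _ ce])
    qed
    then have v72: "1 / 72 \<le> v w" using v34 by linarith
    have "cmod e \<le> 1" using e(1) by auto
    then have "dist w x \<le> dist (w + e) x + 1" using norm_triangle_ineq4[of "w + e - x" e] by (simp add: dist_norm)
    then have "bdist D w \<le> 3 * bdist D x" using bdist_triangle[of D w x] e(2) r unfolding r_def by linarith
    then have X: "1 / (r\<^sup>2 * sqrt r) \<le> 648 * W" unfolding r_def W_def by (rule near_le_weight[OF w(1) \<alpha> v72])
    have "\<bar>nmean corrector w - corrector w\<bar> \<le> C / (r\<^sup>2 * sqrt r)" unfolding C_def r_def by (rule corrector_laplacian[OF w far])
    also have "\<dots> = C * (1 / (r\<^sup>2 * sqrt r))" by simp
    also have "\<dots> \<le> C * (648 * W)" using X C by (rule mult_left_mono)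
    finally show ?thesis by (simp add: mult_ac)
  next
    case False
    then have "nmean corrector w - corrector w = 0" by (intro corrector_laplacian_zero) (unfold r_def[symmetric], meson not_less)
    then show ?thesis using C W0 by simp
  qed
  have "\<bar>parametrix w - nmean parametrix w\<bar> \<le> 16 * (2048 * 64 * 130 ^ 4) * W + 648 * C * W"
    unfolding eq using g c by linarith
  also have "\<dots> = (16 * (2048 * 64 * 130 ^ 4) + 648 * C) * W" by (simp only: distrib_right)
  also have "\<dots> \<le> source_const * W" using W0 source_const_ge(1) unfolding C_def by (intro mult_right_mono)
  finally show ?thesis by (simp only: W_def)
qed

lemma parametrix_source:
  assumes w: "w \<in> V" and \<alpha>: "0 < \<alpha>" "\<alpha> < 1"
  shows "\<bar>(if w = x then 1 else 0) - (parametrix w - nmean parametrix w)\<bar> \<le> source_const * weight \<alpha> w"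
proof -
  define r W where "r = bdist D x" and "W = weight \<alpha> w"
  have r: "r \<ge> 1" using r_ge_1 by (simp add: r_def)
  have W0: "W \<ge> 0" unfolding W_def by (rule weight_nonneg)
  have wl: "w \<in> square_lattice" by (rule V_lattice[OF w])
  \<comment> \<open>The expansion at the pole needs room, hence r >= 64. For smaller r the lattice
    spacing alone keeps w and its neighbours at distance r / 64 from x as soon as |w - x| >
    1.\<close>
  consider (pole) "r \<ge> 64" "dist w x \<le> r / 16" | (far) "r \<ge> 64" "dist w x > r / 16" | (far') "r < 64" "dist w x > 1"
    | (small) "r < 64" "dist w x \<le> 1" by linarith
  then show ?thesis
  proof cases
    case pole
    have v72: "1 / 72 \<le> v w" using v_near[of w] pole unfolding r_def by linarith
    have "bdist D w \<le> 3 * bdist D x" using bdist_triangle[of D w x] pole unfolding r_def by linarith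
    then have X: "1 / (r\<^sup>2 * sqrt r) \<le> 648 * W" unfolding r_def W_def by (rule near_le_weight[OF w \<alpha> v72])
    have "1 / r ^ 4 \<le> 1 / (r\<^sup>2 * sqrt r)"
    proof (rule divide_left_mono)
      have "sqrt r \<le> r\<^sup>2" by (rule real_le_lsqrt) (use r self_le_power[of r 4] in \<open>auto simp: power_mult[symmetric]\<close>)
      then have "r\<^sup>2 * sqrt r \<le> r\<^sup>2 * r\<^sup>2" using r by (intro mult_left_mono) auto
      then show "r\<^sup>2 * sqrt r \<le> r ^ 4" by (simp add: power_add[symmetric])
    qed (use r in auto)
    then have "33280 * (1 / r ^ 4) \<le> 33280 * (648 * W)" using X by simp
    also have "\<dots> = 648 * 33280 * W" by simp
    also have "\<dots> \<le> source_const * W" by (intro mult_right_mono source_const_ge(2) W0)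
    finally have "33280 / r ^ 4 \<le> source_const * W" by simp
    then show ?thesis using parametrix_near_pole[OF _ w] pole unfolding r_def W_def by linarith
  next
    case far
    have f: "dist (w + e) x \<ge> bdist D x / 64" if "e \<in> {0, 1, -1, \<i>, -\<i>}" for e
    proof -
      have "cmod e \<le> 1" using that by auto
      then have "dist w x \<le> dist (w + e) x + 1" using norm_triangle_ineq4[of "w + e - x" e] by (simp add: dist_norm)
      then show ?thesis using far unfolding r_def by linarith
    qed
    have "dist w x > 1" "w \<noteq> x" using far by auto
    then show ?thesis using parametrix_far[OF w _ f \<alpha>] by simp
  next
    case far'
    have f: "dist (w + e) x \<ge> bdist D x / 64" if e: "e \<in> {0, 1, -1, \<i>, -\<i>}" for e
    proof -
      have "cmod e \<le> 1" using e by auto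
      then have "w + e \<noteq> x" using far'(2) by (auto simp: dist_norm)
      moreover have "w + e \<in> square_lattice"
        using e lattice_units[of e] wl by (cases "e = 0") (auto intro!: lattice_add)
      ultimately have "1 \<le> dist (w + e) x" unfolding dist_norm
        by (intro lattice_cmod_ge_1 lattice_diff x_lattice) auto
      then show ?thesis using far'(1) by (simp add: r_def)
    qed
    have "w \<noteq> x" using far' by auto
    then show ?thesis using parametrix_far[OF w _ f \<alpha>] far'(2) by simp
  next
    case small
    have v72: "1 / 72 \<le> v w"
    proof (cases "w = x")
      case True then show ?thesis by (simp add: v_x)
    next
      case False
      have "1 \<le> cmod (w - x)" by (rule lattice_cmod_ge_1[OF lattice_diff[OF wl x_lattice]]) (use False in simp)
      then have "cmod (x - w) = 1" using small by (simp add: dist_norm norm_minus_commute)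
      then have "v (w + (x - w)) \<le> 54 * v w" by (intro V_step w) (use x_V in auto)
      then show ?thesis by (simp add: v_x)
    qed
    have "bdist D w \<le> 3 * bdist D x" using bdist_triangle[of D w x] small r unfolding r_def by linarith
    then have X: "1 / (r\<^sup>2 * sqrt r) \<le> 648 * W" unfolding r_def W_def by (rule near_le_weight[OF w \<alpha> v72])
    have "r\<^sup>2 * sqrt r \<le> 64\<^sup>2 * 64"
    proof (intro mult_mono power_mono)
      have "sqrt r \<le> r" by (rule real_le_lsqrt) (use r self_le_power[of r 2] in auto)
      then show "sqrt r \<le> 64" using small by simp
    qed (use small r in auto)
    then have one: "1 \<le> 64 ^ 3 * (1 / (r\<^sup>2 * sqrt r))" using r by (simp add: le_divide_eq)
    have P: "\<bar>parametrix u\<bar> \<le> crude_const" if "u \<in> V" for u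
      by (rule parametrix_small_domain[OF _ that]) (use small in \<open>simp add: r_def\<close>)
    have P': "\<bar>parametrix u\<bar> \<le> crude_const" for u
      using P[of u] pk_const by (cases "u \<in> V") (auto simp: parametrix_def crude_const_def)
    have c0: "crude_const \<ge> 0" using pk_const by (simp add: crude_const_def)
    have "\<bar>nmean parametrix w\<bar> \<le> crude_const" by (rule nmean_abs_le[OF P'])
    then have "\<bar>(if w = x then 1 else 0) - (parametrix w - nmean parametrix w)\<bar> \<le> (1 + 2 * crude_const) * 1"
      using P'[of w] unfolding abs_le_iff by (simp only: split: if_split) argo
    also have "\<dots> \<le> (1 + 2 * crude_const) * (64 ^ 3 * (648 * W))"
      using one X c0 by (intro mult_left_mono order_trans[OF one] mult_left_mono X) auto
    also have "\<dots> = 648 * (64 ^ 3 * (1 + 2 * crude_const)) * W" by (simp add: mult_ac)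
    also have "\<dots> \<le> source_const * W" by (intro mult_right_mono source_const_ge(3) W0)
    finally show ?thesis by (simp only: W_def)
  qed
qed

text \<open>Beyond distance r the cut-off is 0 and the parametrix is a multiple of
  \<open>g0\<close>; D may be unbounded although its inner radius is finite.\<close>

lemma parametrix_infinity:
  assumes "\<delta> > 0"
  shows "\<exists>n. \<forall>w\<in>V. cmod w > n \<longrightarrow> 0 \<le> parametrix w \<and> parametrix w \<le> \<delta>"
proof -
  obtain B where B: "\<And>w. w \<in> D \<Longrightarrow> cmod w > B \<Longrightarrow> g0 w < \<delta>" using g0_infinity[OF assms] by blast
  show ?thesis
  proof (intro exI[of _ "max B (cmod x + bdist D x)"] ballI impI)
    fix w assume w: "w \<in> V" "cmod w > max B (cmod x + bdist D x)"
    have "cmod w \<le> dist w x + cmod x" using norm_triangle_ineq[of "w - x" x] by (simp add: dist_norm)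
    then have d: "dist w x > bdist D x" using w by simp
    then have "cutoff w = 0" "w \<noteq> x" using r_ge_1 by (auto intro!: cutoff_far)
    then have p: "parametrix w = 2 / pi * g0 w" using w by (simp add: parametrix_def corrector_def)
    have g: "0 \<le> g0 w" "g0 w \<le> \<delta>" using g0_nonneg[OF V_D] B[OF V_D] w by (auto simp: less_imp_le)
    then have "2 / pi * g0 w \<le> 1 * \<delta>" using pi_gt3 by (intro mult_mono) (auto simp: divide_le_eq)
    then show "0 \<le> parametrix w \<and> parametrix w \<le> \<delta>" unfolding p using g by simp
  qed
qed

lemma green_approximation:
  fixes \<alpha> :: real
  defines "\<kappa> \<equiv> min (\<alpha> / 1024) (gap / 2)"
  assumes \<alpha>: "0 < \<alpha>" "\<alpha> \<le> 1/32" "54 powr \<alpha> \<le> 1 + gap / (2 * horizon)" and y: "y \<in> V" "y \<noteq> x"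
  shows "\<bar>rw_green D x y - 2 / pi * green D x y - k_corr (y - x)\<bar>
    \<le> (source_const / \<kappa> * horizon + 512 * pk_const) * bdist D x powr (- (1 - \<alpha>) / 2)"
proof -
  define r A where "r = bdist D x" and "A = r powr (- (1 - \<alpha>) / 2)"
  have r: "r \<ge> 1" using r_ge_1 by (simp add: r_def)
  have A: "A > 0" using r by (simp add: A_def)
  have \<kappa>: "\<kappa> > 0" using \<alpha> gap_pos by (simp add: \<kappa>_def)
  define c where "c = source_const * A / \<kappa>"
  have c: "c \<ge> 0" using A \<kappa> source_const_ge(4) by (simp add: c_def)
  have "\<bar>(\<Sum>j. killed_prob V j x y) - parametrix y\<bar> \<le> c * barrier \<alpha> y"
  proof (rule killed_green_comparison(2)[where \<Phi> = "\<lambda>w. c * barrier \<alpha> w"])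
    show "V \<subseteq> square_lattice" by (auto simp: V_def)
    show "c * barrier \<alpha> w \<ge> 0" for w using c barrier_nonneg by simp
    show "\<bar>(if w = x then 1 else 0) - (parametrix w - nmean parametrix w)\<bar> \<le> c * barrier \<alpha> w - nmean (\<lambda>w. c * barrier \<alpha> w) w"
      if w: "w \<in> V" for w
    proof -
      define t where "t = v w powr \<alpha> / (bdist D w)\<^sup>2"
      have "\<bar>(if w = x then 1 else 0) - (parametrix w - nmean parametrix w)\<bar> \<le> source_const * weight \<alpha> w"
        by (rule parametrix_source[OF w]) (use \<alpha> in auto)
      also have "\<dots> = c * (\<kappa> * t)" using \<kappa> by (simp add: weight_def c_def t_def A_def r_def)
      also have "\<dots> \<le> c * (barrier \<alpha> w - nmean (barrier \<alpha>) w)"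
        unfolding \<kappa>_def t_def by (intro mult_left_mono barrier_supersolution \<alpha> w c)
      finally show ?thesis unfolding nmean_cmult by (simp only: right_diff_distrib)
    qed
    show "parametrix w = 0" if "w \<notin> V" for w using that by (simp add: parametrix_def)
  qed (use x_V y parametrix_infinity in auto)
  also have "c * barrier \<alpha> y \<le> c * horizon" by (intro mult_left_mono barrier_le \<alpha> c)
  also have "\<dots> = source_const / \<kappa> * horizon * A" by (simp add: c_def)
  finally have 1: "\<bar>rw_green D x y - parametrix y\<bar> \<le> source_const / \<kappa> * horizon * A"
    unfolding rw_green_eq V_def .
  have yD: "y \<in> D" by (rule V_D[OF y(1)])
  have l: "y - x \<in> square_lattice" "y - x \<noteq> 0" using lattice_diff[OF V_lattice[OF y(1)] x_lattice] y(2) by auto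
  have k: "k_corr (y - x) = - pk_err (y - x)" by (simp add: k_corr_def pk_err_def)
  \<comment> \<open>Where the cut-off has removed part of the kernel error, |y - x| > r / 4 and that
    error is of order r^(-3/2), better than the required rate.\<close>
  have "parametrix y = 2 / pi * green D x y + k_corr (y - x) + (1 - cutoff y) * pk_err (y - x)"
    using y unfolding k green_eq[OF yD y(2)] by (simp add: parametrix_def corrector_def algebra_simps)
  moreover have "\<bar>(1 - cutoff y) * pk_err (y - x)\<bar> \<le> 512 * pk_const * A"
  proof (cases "dist y x \<le> r / 4")
    case True then show ?thesis using cutoff_near[of y] pk_const A by (simp add: r_def)
  next
    case False
    have "\<bar>1 - cutoff y\<bar> * \<bar>pk_err (y - x)\<bar> \<le> 1 * (512 * pk_const / (r * sqrt r))"
      using cutoff_range[of y] False r by (intro mult_mono pk_err_far[OF l]) (auto simp: dist_norm)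
    also have "\<dots> = 512 * pk_const * (1 / (r * sqrt r))" by simp
    also have "1 / (r * sqrt r) \<le> 1 / sqrt r" using r by (intro divide_left_mono) auto
    also have "1 / sqrt r = r powr (- (1/2))" using r by (simp add: powr_minus_divide powr_half_sqrt)
    also have "r powr (- (1/2)) \<le> A" unfolding A_def using r \<alpha> by (intro powr_mono) (auto simp: field_simps)
    finally show ?thesis using pk_const by (simp add: abs_mult mult_left_mono)
  qed
  ultimately have "\<bar>rw_green D x y - 2 / pi * green D x y - k_corr (y - x)\<bar> \<le> source_const / \<kappa> * horizon * A + 512 * pk_const * A"
    using 1 by linarith
  then show ?thesis unfolding A_def r_def by (simp only: distrib_right)
qed

end

section \<open>The Riemann map and the inner radius\<close>

lemma moebius_recentre:
  assumes f: "f holomorphic_on D" "bij_betw f D (ball 0 1)" and a: "a \<in> D"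
  defines "g \<equiv> \<lambda>z. Moebius_function 0 (f a) (f z)"
  shows "g holomorphic_on D" "bij_betw g D (ball 0 1)" "g a = 0"
proof -
  have fa: "cmod (f a) < 1" using f(2) a by (auto simp: bij_betw_def)
  have sub: "f ` D \<subseteq> ball 0 1" using f(2) by (simp add: bij_betw_def)
  show "g holomorphic_on D"
    unfolding g_def by (rule holomorphic_on_compose_gen[OF f(1) Moebius_function_holomorphic[OF fa] sub, unfolded o_def])
  have "bij_betw (Moebius_function 0 (f a)) (ball 0 1) (ball 0 1)"
  proof (rule bij_betwI[where g = "Moebius_function 0 (- f a)"])
    show "Moebius_function 0 (f a) \<in> ball 0 1 \<rightarrow> ball 0 1" "Moebius_function 0 (- f a) \<in> ball 0 1 \<rightarrow> ball 0 1"
      using fa by (auto intro!: Moebius_function_norm_lt_1)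
    show "Moebius_function 0 (- f a) (Moebius_function 0 (f a) z) = z" if "z \<in> ball 0 1" for z
      by (rule Moebius_function_compose) (use fa that in auto)
    show "Moebius_function 0 (f a) (Moebius_function 0 (- f a) z) = z" if "z \<in> ball 0 1" for z
      by (rule Moebius_function_compose) (use fa that in auto)
  qed
  then show "bij_betw g D (ball 0 1)" unfolding g_def using bij_betw_trans[OF f(2)] by (simp add: o_def)
  show "g a = 0" by (simp add: g_def Moebius_function_eq_zero)
qed

lemma riemann_map_exists:
  assumes D: "open D" "simply_connected D" "0 \<in> D" "D \<noteq> UNIV"
  shows "is_riemann_map D (riemann_map D)"
proof -
  obtain f g where fg: "f holomorphic_on D" "\<And>z. z \<in> D \<Longrightarrow> f z \<in> ball 0 1" "\<And>z. z \<in> D \<Longrightarrow> g (f z) = z"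
    "\<And>z. z \<in> ball 0 1 \<Longrightarrow> g z \<in> D" "\<And>z. z \<in> ball 0 1 \<Longrightarrow> f (g z) = z"
    using Riemann_mapping_theorem[of D] D by blast
  have bij: "bij_betw f D (ball 0 1)" by (rule bij_betwI[where g = g]) (use fg in auto)
  define m where "m = (\<lambda>z. Moebius_function 0 (f 0) (f z))"
  have m: "m holomorphic_on D" "bij_betw m D (ball 0 1)" "m 0 = 0"
    unfolding m_def by (rule moebius_recentre[OF fg(1) bij D(3)])+
  have d0: "deriv m 0 \<noteq> 0"
    by (rule holomorphic_injective_imp_regular[OF m(1) D(1) _ D(3)]) (use m(2) in \<open>simp add: bij_betw_def\<close>)
  define c where "c = cnj (sgn (deriv m 0))"
  have c1: "cmod c = 1" using d0 by (simp add: c_def norm_sgn)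
  define h where "h = (\<lambda>z. c * m z)"
  have hh: "h holomorphic_on D" unfolding h_def by (intro holomorphic_intros m)
  have "bij_betw (\<lambda>z. c * z) (ball 0 1) (ball 0 1)"
  proof (rule bij_betwI[where g = "\<lambda>z. cnj c * z"])
    have cc: "cnj c * c = 1" using c1 by (simp add: complex_norm_square[symmetric] mult.commute)
    show "cnj c * (c * z) = z" "c * (cnj c * z) = z" for z using cc by (simp_all add: mult.assoc[symmetric] mult.commute[of c])
  qed (use c1 in \<open>auto simp: norm_mult\<close>)
  then have hb: "bij_betw h D (ball 0 1)" unfolding h_def using bij_betw_trans[OF m(2)] by (simp add: o_def)
  have "m field_differentiable (at 0)" by (rule holomorphic_on_imp_differentiable_at[OF m(1) D(1,3)])
  then have "deriv h 0 = c * deriv m 0" unfolding h_def by simp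
  also have "\<dots> = of_real (cmod (deriv m 0))"
    using d0 by (simp add: c_def sgn_eq complex_norm_square[symmetric] power2_eq_square mult.commute)
  finally have "deriv h 0 = of_real (cmod (deriv m 0))" .
  then have "is_riemann_map D h" using hh hb m(3) d0 by (simp add: is_riemann_map_def h_def)
  then show ?thesis unfolding riemann_map_def by (rule someI[of "is_riemann_map D"])
qed

text \<open>The approximation from below avoids the question whether the supremum is
  attained.\<close>

lemma inrad_finite: assumes "inrad D = ereal R" shows "D \<noteq> UNIV" "R \<le> bdist D 0"
proof -
  have up: "s \<le> R" if "ball 0 s \<subseteq> D" for s
  proof -
    have "ereal s \<le> inrad D" unfolding inrad_def using that by (intro SUP_upper) simp
    then show ?thesis using assms by simp
  qed
  show nf: "D \<noteq> UNIV" using up[of "R + 1"] by auto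
  show "R \<le> bdist D 0"
  proof (rule dense_le)
    fix s assume "s < R"
    then have "ereal s < inrad D" using assms by simp
    then obtain s' where s': "ball 0 s' \<subseteq> D" "s < s'" unfolding inrad_def less_SUP_iff by auto
    then show "s \<le> bdist D 0" using bdist_ge[OF nf s'(1)] by simp
  qed
qed

text \<open>54^alpha tends to 1, so the loss in \<open>barrier_supersolution\<close> can be kept
  below its gap; the cap by epsilon serves the final exponent.\<close>

lemma small_exponent:
  fixes \<epsilon> :: real assumes "\<epsilon> > 0"
  obtains \<alpha> where "0 < \<alpha>" "\<alpha> \<le> 1/32" "54 powr \<alpha> \<le> 1 + gap / (2 * horizon)" "\<alpha> \<le> \<epsilon>"
proof -
  have "((\<lambda>\<alpha>. 54 powr \<alpha>) \<longlongrightarrow> 54 powr (0::real)) (at_right 0)"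
    by (intro tendsto_intros) auto
  moreover have "54 powr (0::real) < 1 + gap / (2 * horizon)" using gap_pos by (simp add: horizon_def)
  ultimately have "\<forall>\<^sub>F \<alpha> in at_right 0. 54 powr \<alpha> < 1 + gap / (2 * horizon)" by (rule order_tendstoD)
  then obtain b where b: "b > 0" "\<And>\<alpha>. 0 < \<alpha> \<Longrightarrow> \<alpha> < b \<Longrightarrow> 54 powr \<alpha> < 1 + gap / (2 * horizon)"
    unfolding eventually_at_right_field by blast
  show ?thesis
  proof (rule that[of "min (min \<epsilon> (1/32)) (b / 2)"])
    show "54 powr min (min \<epsilon> (1/32)) (b / 2) \<le> 1 + gap / (2 * horizon)"
      by (rule less_imp_le, rule b(2)) (use assms b(1) in auto)
  qed (use assms b(1) in auto)
qed

theorem theoremA1: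
  fixes \<epsilon> \<rho> :: real
  assumes "0 < \<epsilon>" "\<epsilon> < 1/2" "0 < \<rho>" "\<rho> < 1"
  shows "\<exists>c::real. \<forall>(D::complex set) (R::real) x y.
           grid_domain D \<and> simply_connected D \<and> 0 \<in> D \<and> inrad D = ereal R \<and> 0 < R \<and>
           x \<in> D \<inter> square_lattice \<and> y \<in> D \<inter> square_lattice \<and> x \<noteq> y \<and>
           cmod (riemann_map D x) \<le> \<rho> \<longrightarrow>
           \<bar>rw_green D x y - 2 / pi * green D x y - k_corr (y - x)\<bar> \<le> c * R powr (-(1/2 - \<epsilon>))"
proof -
  obtain \<alpha> where \<alpha>: "0 < \<alpha>" "\<alpha> \<le> 1/32" "54 powr \<alpha> \<le> 1 + gap / (2 * horizon)" "\<alpha> \<le> \<epsilon>"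
    using small_exponent[OF assms(1)] .
  define C where "C = source_const / min (\<alpha> / 1024) (gap / 2) * horizon + 512 * pk_const"
  have C: "C \<ge> 0" unfolding C_def using source_const_ge(4) \<alpha>(1) gap_pos pk_const
    by (intro add_nonneg_nonneg mult_nonneg_nonneg divide_nonneg_nonneg) auto
  \<comment> \<open>Beurling's bound at x for the map normalised at 0 reads (1 - rho^2)^2 <= 256 r /
    R, that is, r >= b R.\<close>
  define b where "b = (1 - \<rho>\<^sup>2)\<^sup>2 / 256"
  have "\<rho>\<^sup>2 < 1" using assms(3,4) power_strict_mono[of \<rho> 1 2] by simp
  then have b: "b > 0" by (simp add: b_def)
  define q where "q = - (1/2 - \<epsilon>)"
  have q: "q < 0" using assms(2) by (simp add: q_def)
  show ?thesis
  proof (intro exI[of _ "C * b powr q"] allI impI, elim conjE)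
    fix D :: "complex set" and R :: real and x y
    assume D: "grid_domain D" "simply_connected D" "0 \<in> D" and R: "inrad D = ereal R" "0 < R"
      and x: "x \<in> D \<inter> square_lattice" and y: "y \<in> D \<inter> square_lattice" "x \<noteq> y" and \<rho>: "cmod (riemann_map D x) \<le> \<rho>"
    have oD: "open D" using D(1) by (simp add: grid_domain_def)
    note nf = inrad_finite(1)[OF R(1)]
    define f where "f = riemann_map D"
    have "is_riemann_map D f" unfolding f_def by (rule riemann_map_exists[OF oD D(2,3) nf])
    then have f: "f holomorphic_on D" "bij_betw f D (ball 0 1)" "f 0 = 0" by (auto simp: is_riemann_map_def)
    \<comment> \<open>This instance transfers the inner radius at 0 to the distance r at
      \<open>x\<close>; the Green's function estimate itself belongs to the second instance, with
      pole \<open>x\<close>.\<close>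
    interpret base: conformal_disk D f 0 by unfold_locales (use oD f D(3) nf in auto)
    define \<psi> where "\<psi> = (\<lambda>z. Moebius_function 0 (f x) (f z))"
    have \<psi>: "\<psi> holomorphic_on D" "bij_betw \<psi> D (ball 0 1)" "\<psi> x = 0"
      unfolding \<psi>_def using moebius_recentre[OF f(1,2)] x by auto
    interpret grid_disk D \<psi> x by unfold_locales (use oD \<psi> x nf D(1) in auto)
    define r where "r = bdist D x"
    have r1: "r \<ge> 1" unfolding r_def by (rule r_ge_1)
    have "(cmod (f x))\<^sup>2 \<le> \<rho>\<^sup>2" using \<rho> unfolding f_def by (intro power_mono) auto
    then have "1 - \<rho>\<^sup>2 \<le> base.v x" by (simp add: base.v_def)
    then have "(1 - \<rho>\<^sup>2)\<^sup>2 \<le> (base.v x)\<^sup>2" using \<open>\<rho>\<^sup>2 < 1\<close> by (intro power_mono) auto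
    also have "\<dots> \<le> 256 * r / bdist D 0" unfolding r_def by (rule base.beurling) (use x in simp)
    also have "\<dots> \<le> 256 * r / R" using inrad_finite(2)[OF R(1)] R(2) r1 by (intro divide_left_mono) auto
    finally have "b * R \<le> r" using R(2) by (simp add: b_def le_divide_eq)
    then have "r powr q \<le> (b * R) powr q" using b R(2) q by (intro powr_mono2') auto
    also have "\<dots> = b powr q * R powr q" using b R(2) by (simp add: powr_mult)
    finally have rq: "r powr q \<le> b powr q * R powr q" .
    have "\<bar>rw_green D x y - 2 / pi * green D x y - k_corr (y - x)\<bar> \<le> C * r powr (- (1 - \<alpha>) / 2)"
      unfolding C_def r_def by (rule green_approximation[OF \<alpha>(1-3)]) (use y in \<open>auto simp: V_def\<close>)
    also have "r powr (- (1 - \<alpha>) / 2) \<le> r powr q" using r1 \<alpha> assms(1) by (intro powr_mono) (auto simp: q_def)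
    also have "\<dots> \<le> b powr q * R powr q" by (rule rq)
    finally have "\<bar>rw_green D x y - 2 / pi * green D x y - k_corr (y - x)\<bar> \<le> C * (b powr q * R powr q)"
      using C by (simp add: mult_left_mono)
    then show "\<bar>rw_green D x y - 2 / pi * green D x y - k_corr (y - x)\<bar> \<le> C * b powr q * R powr (-(1/2 - \<epsilon>))"
      by (simp add: q_def mult.assoc)
  qed
qed

end
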